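(* Let $q>0$. For $H=\mathbb{C}_q[SU_{1,1}]\otimes\mathbb{C}_{q^{3/2}}[t,t^{-1}]$, the quantum plane $\mathbb{C}_q^2$ generated by $z,z^*$ with $z^*z=q\,zz^*$ is a quantum complex manifold with (factorisable) Dolbeault double complex $\Omega^{\bullet,\bullet}$ with basis $\partial z,\partial z^*,\bar\partial z,\bar\partial z^*$ of $\Omega^1$ over the algebra, and relations $$z\,\partial z=q^2(\partial z)z,\quad z^*\partial z^*=q^2(\partial z^* )z^*,\quad z\,\partial z^*=q(\partial z^* )z,$$ $$z^*\partial z=q(\partial z)z^*+(q^2-1)(\partial z^* )z,\quad z\,\bar\partial z^*=q^{-1}(\bar\partial z^* )z+(q^{-2}-1)(\bar\partial z)z^*,$$ $$z^*\bar\partial z^*=q^{-2}(\bar\partial z^* )z^*,\quad z\,\bar\partial z=q^{-2}(\bar\partial z)z,\quad z^*\bar\partial z=q^{-1}(\bar\partial z)z^*,$$ $$(\bar\partial z^* )z=q\,z\,\bar\partial z^*+(q^2-1)z^*\,\bar\partial z,$$ $$(\partial z)^2=(\partial z^* )^2=0,\quad \partial z^*\wedge\partial z+q^{-1}\partial z\wedge\partial z^*=0,$$ $$(\bar\partial z)^2=(\bar\partial z^* )^2=0,\quad \bar\partial z^*\wedge\bar\partial z+q^{-1}\bar\partial z\wedge\bar\partial z^*=0,$$ $$\bar\partial z\wedge\partial z=-q^2\partial z\wedge\bar\partial z,\quad \bar\partial z^*\wedge\partial z^*=-q^2\partial z^*\wedge\bar\partial z^*,$$ $$\bar\partial z\wedge\partial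 z^*=-q\,\partial z^*\wedge\bar\partial z,\quad \bar\partial z^*\wedge\partial z=-q\,\partial z\wedge\bar\partial z^*-(q^2-1)\partial z^*\wedge\bar\partial z,$$ where $\bar\partial z^*=(\partial z)^*$ and the total derivative is $\mathrm{d}=\partial+\bar\partial$. The factorisation structure is given by the braiding, i.e. $$\Theta^{1,1}(\bar\partial z\otimes\partial z)=q^2\partial z\otimes\bar\partial z,\quad \Theta^{1,1}(\bar\partial z^*\otimes\partial z^* )=q^2\partial z^*\otimes\bar\partial z^*,\quad \Theta^{1,1}(\bar\partial z\otimes\partial z^* )=q\,\partial z^*\otimes\bar\partial z,$$ $$\Theta^{1,1}(\bar\partial z^*\otimes\partial z)=q\,\partial z\otimes\bar\partial z^*+(q^2-1)\partial z^*\otimes\bar\partial z.$$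
   Context: $H$ is the coquasitriangular Hopf $*$-algebra of real type given by the tensor product of $\mathbb{C}_q[SU_{1,1}]$ (i.e. $\mathbb{C}_q[SL_2]$ with $a^*=d$, $b^*=q^{-1}c$, $c^*=qb$, $d^*=a$ and its standard coquasitriangular structure) and $\mathbb{C}[t,t^{-1}]$ with $t$ grouplike, $t^*=t$, $\mathcal R(t^m,t^n)=q^{\frac32mn}$. $V=\mathbb{C}^2$ with basis $z,w$ is a right $H$-comodule by $(z\ w)\mapsto(z\ w)\otimes\begin{pmatrix}a&b\\c&d\end{pmatrix}\otimes t$, unitary with $z^*=q^{1/2}w$, $w^*=q^{-1/2}z$. The resulting braiding is $\Psi(z\otimes z)=q^2z\otimes z$, $\Psi(w\otimes w)=q^2w\otimes w$, $\Psi(z\otimes w)=q\,w\otimes z$, $\Psi(w\otimes z)=q\,z\otimes w+(q^2-1)w\otimes z$. $B=B_+(V)=TV/\oplus_n\ker[n,\Psi]!$, where $[n,\Psi]!=\sum_{\sigma\in S_n}\Psi_\sigma$ ($\Psi_\sigma$ from a reduced expression); this is $\mathbb{C}_q^2$, a braided Hopf algebra with $\Delta v=v\otimes1+1\otimes v$ on $V$. $\varpi:B\to V$ is projection to degree 1, $\Lambda(V)=TV/\langle\mathrm{Im}(\mathrm{id}+\Psi)\rangle$. $\Omega^{p,q}=\Lambda^p\underline\otimes B\underline\otimes\Lambda^q$ with braided super tensor product $(b\otimes c)(b'\otimes c')=(-1)^{|c||b'|}b\,\Psi(c\otimes b')\,c'$ ($B$ in degree 0), $\partial=(-1)^p((\wedge\otimes\mathrm{id})(\mathrm{id}\otimes\varpi\otimes\mathrm{id})(\mathrm{id}\otimes\Delta))\otimes\mathrm{id}$,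 $\bar\partial=(-1)^p\mathrm{id}\otimes((\mathrm{id}\otimes\wedge)(\mathrm{id}\otimes\varpi\otimes\mathrm{id})(\Delta\otimes\mathrm{id}))$; so $\partial v=v\otimes1\in V\otimes B$ and $\bar\partial v=1\otimes v\in B\otimes V$. The involution is $(\omega\otimes b\otimes\eta)^*=(-1)^{|\omega||\eta|}\eta^*\otimes b^*\otimes\omega^*$, where $*$ is extended antimultiplicatively to $B$ and graded-antimultiplicatively to $\Lambda(V)$. "Quantum complex manifold with factorisable Dolbeault double complex" means: $(\Omega,\mathrm{d}=\partial+\bar\partial,* )$ is a $*$-DGA (with $(\xi\wedge\eta)^*=(-1)^{|\xi||\eta|}\eta^*\wedge\xi^*$, $\mathrm{d}(\xi^* )=(\mathrm{d}\xi)^*$), $\Omega^m=\oplus_{p+q=m}\Omega^{p,q}$ with $\wedge$ respecting bidegree, $\partial,\bar\partial$ anticommuting square-zero graded derivations of bidegrees $(1,0),(0,1)$, $(\Omega^{p,q})^*=\Omega^{q,p}$, $(\partial\xi)^*=\bar\partial(\xi^* )$, and $\wedge:\Omega^{p,0}\otimes_B\Omega^{0,q}\to\Omega^{p,q}$, $\wedge:\Omega^{0,q}\otimes_B\Omega^{p,0}\to\Omega^{p,q}$ are bimodule isomorphisms. $\Theta^{1,1}:\Omega^{0,1}\otimes\Omega^{1,0}\to\Omega^{1,0}\otimes\Omega^{0,1}$ is the $B$-bimodule isomorphism $\Theta^{1,1}=(\Psi_{B,V}\otimes\Psi_{V,B})(\mathrm{id}\otimes\Psi_{V,V}\otimes\mathrm{id})$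 on $(B\otimes V)\otimes(V\otimes B)$. *)

theory Defs
  imports
    Complex_Main
    "HOL-Library.Poly_Mapping"
    "HOL-Library.Product_Plus"
    "HOL-Library.FuncSet"
    "HOL-Combinatorics.Permutations"
    "HOL-Algebra.Module"
    "HOL-Algebra.QuotRing"
begin

section \<open>Free vector spaces, free algebras and quotients\<close>

text \<open>
  With concatenation as addition on words, \<^typ>\<open>'g list \<Rightarrow>\<^sub>0 complex\<close> with its convolution
  product is the free (tensor) algebra on the letters \<^typ>\<open>'g\<close>.  The tensor product of the free
  vector spaces on \<^typ>\<open>'k\<close> and \<^typ>\<open>'l\<close> is the free vector space on \<^typ>\<open>'k \<times> 'l\<close>;
  for words, the convolution product on \<^typ>\<open>'g list \<times> 'h list \<Rightarrow>\<^sub>0 complex\<close> is the ordinary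
  (unbraided) tensor product algebra.
\<close>

instantiation list :: (type) monoid_add
begin
definition zero_list :: "'a list" where "zero_list = []"
definition plus_list :: "'a list \<Rightarrow> 'a list \<Rightarrow> 'a list" where "plus_list = append"
instance by standard (simp_all add: zero_list_def plus_list_def)
end

definition pscale :: "complex \<Rightarrow> ('k \<Rightarrow>\<^sub>0 complex) \<Rightarrow> ('k \<Rightarrow>\<^sub>0 complex)" where
  "pscale c x = Poly_Mapping.map ((*) c) x"

definition mon :: "'k \<Rightarrow> ('k \<Rightarrow>\<^sub>0 complex)" where
  "mon k = Poly_Mapping.single k 1"

definition lin :: "('k \<Rightarrow> ('l \<Rightarrow>\<^sub>0 complex)) \<Rightarrow> ('k \<Rightarrow>\<^sub>0 complex) \<Rightarrow> ('l \<Rightarrow>\<^sub>0 complex)" where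
  "lin f x = (\<Sum>k\<in>Poly_Mapping.keys x. pscale (Poly_Mapping.lookup x k) (f k))"

definition antilin :: "('k \<Rightarrow> ('l \<Rightarrow>\<^sub>0 complex)) \<Rightarrow> ('k \<Rightarrow>\<^sub>0 complex) \<Rightarrow> ('l \<Rightarrow>\<^sub>0 complex)" where
  "antilin f x = (\<Sum>k\<in>Poly_Mapping.keys x. pscale (cnj (Poly_Mapping.lookup x k)) (f k))"

definition lin_form :: "('k \<Rightarrow> complex) \<Rightarrow> ('k \<Rightarrow>\<^sub>0 complex) \<Rightarrow> complex" where
  "lin_form f x = (\<Sum>k\<in>Poly_Mapping.keys x. Poly_Mapping.lookup x k * f k)"

definition pspan :: "('k \<Rightarrow>\<^sub>0 complex) set \<Rightarrow> ('k \<Rightarrow>\<^sub>0 complex) set" where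
  "pspan = Modules.module.span pscale"

definition two_sided_ideal :: "('g list \<Rightarrow>\<^sub>0 complex) set \<Rightarrow> ('g list \<Rightarrow>\<^sub>0 complex) set" where
  "two_sided_ideal S = pspan {x * r * y |x r y. r \<in> S}"

definition supp_on :: "'k set \<Rightarrow> ('k \<Rightarrow>\<^sub>0 complex) set" where
  "supp_on A = {x. Poly_Mapping.keys x \<subseteq> A}"

definition cls :: "('k \<Rightarrow>\<^sub>0 complex) set \<Rightarrow> ('k \<Rightarrow>\<^sub>0 complex) \<Rightarrow> ('k \<Rightarrow>\<^sub>0 complex) set" where
  "cls J x = {y. y - x \<in> J}"

text \<open>
  Maps induced on quotients.  \<^const>\<open>the_elem\<close> makes them meaningful exactly when
  the result does not depend on the representatives.
\<close>

definition induced :: "('k \<Rightarrow>\<^sub>0 complex) set \<Rightarrow> (('l \<Rightarrow>\<^sub>0 complex) \<Rightarrow> ('k \<Rightarrow>\<^sub>0 complex))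
    \<Rightarrow> ('l \<Rightarrow>\<^sub>0 complex) set \<Rightarrow> ('k \<Rightarrow>\<^sub>0 complex) set" where
  "induced J f X = the_elem ((\<lambda>x. cls J (f x)) ` X)"

definition induced2 :: "('k \<Rightarrow>\<^sub>0 complex) set
    \<Rightarrow> (('l \<Rightarrow>\<^sub>0 complex) \<Rightarrow> ('m \<Rightarrow>\<^sub>0 complex) \<Rightarrow> ('k \<Rightarrow>\<^sub>0 complex))
    \<Rightarrow> ('l \<Rightarrow>\<^sub>0 complex) set \<Rightarrow> ('m \<Rightarrow>\<^sub>0 complex) set \<Rightarrow> ('k \<Rightarrow>\<^sub>0 complex) set" where
  "induced2 J f X Y = the_elem ((\<lambda>(x, y). cls J (f x y)) ` (X \<times> Y))"


section \<open>The Hopf algebra $H$\<close>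

text \<open>
  $H$ is the free algebra on $a,b,c,d,t,t^{-1}$ modulo the ideal \<open>H_ideal\<close>.  Linear data on $H$
  are given by linear data on the free algebra that respect this ideal.
\<close>

datatype hgen = Ga | Gb | Gc | Gd | Gt | Gti

type_synonym hfree = "hgen list \<Rightarrow>\<^sub>0 complex"

abbreviation hg :: "hgen \<Rightarrow> hfree" where "hg x \<equiv> mon [x]"

definition H_relations :: "real \<Rightarrow> hfree set" where
  "H_relations q =
    {hg Gb * hg Ga - pscale q (hg Ga * hg Gb),
     hg Gc * hg Ga - pscale q (hg Ga * hg Gc),
     hg Gd * hg Gb - pscale q (hg Gb * hg Gd),
     hg Gd * hg Gc - pscale q (hg Gc * hg Gd),
     hg Gb * hg Gc - hg Gc * hg Gb,
     hg Gd * hg Ga - hg Ga * hg Gd - pscale (q - 1/q) (hg Gb * hg Gc),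
     hg Ga * hg Gd - pscale (1/q) (hg Gb * hg Gc) - 1,
     hg Gt * hg Gti - 1, hg Gti * hg Gt - 1}
    \<union> {hg Gt * hg x - hg x * hg Gt |x. x \<in> {Ga, Gb, Gc, Gd}}"

definition H_ideal :: "real \<Rightarrow> hfree set" where
  "H_ideal q = two_sided_ideal (H_relations q)"

fun H_coprod_gen :: "hgen \<Rightarrow> (hgen list \<times> hgen list) \<Rightarrow>\<^sub>0 complex" where
  "H_coprod_gen Ga = mon ([Ga], [Ga]) + mon ([Gb], [Gc])"
| "H_coprod_gen Gb = mon ([Ga], [Gb]) + mon ([Gb], [Gd])"
| "H_coprod_gen Gc = mon ([Gc], [Ga]) + mon ([Gd], [Gc])"
| "H_coprod_gen Gd = mon ([Gc], [Gb]) + mon ([Gd], [Gd])"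
| "H_coprod_gen Gt = mon ([Gt], [Gt])"
| "H_coprod_gen Gti = mon ([Gti], [Gti])"

definition H_coprod :: "hfree \<Rightarrow> (hgen list \<times> hgen list) \<Rightarrow>\<^sub>0 complex" where
  "H_coprod = lin (\<lambda>w. prod_list (map H_coprod_gen w))"

fun H_counit_gen :: "hgen \<Rightarrow> complex" where
  "H_counit_gen Gb = 0"
| "H_counit_gen Gc = 0"
| "H_counit_gen _ = 1"

definition H_counit :: "hfree \<Rightarrow> complex" where
  "H_counit = lin_form (\<lambda>w. prod_list (map H_counit_gen w))"

fun H_antipode_gen :: "real \<Rightarrow> hgen \<Rightarrow> hfree" where
  "H_antipode_gen q Ga = hg Gd"
| "H_antipode_gen q Gb = pscale (- q) (hg Gb)"
| "H_antipode_gen q Gc = pscale (- (1/q)) (hg Gc)"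
| "H_antipode_gen q Gd = hg Ga"
| "H_antipode_gen q Gt = hg Gti"
| "H_antipode_gen q Gti = hg Gt"

definition H_antipode :: "real \<Rightarrow> hfree \<Rightarrow> hfree" where
  "H_antipode q = lin (\<lambda>w. prod_list (map (H_antipode_gen q) (rev w)))"

fun H_star_gen :: "real \<Rightarrow> hgen \<Rightarrow> hfree" where
  "H_star_gen q Ga = hg Gd"
| "H_star_gen q Gb = pscale (1/q) (hg Gc)"
| "H_star_gen q Gc = pscale q (hg Gb)"
| "H_star_gen q Gd = hg Ga"
| "H_star_gen q Gt = hg Gt"
| "H_star_gen q Gti = hg Gti"

definition H_star :: "real \<Rightarrow> hfree \<Rightarrow> hfree" where
  "H_star q = antilin (\<lambda>w. prod_list (map (H_star_gen q) (rev w)))"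

definition bilinear_form_on_H :: "real \<Rightarrow> (hfree \<Rightarrow> hfree \<Rightarrow> complex) \<Rightarrow> bool" where
  "bilinear_form_on_H q R \<longleftrightarrow>
     (\<forall>x y z. R (x + y) z = R x z + R y z \<and> R z (x + y) = R z x + R z y) \<and>
     (\<forall>s x y. R (pscale s x) y = s * R x y \<and> R x (pscale s y) = s * R x y) \<and>
     (\<forall>x\<in>H_ideal q. \<forall>y. R x y = 0 \<and> R y x = 0)"

definition convolution :: "(hfree \<Rightarrow> hfree \<Rightarrow> complex) \<Rightarrow> (hfree \<Rightarrow> hfree \<Rightarrow> complex)
    \<Rightarrow> hfree \<Rightarrow> hfree \<Rightarrow> complex" where
  "convolution R S x y =
     lin_form (\<lambda>(x1, x2). lin_form (\<lambda>(y1, y2). R (mon x1) (mon y1) * S (mon x2) (mon y2))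
       (H_coprod y)) (H_coprod x)"

definition coquasitriangular_real :: "real \<Rightarrow> (hfree \<Rightarrow> hfree \<Rightarrow> complex) \<Rightarrow> bool" where
  "coquasitriangular_real q R \<longleftrightarrow>
     bilinear_form_on_H q R \<and>
     \<comment> \<open>convolution-invertible; on a Hopf algebra the inverse is R(S x, y)\<close>
     (\<forall>x y. convolution R (\<lambda>x. R (H_antipode q x)) x y = H_counit x * H_counit y) \<and>
     (\<forall>x y. convolution (\<lambda>x. R (H_antipode q x)) R x y = H_counit x * H_counit y) \<and>
     \<comment> \<open>R(xy,z) = R(x,z1)R(y,z2) and R(x,yz) = R(x1,z)R(x2,y)\<close>
     (\<forall>x y z. R (x * y) z = lin_form (\<lambda>(z1, z2). R x (mon z1) * R y (mon z2)) (H_coprod z)) \<and>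
     (\<forall>x y z. R x (y * z) = lin_form (\<lambda>(x1, x2). R (mon x1) z * R (mon x2) y) (H_coprod x)) \<and>
     \<comment> \<open>y1 x1 R(x2,y2) = R(x1,y1) x2 y2 in H\<close>
     (\<forall>x y.
        lin (\<lambda>(x1, x2). lin (\<lambda>(y1, y2). pscale (R (mon x2) (mon y2)) (mon y1 * mon x1))
          (H_coprod y)) (H_coprod x)
        - lin (\<lambda>(x1, x2). lin (\<lambda>(y1, y2). pscale (R (mon x1) (mon y1)) (mon x2 * mon y2))
          (H_coprod y)) (H_coprod x) \<in> H_ideal q) \<and>
     \<comment> \<open>real type\<close>
     (\<forall>x y. cnj (R x y) = R (H_star q y) (H_star q x))"

text \<open>
  The standard R-matrix $q^{-1/2}\left(q\,E_{11}\otimes E_{11}+q\,E_{22}\otimes E_{22}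
  +E_{11}\otimes E_{22}+E_{22}\otimes E_{11}+(q-q^{-1})E_{12}\otimes E_{21}\right)$ evaluated on
  matrix entries: $R(t^i_j,t^k_l)=R^{ik}_{jl}$ with rows $(a,b)$ and $(c,d)$.
\<close>

fun R_standard :: "real \<Rightarrow> hgen \<Rightarrow> hgen \<Rightarrow> real" where
  "R_standard q Ga Ga = q powr (-1/2) * q"
| "R_standard q Gd Gd = q powr (-1/2) * q"
| "R_standard q Ga Gd = q powr (-1/2)"
| "R_standard q Gd Ga = q powr (-1/2)"
| "R_standard q Gb Gc = q powr (-1/2) * (q - 1/q)"
| "R_standard q _ _ = 0"

definition t_power :: "int \<Rightarrow> hfree" where
  "t_power m = (if m \<ge> 0 then hg Gt ^ nat m else hg Gti ^ nat (- m))"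

text \<open>
  The first two clauses fix the coquasitriangular structure on the two tensor factors, the last one
  says that $H$ carries the structure of the tensor product Hopf algebra.  Being multiplicative in
  both arguments, the structure is determined by these values.
\<close>

definition is_R_of_H :: "real \<Rightarrow> (hfree \<Rightarrow> hfree \<Rightarrow> complex) \<Rightarrow> bool" where
  "is_R_of_H q R \<longleftrightarrow>
     coquasitriangular_real q R \<and>
     (\<forall>x\<in>{Ga, Gb, Gc, Gd}. \<forall>y\<in>{Ga, Gb, Gc, Gd}. R (hg x) (hg y) = complex_of_real (R_standard q x y)) \<and>
     (\<forall>m n. R (t_power m) (t_power n) = complex_of_real (q powr (3/2 * m * n))) \<and>
     (\<forall>u v m n. set u \<subseteq> {Ga, Gb, Gc, Gd} \<longrightarrow> set v \<subseteq> {Ga, Gb, Gc, Gd} \<longrightarrow>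
        R (mon u * t_power m) (mon v * t_power n) = R (mon u) (mon v) * R (t_power m) (t_power n))"


section \<open>The comodule $V$, its tensor algebra and the braiding\<close>

datatype vgen = Z | W

type_synonym tv = "vgen list \<Rightarrow>\<^sub>0 complex"
type_synonym tv2 = "vgen list \<times> vgen list \<Rightarrow>\<^sub>0 complex"

fun V_coact_gen :: "vgen \<Rightarrow> (vgen list \<times> hgen list) \<Rightarrow>\<^sub>0 complex" where
  "V_coact_gen Z = mon ([Z], [Ga, Gt]) + mon ([W], [Gc, Gt])"
| "V_coact_gen W = mon ([Z], [Gb, Gt]) + mon ([W], [Gd, Gt])"

definition T_coact :: "vgen list \<Rightarrow> (vgen list \<times> hgen list) \<Rightarrow>\<^sub>0 complex" where
  "T_coact w = prod_list (map V_coact_gen w)"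

text \<open>The braiding $\Psi(x\otimes y)=y_0\otimes x_0\,R(x_1,y_1)$ of the comodule $TV$ with itself.
  It restricts to the braiding of any two tensor powers of $V$, and induces the braidings between
  quotient comodules of $TV$.\<close>

definition psi :: "(hfree \<Rightarrow> hfree \<Rightarrow> complex) \<Rightarrow> vgen list \<Rightarrow> vgen list \<Rightarrow> tv2" where
  "psi R u v = lin (\<lambda>(u0, u1). lin (\<lambda>(v0, v1). pscale (R (mon u1) (mon v1)) (mon (v0, u0)))
     (T_coact v)) (T_coact u)"

lemma lin_single: "lin f (Poly_Mapping.single k c) = pscale c (f k)"
  by (cases "c = 0") (auto simp: lin_def pscale_def intro!: poly_mapping_eqI simp: map.rep_eq)

lemma pscale_add_left: "pscale (a + b) x = pscale a x + pscale b x"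
  by (rule poly_mapping_eqI) (simp add: pscale_def map.rep_eq lookup_add when_def algebra_simps)

lemma lin_add: "lin f (x + y) = lin f x + lin f y"
proof -
  have ext: "lin f z = (\<Sum>k\<in>A. pscale (Poly_Mapping.lookup z k) (f k))"
    if "finite A" "Poly_Mapping.keys z \<subseteq> A" for A z
    unfolding lin_def using that
    by (intro sum.mono_neutral_left)
      (auto simp: in_keys_iff pscale_def intro!: poly_mapping_eqI simp: map.rep_eq)
  let ?A = "Poly_Mapping.keys x \<union> Poly_Mapping.keys y"
  show ?thesis
    using ext[of ?A x] ext[of ?A y] ext[of ?A "x + y"] Poly_Mapping.keys_add[of x y]
    by (simp add: lookup_add pscale_add_left sum.distrib)
qed

lemma lin_mon: "lin f (mon k) = f k"
  unfolding mon_def lin_single by (rule poly_mapping_eqI) (simp add: pscale_def map.rep_eq when_def)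

lemma psi_generators:
  assumes q: "q > 0" and R: "is_R_of_H q R"
  shows "psi R [Z] [Z] = pscale (q\<^sup>2) (mon ([Z], [Z]))"
    and "psi R [W] [W] = pscale (q\<^sup>2) (mon ([W], [W]))"
    and "psi R [Z] [W] = pscale q (mon ([W], [Z]))"
    and "psi R [W] [Z] = pscale q (mon ([Z], [W])) + pscale (q\<^sup>2 - 1) (mon ([W], [Z]))"
proof -
  have val: "R (mon [x, Gt]) (mon [y, Gt]) = complex_of_real (R_standard q x y * q powr (3/2))"
    if "x \<in> {Ga, Gb, Gc, Gd}" "y \<in> {Ga, Gb, Gc, Gd}" for x y
  proof -
    have m: "mon [u, Gt] = mon [u] * t_power 1" for u
      by (simp add: t_power_def mon_def mult_single plus_list_def)
    have "R (mon [x] * t_power 1) (mon [y] * t_power 1)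
        = R (hg x) (hg y) * R (t_power 1) (t_power 1)"
      using R that unfolding is_R_of_H_def by auto
    moreover have "R (hg x) (hg y) = complex_of_real (R_standard q x y)"
      using R that unfolding is_R_of_H_def by blast
    moreover have "R (t_power 1) (t_power 1) = complex_of_real (q powr (3/2))"
    proof -
      have "R (t_power m) (t_power n) = complex_of_real (q powr (3/2 * m * n))" for m n
        using R unfolding is_R_of_H_def by blast
      from this[of 1 1] show ?thesis by simp
    qed
    ultimately show ?thesis by (simp add: m)
  qed
  have p1: "q powr (-1/2) * q powr (3/2) = q"
    using q by (simp add: powr_add[symmetric])
  have p: "q powr (-1/2) * q * q powr (3/2) = q\<^sup>2" "q powr (-1/2) * q powr (3/2) = q"
    "q powr (-1/2) * (q - 1/q) * q powr (3/2) = q\<^sup>2 - 1"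
    using p1 q by (auto simp: power2_eq_square field_simps) 
  have z: "pscale 0 x = 0" for x :: tv2
    by (rule poly_mapping_eqI) (simp add: pscale_def map.rep_eq when_def)
  show "psi R [Z] [Z] = pscale (q\<^sup>2) (mon ([Z], [Z]))"
    "psi R [W] [W] = pscale (q\<^sup>2) (mon ([W], [W]))"
    "psi R [Z] [W] = pscale q (mon ([W], [Z]))"
    "psi R [W] [Z] = pscale q (mon ([Z], [W])) + pscale (q\<^sup>2 - 1) (mon ([W], [Z]))"
    unfolding psi_def T_coact_def
    by (simp_all add: lin_add lin_mon val p p[simplified] z add.commute del: of_real_mult of_real_power of_real_diff)
qed

definition T_star :: "real \<Rightarrow> tv \<Rightarrow> tv" where
  "T_star q = antilin (\<lambda>w. prod_list (map
     (\<lambda>v. case v of Z \<Rightarrow> pscale (q powr (1/2)) (mon [W]) | W \<Rightarrow> pscale (q powr (-1/2)) (mon [Z]))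
     (rev w)))"


section \<open>The braided symmetric algebra $B_+(V)$\<close>

definition perm_of :: "nat list \<Rightarrow> nat \<Rightarrow> nat" where
  "perm_of is = foldr (\<lambda>i p. transpose i (Suc i) \<circ> p) is id"

text \<open>
  A reduced expression of a permutation of \<open>{..<n}\<close>: if $\sigma(k)=n$ then
  $\sigma=\tau s_{n-1}\cdots s_k$ with $\tau$ fixing $n$.
\<close>

fun reduced_expr :: "nat \<Rightarrow> (nat \<Rightarrow> nat) \<Rightarrow> nat list" where
  "reduced_expr 0 \<sigma> = []"
| "reduced_expr (Suc n) \<sigma> =
     (let k = inv_into UNIV \<sigma> n in reduced_expr n (\<sigma> \<circ> perm_of [k..<n]) @ rev [k..<n])"

definition inversions :: "nat \<Rightarrow> (nat \<Rightarrow> nat) \<Rightarrow> (nat \<times> nat) set" where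
  "inversions n \<sigma> = {(i, j). i < j \<and> j < n \<and> \<sigma> j < \<sigma> i}"

lemma perm_of_append: "perm_of (xs @ ys) = perm_of xs \<circ> perm_of ys"
  by (induction xs) (simp_all add: perm_of_def o_assoc)

lemma perm_of_rev: "perm_of xs \<circ> perm_of (rev xs) = id"
proof (induction xs)
  case (Cons i xs)
  have 1: "perm_of (i # xs) = transpose i (Suc i) \<circ> perm_of xs" by (simp add: perm_of_def)
  have 2: "perm_of (rev (i # xs)) = perm_of (rev xs) \<circ> transpose i (Suc i)"
    by (simp add: perm_of_append) (simp add: perm_of_def)
  have "perm_of (i # xs) \<circ> perm_of (rev (i # xs)) =
     transpose i (Suc i) \<circ> (perm_of xs \<circ> perm_of (rev xs)) \<circ> transpose i (Suc i)"
    unfolding 1 2 by (simp only: o_assoc)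
  then show ?case by (simp add: Cons)
qed (simp add: perm_of_def)

lemma perm_of_upt:
  "k \<le> n \<Longrightarrow> perm_of [k..<n] = (\<lambda>i. if i = n then k else if k \<le> i \<and> i < n then Suc i else i)"
proof (induction n)
  case 0 then show ?case by (auto simp: perm_of_def)
next
  case (Suc n)
  show ?case
  proof (cases "k = Suc n")
    case True then show ?thesis by (auto simp: perm_of_def)
  next
    case False
    then have k: "k \<le> n" using Suc by simp
    have "perm_of [n] = transpose n (Suc n)" by (simp add: perm_of_def)
    with k show ?thesis
      by (auto simp: perm_of_append Suc.IH fun_eq_iff transpose_def)
  qed
qed

lemma reduced_expr_is_reduced:
  assumes "\<sigma> permutes {..<n}"
  shows "perm_of (reduced_expr n \<sigma>) = \<sigma> \<and> length (reduced_expr n \<sigma>) = card (inversions n \<sigma>)"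
  using assms
proof (induction n arbitrary: \<sigma>)
  case 0
  then show ?case by (auto simp: inversions_def perm_of_def)
next
  case (Suc n)
  define k where "k = inv_into UNIV \<sigma> n"
  define c where "c = perm_of [k..<n]"
  define \<tau> where "\<tau> = \<sigma> \<circ> c"
  have bij: "bij \<sigma>" using Suc.prems by (rule permutes_bij)
  have sk: "\<sigma> k = n" unfolding k_def using bij by (simp add: bij_is_surj surj_f_inv_f)
  have kn: "k \<le> n"
    using Suc.prems sk by (metis lessThan_iff less_Suc_eq_le permutes_def nle_le)
  have c: "c = (\<lambda>i. if i = n then k else if k \<le> i \<and> i < n then Suc i else i)"
    unfolding c_def using kn by (rule perm_of_upt)
  have bc: "bij c"
    using perm_of_rev[of "[k..<n]"] perm_of_rev[of "rev [k..<n]"] unfolding c_def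
    by (metis o_bij rev_rev_ident)
  have \<tau>bij: "bij \<tau>" unfolding \<tau>_def using bij bc by (simp add: bij_comp)
  have \<tau>id: "\<tau> x = x" if "x \<notin> {..<n}" for x
    using that Suc.prems sk by (cases "x = n") (auto simp: \<tau>_def c permutes_def)
  have \<tau>: "\<tau> permutes {..<n}"
    using \<tau>bij \<tau>id unfolding permutes_def by (metis bij_pointE)
  have IH: "perm_of (reduced_expr n \<tau>) = \<tau>" "length (reduced_expr n \<tau>) = card (inversions n \<tau>)"
    using Suc.IH[OF \<tau>] by auto
  have red: "reduced_expr (Suc n) \<sigma> = reduced_expr n \<tau> @ rev [k..<n]"
    by (simp add: k_def[symmetric] c_def[symmetric] \<tau>_def Let_def)
  have "\<tau> \<circ> perm_of (rev [k..<n]) = \<sigma>"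
    unfolding \<tau>_def c_def by (simp add: o_assoc[symmetric] perm_of_rev)
  then have 1: "perm_of (reduced_expr (Suc n) \<sigma>) = \<sigma>"
    by (simp only: red perm_of_append IH)
  have lt: "\<sigma> j < n" if "j \<noteq> k" "j \<le> n" for j
    using that sk bij Suc.prems
    by (metis bij_pointE lessThan_iff less_Suc_eq less_Suc_eq_le permutes_in_image)
  have inv: "inversions (Suc n) \<sigma> =
      (\<lambda>(i, j). (c i, c j)) ` inversions n \<tau> \<union> (\<lambda>j. (k, j)) ` {Suc k..n}" (is "?L = ?A \<union> ?B")
  proof
    show "?L \<subseteq> ?A \<union> ?B"
    proof
      fix p assume "p \<in> ?L"
      then obtain i j where p: "p = (i, j)" "i < j" "j \<le> n" "\<sigma> j < \<sigma> i"
        by (auto simp: inversions_def)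
      have jk: "j \<noteq> k" using p sk lt[of i] by (cases "i = k") auto
      show "p \<in> ?A \<union> ?B"
      proof (cases "i = k")
        case True then show ?thesis using p by auto
      next
        case False
        let ?d = "\<lambda>x::nat. if x > k then x - 1 else x"
        have "c (?d i) = i" "c (?d j) = j" "?d i < ?d j" "?d j < n"
          using False jk p kn by (auto simp: c)
        moreover from this have "(?d i, ?d j) \<in> inversions n \<tau>"
          using p by (simp add: inversions_def \<tau>_def)
        ultimately show ?thesis using p by force
      qed
    qed
    show "?A \<union> ?B \<subseteq> ?L"
      using lt sk kn by (auto simp: inversions_def \<tau>_def c split: if_splits)
  qed
  have "inj c" using bc by (rule bij_is_inj)
  then have "card ?A = card (inversions n \<tau>)"
    by (intro card_image) (auto simp: inj_on_def)
  moreover have "card ?B = n - k" by (subst card_image) (auto simp: inj_on_def)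
  moreover have "?A \<inter> ?B = {}" by (auto simp: inversions_def c split: if_splits)
  moreover have "finite (inversions n \<tau>)"
    by (rule finite_subset[of _ "{..<n} \<times> {..<n}"]) (auto simp: inversions_def)
  ultimately have "card (inversions (Suc n) \<sigma>) = card (inversions n \<tau>) + (n - k)"
    unfolding inv by (subst card_Un_disjoint) auto
  then show ?case using 1 IH by (simp only: red length_append length_rev length_upt)
qed

definition psi_at :: "(hfree \<Rightarrow> hfree \<Rightarrow> complex) \<Rightarrow> nat \<Rightarrow> tv \<Rightarrow> tv" where
  "psi_at R i = lin (\<lambda>w. lin (\<lambda>(u, v). mon (take i w @ u @ v @ drop (i + 2) w))
     (psi R [w ! i] [w ! (i + 1)]))"

definition psi_perm :: "(hfree \<Rightarrow> hfree \<Rightarrow> complex) \<Rightarrow> nat \<Rightarrow> (nat \<Rightarrow> nat) \<Rightarrow> tv \<Rightarrow> tv" where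
  "psi_perm R n \<sigma> x = foldr (psi_at R) (reduced_expr n \<sigma>) x"

definition braided_factorial :: "(hfree \<Rightarrow> hfree \<Rightarrow> complex) \<Rightarrow> nat \<Rightarrow> tv \<Rightarrow> tv" where
  "braided_factorial R n x = (\<Sum>\<sigma> | \<sigma> permutes {..<n}. psi_perm R n \<sigma> x)"

definition B_ideal :: "(hfree \<Rightarrow> hfree \<Rightarrow> complex) \<Rightarrow> tv set" where
  "B_ideal R = pspan (\<Union>n. {x \<in> supp_on {w. length w = n}. braided_factorial R n x = 0})"

definition B_plus :: "(hfree \<Rightarrow> hfree \<Rightarrow> complex) \<Rightarrow> (complex, tv set) module" where
  "B_plus R = \<lparr>carrier = range (cls (B_ideal R)),
     monoid.mult = induced2 (B_ideal R) (*), one = cls (B_ideal R) 1,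
     zero = cls (B_ideal R) 0, add = induced2 (B_ideal R) (+),
     smult = (\<lambda>s. induced (B_ideal R) (pscale s))\<rparr>"

definition B_star :: "real \<Rightarrow> (hfree \<Rightarrow> hfree \<Rightarrow> complex) \<Rightarrow> tv set \<Rightarrow> tv set" where
  "B_star q R = induced (B_ideal R) (T_star q)"

text \<open>The braided tensor product algebra $TV\underline\otimes TV$ and the braided coproduct, the
  algebra map extending $\Delta v=v\otimes1+1\otimes v$.\<close>

definition T2_mult :: "(hfree \<Rightarrow> hfree \<Rightarrow> complex) \<Rightarrow> tv2 \<Rightarrow> tv2 \<Rightarrow> tv2" where
  "T2_mult R x y = lin (\<lambda>(u, v). lin (\<lambda>(u', v').
     lin (\<lambda>(u'', v''). mon (u @ u'', v'' @ v')) (psi R v u')) y) x"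

fun T_coprod :: "(hfree \<Rightarrow> hfree \<Rightarrow> complex) \<Rightarrow> vgen list \<Rightarrow> tv2" where
  "T_coprod R [] = mon ([], [])"
| "T_coprod R (x # w) = T2_mult R (mon ([x], []) + mon ([], [x])) (T_coprod R w)"

definition varpi :: "vgen list \<Rightarrow> tv" where
  "varpi w = (if length w = 1 then mon w else 0)"


section \<open>The double complex $\Lambda\underline\otimes B\underline\otimes\Lambda$\<close>

definition Lambda_ideal :: "(hfree \<Rightarrow> hfree \<Rightarrow> complex) \<Rightarrow> tv set" where
  "Lambda_ideal R = two_sided_ideal
     {mon [x, y] + lin (\<lambda>(u, v). mon (u @ v)) (psi R [x] [y]) |x y. True}"

type_synonym vword3 = "vgen list \<times> vgen list \<times> vgen list"
type_synonym tv3 = "vword3 \<Rightarrow>\<^sub>0 complex"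

definition tens3 :: "tv \<Rightarrow> tv \<Rightarrow> tv \<Rightarrow> tv3" where
  "tens3 x y z = lin (\<lambda>u. lin (\<lambda>v. lin (\<lambda>w. mon (u, v, w)) z) y) x"

text \<open>
  $\Lambda\otimes B\otimes\Lambda$ is the quotient of $TV\otimes TV\otimes TV$ by the following
  subspace, as $(A/I)\otimes(A'/I')=(A\otimes A')/(I\otimes A'+A\otimes I')$.  All structure maps are
  written on $TV\otimes TV\otimes TV$ and induced on the quotient.
\<close>

definition Omega_rel :: "(hfree \<Rightarrow> hfree \<Rightarrow> complex) \<Rightarrow> tv3 set" where
  "Omega_rel R = pspan
     ({tens3 x y z |x y z. x \<in> Lambda_ideal R} \<union>
      {tens3 x y z |x y z. y \<in> B_ideal R} \<union>
      {tens3 x y z |x y z. z \<in> Lambda_ideal R})"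

text \<open>$(u\otimes b\otimes v)(u'\otimes b'\otimes v')$: move $v$ past $u'$ (with a sign), then $b$ past
  $u'$ and $v$ past $b'$.\<close>

definition T3_mult :: "(hfree \<Rightarrow> hfree \<Rightarrow> complex) \<Rightarrow> tv3 \<Rightarrow> tv3 \<Rightarrow> tv3" where
  "T3_mult R x y = lin (\<lambda>(u, b, v). lin (\<lambda>(u', b', v').
     pscale ((-1) ^ (length v * length u'))
      (lin (\<lambda>(u1, v1). lin (\<lambda>(u2, b1). lin (\<lambda>(b2, v2). mon (u @ u2, b1 @ b2, v2 @ v'))
         (psi R v1 b')) (psi R b u1)) (psi R v u'))) y) x"

definition T3_del :: "(hfree \<Rightarrow> hfree \<Rightarrow> complex) \<Rightarrow> tv3 \<Rightarrow> tv3" where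
  "T3_del R = lin (\<lambda>(u, b, v). pscale ((-1) ^ length u)
     (lin (\<lambda>(b1, b2). tens3 (mon u * varpi b1) (mon b2) (mon v)) (T_coprod R b)))"

definition T3_delbar :: "(hfree \<Rightarrow> hfree \<Rightarrow> complex) \<Rightarrow> tv3 \<Rightarrow> tv3" where
  "T3_delbar R = lin (\<lambda>(u, b, v). pscale ((-1) ^ length u)
     (lin (\<lambda>(b1, b2). tens3 (mon u) (mon b1) (varpi b2 * mon v)) (T_coprod R b)))"

text \<open>Extending $*$ from degree 1 by $(\xi\wedge\eta)^*=(-1)^{|\xi||\eta|}\eta^*\wedge\xi^*$ gives the
  sign $(-1)^{n(n-1)/2}$ in degree $n$.\<close>

definition graded_T_star :: "real \<Rightarrow> tv \<Rightarrow> tv" where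
  "graded_T_star q = antilin (\<lambda>w. pscale ((-1) ^ (length w * (length w - 1) div 2)) (T_star q (mon w)))"

definition T3_star :: "real \<Rightarrow> tv3 \<Rightarrow> tv3" where
  "T3_star q = antilin (\<lambda>(u, b, v). pscale ((-1) ^ (length u * length v))
     (tens3 (graded_T_star q (mon v)) (T_star q (mon b)) (graded_T_star q (mon u))))"

definition bideg_words :: "nat \<Rightarrow> nat \<Rightarrow> vword3 set" where
  "bideg_words p r = {(u, b, v). length u = p \<and> length v = r}"


section \<open>Quantum complex manifolds with factorisable Dolbeault double complex\<close>

definition complex_ring :: "complex ring" where
  "complex_ring = \<lparr>carrier = UNIV, monoid.mult = (*), one = 1, zero = 0, add = (+)\<rparr>"

locale complex_algebra = ring A + Module.module complex_ring A for A (structure) +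
  assumes smult_assoc_left:
      "\<lbrakk>x \<in> carrier A; y \<in> carrier A\<rbrakk> \<Longrightarrow> (s \<odot> x) \<otimes> y = s \<odot> (x \<otimes> y)"
    and smult_assoc_right:
      "\<lbrakk>x \<in> carrier A; y \<in> carrier A\<rbrakk> \<Longrightarrow> x \<otimes> (s \<odot> y) = s \<odot> (x \<otimes> y)"

definition linear_subspace :: "(complex, 'a, 'm) module_scheme \<Rightarrow> 'a set \<Rightarrow> bool" where
  "linear_subspace A S \<longleftrightarrow> S \<subseteq> carrier A \<and> \<zero>\<^bsub>A\<^esub> \<in> S \<and>
     (\<forall>x\<in>S. \<forall>y\<in>S. x \<oplus>\<^bsub>A\<^esub> y \<in> S) \<and> (\<forall>s. \<forall>x\<in>S. s \<odot>\<^bsub>A\<^esub> x \<in> S)"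

definition linear_endo :: "(complex, 'a, 'm) module_scheme \<Rightarrow> ('a \<Rightarrow> 'a) \<Rightarrow> bool" where
  "linear_endo A f \<longleftrightarrow> f \<in> carrier A \<rightarrow> carrier A \<and>
     (\<forall>x\<in>carrier A. \<forall>y\<in>carrier A. f (x \<oplus>\<^bsub>A\<^esub> y) = f x \<oplus>\<^bsub>A\<^esub> f y) \<and>
     (\<forall>s. \<forall>x\<in>carrier A. f (s \<odot>\<^bsub>A\<^esub> x) = s \<odot>\<^bsub>A\<^esub> f x)"

definition internal_direct_sum ::
    "(complex, 'a, 'm) module_scheme \<Rightarrow> 'i set \<Rightarrow> ('i \<Rightarrow> 'a set) \<Rightarrow> 'a set \<Rightarrow> bool" where
  "internal_direct_sum A I M X \<longleftrightarrow>
     (\<forall>i\<in>I. linear_subspace A (M i)) \<and>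
     X = {\<Oplus>\<^bsub>A\<^esub>i\<in>J. f i |J f. finite J \<and> J \<subseteq> I \<and> (\<forall>i\<in>J. f i \<in> M i)} \<and>
     (\<forall>J f. finite J \<and> J \<subseteq> I \<and> (\<forall>i\<in>J. f i \<in> M i) \<and> (\<Oplus>\<^bsub>A\<^esub>i\<in>J. f i) = \<zero>\<^bsub>A\<^esub>
        \<longrightarrow> (\<forall>i\<in>J. f i = \<zero>\<^bsub>A\<^esub>))"

locale star_DGA = complex_algebra A for A (structure) +
  fixes deg :: "nat \<Rightarrow> 'a set" and diff :: "'a \<Rightarrow> 'a" and star :: "'a \<Rightarrow> 'a"
  assumes grading: "internal_direct_sum A UNIV deg (carrier A)"
    and one_deg: "\<one> \<in> deg 0"
    and mult_deg: "\<lbrakk>x \<in> deg m; y \<in> deg n\<rbrakk> \<Longrightarrow> x \<otimes> y \<in> deg (m + n)"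
    and diff_linear: "linear_endo A diff"
    and diff_deg: "x \<in> deg m \<Longrightarrow> diff x \<in> deg (Suc m)"
    and diff_diff: "x \<in> carrier A \<Longrightarrow> diff (diff x) = \<zero>"
    and diff_Leibniz: "\<lbrakk>x \<in> deg m; y \<in> carrier A\<rbrakk> \<Longrightarrow>
        diff (x \<otimes> y) = diff x \<otimes> y \<oplus> (-1) ^ m \<odot> (x \<otimes> diff y)"
    and star_deg: "x \<in> deg m \<Longrightarrow> star x \<in> deg m"
    and star_closed: "x \<in> carrier A \<Longrightarrow> star x \<in> carrier A"
    and star_add: "\<lbrakk>x \<in> carrier A; y \<in> carrier A\<rbrakk> \<Longrightarrow> star (x \<oplus> y) = star x \<oplus> star y"
    and star_smult: "x \<in> carrier A \<Longrightarrow> star (s \<odot> x) = cnj s \<odot> star x"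
    and star_star: "x \<in> carrier A \<Longrightarrow> star (star x) = x"
    and star_mult: "\<lbrakk>x \<in> deg m; y \<in> deg n\<rbrakk> \<Longrightarrow>
        star (x \<otimes> y) = (-1) ^ (m * n) \<odot> (star y \<otimes> star x)"
    and diff_star: "x \<in> carrier A \<Longrightarrow> diff (star x) = star (diff x)"

text \<open>Bimodules over a complex algebra and the tensor product $M\otimes_BN$: the vector space freely
  spanned by $M\times N$ modulo the bilinearity and balancing relations.\<close>

record ('b, 'm) bimodule =
  bim_carrier :: "'m set"
  bim_add :: "'m \<Rightarrow> 'm \<Rightarrow> 'm"
  bim_scale :: "complex \<Rightarrow> 'm \<Rightarrow> 'm"
  bim_left :: "'b \<Rightarrow> 'm \<Rightarrow> 'm"
  bim_right :: "'m \<Rightarrow> 'b \<Rightarrow> 'm"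

definition bimodule_iso ::
    "'b set \<Rightarrow> ('b, 'm) bimodule \<Rightarrow> ('b, 'n) bimodule \<Rightarrow> ('m \<Rightarrow> 'n) \<Rightarrow> bool" where
  "bimodule_iso B M N h \<longleftrightarrow> bij_betw h (bim_carrier M) (bim_carrier N) \<and>
     (\<forall>x\<in>bim_carrier M. \<forall>y\<in>bim_carrier M. h (bim_add M x y) = bim_add N (h x) (h y)) \<and>
     (\<forall>s. \<forall>x\<in>bim_carrier M. h (bim_scale M s x) = bim_scale N s (h x)) \<and>
     (\<forall>b\<in>B. \<forall>x\<in>bim_carrier M. h (bim_left M b x) = bim_left N b (h x) \<and>
        h (bim_right M x b) = bim_right N (h x) b)"

definition balanced_rel ::
    "'b set \<Rightarrow> ('b, 'm) bimodule \<Rightarrow> ('b, 'n) bimodule \<Rightarrow> ('m \<times> 'n \<Rightarrow>\<^sub>0 complex) set" where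
  "balanced_rel B M N = pspan
     ({mon (bim_add M x x', y) - mon (x, y) - mon (x', y) |x x' y.
         x \<in> bim_carrier M \<and> x' \<in> bim_carrier M \<and> y \<in> bim_carrier N} \<union>
      {mon (x, bim_add N y y') - mon (x, y) - mon (x, y') |x y y'.
         x \<in> bim_carrier M \<and> y \<in> bim_carrier N \<and> y' \<in> bim_carrier N} \<union>
      {mon (bim_scale M s x, y) - pscale s (mon (x, y)) |s x y.
         x \<in> bim_carrier M \<and> y \<in> bim_carrier N} \<union>
      {mon (x, bim_scale N s y) - pscale s (mon (x, y)) |s x y.
         x \<in> bim_carrier M \<and> y \<in> bim_carrier N} \<union>
      {mon (bim_right M x b, y) - mon (x, bim_left N b y) |b x y.
         b \<in> B \<and> x \<in> bim_carrier M \<and> y \<in> bim_carrier N})"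

definition tensor_over ::
    "'b set \<Rightarrow> ('b, 'm) bimodule \<Rightarrow> ('b, 'n) bimodule \<Rightarrow> ('b, ('m \<times> 'n \<Rightarrow>\<^sub>0 complex) set) bimodule" where
  "tensor_over B M N =
     \<lparr>bim_carrier = cls (balanced_rel B M N) ` supp_on (bim_carrier M \<times> bim_carrier N),
      bim_add = induced2 (balanced_rel B M N) (+),
      bim_scale = (\<lambda>s. induced (balanced_rel B M N) (pscale s)),
      bim_left = (\<lambda>b. induced (balanced_rel B M N) (lin (\<lambda>(x, y). mon (bim_left M b x, y)))),
      bim_right = (\<lambda>X b. induced (balanced_rel B M N) (lin (\<lambda>(x, y). mon (x, bim_right N y b))) X)\<rparr>"

definition pure_tensor ::
    "'b set \<Rightarrow> ('b, 'm) bimodule \<Rightarrow> ('b, 'n) bimodule \<Rightarrow> 'm \<Rightarrow> 'n \<Rightarrow> ('m \<times> 'n \<Rightarrow>\<^sub>0 complex) set" where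
  "pure_tensor B M N x y = cls (balanced_rel B M N) (mon (x, y))"

record 'a dolbeault_data = "(complex, 'a) module" +
  dstar :: "'a \<Rightarrow> 'a"
  bideg :: "nat \<Rightarrow> nat \<Rightarrow> 'a set"
  del :: "'a \<Rightarrow> 'a"
  delbar :: "'a \<Rightarrow> 'a"

definition total_deg :: "'a dolbeault_data \<Rightarrow> nat \<Rightarrow> 'a set" where
  "total_deg \<Omega> m = {\<Oplus>\<^bsub>\<Omega>\<^esub>p\<in>{..m}. f p |f. \<forall>p\<le>m. f p \<in> bideg \<Omega> p (m - p)}"

definition total_diff :: "'a dolbeault_data \<Rightarrow> 'a \<Rightarrow> 'a" where
  "total_diff \<Omega> x = del \<Omega> x \<oplus>\<^bsub>\<Omega>\<^esub> delbar \<Omega> x"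

definition form_bimodule :: "'a dolbeault_data \<Rightarrow> nat \<Rightarrow> nat \<Rightarrow> ('a, 'a) bimodule" where
  "form_bimodule \<Omega> p r = \<lparr>bim_carrier = bideg \<Omega> p r, bim_add = add \<Omega>, bim_scale = smult \<Omega>,
     bim_left = monoid.mult \<Omega>, bim_right = monoid.mult \<Omega>\<rparr>"

text \<open>\<open>form_tensor \<Omega> p r p' r'\<close> is $\Omega^{p,r}\otimes_{\Omega^{0,0}}\Omega^{p',r'}$, and \<open>wedge_map\<close> the map
  $x\otimes y\mapsto x\wedge y$ on it.\<close>

definition form_tensor :: "'a dolbeault_data \<Rightarrow> nat \<Rightarrow> nat \<Rightarrow> nat \<Rightarrow> nat
    \<Rightarrow> ('a, ('a \<times> 'a \<Rightarrow>\<^sub>0 complex) set) bimodule" where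
  "form_tensor \<Omega> p r p' r' =
     tensor_over (bideg \<Omega> 0 0) (form_bimodule \<Omega> p r) (form_bimodule \<Omega> p' r')"

definition form_pure :: "'a dolbeault_data \<Rightarrow> nat \<Rightarrow> nat \<Rightarrow> nat \<Rightarrow> nat
    \<Rightarrow> 'a \<Rightarrow> 'a \<Rightarrow> ('a \<times> 'a \<Rightarrow>\<^sub>0 complex) set" where
  "form_pure \<Omega> p r p' r' =
     pure_tensor (bideg \<Omega> 0 0) (form_bimodule \<Omega> p r) (form_bimodule \<Omega> p' r')"

definition wedge_map :: "'a dolbeault_data \<Rightarrow> nat \<Rightarrow> nat \<Rightarrow> nat \<Rightarrow> nat
    \<Rightarrow> ('a \<times> 'a \<Rightarrow>\<^sub>0 complex) set \<Rightarrow> 'a" where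
  "wedge_map \<Omega> p r p' r' X =
     the_elem ((\<lambda>f. \<Oplus>\<^bsub>\<Omega>\<^esub>k\<in>Poly_Mapping.keys f. Poly_Mapping.lookup f k \<odot>\<^bsub>\<Omega>\<^esub> (fst k \<otimes>\<^bsub>\<Omega>\<^esub> snd k))
       ` (X \<inter> supp_on (bideg \<Omega> p r \<times> bideg \<Omega> p' r')))"

locale quantum_complex_manifold =
  star_DGA \<Omega> "total_deg \<Omega>" "total_diff \<Omega>" "dstar \<Omega>" for \<Omega> (structure) +
  assumes bigrading: "internal_direct_sum \<Omega> {..m} (\<lambda>p. bideg \<Omega> p (m - p)) (total_deg \<Omega> m)"
    and wedge_bideg: "\<lbrakk>x \<in> bideg \<Omega> p r; y \<in> bideg \<Omega> p' r'\<rbrakk> \<Longrightarrow> x \<otimes> y \<in> bideg \<Omega> (p + p') (r + r')"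
    and del_linear: "linear_endo \<Omega> (del \<Omega>)"
    and delbar_linear: "linear_endo \<Omega> (delbar \<Omega>)"
    and del_bideg: "x \<in> bideg \<Omega> p r \<Longrightarrow> del \<Omega> x \<in> bideg \<Omega> (Suc p) r"
    and delbar_bideg: "x \<in> bideg \<Omega> p r \<Longrightarrow> delbar \<Omega> x \<in> bideg \<Omega> p (Suc r)"
    and del_Leibniz: "\<lbrakk>x \<in> bideg \<Omega> p r; y \<in> carrier \<Omega>\<rbrakk> \<Longrightarrow>
        del \<Omega> (x \<otimes> y) = del \<Omega> x \<otimes> y \<oplus> (-1) ^ (p + r) \<odot> (x \<otimes> del \<Omega> y)"
    and delbar_Leibniz: "\<lbrakk>x \<in> bideg \<Omega> p r; y \<in> carrier \<Omega>\<rbrakk> \<Longrightarrow>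
        delbar \<Omega> (x \<otimes> y) = delbar \<Omega> x \<otimes> y \<oplus> (-1) ^ (p + r) \<odot> (x \<otimes> delbar \<Omega> y)"
    and del_del: "x \<in> carrier \<Omega> \<Longrightarrow> del \<Omega> (del \<Omega> x) = \<zero>"
    and delbar_delbar: "x \<in> carrier \<Omega> \<Longrightarrow> delbar \<Omega> (delbar \<Omega> x) = \<zero>"
    and del_delbar: "x \<in> carrier \<Omega> \<Longrightarrow> del \<Omega> (delbar \<Omega> x) \<oplus> delbar \<Omega> (del \<Omega> x) = \<zero>"
    and star_bideg: "dstar \<Omega> ` bideg \<Omega> p r = bideg \<Omega> r p"
    and star_del: "x \<in> carrier \<Omega> \<Longrightarrow> dstar \<Omega> (del \<Omega> x) = delbar \<Omega> (dstar \<Omega> x)"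
    and factorisable: "bimodule_iso (bideg \<Omega> 0 0)
        (form_tensor \<Omega> p 0 0 r) (form_bimodule \<Omega> p r) (wedge_map \<Omega> p 0 0 r)"
    and factorisable': "bimodule_iso (bideg \<Omega> 0 0)
        (form_tensor \<Omega> 0 r p 0) (form_bimodule \<Omega> p r) (wedge_map \<Omega> 0 r p 0)"

definition left_basis :: "(complex, 'a, 'm) module_scheme \<Rightarrow> 'a set \<Rightarrow> 'a set \<Rightarrow> 'a list \<Rightarrow> bool" where
  "left_basis A B M es \<longleftrightarrow> set es \<subseteq> M \<and>
     (\<forall>x\<in>M. \<exists>!c. c \<in> {..<length es} \<rightarrow>\<^sub>E B \<and> x = (\<Oplus>\<^bsub>A\<^esub>i\<in>{..<length es}. c i \<otimes>\<^bsub>A\<^esub> es ! i))"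

definition right_basis :: "(complex, 'a, 'm) module_scheme \<Rightarrow> 'a set \<Rightarrow> 'a set \<Rightarrow> 'a list \<Rightarrow> bool" where
  "right_basis A B M es \<longleftrightarrow> set es \<subseteq> M \<and>
     (\<forall>x\<in>M. \<exists>!c. c \<in> {..<length es} \<rightarrow>\<^sub>E B \<and> x = (\<Oplus>\<^bsub>A\<^esub>i\<in>{..<length es}. es ! i \<otimes>\<^bsub>A\<^esub> c i))"


section \<open>The data of the theorem\<close>

definition Omega :: "real \<Rightarrow> (hfree \<Rightarrow> hfree \<Rightarrow> complex) \<Rightarrow> tv3 set dolbeault_data" where
  "Omega q R = (let J = Omega_rel R in
     \<lparr>carrier = range (cls J), monoid.mult = induced2 J (T3_mult R), one = cls J (mon ([], [], [])),
      zero = cls J 0, add = induced2 J (+), smult = (\<lambda>s. induced J (pscale s)),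
      dstar = induced J (T3_star q),
      bideg = (\<lambda>p r. cls J ` supp_on (bideg_words p r)),
      del = induced J (T3_del R), delbar = induced J (T3_delbar R)\<rparr>)"

text \<open>The embedding $b\mapsto1\otimes b\otimes1$ of $B$ onto $\Omega^{0,0}$.\<close>

definition B_embed :: "(hfree \<Rightarrow> hfree \<Rightarrow> complex) \<Rightarrow> tv set \<Rightarrow> tv3 set" where
  "B_embed R = induced (Omega_rel R) (\<lambda>b. tens3 1 b 1)"

text \<open>
  $\Theta^{1,1}=(\Psi_{B,V}\otimes\Psi_{V,B})(\mathrm{id}\otimes\Psi_{V,V}\otimes\mathrm{id})$ is written on
  $(TV\otimes V)\otimes(V\otimes TV)$, whose basis words are the pairs of triples
  \<open>(([], b, v), (u, b', []))\<close> with $v$, $u$ letters, and then induced on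
  $\Omega^{0,1}\otimes_B\Omega^{1,0}$; \<open>form_proj\<close> is the projection onto the tensor product
  over $B$.
\<close>

definition theta_words :: "(hfree \<Rightarrow> hfree \<Rightarrow> complex) \<Rightarrow> vword3 \<times> vword3 \<Rightarrow> (vword3 \<times> vword3 \<Rightarrow>\<^sub>0 complex)" where
  "theta_words R = (\<lambda>((_, b, v), (u, b', _)).
     lin (\<lambda>(u1, v1). lin (\<lambda>(u2, b1). lin (\<lambda>(b2, v2). mon ((u2, b1, []), ([], b2, v2)))
       (psi R v1 b')) (psi R b u1)) (psi R v u))"

definition form_proj :: "real \<Rightarrow> (hfree \<Rightarrow> hfree \<Rightarrow> complex) \<Rightarrow> nat \<Rightarrow> nat \<Rightarrow> nat \<Rightarrow> nat
    \<Rightarrow> (vword3 \<times> vword3 \<Rightarrow>\<^sub>0 complex) \<Rightarrow> (tv3 set \<times> tv3 set \<Rightarrow>\<^sub>0 complex) set" where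
  "form_proj q R p r p' r' g =
     cls (balanced_rel (bideg (Omega q R) 0 0)
           (form_bimodule (Omega q R) p r) (form_bimodule (Omega q R) p' r'))
       (lin (\<lambda>(x, y). mon (cls (Omega_rel R) (mon x), cls (Omega_rel R) (mon y))) g)"

definition Theta11 :: "real \<Rightarrow> (hfree \<Rightarrow> hfree \<Rightarrow> complex)
    \<Rightarrow> (tv3 set \<times> tv3 set \<Rightarrow>\<^sub>0 complex) set \<Rightarrow> (tv3 set \<times> tv3 set \<Rightarrow>\<^sub>0 complex) set" where
  "Theta11 q R X = the_elem ((\<lambda>g. form_proj q R 1 0 0 1 (lin (theta_words R) g)) `
     {g \<in> supp_on (bideg_words 0 1 \<times> bideg_words 1 0). form_proj q R 0 1 1 0 g = X})"

end

theory Submission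
  imports Defs
begin

text \<open>
  Left multiplication by a single letter placed in one of the three tensor factors of
  $\Lambda\otimes B\otimes\Lambda$ generates the whole product, and moving such a letter to its place
  only uses the braiding of two letters. On free words the structure is therefore governed by three
  families of letter operators with quadratic exchange relations. Associativity, the Leibniz rules,
  the compatibility with the involution and the invariance of the relations are checked one letter
  at a time; the differentials satisfy the Leibniz rule on free words only up to multiples of the
  relations.

  The braided factorial satisfies $[n+1]! = ([n]!\otimes\mathrm{id})\,[n+1]$, and the braided integer
  $[n+1]$ is $\bar\partial$ on words in the middle factor. Hence the kernel of $[n]!$ consists of the elements
  all of whose braided partial derivatives lie in the kernel of $[n-1]!$. On the ordered monomials $z^iw^j$
  these derivatives multiply by $q^2$-integers, which do not vanish for $q>0$, so the kernel is the ideal of the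
  relation of the quantum plane.

  Normal forms in each factor give the factorisation of $\Omega^{p,r}$ through $\Omega^{p,0}\otimes_B\Omega^{0,r}$.
  The other order follows from an isomorphism, reversing the tensor factors and exchanging $z$ and $w$, with
  the complex for the parameter $q^{-1}$. Finally $\Theta^{1,1}$ is determined by the wedge products,
  because $\wedge\Theta^{1,1} = -\wedge$ and both are injective.
\<close>

section \<open>Linear algebra on free vector spaces\<close>

text \<open>The form \<open>R\<close> is known only through its axioms. That pairing with the unit
  gives the counit is not one of them and has to be won from convolution invertibility; then the two
  hexagon identities reduce the braiding of words to that of two letters.

  The failure of the Leibniz rule on free words has one source. A middle letter c standing before a
  left letter x is rewritten as Psi(c x), with the left letter in front. Differentiating c by del
  before this rewriting gives c x, and after it gives -Psi(c x), so the discrepancy is the relation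
  c x + Psi(c x) of the exterior algebra. For delbar the same happens when a right letter crosses a
  middle one. Hence identities for the differentials are memberships in the ideal \<open>J3\<close>,
  and its stability under all letter operators has to come before them.

  The parameter 1/q of the reversal comes from the inverse of the letter braiding: after exchanging
  z and w it is the letter braiding for 1/q. In free words the left letters always stand first, so
  the factorisation in the opposite order is visible only after such a reversal.\<close>

lemma lookup_pscale [simp]: "Poly_Mapping.lookup (pscale c x) k = c * Poly_Mapping.lookup x k"
  by (simp add: pscale_def map.rep_eq when_def)

interpretation pm: vector_space "pscale :: complex \<Rightarrow> ('k \<Rightarrow>\<^sub>0 complex) \<Rightarrow> _"
  by standard (auto intro!: poly_mapping_eqI simp: lookup_add algebra_simps)

lemma pspan_def': "pspan = pm.span"
  by (simp add: pspan_def fun_eq_iff)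

definition plinear :: "(('k \<Rightarrow>\<^sub>0 complex) \<Rightarrow> ('l \<Rightarrow>\<^sub>0 complex)) \<Rightarrow> bool" where
  "plinear f \<longleftrightarrow> (\<forall>x y. f (x + y) = f x + f y) \<and> (\<forall>c x. f (pscale c x) = pscale c (f x))"

lemma plinear_simps:
  assumes "plinear f"
  shows "f (x + y) = f x + f y" "f (pscale c x) = pscale c (f x)" "f 0 = 0" "f (- x) = - f x"
    "f (x - y) = f x - f y" "f (sum g A) = (\<Sum>a\<in>A. f (g a))"
proof -
  show a: "f (x + y) = f x + f y" for x y using assms by (simp add: plinear_def)
  show s: "f (pscale c x) = pscale c (f x)" for c x using assms by (simp add: plinear_def)
  show z: "f 0 = 0" using s[of 0 0] by simp
  show m: "f (- x) = - f x" for x using s[of "-1" x] by simp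
  show "f (x - y) = f x - f y" using a[of x "- y"] m[of y] by simp
  show "f (sum g A) = (\<Sum>a\<in>A. f (g a))"
    by (induction A rule: infinite_finite_induct) (simp_all add: z a)
qed

lemma lin_pscale: "lin f (pscale c x) = pscale c (lin f x)"
proof (cases "c = 0")
  case False
  then have "Poly_Mapping.keys (pscale c x) = Poly_Mapping.keys x" by (auto simp: in_keys_iff)
  then show ?thesis by (simp add: lin_def pm.scale_sum_right)
qed (simp add: lin_def)

lemma plinear_lin: "plinear (lin f)"
  by (simp add: plinear_def lin_add lin_pscale)

lemmas lin_simps [simp] = plinear_simps(3-6)[OF plinear_lin] lin_add lin_pscale lin_mon

lemma pm_eq_sum_mon: "x = (\<Sum>k\<in>Poly_Mapping.keys x. pscale (Poly_Mapping.lookup x k) (mon k))"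
proof (rule poly_mapping_eqI)
  fix j
  have "Poly_Mapping.lookup (pscale (Poly_Mapping.lookup x k) (mon k)) j
      = (if k = j then Poly_Mapping.lookup x k else 0)" for k
    by (simp add: mon_def lookup_single when_def)
  then show "Poly_Mapping.lookup x j = Poly_Mapping.lookup (\<Sum>k\<in>Poly_Mapping.keys x. pscale (Poly_Mapping.lookup x k) (mon k)) j"
    by (simp add: lookup_sum in_keys_iff del: lookup_pscale)
qed

lemma plinear_eq_lin: "plinear f \<Longrightarrow> f x = lin (\<lambda>k. f (mon k)) x"
  using arg_cong[OF pm_eq_sum_mon[of x], of f] by (simp add: plinear_simps lin_def)

lemma plinear_eqI:
  assumes "plinear f" "plinear g" "\<And>k. f (mon k) = g (mon k)"
  shows "f x = g x"
  by (subst plinear_eq_lin[OF assms(1)], subst plinear_eq_lin[OF assms(2)]) (simp add: assms(3))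

lemma lin_in_subspace: "pm.subspace S \<Longrightarrow> (\<And>k. k \<in> Poly_Mapping.keys x \<Longrightarrow> f k \<in> S) \<Longrightarrow> lin f x \<in> S"
  unfolding lin_def by (intro pm.subspace_sum pm.subspace_scale)

lemma plinear_in_subspace:
  assumes "plinear f" "pm.subspace S" "\<And>k. k \<in> Poly_Mapping.keys x \<Longrightarrow> f (mon k) \<in> S"
  shows "f x \<in> S"
  by (subst plinear_eq_lin[OF assms(1)]) (intro lin_in_subspace assms)

lemma lin_const0 [simp]: "lin (\<lambda>_. 0) x = 0"
  by (simp add: lin_def)

lemma lin_lin: "lin f (lin g x) = lin (\<lambda>k. lin f (g k)) x"
  unfolding lin_def[of g x] lin_def[of "\<lambda>k. lin f (g k)" x] by simp

lemma lin_mon_id [simp]: "lin mon x = x"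
  using pm_eq_sum_mon[of x] by (simp add: lin_def)

lemma lin_cong: "(\<And>k. k \<in> Poly_Mapping.keys x \<Longrightarrow> f k = g k) \<Longrightarrow> lin f x = lin g x"
  by (auto simp: lin_def intro!: sum.cong)

lemma lin_fun_add: "lin (\<lambda>k. f k + g k) x = lin f x + lin g x"
  by (simp add: lin_def pm.scale_right_distrib sum.distrib)

lemma lin_fun_uminus: "lin (\<lambda>k. - f k) x = - lin f x"
  by (simp add: lin_def sum_negf)

lemma lin_fun_pscale: "lin (\<lambda>k. pscale c (f k)) x = pscale c (lin f x)"
  by (simp add: lin_def pm.scale_sum_right mult.commute)

text \<open>Fubini for nested linear extensions; it exchanges Sweedler sums that run over different
  tensor legs.\<close>

lemma lin_swap: "lin (\<lambda>k. lin (\<lambda>l. h k l) y) x = lin (\<lambda>l. lin (\<lambda>k. h k l) x) y"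
  unfolding lin_def by (simp add: pm.scale_sum_right mult.commute) (rule sum.swap)

lemma plinear_ident: "plinear (\<lambda>x. x)"
  by (simp add: plinear_def)

lemma plinear_comp: "plinear f \<Longrightarrow> plinear g \<Longrightarrow> plinear (\<lambda>x. f (g x))"
  by (simp add: plinear_def)

lemma plinear_plus: "plinear f \<Longrightarrow> plinear g \<Longrightarrow> plinear (\<lambda>x. f x + g x)"
  by (simp add: plinear_def pm.scale_right_distrib algebra_simps)

lemma plinear_minus: "plinear f \<Longrightarrow> plinear g \<Longrightarrow> plinear (\<lambda>x. f x - g x)"
  by (simp add: plinear_def pm.scale_right_diff_distrib algebra_simps)

lemma plinear_uminus: "plinear f \<Longrightarrow> plinear (\<lambda>x. - f x)"
  by (simp add: plinear_def)

lemma plinear_pscale: "plinear f \<Longrightarrow> plinear (\<lambda>x. pscale c (f x))"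
  by (simp add: plinear_def pm.scale_right_distrib mult.commute)

lemma plinear_lin_fun: "(\<And>k. plinear (F k)) \<Longrightarrow> plinear (\<lambda>x. lin (\<lambda>k. F k x) y)"
  by (simp add: plinear_def lin_fun_add lin_fun_pscale)

lemma plinear_zero: "plinear (\<lambda>x. 0)"
  by (simp add: plinear_def)

lemma plinear_case_prod: "plinear (\<lambda>x. f (fst p) (snd p) x) \<Longrightarrow> plinear (\<lambda>x. case p of (a, b) \<Rightarrow> f a b x)"
  by (simp add: case_prod_beta)

lemmas plinear_intros = plinear_ident plinear_plus plinear_minus plinear_uminus plinear_pscale
  plinear_lin_fun plinear_zero plinear_comp[OF plinear_lin] plinear_lin plinear_case_prod

lemma lookup_mon: "Poly_Mapping.lookup (mon k) l = (if k = l then 1 else 0)"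
  by (simp add: mon_def lookup_single when_def)

lemma keys_mon [simp]: "Poly_Mapping.keys (mon k) = {k}"
  by (simp add: mon_def)

lemma mon_eq_iff [simp]: "mon k = mon l \<longleftrightarrow> k = l"
  by (metis keys_mon singleton_inject)

lemma subspace_supp_on: "pm.subspace (supp_on A)"
  by (auto simp: supp_on_def pm.subspace_def in_keys_iff lookup_add subset_iff) (metis add_0)

lemma mon_supp_on [simp]: "mon k \<in> supp_on A \<longleftrightarrow> k \<in> A"
  by (simp add: supp_on_def)

lemma lin_eq_on_supp: "x \<in> supp_on A \<Longrightarrow> (\<And>k. k \<in> A \<Longrightarrow> f k = g k) \<Longrightarrow> lin f x = lin g x"
  by (intro lin_cong) (auto simp: supp_on_def)

lemma lin_supp_on: "x \<in> supp_on A \<Longrightarrow> (\<And>k. k \<in> A \<Longrightarrow> f k \<in> supp_on B) \<Longrightarrow> lin f x \<in> supp_on B"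
  by (intro lin_in_subspace subspace_supp_on) (auto simp: supp_on_def)

lemma single_eq_pscale_mon: "Poly_Mapping.single k c = pscale c (mon k)"
  by (rule poly_mapping_eqI) (simp add: mon_def lookup_single when_def)

lemma lin_form_add: "lin_form f (x + y) = lin_form f x + lin_form f y"
  unfolding lin_form_def by (subst setsum_keys_plus_distrib) (auto simp: lookup_add algebra_simps)

lemma lin_form_mon: "lin_form f (mon k) = f k"
  by (simp add: lin_form_def lookup_mon)

lemma pscale_lin_form: "pscale (lin_form f x) y = lin (\<lambda>k. pscale (f k) y) x"
  by (simp add: lin_form_def lin_def pm.scale_sum_left)

lemma mult_pscale_left: "pscale c x * y = pscale c (x * (y :: 'a::monoid_add \<Rightarrow>\<^sub>0 complex))"
  by (simp add: pscale_def mult_map_scale_conv_mult mult.assoc)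

lemma mult_mon: "mon k * mon l = mon (k + l)"
  by (simp add: mon_def mult_single)

text \<open>Words do not commute, so a scalar in the right factor needs its own argument: it is
  carried through the product by the central element \<open>single 0 c\<close>.\<close>

lemma mult_single_0: "x * Poly_Mapping.single 0 c = pscale c (x :: 'a::monoid_add \<Rightarrow>\<^sub>0 complex)"
proof -
  have 1: "plinear (\<lambda>x. x * Poly_Mapping.single 0 c :: 'a \<Rightarrow>\<^sub>0 complex)"
    by (simp add: plinear_def distrib_right mult_pscale_left)
  have 2: "plinear (\<lambda>x. pscale c x :: 'a \<Rightarrow>\<^sub>0 complex)"
    by (intro plinear_intros)
  show ?thesis
    by (rule plinear_eqI[OF 1 2]) (subst single_eq_pscale_mon[symmetric], simp add: mon_def mult_single)
qed

lemma mult_pscale_right: "x * pscale c y = pscale c (x * (y :: 'a::monoid_add \<Rightarrow>\<^sub>0 complex))"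
proof -
  have "x * pscale c y = x * (Poly_Mapping.single 0 c * y)"
    by (simp add: pscale_def mult_map_scale_conv_mult)
  also have "\<dots> = pscale c x * y"
    by (simp only: mult.assoc[symmetric] mult_single_0)
  finally show ?thesis by (simp add: mult_pscale_left)
qed

lemma plinear_mult_left: "plinear (\<lambda>x. x * (y :: 'a::monoid_add \<Rightarrow>\<^sub>0 complex))"
  by (simp add: plinear_def distrib_right mult_pscale_left)

lemma plinear_mult_right: "plinear (\<lambda>x. (y :: 'a::monoid_add \<Rightarrow>\<^sub>0 complex) * x)"
  by (simp add: plinear_def distrib_left mult_pscale_right)

lemma mult_lin: "x * y = lin (\<lambda>k. lin (\<lambda>l. mon (k + l)) y) (x :: 'a::monoid_add \<Rightarrow>\<^sub>0 complex)"
proof -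
  have 1: "x * y = lin (\<lambda>k. mon k * y) x"
    using plinear_mult_left by (rule plinear_eq_lin)
  have 2: "mon k * y = lin (\<lambda>l. mon k * mon l) y" for k
    using plinear_mult_right by (rule plinear_eq_lin)
  show ?thesis unfolding 1 2 mult_mon ..
qed

lemma lin_mult_left: "lin f x * z = lin (\<lambda>k. f k * (z :: 'a::monoid_add \<Rightarrow>\<^sub>0 complex)) x"
  by (simp add: lin_def sum_distrib_right mult_pscale_left)

lemma lin_mult_right: "z * lin f x = lin (\<lambda>k. (z :: 'a::monoid_add \<Rightarrow>\<^sub>0 complex) * f k) x"
  by (simp add: lin_def sum_distrib_left mult_pscale_right)

lemma mon_Nil: "mon [] = 1"
  by (simp add: mon_def flip: single_one zero_list_def)

section \<open>The braiding\<close>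

text \<open>Lets identities between linear extensions that are algebra maps be checked on
  letters.\<close>

lemma lin_mult_hom:
  assumes "\<And>k l. f (k + l) = f k * f l"
  shows "lin f (x * y) = lin f x * lin (f :: 'a::monoid_add \<Rightarrow> 'b::monoid_add \<Rightarrow>\<^sub>0 complex) y"
  by (simp add: mult_lin[of x y] lin_lin assms lin_mult_left lin_mult_right)
    (rule lin_swap)

lemma mult_lin_prod:
  "x * y = lin (\<lambda>(a, b). lin (\<lambda>(a', b'). mon (a + a', b + b')) y)
    (x :: 'a::monoid_add \<times> 'b::monoid_add \<Rightarrow>\<^sub>0 complex)"
  by (simp add: mult_lin[of x y] case_prod_unfold plus_prod_def)

lemma T_coact_append: "T_coact (u @ v) = T_coact u * T_coact v"
  by (simp add: T_coact_def)

lemma H_coprod_append: "H_coprod (mon (u + v)) = H_coprod (mon u) * H_coprod (mon v)"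
  by (simp add: H_coprod_def plus_list_def)

lemma one_eq_mon: "1 = mon 0"
  by (simp add: mon_def)

lemma H_coprod_Nil: "H_coprod 1 = mon ([], [])"
  by (simp add: H_coprod_def mon_Nil[symmetric]) (simp add: one_eq_mon zero_prod_def zero_list_def)

text \<open>Both sides extend multiplicatively from letters, so the two letters of V decide. The
  identity holds before the relations of H are imposed, because the coproduct is already an algebra
  map on the free algebra.\<close>

lemma T_coact_coassoc:
  "lin (\<lambda>(w0, w1). lin (\<lambda>(a, b). mon (a, b, w1)) (T_coact w0)) (T_coact w)
   = lin (\<lambda>(w0, w1). lin (\<lambda>(a, b). mon (w0, a, b)) (H_coprod (mon w1))) (T_coact w)"
  (is "lin ?f _ = lin ?g _")
proof -
  have f: "?f (k + l) = ?f k * ?f l" for k l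
    by (simp add: case_prod_unfold plus_prod_def plus_list_def[where 'a=vgen] T_coact_append
        mult_lin[of "T_coact (fst k)"] lin_lin lin_mult_left lin_mult_right mult_mon)
      (rule lin_swap)
  have g: "?g (k + l) = ?g k * ?g l" for k l
      by (simp add: case_prod_unfold plus_prod_def H_coprod_append
          mult_lin[of "H_coprod (mon (snd k))"] lin_lin lin_mult_left lin_mult_right mult_mon)
        (rule lin_swap)
  have letter: "lin ?f (V_coact_gen c) = lin ?g (V_coact_gen c)" for c
    by (cases c) (simp_all add: T_coact_def H_coprod_def mult_mon plus_prod_def plus_list_def distrib_left distrib_right
       algebra_simps)
  show ?thesis
  proof (induction w)
    case Nil
    then show ?case by (simp add: T_coact_def one_eq_mon)
      (simp add: zero_prod_def T_coact_def H_coprod_def zero_list_def one_eq_mon)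
  next
    case (Cons c w)
    have "T_coact (c # w) = V_coact_gen c * T_coact w" by (simp add: T_coact_def)
    then show ?case by (simp only: lin_mult_hom[of ?f, OF f] lin_mult_hom[of ?g, OF g] letter Cons)
  qed
qed

text \<open>Stated for a multiplicative functional with the values of the counit on the letters of
  the coaction, because it is applied to R(1, .) and to R(., 1); the second of these is known only
  on those letters and by multiplicativity.\<close>

lemma T_coact_counit:
  assumes \<chi>: "\<And>u v. \<chi> (u @ v) = \<chi> u * \<chi> v" "\<chi> [] = 1"
    and "\<chi> [Ga] = 1" "\<chi> [Gb] = 0" "\<chi> [Gc] = 0" "\<chi> [Gd] = 1" "\<chi> [Gt] = 1"
  shows "lin (\<lambda>(w0, w1). pscale (\<chi> w1) (mon w0)) (T_coact w) = mon w" (is "lin ?f _ = _")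
proof -
  have f: "?f (k + l) = ?f k * ?f l" for k l
    by (simp add: case_prod_unfold plus_prod_def plus_list_def \<chi> mult_pscale_left mult_pscale_right mult_mon)
  have \<chi>2: "\<chi> [x, y] = \<chi> [x] * \<chi> [y]" for x y using \<chi>(1)[of "[x]" "[y]"] by simp
  have letter: "lin ?f (V_coact_gen c) = mon [c]" for c
    by (cases c) (simp_all add: \<chi>2 assms)
  show ?thesis
  proof (induction w)
    case Nil
    then show ?case by (simp add: T_coact_def one_eq_mon)
      (simp add: zero_prod_def zero_list_def \<chi>)
  next
    case (Cons c w)
    have "T_coact (c # w) = V_coact_gen c * T_coact w" by (simp add: T_coact_def)
    then show ?case
      by (simp only: lin_mult_hom[of ?f, OF f] letter Cons) (simp add: mult_mon plus_list_def)
  qed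
qed

locale R_of_H =
  fixes q :: real and R :: "hfree \<Rightarrow> hfree \<Rightarrow> complex"
  assumes q: "q > 0" and R: "is_R_of_H q R"
begin

section \<open>Pairing with the unit\<close>

lemma R_mult_left:
  "R (x * y) z = lin_form (\<lambda>(z1, z2). R x (mon z1) * R y (mon z2)) (H_coprod z)"
  using R unfolding is_R_of_H_def coquasitriangular_real_def by meson

lemma R_mult_right:
  "R x (y * z) = lin_form (\<lambda>(x1, x2). R (mon x1) z * R (mon x2) y) (H_coprod x)"
  using R unfolding is_R_of_H_def coquasitriangular_real_def by meson

lemma R_antipode: "convolution R (\<lambda>x. R (H_antipode q x)) x y = H_counit x * H_counit y"
  using R unfolding is_R_of_H_def coquasitriangular_real_def by meson

lemma R_pscale: "R (pscale s x) y = s * R x y"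
  using R unfolding is_R_of_H_def coquasitriangular_real_def bilinear_form_on_H_def by meson

lemma R_uminus: "R (- x) y = - R x y"
  using R_pscale[of "- 1" x y] by simp

lemma H_antipode_1: "H_antipode q 1 = 1"
  by (simp add: H_antipode_def mon_Nil[symmetric])

text \<open>The unit is grouplike and fixed by the antipode, so R(1 1, y) is the convolution of R
  with its inverse at 1.\<close>

lemma R_1_left: "R 1 y = H_counit y"
proof -
  have "R (1 * 1) y = convolution R (\<lambda>x. R (H_antipode q x)) 1 y"
    unfolding R_mult_left convolution_def by (simp add: H_coprod_Nil lin_form_mon mon_Nil H_antipode_1)
  also have "\<dots> = H_counit y"
    by (simp add: R_antipode) (simp add: H_counit_def lin_form_mon mon_Nil[symmetric])
  finally show ?thesis by simp
qed

text \<open>The values R(x, 1) for x = a, b, c, d form a matrix m that is idempotent, by R(x, 1 1),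
  and has a right inverse built from the antipode; hence it is the identity.\<close>

lemma R_1_right:
  "R (hg Ga) 1 = 1" "R (hg Gb) 1 = 0" "R (hg Gc) 1 = 0" "R (hg Gd) 1 = 1" "R (hg Gt) 1 = 1"
proof -
  let ?m = "\<lambda>x. R (hg x) 1"
  have idem: "R x 1 = lin_form (\<lambda>(x1, x2). R (mon x1) 1 * R (mon x2) 1) (H_coprod x)" for x
    using R_mult_right[of x 1 1] by simp
  have inv: "lin_form (\<lambda>(x1, x2). R (mon x1) 1 * R (H_antipode q (mon x2)) 1) (H_coprod x) = H_counit x" for x
    using R_antipode[of x 1] unfolding convolution_def
    by (simp add: H_coprod_Nil lin_form_mon mon_Nil)
      (simp add: H_counit_def lin_form_mon mon_Nil[symmetric])
  have i: "?m Ga = ?m Ga * ?m Ga + ?m Gb * ?m Gc" "?m Gb = ?m Ga * ?m Gb + ?m Gb * ?m Gd"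
    "?m Gc = ?m Gc * ?m Ga + ?m Gd * ?m Gc" "?m Gd = ?m Gc * ?m Gb + ?m Gd * ?m Gd"
    by (subst idem, simp add: H_coprod_def lin_form_add lin_form_mon)+
  have j: "?m Ga * ?m Gd - ?m Gb * ?m Gc / q = 1" "- q * ?m Ga * ?m Gb + ?m Gb * ?m Ga = 0"
    "?m Gc * ?m Gd - ?m Gd * ?m Gc / q = 0" "- q * ?m Gc * ?m Gb + ?m Gd * ?m Ga = 1"
    using inv[of "hg Ga"] inv[of "hg Gb"] inv[of "hg Gc"] inv[of "hg Gd"]
    by (simp_all add: H_coprod_def lin_form_add lin_form_mon H_antipode_def R_pscale R_uminus H_counit_def algebra_simps)
  \<comment> \<open>With n the matrix of antipode values, m = m (m n) = (m m) n = m n = 1, written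
    out entry by entry here and below.\<close>
  show "?m Ga = 1"
  proof -
    have "?m Ga = ?m Ga * (?m Ga * ?m Gd - ?m Gb * ?m Gc / q) + ?m Gb * (?m Gc * ?m Gd - ?m Gd * ?m Gc / q)"
      by (simp only: j mult_1_right mult_zero_right add_0_right add_0_left)
    also have "\<dots> = (?m Ga * ?m Ga + ?m Gb * ?m Gc) * ?m Gd - (?m Ga * ?m Gb + ?m Gb * ?m Gd) * ?m Gc / q"
      by (simp add: algebra_simps add_divide_distrib)
    also have "\<dots> = 1" by (simp only: i[symmetric] j)
    finally show ?thesis .
  qed
  show "?m Gb = 0"
  proof -
    have "?m Gb = ?m Ga * (- q * ?m Ga * ?m Gb + ?m Gb * ?m Ga) + ?m Gb * (- q * ?m Gc * ?m Gb + ?m Gd * ?m Ga)"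
      by (simp only: j mult_1_right mult_zero_right add_0_right add_0_left)
    also have "\<dots> = - q * (?m Ga * ?m Ga + ?m Gb * ?m Gc) * ?m Gb + (?m Ga * ?m Gb + ?m Gb * ?m Gd) * ?m Ga"
      by (simp add: algebra_simps)
    also have "\<dots> = 0" by (simp only: i[symmetric] j)
    finally show ?thesis .
  qed
  show "?m Gc = 0"
  proof -
    have "?m Gc = ?m Gc * (?m Ga * ?m Gd - ?m Gb * ?m Gc / q) + ?m Gd * (?m Gc * ?m Gd - ?m Gd * ?m Gc / q)"
      by (simp only: j mult_1_right mult_zero_right add_0_right add_0_left)
    also have "\<dots> = (?m Gc * ?m Ga + ?m Gd * ?m Gc) * ?m Gd - (?m Gc * ?m Gb + ?m Gd * ?m Gd) * ?m Gc / q"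
      by (simp add: algebra_simps add_divide_distrib)
    also have "\<dots> = 0" by (simp only: i[symmetric] j)
    finally show ?thesis .
  qed
  show "?m Gd = 1"
  proof -
    have "?m Gd = ?m Gc * (- q * ?m Ga * ?m Gb + ?m Gb * ?m Ga) + ?m Gd * (- q * ?m Gc * ?m Gb + ?m Gd * ?m Ga)"
      by (simp only: j mult_1_right mult_zero_right add_0_right add_0_left)
    also have "\<dots> = - q * (?m Gc * ?m Ga + ?m Gd * ?m Gc) * ?m Gb + (?m Gc * ?m Gb + ?m Gd * ?m Gd) * ?m Ga"
      by (simp add: algebra_simps)
    also have "\<dots> = 1" by (simp only: i[symmetric] j)
    finally show ?thesis .
  qed
  \<comment> \<open>Since t^0 = 1, the value prescribed on powers of t at the exponents 1 and 0 is
    R(t, 1).\<close>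
  have "R (t_power m) (t_power n) = complex_of_real (q powr (3/2 * m * n))" for m n
    using R unfolding is_R_of_H_def by blast
  from this[of 1 0] show "?m Gt = 1" using q by (simp add: t_power_def)
qed

section \<open>Unit laws and hexagon identities of the braiding\<close>

lemma psi_Nil_left: "psi R [] v = mon (v, [])"
proof -
  have c: "lin (\<lambda>(v0, v1). pscale (R 1 (mon v1)) (mon v0)) (T_coact v) = mon v"
    by (rule T_coact_counit) (simp_all add: R_1_left H_counit_def lin_form_mon)
  have "T_coact [] = mon ([], [])" by (simp add: T_coact_def one_eq_mon zero_prod_def zero_list_def)
  then show ?thesis unfolding psi_def using arg_cong[OF c, of "lin (\<lambda>w. mon (w, []))"]
    by (simp add: mon_Nil lin_lin case_prod_unfold)
qed

lemma psi_Nil_right: "psi R u [] = mon ([], u)"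
proof -
  have m: "R (mon (x @ y)) 1 = R (mon x) 1 * R (mon y) 1" for x y
    using R_mult_left[of "mon x" "mon y" 1] by (simp add: H_coprod_Nil lin_form_mon mult_mon plus_list_def mon_Nil)
  have c: "lin (\<lambda>(u0, u1). pscale (R (mon u1) 1) (mon u0)) (T_coact u) = mon u"
    by (rule T_coact_counit) (simp_all add: m R_1_right R_1_left H_counit_def lin_form_mon mon_Nil,
      simp add: mon_Nil[symmetric] lin_form_mon)
  have "T_coact [] = mon ([], [])" by (simp add: T_coact_def one_eq_mon zero_prod_def zero_list_def)
  then show ?thesis unfolding psi_def using arg_cong[OF c, of "lin (\<lambda>w. mon ([], w))"]
    by (simp add: mon_Nil lin_lin case_prod_unfold)
qed

text \<open>R(xy, z) = R(x, z1) R(y, z2) lets the two halves of the left word read successive legs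
  of the coaction on v; coassociativity turns the coproduct of that H-leg into a second
  coaction.\<close>

lemma psi_append_left:
  "psi R (u @ u') v = lin (\<lambda>(v1, u1'). lin (\<lambda>(v2, u1). mon (v2, u1 @ u1')) (psi R u v1)) (psi R u' v)"
proof -
  have "psi R (u @ u') v = lin (\<lambda>(a, b). lin (\<lambda>(a', b'). lin (\<lambda>(v0, v1). lin (\<lambda>(z1, z2).
      pscale (R (mon b) (mon z1) * R (mon b') (mon z2)) (mon (v0, a @ a'))) (H_coprod (mon v1)))
        (T_coact v)) (T_coact u')) (T_coact u)"
    unfolding psi_def T_coact_append mult_lin_prod
    by (simp add: lin_lin case_prod_unfold plus_list_def mult_mon[symmetric, where 'a="hgen list", unfolded plus_list_def]
       R_mult_left pscale_lin_form)
  also have "\<dots> = lin (\<lambda>(a, b). lin (\<lambda>(a', b').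
      lin (\<lambda>(v0, z1, z2). pscale (R (mon b) (mon z1) * R (mon b') (mon z2)) (mon (v0, a @ a')))
       (lin (\<lambda>(v0, v1). lin (\<lambda>(z1, z2). mon (v0, z1, z2)) (H_coprod (mon v1))) (T_coact v))) (T_coact u')) (T_coact u)"
    by (simp add: lin_lin case_prod_unfold)
  also have "\<dots> = lin (\<lambda>(a, b). lin (\<lambda>(a', b'). lin (\<lambda>(v0, v1). lin (\<lambda>(v00, v01).
      pscale (R (mon b) (mon v01) * R (mon b') (mon v1)) (mon (v00, a @ a'))) (T_coact v0))
        (T_coact v)) (T_coact u')) (T_coact u)"
    unfolding T_coact_coassoc[symmetric] by (simp add: lin_lin case_prod_unfold)
  also have "\<dots> = lin (\<lambda>(a', b'). lin (\<lambda>(v0, v1). lin (\<lambda>(a, b). lin (\<lambda>(v00, v01).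
      pscale (R (mon b) (mon v01) * R (mon b') (mon v1)) (mon (v00, a @ a'))) (T_coact v0))
        (T_coact u)) (T_coact v)) (T_coact u')"
    unfolding case_prod_unfold by (subst lin_swap, intro lin_cong, rule lin_swap)
  also have "\<dots> = lin (\<lambda>(v1, u1'). lin (\<lambda>(v2, u1). mon (v2, u1 @ u1')) (psi R u v1)) (psi R u' v)"
    by (simp add: psi_def lin_lin case_prod_unfold lin_fun_pscale[symmetric] mult.commute)
  finally show ?thesis .
qed

text \<open>R(x, yz) = R(x1, z) R(x2, y) pairs the outer leg of the coaction on u with the first
  word, so u crosses v before v'.\<close>

lemma psi_append_right:
  "psi R u (v @ v') = lin (\<lambda>(v1, u1). lin (\<lambda>(v1', u2). mon (v1 @ v1', u2)) (psi R u1 v')) (psi R u v)"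
proof -
  have "psi R u (v @ v') = lin (\<lambda>(u0, u1). lin (\<lambda>(a, b). lin (\<lambda>(a', b'). lin (\<lambda>(z1, z2).
      pscale (R (mon z1) (mon b') * R (mon z2) (mon b)) (mon (a @ a', u0))) (H_coprod (mon u1)))
        (T_coact v')) (T_coact v)) (T_coact u)"
    unfolding psi_def T_coact_append mult_lin_prod
    by (simp add: lin_lin case_prod_unfold plus_list_def mult_mon[symmetric, where 'a="hgen list", unfolded plus_list_def]
       R_mult_right pscale_lin_form)
  also have "\<dots> = lin (\<lambda>(u0, u1). lin (\<lambda>(z1, z2). lin (\<lambda>(a, b). lin (\<lambda>(a', b').
      pscale (R (mon z1) (mon b') * R (mon z2) (mon b)) (mon (a @ a', u0)))
        (T_coact v')) (T_coact v)) (H_coprod (mon u1))) (T_coact u)"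
    unfolding case_prod_unfold by (rule lin_cong, subst lin_swap, rule lin_swap[symmetric])
  also have "\<dots> = lin (\<lambda>(u0, z1, z2). lin (\<lambda>(a, b). lin (\<lambda>(a', b').
        pscale (R (mon z1) (mon b') * R (mon z2) (mon b)) (mon (a @ a', u0))) (T_coact v')) (T_coact v))
       (lin (\<lambda>(u0, u1). lin (\<lambda>(z1, z2). mon (u0, z1, z2)) (H_coprod (mon u1))) (T_coact u))"
    by (simp add: lin_lin case_prod_unfold)
  also have "\<dots> = lin (\<lambda>(u0, u1). lin (\<lambda>(u00, u01). lin (\<lambda>(a, b). lin (\<lambda>(a', b').
      pscale (R (mon u01) (mon b') * R (mon u1) (mon b)) (mon (a @ a', u00))) (T_coact v')) (T_coact v)) (T_coact u0))
        (T_coact u)"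
    unfolding T_coact_coassoc[symmetric] by (simp add: lin_lin case_prod_unfold)
  also have "\<dots> = lin (\<lambda>(u0, u1). lin (\<lambda>(a, b). lin (\<lambda>(u00, u01). lin (\<lambda>(a', b').
      pscale (R (mon u01) (mon b') * R (mon u1) (mon b)) (mon (a @ a', u00))) (T_coact v')) (T_coact u0)) (T_coact v))
        (T_coact u)"
    unfolding case_prod_unfold by (rule lin_cong, rule lin_swap)
  also have "\<dots> = lin (\<lambda>(v1, u1). lin (\<lambda>(v1', u2). mon (v1 @ v1', u2)) (psi R u1 v')) (psi R u v)"
    by (simp add: psi_def lin_lin case_prod_unfold lin_fun_pscale[symmetric] mult.commute)
  finally show ?thesis .
qed

end

section \<open>Letter operators on the triple tensor product\<close>

text \<open>\<open>brl\<close> is the braiding of two letters. \<open>opL\<close>, \<open>opM\<close> and \<open>opR\<close> multiply on the left by a letter of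
  the left, middle and right tensor factor, respectively. They depend on a complex parameter because the
  reversal of the tensor factors below replaces \<open>q\<close> by \<open>1 / q\<close>.\<close>

fun brl :: "complex \<Rightarrow> vgen \<Rightarrow> vgen \<Rightarrow> (vgen \<times> vgen \<Rightarrow>\<^sub>0 complex)" where
  "brl q Z Z = pscale (q\<^sup>2) (mon (Z, Z))"
| "brl q W W = pscale (q\<^sup>2) (mon (W, W))"
| "brl q Z W = pscale q (mon (W, Z))"
| "brl q W Z = pscale q (mon (Z, W)) + pscale (q\<^sup>2 - 1) (mon (W, Z))"

definition opL :: "vgen \<Rightarrow> tv3 \<Rightarrow> tv3" where
  "opL c = lin (\<lambda>(u, b, v). mon (c # u, b, v))"

fun wM :: "complex \<Rightarrow> vgen \<Rightarrow> vgen list \<Rightarrow> vgen list \<Rightarrow> vgen list \<Rightarrow> tv3" where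
  "wM q c [] b v = mon ([], c # b, v)"
| "wM q c (x # u) b v = lin (\<lambda>(x', c'). opL x' (wM q c' u b v)) (brl q c x)"

definition opM :: "complex \<Rightarrow> vgen \<Rightarrow> tv3 \<Rightarrow> tv3" where
  "opM q c = lin (\<lambda>(u, b, v). wM q c u b v)"

text \<open>The minus sign for crossing a left letter is the super sign of two elements of degree
  one; letters of the middle factor have degree zero and give none.\<close>

fun wR :: "complex \<Rightarrow> vgen \<Rightarrow> vgen list \<Rightarrow> vgen list \<Rightarrow> vgen list \<Rightarrow> tv3" where
  "wR q c [] [] v = mon ([], [], c # v)"
| "wR q c [] (x # b) v = lin (\<lambda>(x', c'). opM q x' (wR q c' [] b v)) (brl q c x)"
| "wR q c (x # u) b v = - lin (\<lambda>(x', c'). opL x' (wR q c' u b v)) (brl q c x)"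

definition opR :: "complex \<Rightarrow> vgen \<Rightarrow> tv3 \<Rightarrow> tv3" where
  "opR q c = lin (\<lambda>(u, b, v). wR q c u b v)"

lemma plinear_op: "plinear (opL c)" "plinear (opM q c)" "plinear (opR q c)"
  by (simp_all add: opL_def opM_def opR_def plinear_lin)

lemmas op_simps [simp] = plinear_simps[OF plinear_op(1)] plinear_simps[OF plinear_op(2)]
  plinear_simps[OF plinear_op(3)]

lemmas op_intros = plinear_intros plinear_comp[OF plinear_op(1)] plinear_comp[OF plinear_op(2)]
  plinear_comp[OF plinear_op(3)] plinear_op

lemma op_lin: "opL c (lin f x) = lin (\<lambda>k. opL c (f k)) x" "opM q c (lin f x) = lin (\<lambda>k. opM q c (f k)) x"
  "opR q c (lin f x) = lin (\<lambda>k. opR q c (f k)) x"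
  by (simp_all add: opL_def opM_def opR_def lin_lin)

lemma opL_mon [simp]: "opL c (mon (u, b, v)) = mon (c # u, b, v)"
  by (simp add: opL_def)

lemma opM_mon_Nil [simp]: "opM q c (mon ([], b, v)) = mon ([], c # b, v)"
  by (simp add: opM_def)

lemma opR_mon_Nil [simp]: "opR q c (mon ([], [], v)) = mon ([], [], c # v)"
  by (simp add: opR_def)

lemma mon_Cons: "mon (c # u, b, v) = opL c (mon (u, b, v))"
  "mon ([], c # b, v) = opM q c (mon ([], b, v))"
  "mon ([], [], c # v) = opR q c (mon ([], [], v))"
  by simp_all

lemma opM_opL_lin: "opM q c (opL x y) = lin (\<lambda>(x', c'). opL x' (opM q c' y)) (brl q c x)"
proof (rule plinear_eqI[of "\<lambda>y. opM q c (opL x y)"])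
  fix k :: vword3
  show "opM q c (opL x (mon k)) = lin (\<lambda>(x', c'). opL x' (opM q c' (mon k))) (brl q c x)"
    by (cases k) (simp add: opM_def)
qed (intro op_intros)+

lemma opR_opL_lin: "opR q c (opL x y) = - lin (\<lambda>(x', c'). opL x' (opR q c' y)) (brl q c x)"
proof (rule plinear_eqI[of "\<lambda>y. opR q c (opL x y)"])
  fix k :: vword3
  show "opR q c (opL x (mon k)) = - lin (\<lambda>(x', c'). opL x' (opR q c' (mon k))) (brl q c x)"
    by (cases k) (simp add: opR_def)
qed (intro op_intros)+

lemma opM_opL:
  "opM q Z (opL Z y) = pscale (q\<^sup>2) (opL Z (opM q Z y))"
  "opM q W (opL W y) = pscale (q\<^sup>2) (opL W (opM q W y))"
  "opM q Z (opL W y) = pscale q (opL W (opM q Z y))"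
  "opM q W (opL Z y) = pscale q (opL Z (opM q W y)) + pscale (q\<^sup>2 - 1) (opL W (opM q Z y))"
  by (simp_all add: opM_opL_lin)

lemma opR_opL:
  "opR q Z (opL Z y) = - pscale (q\<^sup>2) (opL Z (opR q Z y))"
  "opR q W (opL W y) = - pscale (q\<^sup>2) (opL W (opR q W y))"
  "opR q Z (opL W y) = - pscale q (opL W (opR q Z y))"
  "opR q W (opL Z y) = - pscale q (opL Z (opR q W y)) - pscale (q\<^sup>2 - 1) (opL W (opR q Z y))"
  by (simp_all add: opR_opL_lin)

lemmas coeff_simps = lookup_add lookup_minus algebra_simps power2_eq_square

text \<open>The Yang--Baxter equation for three letters is what makes this relation pass the left letters.\<close>

lemma opR_opM_lin: "opR q c (opM q x y) = lin (\<lambda>(x', c'). opM q x' (opR q c' y)) (brl q c x)"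
proof (rule plinear_eqI[of "\<lambda>y. opR q c (opM q x y)"])
  fix k :: vword3
  obtain u b v where k: "k = (u, b, v)" by (cases k)
  show "opR q c (opM q x (mon k)) = lin (\<lambda>(x', c'). opM q x' (opR q c' (mon k))) (brl q c x)"
    unfolding k
  proof (induction u arbitrary: c x)
    case Nil
    show ?case by (simp add: opR_def)
  next
    case (Cons y u)
    let ?m = "mon (u, b, v)"
    have IH: "opR q Z (opM q Z ?m) = pscale (q\<^sup>2) (opM q Z (opR q Z ?m))"
      "opR q W (opM q W ?m) = pscale (q\<^sup>2) (opM q W (opR q W ?m))"
      "opR q Z (opM q W ?m) = pscale q (opM q W (opR q Z ?m))"
      "opR q W (opM q Z ?m) = pscale q (opM q Z (opR q W ?m)) + pscale (q\<^sup>2 - 1) (opM q W (opR q Z ?m))"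
      by (simp_all add: Cons.IH)
    show ?case
      unfolding mon_Cons(1)
      by (cases c; cases x; cases y)
        (auto simp: opM_opL opR_opL IH coeff_simps simp del: opL_mon intro!: poly_mapping_eqI)
  qed
qed (intro op_intros)+

lemma opR_opM:
  "opR q Z (opM q Z y) = pscale (q\<^sup>2) (opM q Z (opR q Z y))"
  "opR q W (opM q W y) = pscale (q\<^sup>2) (opM q W (opR q W y))"
  "opR q Z (opM q W y) = pscale q (opM q W (opR q Z y))"
  "opR q W (opM q Z y) = pscale q (opM q Z (opR q W y)) + pscale (q\<^sup>2 - 1) (opM q W (opR q Z y))"
  by (simp_all add: opR_opM_lin)

section \<open>The braided super tensor product algebra\<close>

text \<open>A word is the product of its letters in the order left, middle, right, so left
  multiplication by it is a composite of letter operators.\<close>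

definition opW :: "complex \<Rightarrow> vword3 \<Rightarrow> tv3 \<Rightarrow> tv3" where
  "opW q = (\<lambda>(u, b, v) y. foldr opL u (foldr (opM q) b (foldr (opR q) v y)))"

definition mul :: "complex \<Rightarrow> tv3 \<Rightarrow> tv3 \<Rightarrow> tv3" where
  "mul q x y = lin (\<lambda>k. opW q k y) x"

abbreviation one3 :: tv3 where "one3 \<equiv> mon ([], [], [])"

lemma plinear_foldr: "(\<And>c. plinear (f c)) \<Longrightarrow> plinear (foldr f w)"
  by (induction w) (simp_all add: plinear_def)

lemma plinear_opW: "plinear (opW q k)"
  unfolding opW_def case_prod_unfold
  by (intro plinear_comp[OF plinear_foldr] plinear_foldr plinear_op)

lemma plinear_mul_left: "plinear (\<lambda>x. mul q x y)"
  unfolding mul_def by (intro plinear_intros)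

lemma plinear_mul_right: "plinear (mul q x)"
  unfolding mul_def by (intro plinear_intros plinear_opW)

lemmas mul_simps [simp] = plinear_simps[OF plinear_mul_left] plinear_simps[OF plinear_mul_right]

lemmas mul_intros = op_intros plinear_comp[OF plinear_mul_left] plinear_comp[OF plinear_mul_right]
  plinear_mul_left plinear_mul_right

lemma mul_mon: "mul q (mon k) y = opW q k y"
  by (simp add: mul_def)

lemma mul_lin: "mul q (lin f x) y = lin (\<lambda>k. mul q (f k) y) x" "mul q y (lin f x) = lin (\<lambda>k. mul q y (f k)) x"
proof -
  show "mul q (lin f x) y = lin (\<lambda>k. mul q (f k) y) x" by (simp add: mul_def lin_lin)
  show "mul q y (lin f x) = lin (\<lambda>k. mul q y (f k)) x"
    by (rule plinear_eqI[of "\<lambda>x. mul q y (lin f x)"]) (intro mul_intros | simp)+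
qed

lemma mul_opL: "mul q (opL c x) y = opL c (mul q x y)"
proof (rule plinear_eqI[of "\<lambda>x. mul q (opL c x) y"])
  show "mul q (opL c (mon k)) y = opL c (mul q (mon k) y)" for k
    by (cases k) (simp add: mul_mon opW_def)
qed (intro mul_intros)+

text \<open>On a word with left letters the middle letter first moves past them. The exchange
  relation is an identity of operators, so it applies to the word and to its product with y
  alike.\<close>

lemma mul_opM: "mul q (opM q c x) y = opM q c (mul q x y)"
proof (rule plinear_eqI[of "\<lambda>x. mul q (opM q c x) y"])
  fix k :: vword3
  obtain u b v where k: "k = (u, b, v)" by (cases k)
  show "mul q (opM q c (mon k)) y = opM q c (mul q (mon k) y)"
    unfolding k
  proof (induction u arbitrary: c)
    case Nil
    show ?case by (simp add: mul_mon opW_def)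
  next
    case (Cons x u)
    show ?case
      by (simp only: mon_Cons(1) opM_opL_lin mul_lin(1) mul_opL)
         (simp add: case_prod_unfold mul_opL Cons)
  qed
qed (intro mul_intros)+

lemma mul_opR: "mul q (opR q c x) y = opR q c (mul q x y)"
proof (rule plinear_eqI[of "\<lambda>x. mul q (opR q c x) y"])
  fix k :: vword3
  obtain u b v where k: "k = (u, b, v)" by (cases k)
  show "mul q (opR q c (mon k)) y = opR q c (mul q (mon k) y)"
    unfolding k
  proof (induction u arbitrary: c)
    case Nil
    show ?case
    proof (induction b arbitrary: c)
      case Nil
      show ?case by (simp add: mul_mon opW_def)
    next
      case (Cons x b)
      show ?case
        by (simp only: mon_Cons(2)[of _ _ _ q] opR_opM_lin mul_lin(1) mul_opM)
          (simp add: case_prod_unfold mul_opM Cons)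
    qed
  next
    case (Cons x u)
    show ?case
      by (simp only: mon_Cons(1) opR_opL_lin mul_simps mul_lin(1) mul_opL)
         (simp add: case_prod_unfold mul_opL Cons)
  qed
qed (intro mul_intros)+

lemmas mul_op = mul_opL mul_opM mul_opR

lemma mul_foldr: "mul q (foldr opL u x) y = foldr opL u (mul q x y)"
  "mul q (foldr (opM q) b x) y = foldr (opM q) b (mul q x y)"
  "mul q (foldr (opR q) v x) y = foldr (opR q) v (mul q x y)"
  by (induction u, simp_all add: mul_op) (induction b, simp_all add: mul_op, induction v, simp_all add: mul_op)

lemma mul_one_left [simp]: "mul q one3 x = x"
  by (simp add: mul_mon opW_def)

lemma mul_opW: "mul q (opW q k x) y = opW q k (mul q x y)"
  by (simp add: opW_def case_prod_unfold mul_foldr)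

lemma opW_one: "opW q k one3 = mon k"
proof -
  obtain u b v where k: "k = (u, b, v)" by (cases k)
  have 1: "foldr (opR q) v one3 = mon ([], [], v)" by (induction v) simp_all
  have 2: "foldr (opM q) b (mon ([], [], v)) = mon ([], b, v)" by (induction b) simp_all
  have 3: "foldr opL u (mon ([], b, v)) = mon (u, b, v)" by (induction u) simp_all
  show ?thesis by (simp add: k opW_def 1 2 3)
qed

lemma mul_one_right [simp]: "mul q x one3 = x"
  by (simp add: mul_def opW_one)

lemma mul_assoc: "mul q (mul q x y) w = mul q x (mul q y w)"
proof (rule plinear_eqI[of "\<lambda>x. mul q (mul q x y) w"])
  show "mul q (mul q (mon k) y) w = mul q (mon k) (mul q y w)" for k
    by (simp add: mul_mon mul_opW)
qed (intro mul_intros)+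

text \<open>Letters are added from the right factor outwards, so in each case the operator merely
  prefixes a letter, with no crossing.\<close>

lemma word_induct [case_names one L M R]:
  assumes "P one3" "\<And>c u b v. P (mon (u, b, v)) \<Longrightarrow> P (opL c (mon (u, b, v)))"
    "\<And>c b v. P (mon ([], b, v)) \<Longrightarrow> P (opM q c (mon ([], b, v)))"
    "\<And>c v. P (mon ([], [], v)) \<Longrightarrow> P (opR q c (mon ([], [], v)))"
  shows "P (mon (u, b, v))"
proof -
  have 1: "P (mon ([], [], v))" by (induction v) (use assms in auto)
  have 2: "P (mon ([], b, v))" by (induction b) (use assms 1 in auto)
  show ?thesis by (induction u) (use assms 2 in auto)
qed

section \<open>The structure maps on words\<close>

lemma tens3_mon: "tens3 (mon u) (mon b) (mon v) = mon (u, b, v)"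
  by (simp add: tens3_def)

lemma plinear_tens3: "plinear (\<lambda>x. tens3 x y z)" "plinear (\<lambda>y. tens3 x y z)" "plinear (\<lambda>z. tens3 x y z)"
  unfolding tens3_def by (intro plinear_intros)+

lemmas tens3_simps [simp] = plinear_simps[OF plinear_tens3(1)] plinear_simps[OF plinear_tens3(2)]
  plinear_simps[OF plinear_tens3(3)]

lemma mon_mult_list: "mon (u :: 'a list) * mon v = mon (u @ v)"
  by (simp add: mult_mon plus_list_def)

lemma supp_on_mult:
  assumes "x \<in> supp_on A" "y \<in> supp_on B" "\<And>k l. k \<in> A \<Longrightarrow> l \<in> B \<Longrightarrow> k + l \<in> C"
  shows "x * y \<in> supp_on (C :: 'a::monoid_add set)"
  unfolding mult_lin by (intro lin_supp_on[OF assms(1)] lin_supp_on[OF assms(2)]) (use assms(3) in simp)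

lemma T_coact_supp: "T_coact w \<in> supp_on {(w0, w1). length w0 = length w}"
proof (induction w)
  case Nil
  show ?case by (simp add: T_coact_def one_eq_mon zero_prod_def zero_list_def)
next
  case (Cons c w)
  have "V_coact_gen c \<in> supp_on {(w0, w1). length w0 = 1}"
    by (cases c) (auto intro!: pm.subspace_add subspace_supp_on)
  from supp_on_mult[OF this Cons] have "V_coact_gen c * T_coact w \<in> supp_on {(w0, w1). length w0 = length (c # w)}"
    by (auto simp: plus_prod_def plus_list_def)
  then show ?case by (simp add: T_coact_def)
qed

text \<open>The coaction keeps the length of a word, hence so does the braiding;
  \<open>lin_psi_cong\<close> uses this to rewrite length conditions under a braided sum.\<close>

lemma psi_supp: "psi R u v \<in> supp_on {(v', u'). length v' = length v \<and> length u' = length u}"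
  unfolding psi_def
  by (rule lin_supp_on[OF T_coact_supp], clarsimp, rule lin_supp_on[OF T_coact_supp], clarsimp)
     (auto intro!: pm.subspace_scale subspace_supp_on)

lemma lin_psi_cong:
  assumes "\<And>v' u'. length v' = length v \<Longrightarrow> length u' = length u \<Longrightarrow> f (v', u') = g (v', u')"
  shows "lin f (psi R u v) = lin g (psi R u v)"
  by (rule lin_eq_on_supp[OF psi_supp]) (use assms in auto)

abbreviation "ltL c \<equiv> mon ([c], [], []) :: tv3"
abbreviation "ltM c \<equiv> mon ([], [c], []) :: tv3"
abbreviation "ltR c \<equiv> mon ([], [], [c]) :: tv3"

lemma mul_ltL: "mul q (ltL c) x = opL c x"
  by (simp add: mul_mon opW_def)

lemma mul_ltM: "mul q (ltM c) x = opM q c x"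
  by (simp add: mul_mon opW_def)

lemma mul_ltR: "mul q (ltR c) x = opR q c x"
  by (simp add: mul_mon opW_def)

text \<open>The products in which no letter has to cross another, so that they are
  concatenations.\<close>

lemma opW_mult:
  "opW q (a, b, w) (mon ([], [], w')) = mon (a, b, w @ w')"
  "opW q (a, b, []) (mon ([], b', w')) = mon (a, b @ b', w')"
  "opW q (a, [], []) (mon (a', b', w')) = mon (a @ a', b', w')"
proof -
  have 1: "foldr (opR q) v (mon ([], [], w)) = mon ([], [], v @ w)" for v w by (induction v) simp_all
  have 2: "foldr (opM q) b (mon ([], b', v)) = mon ([], b @ b', v)" for b b' v by (induction b) simp_all
  have 3: "foldr opL u (mon (u', b, v)) = mon (u @ u', b, v)" for u u' b v by (induction u) simp_all
  show "opW q (a, b, w) (mon ([], [], w')) = mon (a, b, w @ w')"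
    "opW q (a, b, []) (mon ([], b', w')) = mon (a, b @ b', w')"
    "opW q (a, [], []) (mon (a', b', w')) = mon (a @ a', b', w')"
    by (simp_all add: opW_def 1 2[of _ "[]", simplified] 2 3[of _ "[]", simplified] 3)
qed

lemma mul_tens3:
  "mul q (tens3 a b w) (mon ([], [], w')) = tens3 a b (w * mon w')"
  "mul q (tens3 a b 1) (mon ([], b', [])) = tens3 a (b * mon b') 1"
  "mul q (tens3 a 1 1) (mon (a', [], [])) = tens3 (a * mon a') 1 1"
  by (simp_all add: tens3_def mult_lin[of _ "mon _"] mul_lin lin_lin mul_mon opW_mult
      mon_Nil[symmetric] plus_list_def)

subsection \<open>The involution\<close>

lemma antilin_add: "antilin f (x + y) = antilin f x + antilin f y"
  unfolding antilin_def
  by (subst setsum_keys_plus_distrib) (simp_all add: pm.scale_left_distrib)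

lemma antilin_pscale: "antilin f (pscale c x) = pscale (cnj c) (antilin f x)"
proof (cases "c = 0")
  case False
  then have "Poly_Mapping.keys (pscale c x) = Poly_Mapping.keys x" by (auto simp: in_keys_iff)
  then show ?thesis by (simp add: antilin_def pm.scale_sum_right)
qed (simp add: antilin_def)

lemma antilin_mon: "antilin f (mon k) = f k"
  by (simp add: antilin_def lookup_mon)

definition flipv :: "vgen \<Rightarrow> vgen" where "flipv c = (case c of Z \<Rightarrow> W | W \<Rightarrow> Z)"

lemma flipv_simps [simp]: "flipv Z = W" "flipv W = Z" "flipv (flipv c) = c"
  by (simp_all add: flipv_def split: vgen.split)

definition star_coeff :: "real \<Rightarrow> vgen \<Rightarrow> complex" where
  "star_coeff q c = (case c of Z \<Rightarrow> q powr (1/2) | W \<Rightarrow> q powr (-1/2))"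

lemma T_star_Nil: "T_star q 1 = 1"
  by (simp add: T_star_def mon_Nil[symmetric] antilin_mon)

lemma T_star_Cons: "T_star q (mon (c # w)) = pscale (star_coeff q c) (T_star q (mon w) * mon [flipv c])"
  by (cases c) (simp_all add: T_star_def antilin_mon mult_pscale_right star_coeff_def)

lemma graded_T_star_Nil: "graded_T_star q 1 = 1"
  by (simp add: graded_T_star_def mon_Nil[symmetric] antilin_mon) (simp add: mon_Nil T_star_Nil)

lemma graded_T_star_Cons:
  "graded_T_star q (mon (c # w)) = pscale ((-1) ^ length w * star_coeff q c) (graded_T_star q (mon w) * mon [flipv c])"
proof -
  \<comment> \<open>The exponent n(n-1)/2 grows by n when a letter is added, which is the sign of
    moving the new letter past the n others.\<close>
  have "Suc n * n div 2 = n + n * (n - 1) div 2" for n :: nat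
  proof (cases n)
    case (Suc m)
    then have "Suc n * n = 2 * n + n * (n - 1)" by simp
    then show ?thesis by simp
  qed simp
  then show ?thesis
    by (simp add: graded_T_star_def antilin_mon T_star_Cons mult_pscale_left power_add mult.assoc mult.left_commute)
qed

lemma T3_star_add: "T3_star q (x + y) = T3_star q x + T3_star q y"
  by (simp add: T3_star_def antilin_add)

lemma T3_star_pscale: "T3_star q (pscale c x) = pscale (cnj c) (T3_star q x)"
  by (simp add: T3_star_def antilin_pscale)

lemma T3_star_mon: "T3_star q (mon (u, b, v)) = pscale ((-1) ^ (length u * length v))
     (tens3 (graded_T_star q (mon v)) (T_star q (mon b)) (graded_T_star q (mon u)))"
  by (simp add: T3_star_def antilin_mon)

lemma T3_star_one [simp]: "T3_star q one3 = one3"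
  by (simp add: T3_star_mon, simp add: mon_Nil T_star_Nil graded_T_star_Nil, simp add: mon_Nil[symmetric] tens3_mon)

text \<open>The star of a first letter becomes a last letter of the opposite factor, where
  multiplication is concatenation; hence the parameter \<open>p\<close> of the product is arbitrary,
  here and in the next two lemmas.\<close>

lemma T3_star_L: "T3_star q (mon (c # u, b, v)) =
    pscale ((-1) ^ (length u + length v) * star_coeff q c) (mul p (T3_star q (mon (u, b, v))) (ltR (flipv c)))"
  by (simp add: T3_star_mon graded_T_star_Cons mul_tens3 power_add mult_ac)

lemma T3_star_M: "T3_star q (mon ([], c # b, v)) =
    pscale (star_coeff q c) (mul p (T3_star q (mon ([], b, v))) (ltM (flipv c)))"
  by (simp add: T3_star_mon T_star_Cons mon_Nil graded_T_star_Nil mul_tens3)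

lemma T3_star_R: "T3_star q (mon ([], [], c # v)) =
    pscale ((-1) ^ length v * star_coeff q c) (mul p (T3_star q (mon ([], [], v))) (ltL (flipv c)))"
  by (simp add: T3_star_mon graded_T_star_Cons mon_Nil graded_T_star_Nil T_star_Nil mul_tens3)

context R_of_H
begin

abbreviation Q :: complex where "Q \<equiv> complex_of_real q"

lemma psi_letter: "psi R [c] [x] = lin (\<lambda>(x', c'). mon ([x'], [c'])) (brl Q c x)"
  by (cases c; cases x) (simp_all add: psi_generators[OF q R])

lemma psi_Cons: "psi R [c] (x # u) =
    lin (\<lambda>(x', c'). lin (\<lambda>(u1, c1). mon (x' # u1, c1)) (psi R [c'] u)) (brl Q c x)"
  using psi_append_right[of "[c]" "[x]" u] by (simp add: psi_letter lin_lin case_prod_unfold)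

text \<open>\<open>psi_Cons\<close>, the hexagon identity for a word split after its first letter,
  is the recursion that defines the letter operator.\<close>

lemma opM_psi: "opM Q c (mon (u, b, v)) = lin (\<lambda>(u1, c1). mon (u1, c1 @ b, v)) (psi R [c] u)"
proof (induction u arbitrary: c)
  case Nil
  show ?case by (simp add: psi_Nil_right)
next
  case (Cons x u)
  show ?case
    unfolding psi_Cons mon_Cons(1) opM_opL_lin by (simp add: lin_lin case_prod_unfold Cons op_lin)
qed

lemma opR_psi: "opR Q c (mon (u, b, v)) = pscale ((-1) ^ length u)
   (lin (\<lambda>(u1, c1). lin (\<lambda>(b1, c2). mon (u1, b1, c2 @ v)) (psi R c1 b)) (psi R [c] u))"
proof (induction u arbitrary: c)
  case Nil
  show ?case
  proof (induction b arbitrary: c)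
    case Nil
    show ?case by (simp add: psi_Nil_right)
  next
    case (Cons x b)
    show ?case
      unfolding mon_Cons(2)[of _ _ _ Q] opR_opM_lin
      by (simp add: psi_Nil_right psi_Cons lin_lin case_prod_unfold Cons[simplified psi_Nil_right, simplified] op_lin)
  qed
next
  case (Cons x u)
  show ?case
    unfolding psi_Cons mon_Cons(1) opR_opL_lin
    by (simp add: lin_lin case_prod_unfold Cons op_lin lin_fun_pscale)
qed

lemma foldr_opR_psi: "foldr (opR Q) v (mon (u', b', w)) = pscale ((-1) ^ (length v * length u'))
   (lin (\<lambda>(u1, v1). lin (\<lambda>(b2, v2). mon (u1, b2, v2 @ w)) (psi R v1 b')) (psi R v u'))"
proof (induction v)
  case Nil
  show ?case by (simp add: psi_Nil_left)
next
  case (Cons c v)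
  have "foldr (opR Q) (c # v) (mon (u', b', w)) = pscale ((-1) ^ (length v * length u'))
     (lin (\<lambda>(u1, v1). lin (\<lambda>(b2, v2). opR Q c (mon (u1, b2, v2 @ w))) (psi R v1 b')) (psi R v u'))"
    by (simp add: Cons op_lin case_prod_unfold)
  also have "lin (\<lambda>(u1, v1). lin (\<lambda>(b2, v2). opR Q c (mon (u1, b2, v2 @ w))) (psi R v1 b')) (psi R v u')
    = lin (\<lambda>(u1, v1). lin (\<lambda>(b2, v2). pscale ((-1) ^ length u') (lin (\<lambda>(u2, c1). lin (\<lambda>(b3, c2).
          mon (u2, b3, c2 @ v2 @ w)) (psi R c1 b2)) (psi R [c] u1))) (psi R v1 b')) (psi R v u')"
    by (rule lin_psi_cong) (simp add: opR_psi)
  \<comment> \<open>The letter c crosses u1 while v1 crosses b', on disjoint legs, so the sums may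
    be exchanged; the hexagon identity then recombines c with v.\<close>
  also have "\<dots> = pscale ((-1) ^ length u') (lin (\<lambda>(u1, v1). lin (\<lambda>(u2, c1). lin (\<lambda>(b2, v2). lin (\<lambda>(b3, c2).
          mon (u2, b3, c2 @ v2 @ w)) (psi R c1 b2)) (psi R v1 b')) (psi R [c] u1)) (psi R v u'))"
    unfolding case_prod_unfold lin_fun_pscale
    by (subst lin_swap) (rule refl)
  finally show ?case
    using psi_append_left[of "[c]" v u'] psi_append_left[of _ _ b']
    by (simp add: lin_lin case_prod_unfold power_add mult.commute)
qed

lemma foldr_opM_psi: "foldr (opM Q) b (mon (u', b', w)) =
   lin (\<lambda>(u1, b1). mon (u1, b1 @ b', w)) (psi R b u')"
proof (induction b)
  case Nil
  show ?case by (simp add: psi_Nil_left)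
next
  case (Cons c b)
  show ?case
    using psi_append_left[of "[c]" b u']
    by (simp add: Cons op_lin opM_psi lin_lin case_prod_unfold)
qed

lemma foldr_opM_lin: "foldr (opM Q) b (lin f x) = lin (\<lambda>k. foldr (opM Q) b (f k)) x"
  by (induction b) (simp_all add: op_lin)

lemma foldr_opL_lin: "foldr opL b (lin f x) = lin (\<lambda>k. foldr opL b (f k)) x"
  by (induction b) (simp_all add: op_lin)

lemma foldr_opL_mon: "foldr opL b (mon (u, x, y)) = mon (b @ u, x, y)"
  by (induction b) (simp_all add: op_lin)

lemma T3_mult_eq_mul: "T3_mult R x y = mul Q x y"
proof -
  have "opW Q (u, b, v) (mon (u', b', v')) = pscale ((-1) ^ (length v * length u'))
      (lin (\<lambda>(u1, v1). lin (\<lambda>(u2, b1). lin (\<lambda>(b2, v2). mon (u @ u2, b1 @ b2, v2 @ v'))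
         (psi R v1 b')) (psi R b u1)) (psi R v u'))" for u b v u' b' v'
  proof -
    have "opW Q (u, b, v) (mon (u', b', v')) = pscale ((-1) ^ (length v * length u'))
      (lin (\<lambda>(u1, v1). lin (\<lambda>(b2, v2). lin (\<lambda>(u2, b1). mon (u @ u2, b1 @ b2, v2 @ v'))
         (psi R b u1)) (psi R v1 b')) (psi R v u'))"
      by (simp add: opW_def foldr_opR_psi plinear_simps[OF plinear_foldr] plinear_op foldr_opM_lin
          foldr_opM_psi foldr_opL_lin case_prod_unfold foldr_opL_mon)
    \<comment> \<open>The braidings of b with u1 and of v1 with b' act on different legs, so their
      order is immaterial.\<close>
    also have "\<dots> = pscale ((-1) ^ (length v * length u'))
      (lin (\<lambda>(u1, v1). lin (\<lambda>(u2, b1). lin (\<lambda>(b2, v2). mon (u @ u2, b1 @ b2, v2 @ v'))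
         (psi R v1 b')) (psi R b u1)) (psi R v u'))"
      unfolding case_prod_unfold by (subst lin_swap) (rule refl)
    finally show ?thesis .
  qed
  then have "opW Q k (mon l) = (case l of (u', b', v') \<Rightarrow> case k of (u, b, v) \<Rightarrow> pscale ((-1) ^ (length v * length u'))
      (lin (\<lambda>(u1, v1). lin (\<lambda>(u2, b1). lin (\<lambda>(b2, v2). mon (u @ u2, b1 @ b2, v2 @ v'))
         (psi R v1 b')) (psi R b u1)) (psi R v u')))" for k l
    by (cases k; cases l) simp
  then have "opW Q k y = lin (\<lambda>(u', b', v'). case k of (u, b, v) \<Rightarrow> pscale ((-1) ^ (length v * length u'))
      (lin (\<lambda>(u1, v1). lin (\<lambda>(u2, b1). lin (\<lambda>(b2, v2). mon (u @ u2, b1 @ b2, v2 @ v'))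
         (psi R v1 b')) (psi R b u1)) (psi R v u'))) y" for k
    by (subst plinear_eq_lin[OF plinear_opW]) simp
  then show ?thesis by (simp add: T3_mult_def mul_def case_prod_unfold)
qed

subsection \<open>The differentials\<close>

lemma T_coprod_Cons: "T_coprod R (c # w) = lin (\<lambda>(u', v'). mon (c # u', v')) (T_coprod R w)
   + lin (\<lambda>(u', v'). lin (\<lambda>(u'', v''). mon (u'', v'' @ v')) (psi R [c] u')) (T_coprod R w)"
  by (simp add: T2_mult_def psi_Nil_left)

text \<open>The braiding preserves lengths, so only the term in which the new letter crosses an
  empty left leg survives; \<open>F\<close> absorbs that letter in the induction.\<close>

lemma T_coprod_counit_left: "lin (\<lambda>(b1, b2). if b1 = [] then F b2 else 0) (T_coprod R b) = F b"
proof (induction b arbitrary: F)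
  case (Cons c b)
  have "lin (\<lambda>(u', v'). lin (\<lambda>(u'', v''). if u'' = [] then F (v'' @ v') else 0) (psi R [c] u')) (T_coprod R b)
     = lin (\<lambda>(u', v'). if u' = [] then F (c # v') else 0) (T_coprod R b)"
  proof (intro lin_cong, clarify)
    fix u' v'
    show "lin (\<lambda>(u'', v''). if u'' = [] then F (v'' @ v') else 0) (psi R [c] u') = (if u' = [] then F (c # v') else 0)"
    proof (cases u')
      case Nil
      then show ?thesis by (simp add: psi_Nil_right)
    next
      case (Cons x y)
      then have "lin (\<lambda>(u'', v''). if u'' = [] then F (v'' @ v') else 0) (psi R [c] u') = lin (\<lambda>_. 0) (psi R [c] u')"
        by (intro lin_psi_cong) auto
      then show ?thesis using Cons by simp
    qed
  qed
  then show ?case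
    unfolding T_coprod_Cons using Cons.IH[of "\<lambda>w. F (c # w)"]
    by (simp add: lin_lin case_prod_unfold cong: if_cong)
qed simp

lemma T_coprod_counit_right: "lin (\<lambda>(b1, b2). if b2 = [] then F b1 else 0) (T_coprod R b) = F b"
proof (induction b arbitrary: F)
  case (Cons c b)
  have "lin (\<lambda>(u', v'). lin (\<lambda>(u'', v''). if v'' @ v' = [] then F u'' else 0) (psi R [c] u')) (T_coprod R b)
     = lin (\<lambda>(u', v'). 0) (T_coprod R b)"
  proof (intro lin_cong, clarify)
    fix u' v'
    have "lin (\<lambda>(u'', v''). if v'' @ v' = [] then F u'' else 0) (psi R [c] u') = lin (\<lambda>_. 0) (psi R [c] u')"
        by (intro lin_psi_cong) auto
    then show "lin (\<lambda>(u'', v''). if v'' @ v' = [] then F u'' else 0) (psi R [c] u') = 0" by simp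
  qed
  then show ?case
    unfolding T_coprod_Cons using Cons.IH[of "\<lambda>w. F (c # w)"]
    by (simp add: lin_lin case_prod_unfold cong: if_cong)
qed simp

lemma plinear_T3_del: "plinear (T3_del R)" "plinear (T3_delbar R)"
  by (simp_all add: T3_del_def T3_delbar_def plinear_lin)

lemmas T3_del_simps [simp] = plinear_simps[OF plinear_T3_del(1)] plinear_simps[OF plinear_T3_del(2)]

lemma T3_del_mon: "T3_del R (mon (u, b, v)) = pscale ((-1) ^ length u)
     (lin (\<lambda>(b1, b2). if length b1 = 1 then mon (u @ b1, b2, v) else 0) (T_coprod R b))"
  by (simp add: T3_del_def)
    (intro arg_cong[where f="pscale _"] lin_cong, auto simp: varpi_def mon_mult_list tens3_mon)

lemma T3_delbar_mon: "T3_delbar R (mon (u, b, v)) = pscale ((-1) ^ length u)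
     (lin (\<lambda>(b1, b2). if length b2 = 1 then mon (u, b1, b2 @ v) else 0) (T_coprod R b))"
  by (simp add: T3_delbar_def)
    (intro arg_cong[where f="pscale _"] lin_cong, auto simp: varpi_def mon_mult_list tens3_mon)

lemma T3_del_opL: "T3_del R (opL c x) = - opL c (T3_del R x)"
proof (rule plinear_eqI[of "\<lambda>x. T3_del R (opL c x)"])
  fix k :: vword3 obtain u b v where k: "k = (u, b, v)" by (cases k)
  show "T3_del R (opL c (mon k)) = - opL c (T3_del R (mon k))"
    by (simp add: k T3_del_mon op_lin case_prod_unfold if_distrib cong: if_cong)
qed (intro op_intros plinear_comp[OF plinear_T3_del(1)] plinear_T3_del)+

lemma T3_delbar_opL: "T3_delbar R (opL c x) = - opL c (T3_delbar R x)"
proof (rule plinear_eqI[of "\<lambda>x. T3_delbar R (opL c x)"])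
  fix k :: vword3 obtain u b v where k: "k = (u, b, v)" by (cases k)
  show "T3_delbar R (opL c (mon k)) = - opL c (T3_delbar R (mon k))"
    by (simp add: k T3_delbar_mon op_lin case_prod_unfold if_distrib cong: if_cong)
qed (intro op_intros plinear_comp[OF plinear_T3_del(2)] plinear_T3_del)+

text \<open>In the coproduct of c b the left leg has length one in two ways: c stands in front of an
  empty leg, where the counit returns b, or c crosses a left leg of length one, which is
  \<open>opM\<close>.\<close>

lemma T3_del_M: "T3_del R (mon ([], c # b, v)) = mon ([c], b, v) + opM Q c (T3_del R (mon ([], b, v)))"
proof -
  have 1: "lin (\<lambda>(u', v'). lin (\<lambda>(u'', v''). if length u'' = 1 then mon (u'', v'' @ v', v) else 0) (psi R [c] u')) (T_coprod R b)
    = lin (\<lambda>(u', v'). if length u' = 1 then opM Q c (mon (u', v', v)) else 0) (T_coprod R b)"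
  proof (intro lin_cong, clarify)
    fix u' v'
    have "lin (\<lambda>(u'', v''). if length u'' = 1 then mon (u'', v'' @ v', v) else 0) (psi R [c] u') =
      lin (\<lambda>(u'', v''). if length u' = 1 then mon (u'', v'' @ v', v) else 0) (psi R [c] u')"
      by (rule lin_psi_cong) simp
    then show "lin (\<lambda>(u'', v''). if length u'' = 1 then mon (u'', v'' @ v', v) else 0) (psi R [c] u') =
      (if length u' = 1 then opM Q c (mon (u', v', v)) else 0)"
      by (simp add: opM_psi case_prod_unfold)
  qed
  have 2: "lin (\<lambda>(u', v'). if u' = [] then mon (c # u', v', v) else 0) (T_coprod R b) = mon ([c], b, v)"
    using T_coprod_counit_left[of "\<lambda>b. mon ([c], b, v)" b] by (simp add: case_prod_unfold cong: if_cong)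
  show ?thesis
    unfolding T3_del_mon T_coprod_Cons using 1 2
    by (simp add: lin_lin case_prod_unfold op_lin if_distrib cong: if_cong)
qed

text \<open>The right leg has length one in two ways: c crosses the whole left leg to meet an empty
  right leg, which is \<open>opR\<close> on all of b by the counit, or c stays in front while b
  supplies the right letter.\<close>

lemma T3_delbar_M: "T3_delbar R (mon ([], c # b, v)) = opR Q c (mon ([], b, v)) + opM Q c (T3_delbar R (mon ([], b, v)))"
proof -
  have 1: "lin (\<lambda>(u', v'). lin (\<lambda>(u'', v''). if length (v'' @ v') = 1 then mon ([], u'', (v'' @ v') @ v) else 0) (psi R [c] u')) (T_coprod R b)
    = lin (\<lambda>(u', v'). if v' = [] then opR Q c (mon ([], u', v)) else 0) (T_coprod R b)"
  proof (intro lin_cong, clarify)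
    fix u' v'
    have "lin (\<lambda>(u'', v''). if length (v'' @ v') = 1 then mon ([], u'', (v'' @ v') @ v) else 0) (psi R [c] u') =
      lin (\<lambda>(u'', v''). if v' = [] then mon ([], u'', v'' @ v) else 0) (psi R [c] u')"
      by (rule lin_psi_cong) simp
    then show "lin (\<lambda>(u'', v''). if length (v'' @ v') = 1 then mon ([], u'', (v'' @ v') @ v) else 0) (psi R [c] u') =
      (if v' = [] then opR Q c (mon ([], u', v)) else 0)"
      by (rule trans) (simp add: opR_psi psi_Nil_right case_prod_unfold)
  qed
  have 2: "lin (\<lambda>(u', v'). if v' = [] then opR Q c (mon ([], u', v)) else 0) (T_coprod R b) = opR Q c (mon ([], b, v))"
    using T_coprod_counit_right[of "\<lambda>u'. opR Q c (mon ([], u', v))" b] by simp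
  show ?thesis
    unfolding T3_delbar_mon T_coprod_Cons using 1 2
    by (simp add: lin_lin case_prod_unfold op_lin if_distrib cong: if_cong)
qed

lemma T3_del_R: "T3_del R (mon ([], [], v)) = 0" "T3_delbar R (mon ([], [], v)) = 0"
  by (simp_all add: T3_del_mon T3_delbar_mon)

end

section \<open>The relations\<close>

lemma two_sided_ideal_subspace: "pm.subspace (two_sided_ideal S)"
  by (simp add: two_sided_ideal_def pspan_def')

lemma pspan_minimal: "S \<subseteq> T \<Longrightarrow> pm.subspace T \<Longrightarrow> pspan S \<subseteq> T"
  unfolding pspan_def' by (rule pm.span_minimal)

lemma two_sided_ideal_minimal:
  assumes "pm.subspace T" "\<And>u r v. r \<in> S \<Longrightarrow> mon u * r * mon v \<in> T"
  shows "two_sided_ideal S \<subseteq> T"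
  unfolding two_sided_ideal_def
proof (rule pspan_minimal, safe)
  fix x r y :: "'a list \<Rightarrow>\<^sub>0 complex" assume r: "r \<in> S"
  show "x * r * y \<in> T"
  proof (rule plinear_in_subspace[of "\<lambda>y. x * r * y", OF plinear_mult_right assms(1)])
    fix v show "x * r * mon v \<in> T"
      by (rule plinear_in_subspace[of "\<lambda>x. x * r * mon v"])
        (auto intro!: assms r plinear_comp[OF plinear_mult_left] plinear_mult_left)
  qed
qed (fact assms)

lemma two_sided_ideal_base: "r \<in> S \<Longrightarrow> x * r * y \<in> two_sided_ideal S"
  unfolding two_sided_ideal_def pspan_def' by (rule pm.span_base) blast

lemma subspace_vimage: "plinear f \<Longrightarrow> pm.subspace S \<Longrightarrow> pm.subspace {x. f x \<in> S}"
  unfolding pm.subspace_def by (simp add: plinear_simps)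

lemma two_sided_ideal_mult:
  assumes "x \<in> two_sided_ideal S"
  shows "a * x * b \<in> two_sided_ideal S"
proof -
  have "plinear (\<lambda>x. a * x * b)" by (intro plinear_comp[OF plinear_mult_left] plinear_mult_right)
  then have "pm.subspace {x. a * x * b \<in> two_sided_ideal S}"
    by (rule subspace_vimage) (rule two_sided_ideal_subspace)
  moreover have "a * (mon u * r * mon v) * b \<in> two_sided_ideal S" if "r \<in> S" for u r v
    using two_sided_ideal_base[OF that, of "a * mon u" "mon v * b"] by (simp add: mult.assoc)
  ultimately have "two_sided_ideal S \<subseteq> {x. a * x * b \<in> two_sided_ideal S}"
    by (intro two_sided_ideal_minimal) auto
  then show ?thesis using assms by auto
qed

section \<open>The relations of the three factors and the ideal they span\<close>

definition relB :: "complex \<Rightarrow> tv" where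
  "relB q = mon [W, Z] - pscale q (mon [Z, W])"

definition relL :: "complex \<Rightarrow> vgen \<Rightarrow> vgen \<Rightarrow> tv" where
  "relL q x y = mon [x, y] + lin (\<lambda>(a, b). mon [a, b]) (brl q x y)"

definition IB :: "complex \<Rightarrow> tv set" where "IB q = two_sided_ideal {relB q}"

definition IL :: "complex \<Rightarrow> tv set" where "IL q = two_sided_ideal {relL q x y |x y. True}"

definition J3 :: "complex \<Rightarrow> tv3 set" where
  "J3 q = pspan ({tens3 x y z |x y z. x \<in> IL q} \<union> {tens3 x y z |x y z. y \<in> IB q} \<union>
      {tens3 x y z |x y z. z \<in> IL q})"

lemma subspace_J3: "pm.subspace (J3 q)"
  by (simp add: J3_def pspan_def')

lemma subspace_IB: "pm.subspace (IB q)" and subspace_IL: "pm.subspace (IL q)"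
  by (simp_all add: IB_def IL_def two_sided_ideal_subspace)

lemma J3_tens3: "x \<in> IL q \<Longrightarrow> tens3 x y z \<in> J3 q" "y \<in> IB q \<Longrightarrow> tens3 x y z \<in> J3 q"
    "z \<in> IL q \<Longrightarrow> tens3 x y z \<in> J3 q"
  unfolding J3_def pspan_def' by (rule pm.span_base, blast)+

lemma relL_IL: "a * relL q x y * b \<in> IL q"
  unfolding IL_def by (rule two_sided_ideal_base) blast

lemma IL_mult: "x \<in> IL q \<Longrightarrow> a * x * b \<in> IL q"
  unfolding IL_def by (rule two_sided_ideal_mult)

lemma IB_mult: "y \<in> IB q \<Longrightarrow> a * y * b \<in> IB q"
  unfolding IB_def by (rule two_sided_ideal_mult)

lemma relB_IB: "a * relB q * b \<in> IB q"
  unfolding IB_def by (rule two_sided_ideal_base) blast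

text \<open>This and the next two definitions put the relations as operators in front of an
  arbitrary element. On words of their own factor they give generators of the ideal, and in this
  form they can be moved past letters.\<close>

definition rL :: "complex \<Rightarrow> vgen \<Rightarrow> vgen \<Rightarrow> tv3 \<Rightarrow> tv3" where
  "rL q x y k = opL x (opL y k) + lin (\<lambda>(a, b). opL a (opL b k)) (brl q x y)"

definition rM :: "complex \<Rightarrow> tv3 \<Rightarrow> tv3" where
  "rM q k = opM q W (opM q Z k) - pscale q (opM q Z (opM q W k))"

definition rR :: "complex \<Rightarrow> vgen \<Rightarrow> vgen \<Rightarrow> tv3 \<Rightarrow> tv3" where
  "rR q x y k = opR q x (opR q y k) + lin (\<lambda>(a, b). opR q a (opR q b k)) (brl q x y)"

lemma plinear_rel: "plinear (rL q x y)" "plinear (rM q)" "plinear (rR q x y)"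
  unfolding rL_def rM_def rR_def by (intro op_intros)+

lemmas rel_simps [simp] = plinear_simps[OF plinear_rel(1)] plinear_simps[OF plinear_rel(2)]
  plinear_simps[OF plinear_rel(3)]

text \<open>The relation of the quantum plane spans a one-dimensional comodule whose H-leg is t^2,
  the q-determinant being 1; it therefore crosses a letter with the factor R(t^2, t) = q^3.\<close>

lemma rM_opL: "rM q (opL c k) = pscale (q ^ 3) (opL c (rM q k))"
  by (cases c) (auto simp: rM_def opM_opL coeff_simps power3_eq_cube intro!: poly_mapping_eqI)

lemma opR_rM: "opR q c (rM q k) = pscale (q ^ 3) (rM q (opR q c k))"
  by (cases c) (auto simp: rM_def opR_opM coeff_simps power3_eq_cube intro!: poly_mapping_eqI)

text \<open>Naturality of the braiding with respect to id + Psi, which is the Yang-Baxter equation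
  on three letters, carries relations to relations. Where right letters cross left ones, the two
  super signs cancel. The next three lemmas are the other crossings.\<close>

lemma rR_opL: "rR q x y (opL c k) = lin (\<lambda>(c1, y'). lin (\<lambda>(c2, x'). opL c2 (rR q x' y' k)) (brl q x c1)) (brl q y c)"
  by (cases c; cases x; cases y) (auto simp: rR_def opR_opL coeff_simps intro!: poly_mapping_eqI)

lemma rR_opM: "rR q x y (opM q c k) = lin (\<lambda>(c1, y'). lin (\<lambda>(c2, x'). opM q c2 (rR q x' y' k)) (brl q x c1)) (brl q y c)"
  by (cases c; cases x; cases y) (auto simp: rR_def opR_opM coeff_simps intro!: poly_mapping_eqI)

lemma opM_rL: "opM q c (rL q x y k) = lin (\<lambda>(x', c'). lin (\<lambda>(y', c''). rL q x' y' (opM q c'' k)) (brl q c' y)) (brl q c x)"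
  by (cases c; cases x; cases y) (auto simp: rL_def opM_opL coeff_simps intro!: poly_mapping_eqI)

lemma opR_rL: "opR q c (rL q x y k) = lin (\<lambda>(x', c'). lin (\<lambda>(y', c''). rL q x' y' (opR q c'' k)) (brl q c' y)) (brl q c x)"
  by (cases c; cases x; cases y) (auto simp: rL_def opR_opL coeff_simps intro!: poly_mapping_eqI)

lemma rL_mon: "rL q x y (mon (u, b, v)) = tens3 (relL q x y * mon u) (mon b) (mon v)"
  by (cases x; cases y) (simp_all add: rL_def relL_def distrib_right mult_pscale_left mon_mult_list tens3_mon)

lemma rM_mon: "rM q (mon ([], b, v)) = tens3 1 (relB q * mon b) (mon v)"
  by (simp add: rM_def relB_def left_diff_distrib mult_pscale_left mon_mult_list tens3_mon mon_Nil[symmetric])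

lemma rR_mon: "rR q x y (mon ([], [], v)) = tens3 1 1 (relL q x y * mon v)"
  by (cases x; cases y)
    (simp_all add: rR_def relL_def distrib_right mult_pscale_left mon_mult_list tens3_mon mon_Nil[symmetric])

lemma foldr_op_tens3: "foldr opL u (tens3 a b v) = tens3 (mon u * a) b v"
  "foldr (opM q) w (tens3 1 b v) = tens3 1 (mon w * b) v"
  "foldr (opR q) v' (tens3 1 1 v) = tens3 1 1 (mon v' * v)"
proof -
  have L: "opL c (tens3 a b v) = tens3 (mon [c] * a) b v" for c a
    by (simp add: tens3_def mult_lin[of "mon _"] op_lin lin_lin plus_list_def)
  show "foldr opL u (tens3 a b v) = tens3 (mon u * a) b v"
    by (induction u) (simp_all add: L mult.assoc[symmetric] mon_mult_list, simp add: mon_Nil)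
  have M: "opM q c (tens3 1 b v) = tens3 1 (mon [c] * b) v" for c b
    by (simp add: tens3_def mult_lin[of "mon _"] op_lin lin_lin plus_list_def mon_Nil[symmetric])
  show "foldr (opM q) w (tens3 1 b v) = tens3 1 (mon w * b) v"
    by (induction w) (simp_all add: M mult.assoc[symmetric] mon_mult_list, simp add: mon_Nil)
  have R: "opR q c (tens3 1 1 v) = tens3 1 1 (mon [c] * v)" for c v
    by (simp add: tens3_def mult_lin[of "mon _"] op_lin lin_lin plus_list_def mon_Nil[symmetric])
  show "foldr (opR q) v' (tens3 1 1 v) = tens3 1 1 (mon v' * v)"
    by (induction v') (simp_all add: R mult.assoc[symmetric] mon_mult_list, simp add: mon_Nil)
qed

lemma foldr_op_tens3_1: "opL c (tens3 a b v) = tens3 (mon [c] * a) b v"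
  "opM q c (tens3 1 b v) = tens3 1 (mon [c] * b) v" "opR q c (tens3 1 1 v) = tens3 1 1 (mon [c] * v)"
  using foldr_op_tens3(1)[of "[c]"] foldr_op_tens3(2)[of q "[c]"] foldr_op_tens3(3)[of q "[c]"]
  by simp_all

text \<open>Stability of the ideal under \<open>opM\<close> and \<open>opR\<close> is to be derived
  from this criterion, so T is only asked to be closed under \<open>opL\<close>, and the middle and
  right relations come with the letters in front of them.\<close>

lemma J3_minimal_words:
  assumes T: "pm.subspace T" and "\<And>c z. z \<in> T \<Longrightarrow> opL c z \<in> T"
    and L: "\<And>x y k. rL q x y (mon k) \<in> T"
    and M: "\<And>b1 b2 v. foldr (opM q) b1 (rM q (mon ([], b2, v))) \<in> T"
    and R: "\<And>b v1 x y v2. foldr (opM q) b (foldr (opR q) v1 (rR q x y (mon ([], [], v2)))) \<in> T"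
  shows "J3 q \<subseteq> T"
proof -
  have fL: "z \<in> T \<Longrightarrow> foldr opL u z \<in> T" for u z by (induction u) (use assms in auto)
  \<comment> \<open>Trilinearity reduces the outer parts a', b', c' of the three factors to
    words.\<close>
  have t: "tens3 x y z \<in> T" if *: "\<And>u v w. tens3 (mon u * a) (mon v * b) (mon w * c) \<in> T"
      "x = a' * a" "y = b' * b" "z = c' * c" for x y z a b c a' b' c'
  proof -
    have "plinear (\<lambda>a'. tens3 (a' * a) (b' * b) (c' * c))" "plinear (\<lambda>b'. tens3 (a' * a) (b' * b) (c' * c))"
        "plinear (\<lambda>c'. tens3 (a' * a) (b' * b) (c' * c))" for a' b' c'
      by (intro plinear_comp[OF plinear_tens3(1)] plinear_comp[OF plinear_tens3(2)]
          plinear_comp[OF plinear_tens3(3)] plinear_mult_left)+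
    note l = this
    show ?thesis unfolding *(2-4)
      by (rule plinear_in_subspace[OF l(1) T], rule plinear_in_subspace[OF l(2) T],
          rule plinear_in_subspace[OF l(3) T]) (rule *)
  qed
  have "tens3 x y z \<in> T" if "x \<in> IL q" for x y z
  proof -
    have "pm.subspace {x. tens3 x y z \<in> T}" using T unfolding pm.subspace_def by simp
    moreover have "tens3 (mon u * relL q a b * mon u') y z \<in> T" for u u' a b
    proof (rule t[where a="relL q a b * mon u'" and b=1 and c=1])
      show "tens3 (mon u * (relL q a b * mon u')) (mon v * 1) (mon w * 1) \<in> T" for u v w
        using fL[OF L, of u a b "(u', v, w)"] by (simp add: rL_mon foldr_op_tens3)
    qed (simp_all add: mult.assoc)
    ultimately have "IL q \<subseteq> {x. tens3 x y z \<in> T}" unfolding IL_def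
      by (intro two_sided_ideal_minimal) auto
    then show ?thesis using that by blast
  qed
  moreover have "tens3 x y z \<in> T" if "y \<in> IB q" for x y z
  proof -
    have "pm.subspace {y. tens3 x y z \<in> T}" using T unfolding pm.subspace_def by simp
    moreover have "tens3 x (mon u * relB q * mon u') z \<in> T" for u u'
    proof (rule t[where b="relB q * mon u'" and a=1 and c=1])
      show "tens3 (mon v * 1) (mon u * (relB q * mon u')) (mon w * 1) \<in> T" for u v w
        using fL[OF M, of v u u' w] by (simp add: rM_mon foldr_op_tens3)
    qed (simp_all add: mult.assoc)
    ultimately have "IB q \<subseteq> {y. tens3 x y z \<in> T}" unfolding IB_def
      by (intro two_sided_ideal_minimal) auto
    then show ?thesis using that by blast
  qed
  moreover have "tens3 x y z \<in> T" if "z \<in> IL q" for x y z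
  proof -
    have "pm.subspace {z. tens3 x y z \<in> T}" using T unfolding pm.subspace_def by simp
    moreover have "tens3 x y (mon u * relL q a b * mon u') \<in> T" for u u' a b
    proof (rule t[where c="relL q a b * mon u'" and a=1 and b=1])
      show "tens3 (mon v * 1) (mon w * 1) (mon u * (relL q a b * mon u')) \<in> T" for u v w
        using fL[OF R, of v w u a b u'] by (simp add: rR_mon foldr_op_tens3)
    qed (simp_all add: mult.assoc)
    ultimately have "IL q \<subseteq> {z. tens3 x y z \<in> T}" unfolding IL_def
      by (intro two_sided_ideal_minimal) auto
    then show ?thesis using that by blast
  qed
  ultimately show ?thesis unfolding J3_def by (intro pspan_minimal T) blast
qed

lemma in_J3_linI: "(\<And>k. f k \<in> J3 q) \<Longrightarrow> lin f x \<in> J3 q"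
  by (intro lin_in_subspace subspace_J3)

lemma J3_opL: "z \<in> J3 q \<Longrightarrow> opL c z \<in> J3 q"
proof -
  have "pm.subspace {z. opL c z \<in> J3 q}"
    using subspace_J3[of q] unfolding pm.subspace_def by simp
  moreover have "{tens3 x y z |x y z. x \<in> IL q} \<union> {tens3 x y z |x y z. y \<in> IB q} \<union>
      {tens3 x y z |x y z. z \<in> IL q} \<subseteq> {z. opL c z \<in> J3 q}"
    using IL_mult[of _ q "mon [c]" 1] by (auto simp: foldr_op_tens3_1 J3_tens3)
  ultimately have "J3 q \<subseteq> {z. opL c z \<in> J3 q}"
    unfolding J3_def by (intro pspan_minimal) (auto simp: J3_def)
  then show "z \<in> J3 q \<Longrightarrow> opL c z \<in> J3 q" by blast
qed

lemma J3_foldr_opL: "z \<in> J3 q \<Longrightarrow> foldr opL u z \<in> J3 q"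
  by (induction u) (simp_all add: J3_opL)

text \<open>If letters of other factors stand before the place of the relation, it is moved past
  them; what remains are letters in front of generators.\<close>

lemma rel_in_J3_mon: "rL q x y (mon k) \<in> J3 q" "rM q (mon k) \<in> J3 q" "rR q x y (mon k) \<in> J3 q"
proof -
  obtain u b v where k: "k = (u, b, v)" by (cases k)
  show "rL q x y (mon k) \<in> J3 q"
    using relL_IL[of 1 q x y "mon u"] by (simp add: k rL_mon J3_tens3)
  show "rM q (mon k) \<in> J3 q" unfolding k
  proof (induction u)
    case Nil
    then show ?case using relB_IB[of 1 q "mon b"] by (simp add: rM_mon J3_tens3)
  next
    case (Cons c u)
    then show ?case unfolding mon_Cons(1) rM_opL by (intro pm.subspace_scale subspace_J3 J3_opL)
  qed
  have R1: "foldr (opM q) b (rR q x y (mon ([], [], v))) \<in> J3 q" for b x y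
    using relL_IL[of 1 q x y "mon v"] by (simp add: rR_mon foldr_op_tens3 J3_tens3)
  \<comment> \<open>Stability under middle letters is proved below from this lemma, so the letters
    that end up in front are recorded explicitly as words w.\<close>
  have "\<exists>S. rR q x y (mon ([], b, v)) = lin (\<lambda>(w, x, y). foldr (opM q) w (rR q x y (mon ([], [], v)))) S" for x y
  proof (induction b arbitrary: x y)
    case Nil
    show ?case by (rule exI[of _ "mon ([], x, y)"]) simp
  next
    case (Cons c b)
    from Cons.IH obtain S where S: "\<And>x y. rR q x y (mon ([], b, v)) = lin (\<lambda>(w, x, y). foldr (opM q) w (rR q x y (mon ([], [], v)))) (S x y)"
      by metis
    show ?case
      unfolding mon_Cons(2)[of _ _ _ q] rR_opM S op_lin
      by (rule exI[of _ "lin (\<lambda>(c1, y'). lin (\<lambda>(c2, x'). lin (\<lambda>(w, x, y). mon (c2 # w, x, y)) (S x' y')) (brl q x c1)) (brl q y c)"])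
         (simp add: lin_lin case_prod_unfold op_lin)
  qed
  then have R2: "rR q x y (mon ([], b, v)) \<in> J3 q" for x y
    using R1 by (metis (mono_tags, lifting) in_J3_linI case_prod_unfold)
  show "rR q x y (mon k) \<in> J3 q" unfolding k
  proof (induction u arbitrary: x y)
    case Nil
    then show ?case by (rule R2)
  next
    case (Cons c u)
    then show ?case unfolding mon_Cons(1) rR_opL case_prod_unfold by (intro in_J3_linI J3_opL)
  qed
qed

lemma rel_in_J3: "rL q x y k \<in> J3 q" "rM q k \<in> J3 q" "rR q x y k \<in> J3 q"
  by (rule plinear_in_subspace[OF _ subspace_J3], rule plinear_rel, rule rel_in_J3_mon)+

lemma J3_opM: "z \<in> J3 q \<Longrightarrow> opM q c z \<in> J3 q"
proof -
  \<comment> \<open>All letters at once, since crossing a left letter may replace c by another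
    letter.\<close>
  have "J3 q \<subseteq> {z. \<forall>c. opM q c z \<in> J3 q}"
  proof (rule J3_minimal_words)
    show "pm.subspace {z. \<forall>c. opM q c z \<in> J3 q}"
      using subspace_J3[of q] unfolding pm.subspace_def by simp
    show "opL c z \<in> {z. \<forall>c. opM q c z \<in> J3 q}" if "z \<in> {z. \<forall>c. opM q c z \<in> J3 q}" for c z
      using that by (auto simp: opM_opL_lin case_prod_unfold intro!: in_J3_linI J3_opL)
    show "rL q x y (mon k) \<in> {z. \<forall>c. opM q c z \<in> J3 q}" for x y k
      by (auto simp: opM_rL case_prod_unfold intro!: in_J3_linI rel_in_J3)
    show "foldr (opM q) b1 (rM q (mon ([], b2, v))) \<in> {z. \<forall>c. opM q c z \<in> J3 q}" for b1 b2 v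
      using relB_IB[of "mon (_ # b1)" q "mon b2"]
      by (auto simp: rM_mon foldr_op_tens3 foldr_op_tens3_1 mult.assoc[symmetric] mon_mult_list intro!: J3_tens3(2))
    show "foldr (opM q) b (foldr (opR q) v1 (rR q x y (mon ([], [], v2)))) \<in> {z. \<forall>c. opM q c z \<in> J3 q}" for b v1 x y v2
      using relL_IL[of "mon v1" q x y "mon v2"]
      by (auto simp: rR_mon foldr_op_tens3 foldr_op_tens3_1 mult.assoc[symmetric] mon_mult_list intro!: J3_tens3(3))
  qed
  then show "z \<in> J3 q \<Longrightarrow> opM q c z \<in> J3 q" by blast
qed

lemma J3_foldr_opM: "z \<in> J3 q \<Longrightarrow> foldr (opM q) u z \<in> J3 q"
  by (induction u) (simp_all add: J3_opM)

lemma J3_opR: "z \<in> J3 q \<Longrightarrow> opR q c z \<in> J3 q"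
proof -
  \<comment> \<open>That every right letter carries z into the ideal survives the prefixing of
    middle letters, by the exchange relations and stability under \<open>opM\<close>.\<close>
  have pass: "opR q c (foldr (opM q) b z) \<in> J3 q" if "\<And>c. opR q c z \<in> J3 q" for b z c
    by (induction b arbitrary: c)
      (use that in \<open>auto simp: opR_opM_lin case_prod_unfold intro!: in_J3_linI J3_opM\<close>)
  have "J3 q \<subseteq> {z. \<forall>c. opR q c z \<in> J3 q}"
  proof (rule J3_minimal_words)
    show "pm.subspace {z. \<forall>c. opR q c z \<in> J3 q}"
      using subspace_J3[of q] unfolding pm.subspace_def by simp
    show "opL c z \<in> {z. \<forall>c. opR q c z \<in> J3 q}" if "z \<in> {z. \<forall>c. opR q c z \<in> J3 q}" for c z
      using that by (auto simp: opR_opL_lin case_prod_unfold intro!: in_J3_linI J3_opL pm.subspace_neg subspace_J3)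
    show "rL q x y (mon k) \<in> {z. \<forall>c. opR q c z \<in> J3 q}" for x y k
      by (auto simp: opR_rL case_prod_unfold intro!: in_J3_linI rel_in_J3)
    show "foldr (opM q) b1 (rM q (mon ([], b2, v))) \<in> {z. \<forall>c. opR q c z \<in> J3 q}" for b1 b2 v
      by (auto simp: opR_rM intro!: pass rel_in_J3 pm.subspace_scale subspace_J3)
    have "opR q c (foldr (opR q) v1 (rR q x y (mon ([], [], v2)))) \<in> J3 q" for c v1 x y v2
      using relL_IL[of "mon (c # v1)" q x y "mon v2"]
      by (auto simp: rR_mon foldr_op_tens3 foldr_op_tens3_1 mult.assoc[symmetric] mon_mult_list intro!: J3_tens3(3))
    then show "foldr (opM q) b (foldr (opR q) v1 (rR q x y (mon ([], [], v2)))) \<in> {z. \<forall>c. opR q c z \<in> J3 q}" for b v1 x y v2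
      by (auto intro!: pass)
  qed
  then show "z \<in> J3 q \<Longrightarrow> opR q c z \<in> J3 q" by blast
qed

lemma J3_foldr_opR: "z \<in> J3 q \<Longrightarrow> foldr (opR q) u z \<in> J3 q"
  by (induction u) (simp_all add: J3_opR)

text \<open>With stability under all letter operators at hand, prefixes no longer have to be
  tracked: relations on words generate the ideal under the three operators, and membership in it may
  be assumed in the closure steps.\<close>

lemma J3_minimal:
  assumes T: "pm.subspace T" "\<And>c z. z \<in> J3 q \<Longrightarrow> z \<in> T \<Longrightarrow> opL c z \<in> T"
    "\<And>c z. z \<in> J3 q \<Longrightarrow> z \<in> T \<Longrightarrow> opM q c z \<in> T" "\<And>c z. z \<in> J3 q \<Longrightarrow> z \<in> T \<Longrightarrow> opR q c z \<in> T"
    and r: "\<And>x y k. rL q x y (mon k) \<in> T" "\<And>k. rM q (mon k) \<in> T" "\<And>x y k. rR q x y (mon k) \<in> T"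
  shows "J3 q \<subseteq> T"
proof -
  have M: "foldr (opM q) b z \<in> T \<inter> J3 q" if "z \<in> T \<inter> J3 q" for b z
    by (induction b) (use that T(3) in \<open>auto intro!: J3_opM\<close>)
  have R: "foldr (opR q) b z \<in> T \<inter> J3 q" if "z \<in> T \<inter> J3 q" for b z
    by (induction b) (use that T(4) in \<open>auto intro!: J3_opR\<close>)
  have "J3 q \<subseteq> T \<inter> J3 q"
    by (rule J3_minimal_words) (use T r in \<open>auto intro!: pm.subspace_inter subspace_J3 J3_opL rel_in_J3 M R
      simp del: Int_iff simp: Int_iff[of "opL _ _"] Int_iff[of "rL _ _ _ _"] Int_iff[of "rM _ _"] Int_iff[of "rR _ _ _ _"]\<close>)
  then show ?thesis by blast
qed

text \<open>Right multiplication commutes with the letter operators, hence with the relations built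
  from them.\<close>

lemma J3_mul_right: "z \<in> J3 q \<Longrightarrow> mul q z y \<in> J3 q"
proof -
  have "J3 q \<subseteq> {z. mul q z y \<in> J3 q}"
  proof (rule J3_minimal)
    show "pm.subspace {z. mul q z y \<in> J3 q}"
      using subspace_J3[of q] unfolding pm.subspace_def by simp
    show "rL q x x' (mon k) \<in> {z. mul q z y \<in> J3 q}" for x x' k
      using rel_in_J3(1)[of q x x' "mul q (mon k) y"]
      by (simp add: rL_def mul_op mul_lin(1) case_prod_unfold)
    show "rM q (mon k) \<in> {z. mul q z y \<in> J3 q}" for k
      using rel_in_J3(2)[of q "mul q (mon k) y"] by (simp add: rM_def mul_op)
    show "rR q x x' (mon k) \<in> {z. mul q z y \<in> J3 q}" for x x' k
      using rel_in_J3(3)[of q x x' "mul q (mon k) y"]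
      by (simp add: rR_def mul_op mul_lin(1) case_prod_unfold)
  qed (simp_all add: mul_op J3_opL J3_opM J3_opR)
  then show "z \<in> J3 q \<Longrightarrow> mul q z y \<in> J3 q" by blast
qed

lemma J3_mul_left: "z \<in> J3 q \<Longrightarrow> mul q y z \<in> J3 q"
  by (rule plinear_in_subspace[OF plinear_mul_left subspace_J3])
    (simp add: mul_mon opW_def case_prod_unfold J3_foldr_opL J3_foldr_opM J3_foldr_opR)

section \<open>Normal forms\<close>

text \<open>\<open>actB\<close> and \<open>actL\<close> multiply a normal word on the left by a letter and normalise the result.\<close>

definition actB :: "complex \<Rightarrow> vgen \<Rightarrow> vgen list \<Rightarrow> tv" where
  "actB q c w = (case c of Z \<Rightarrow> mon (Z # w) | W \<Rightarrow> pscale (q ^ count_list w Z) (mon (w @ [W])))"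

definition nB :: "complex \<Rightarrow> tv \<Rightarrow> tv" where
  "nB q = lin (\<lambda>w. foldr (\<lambda>c. lin (actB q c)) w (mon []))"

definition normB :: "vgen list set" where
  "normB = {replicate i Z @ replicate j W |i j. True}"

lemma plinear_nB: "plinear (nB q)"
  by (simp add: nB_def plinear_lin)

lemmas nB_simps [simp] = plinear_simps[OF plinear_nB]

lemma nB_Nil [simp]: "nB q (mon []) = mon []"
  by (simp add: nB_def)

lemma nB_Cons: "nB q (mon (c # w)) = lin (actB q c) (nB q (mon w))"
  by (simp add: nB_def)

lemma nB_mult: "nB q (mon u * x) = foldr (\<lambda>c. lin (actB q c)) u (nB q x)"
proof (rule plinear_eqI[of "\<lambda>x. nB q (mon u * x)"])
  show "nB q (mon u * mon w) = foldr (\<lambda>c. lin (actB q c)) u (nB q (mon w))" for w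
    by (simp add: mon_mult_list nB_def)
qed (intro plinear_comp[OF plinear_nB] plinear_mult_right plinear_comp[OF plinear_foldr] plinear_lin plinear_nB)+

text \<open>On all words, normal or not, the letter operators form a representation of the quantum
  plane; hence \<open>nB\<close>, which applies a word to the empty word in this representation,
  kills the ideal.\<close>

lemma actB_rel: "lin (actB q W) (lin (actB q Z) x) = pscale q (lin (actB q Z) (lin (actB q W) x))"
  by (rule plinear_eqI[of "\<lambda>x. lin (actB q W) (lin (actB q Z) x)"])
     ((intro plinear_intros)+, simp add: actB_def)

lemma nB_IB: "x \<in> IB q \<Longrightarrow> nB q x = 0"
proof -
  have "pm.subspace {x. nB q x = 0}" unfolding pm.subspace_def by simp
  moreover have "nB q (mon u * relB q * mon v) = 0" for u v
  proof -
    have "nB q (relB q * mon v) = 0"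
      by (simp add: relB_def left_diff_distrib mult_pscale_left mon_mult_list nB_Cons actB_rel)
    then show ?thesis
      by (simp add: nB_mult mult.assoc plinear_simps[OF plinear_foldr[OF plinear_lin]])
  qed
  ultimately have "IB q \<subseteq> {x. nB q x = 0}" unfolding IB_def by (intro two_sided_ideal_minimal) auto
  then show "x \<in> IB q \<Longrightarrow> nB q x = 0" by blast
qed

lemma normB_Nil [simp]: "[] \<in> normB"
  unfolding normB_def by force

lemma normB_snoc: "w \<in> normB \<Longrightarrow> w @ [W] \<in> normB"
  unfolding normB_def by (clarsimp, metis replicate_append_same replicate_Suc)

lemma normB_Cons: "w \<in> normB \<Longrightarrow> Z # w \<in> normB"
  unfolding normB_def by (clarsimp, metis replicate_Suc append_Cons)

lemma zero_supp_on [simp]: "0 \<in> supp_on A"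
  by (simp add: supp_on_def)

lemma uminus_supp_on [simp]: "- x \<in> supp_on A \<longleftrightarrow> x \<in> supp_on A"
  by (simp add: supp_on_def in_keys_iff subset_iff)

lemma actB_supp: "w \<in> normB \<Longrightarrow> actB q c w \<in> supp_on (normB \<inter> {w'. length w' = Suc (length w)})"
  by (cases c) (auto simp: actB_def normB_snoc normB_Cons intro!: pm.subspace_scale subspace_supp_on)

lemma nB_supp_length: "nB q (mon w) \<in> supp_on (normB \<inter> {w'. length w' = length w})"
proof (induction w)
  case (Cons c w)
  have "actB q c w' \<in> supp_on (normB \<inter> {w'. length w' = length (c # w)})"
    if "w' \<in> normB \<inter> {w'. length w' = length w}" for w'
    using actB_supp[of w' q c] that by simp
  then show ?case unfolding nB_Cons by (intro lin_supp_on[OF Cons])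
qed simp

lemma supp_on_mono: "A \<subseteq> B \<Longrightarrow> x \<in> supp_on A \<Longrightarrow> x \<in> supp_on B"
  by (auto simp: supp_on_def)

lemma nB_supp: "nB q x \<in> supp_on normB"
  by (rule plinear_in_subspace[OF plinear_nB subspace_supp_on])
    (rule supp_on_mono[OF _ nB_supp_length], simp)

lemma nB_norm: "w \<in> normB \<Longrightarrow> nB q (mon w) = mon w"
proof -
  have 1: "nB q (mon (replicate j W)) = mon (replicate j W)" for j
    by (induction j) (simp_all add: nB_Cons actB_def replicate_append_same)
  have "nB q (mon (replicate i Z @ replicate j W)) = mon (replicate i Z @ replicate j W)" for i j
    by (induction i) (simp_all add: nB_Cons 1, simp add: actB_def)
  then show "w \<in> normB \<Longrightarrow> nB q (mon w) = mon w" by (auto simp: normB_def)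
qed

lemma nB_id: "x \<in> supp_on normB \<Longrightarrow> nB q x = x"
  by (subst plinear_eq_lin[OF plinear_nB], subst (2) lin_mon_id[symmetric])
    (rule lin_eq_on_supp, auto simp: nB_norm)

lemma count_list_replicate: "count_list (replicate n x) y = (if x = y then n else 0)"
  by (induction n) auto

lemma actB_IB: "w \<in> normB \<Longrightarrow> mon (c # w) - actB q c w \<in> IB q"
proof (cases c)
  case W
  have "mon (W # replicate i Z @ v) - pscale (q ^ i) (mon (replicate i Z @ W # v)) \<in> IB q" for i v
  proof (induction i)
    case 0
    show ?case using subspace_IB pm.subspace_0 by auto
  next
    case (Suc i)
    let ?r = "replicate i Z @ v"
    have "mon [] * relB q * mon ?r + pscale q (mon [Z] * (mon (W # ?r) - pscale (q ^ i) (mon (replicate i Z @ W # v))) * mon []) \<in> IB q"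
      by (intro pm.subspace_add pm.subspace_scale subspace_IB relB_IB IB_mult Suc)
    then show ?case
      by (simp add: relB_def left_diff_distrib right_diff_distrib mult_pscale_left mult_pscale_right mon_mult_list
          pm.scale_right_diff_distrib)
  qed
  note 1 = this
  assume "w \<in> normB"
  then obtain i j where "w = replicate i Z @ replicate j W" by (auto simp: normB_def)
  then show ?thesis using 1[of i "replicate j W"] W
    by (simp add: actB_def replicate_append_same count_list_replicate)
next
  case Z
  then show ?thesis using subspace_IB pm.subspace_0 by (auto simp: actB_def)
qed

text \<open>Together with \<open>nB_IB\<close> this makes \<open>nB\<close> a projection whose
  kernel is the ideal; it takes the place of a confluence argument.\<close>

lemma minus_nB: "x - nB q x \<in> IB q"
proof (rule plinear_in_subspace[of "\<lambda>x. x - nB q x", OF _ subspace_IB])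
  show "plinear (\<lambda>x. x - nB q x)" by (intro plinear_intros plinear_nB)
  show "mon w - nB q (mon w) \<in> IB q" for w
  proof (induction w)
    case Nil
    show ?case using subspace_IB pm.subspace_0 by auto
  next
    case (Cons c w)
    have "mon [c] * n - lin (actB q c) n \<in> IB q" if "n \<in> supp_on normB" for n
      by (rule plinear_in_subspace[of "\<lambda>n. mon [c] * n - lin (actB q c) n", OF _ subspace_IB])
        (use that in \<open>auto intro!: plinear_minus plinear_mult_right plinear_lin simp: mon_mult_list supp_on_def actB_IB subset_iff\<close>)
    from this[OF nB_supp, of q "mon w"] IB_mult[OF Cons, of "mon [c]" 1]
    have "(mon [c] * (mon w - nB q (mon w)) * 1) + (mon [c] * nB q (mon w) - lin (actB q c) (nB q (mon w))) \<in> IB q"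
      by (intro pm.subspace_add subspace_IB)
    then show ?case by (simp add: nB_Cons right_diff_distrib mon_mult_list)
  qed
qed

lemma IB_iff: "x \<in> IB q \<longleftrightarrow> nB q x = 0"
  using minus_nB[of x q] nB_IB[of x q] by auto

section \<open>Normal forms in the exterior algebra\<close>

fun actL :: "complex \<Rightarrow> vgen \<Rightarrow> vgen list \<Rightarrow> tv" where
  "actL q c [] = mon [c]"
| "actL q Z [W] = mon [Z, W]"
| "actL q W [Z] = pscale (- 1 / q) (mon [Z, W])"
| "actL q _ _ = 0"

definition nL :: "complex \<Rightarrow> tv \<Rightarrow> tv" where
  "nL q = lin (\<lambda>w. foldr (\<lambda>c. lin (actL q c)) w (mon []))"

definition normL :: "vgen list set" where
  "normL = {[], [Z], [W], [Z, W]}"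

lemma plinear_nL: "plinear (nL q)"
  by (simp add: nL_def plinear_lin)

lemmas nL_simps [simp] = plinear_simps[OF plinear_nL]

lemma nL_Nil [simp]: "nL q (mon []) = mon []"
  by (simp add: nL_def)

lemma nL_Cons: "nL q (mon (c # w)) = lin (actL q c) (nL q (mon w))"
  by (simp add: nL_def)

lemma nL_mult: "nL q (mon u * x) = foldr (\<lambda>c. lin (actL q c)) u (nL q x)"
proof (rule plinear_eqI[of "\<lambda>x. nL q (mon u * x)"])
  show "nL q (mon u * mon w) = foldr (\<lambda>c. lin (actL q c)) u (nL q (mon w))" for w
    by (simp add: mon_mult_list nL_def)
qed (intro plinear_comp[OF plinear_nL] plinear_mult_right plinear_comp[OF plinear_foldr] plinear_lin plinear_nL)+

lemma actL_supp: "w \<in> normL \<Longrightarrow> actL q c w \<in> supp_on (normL \<inter> {w'. length w' = Suc (length w)})"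
  by (cases c) (auto simp: normL_def intro!: pm.subspace_scale subspace_supp_on)

lemma nL_supp_length: "nL q (mon w) \<in> supp_on (normL \<inter> {w'. length w' = length w})"
proof (induction w)
  case (Cons c w)
  have "actL q c w' \<in> supp_on (normL \<inter> {w'. length w' = length (c # w)})"
    if "w' \<in> normL \<inter> {w'. length w' = length w}" for w'
    using actL_supp[of w' q c] that by simp
  then show ?case unfolding nL_Cons by (intro lin_supp_on[OF Cons])
qed (simp add: normL_def)

lemma nL_supp: "nL q x \<in> supp_on normL"
  by (rule plinear_in_subspace[OF plinear_nL subspace_supp_on])
    (rule supp_on_mono[OF _ nL_supp_length], simp)

lemma nL_norm: "w \<in> normL \<Longrightarrow> nL q (mon w) = mon w"
  by (auto simp: normL_def nL_Cons)

text \<open>The condition \<open>q1\<close> allows the relation (1 + q^2) c c = 0 to be divided, so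
  that squares of one-forms vanish. The parameter is complex and generic because the locale is also
  instantiated at 1/q.\<close>

locale qgen =
  fixes q :: complex
  assumes q0: "q \<noteq> 0" and q1: "1 + q\<^sup>2 \<noteq> 0"
begin

lemma actL_rel: "w \<in> normL \<Longrightarrow> lin (actL q x) (actL q y w) + lin (\<lambda>(a, b). lin (actL q a) (actL q b w)) (brl q x y) = 0"
  using q0 by (cases x; cases y) (auto simp: normL_def power2_eq_square intro!: poly_mapping_eqI simp: coeff_simps)

lemma nL_IL: "x \<in> IL q \<Longrightarrow> nL q x = 0"
proof -
  have "pm.subspace {x. nL q x = 0}" unfolding pm.subspace_def by simp
  moreover have "nL q (mon u * relL q x y * mon v) = 0" for u v x y
  proof -
    have "nL q (relL q x y * mon v) = lin (actL q x) (lin (actL q y) (nL q (mon v))) +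
       lin (\<lambda>(a, b). lin (actL q a) (lin (actL q b) (nL q (mon v)))) (brl q x y)"
      by (cases x; cases y) (simp_all add: relL_def distrib_right mult_pscale_left mon_mult_list nL_Cons)
    also have "\<dots> = lin (\<lambda>w. lin (actL q x) (actL q y w) + lin (\<lambda>(a, b). lin (actL q a) (actL q b w)) (brl q x y)) (nL q (mon v))"
      unfolding lin_lin lin_fun_add case_prod_unfold
      by (rule arg_cong2[where f="(+)", OF refl]) (rule lin_swap)
    also have "\<dots> = lin (\<lambda>_. 0) (nL q (mon v))"
      by (rule lin_eq_on_supp[OF nL_supp]) (rule actL_rel)
    finally show ?thesis
      by (simp add: nL_mult mult.assoc plinear_simps[OF plinear_foldr[OF plinear_lin]])
  qed
  ultimately have "IL q \<subseteq> {x. nL q x = 0}" unfolding IL_def by (intro two_sided_ideal_minimal) auto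
  then show "x \<in> IL q \<Longrightarrow> nL q x = 0" by blast
qed

text \<open>On pairs of letters id + Psi has rank three: it multiplies c c by 1 + q^2, and its
  values on z w and w z are both proportional to z w + q w z.\<close>

lemma IL_words: "mon [c, c] \<in> IL q" "mon [W, Z] + pscale (1 / q) (mon [Z, W]) \<in> IL q"
proof -
  have "pscale (1 / (1 + q\<^sup>2)) (1 * relL q c c * 1) = mon [c, c]"
  proof -
    have "relL q c c = pscale (1 + q\<^sup>2) (mon [c, c])"
      by (cases c) (simp_all add: relL_def pm.scale_left_distrib)
    then show ?thesis using q1 by simp
  qed
  then show "mon [c, c] \<in> IL q"
    using pm.subspace_scale[OF subspace_IL relL_IL] by metis
  have "pscale (1 / q) (1 * relL q Z W * 1) = mon [W, Z] + pscale (1 / q) (mon [Z, W])"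
    using q0 by (simp add: relL_def pm.scale_right_distrib add.commute)
  then show "mon [W, Z] + pscale (1 / q) (mon [Z, W]) \<in> IL q"
    using pm.subspace_scale[OF subspace_IL relL_IL] by metis
qed

lemma actL_IL: "w \<in> normL \<Longrightarrow> mon (c # w) - actL q c w \<in> IL q"
proof -
  have z: "0 \<in> IL q" using subspace_IL pm.subspace_0 by auto
  \<comment> \<open>The top form z w times either letter lies in the ideal: z z w contains a square,
    and w z w is congruent to a multiple of z w w.\<close>
  have 1: "mon [Z, Z, W] \<in> IL q"
    using IL_mult[OF IL_words(1)[of Z], of 1 "mon [W]"] by (simp add: mon_mult_list)
  have "1 * (mon [W, Z] + pscale (1 / q) (mon [Z, W])) * mon [W] - pscale (1 / q) (mon [Z] * mon [W, W] * 1) \<in> IL q"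
    by (intro pm.subspace_diff subspace_IL pm.subspace_scale IL_mult IL_words)
  then have 2: "mon [W, Z, W] \<in> IL q" by (simp add: distrib_right mult_pscale_left mon_mult_list)
  show "w \<in> normL \<Longrightarrow> mon (c # w) - actL q c w \<in> IL q"
    using IL_words z 1 2 by (cases c) (auto simp: normL_def)
qed

lemma minus_nL: "x - nL q x \<in> IL q"
proof (rule plinear_in_subspace[of "\<lambda>x. x - nL q x", OF _ subspace_IL])
  show "plinear (\<lambda>x. x - nL q x)" by (intro plinear_intros plinear_nL)
  show "mon w - nL q (mon w) \<in> IL q" for w
  proof (induction w)
    case Nil
    show ?case using subspace_IL pm.subspace_0 by auto
  next
    case (Cons c w)
    have "mon [c] * n - lin (actL q c) n \<in> IL q" if "n \<in> supp_on normL" for n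
      by (rule plinear_in_subspace[of "\<lambda>n. mon [c] * n - lin (actL q c) n", OF _ subspace_IL])
        (use that in \<open>auto intro!: plinear_minus plinear_mult_right plinear_lin simp: mon_mult_list supp_on_def actL_IL subset_iff\<close>)
    from this[OF nL_supp, of q "mon w"] IL_mult[OF Cons, of "mon [c]" 1]
    have "(mon [c] * (mon w - nL q (mon w)) * 1) + (mon [c] * nL q (mon w) - lin (actL q c) (nL q (mon w))) \<in> IL q"
      by (intro pm.subspace_add subspace_IL)
    then show ?case by (simp add: nL_Cons right_diff_distrib mon_mult_list)
  qed
qed

section \<open>Normal forms in the triple tensor product\<close>

definition N3 :: "tv3 \<Rightarrow> tv3" where
  "N3 = lin (\<lambda>(u, b, v). tens3 (nL q (mon u)) (nB q (mon b)) (nL q (mon v)))"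

definition norm3 :: "vword3 set" where
  "norm3 = normL \<times> normB \<times> normL"

lemma plinear_N3: "plinear N3"
  by (simp add: N3_def plinear_lin)

lemmas N3_simps [simp] = plinear_simps[OF plinear_N3]

lemma N3_mon: "N3 (mon (u, b, v)) = tens3 (nL q (mon u)) (nB q (mon b)) (nL q (mon v))"
  by (simp add: N3_def)

lemma N3_tens3: "N3 (tens3 x y z) = tens3 (nL q x) (nB q y) (nL q z)"
proof -
  have 1: "plinear (\<lambda>x. tens3 (nL q x) y z)" "plinear (\<lambda>y. tens3 x (nB q y) z)"
    "plinear (\<lambda>z. tens3 x y (nL q z))" for x y z
    by (rule plinear_comp[OF plinear_tens3(1) plinear_nL] plinear_comp[OF plinear_tens3(2) plinear_nB]
      plinear_comp[OF plinear_tens3(3) plinear_nL])+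
  have "N3 (tens3 x y z) = lin (\<lambda>u. lin (\<lambda>v. lin (\<lambda>w. tens3 (nL q (mon u)) (nB q (mon v)) (nL q (mon w))) z) y) x"
    by (simp add: N3_def tens3_def[of x y z] lin_lin)
  also have "\<dots> = tens3 (nL q x) (nB q y) (nL q z)"
    by (subst plinear_eq_lin[OF 1(1), of x], subst plinear_eq_lin[OF 1(2), of _ y],
        subst plinear_eq_lin[OF 1(3), of _ _ z]) (rule refl)
  finally show ?thesis .
qed

lemma minus_N3: "x - N3 x \<in> J3 q"
proof (rule plinear_in_subspace[of "\<lambda>x. x - N3 x", OF _ subspace_J3])
  show "plinear (\<lambda>x. x - N3 x)" by (intro plinear_intros plinear_N3)
  fix k :: vword3
  obtain u b v where k: "k = (u, b, v)" by (cases k)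
  have "mon k - N3 (mon k) = tens3 (mon u - nL q (mon u)) (mon b) (mon v)
      + tens3 (nL q (mon u)) (mon b - nB q (mon b)) (mon v)
      + tens3 (nL q (mon u)) (nB q (mon b)) (mon v - nL q (mon v))"
    by (simp add: k N3_mon tens3_mon)
  also have "\<dots> \<in> J3 q"
    by (intro pm.subspace_add[OF subspace_J3] J3_tens3(1)[OF minus_nL] J3_tens3(2)[OF minus_nB] J3_tens3(3)[OF minus_nL])
  finally show "mon k - N3 (mon k) \<in> J3 q" .
qed

text \<open>As a vector space the quotient is an ordinary tensor product of the three quotients, so
  normalising the factors separately decides membership.\<close>

lemma J3_iff: "x \<in> J3 q \<longleftrightarrow> N3 x = 0"
proof
  have "J3 q \<subseteq> {x. N3 x = 0}"
    unfolding J3_def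
    by (rule pspan_minimal) (auto simp: N3_tens3 nL_IL nB_IB pm.subspace_def)
  then show "x \<in> J3 q \<Longrightarrow> N3 x = 0" by blast
  show "N3 x = 0 \<Longrightarrow> x \<in> J3 q" using minus_N3[of x] by simp
qed

lemma N3_supp_mon: "N3 (mon (u, b, v)) \<in> supp_on (norm3 \<inter> {(u', b', v'). length u' = length u \<and> length b' = length b \<and> length v' = length v})"
  unfolding N3_mon tens3_def
  by (rule lin_supp_on[OF nL_supp_length], rule lin_supp_on[OF nB_supp_length], rule lin_supp_on[OF nL_supp_length])
    (auto simp: norm3_def)

lemma N3_id: "x \<in> supp_on norm3 \<Longrightarrow> N3 x = x"
  by (subst plinear_eq_lin[OF plinear_N3], subst (2) lin_mon_id[symmetric])
    (rule lin_eq_on_supp, auto simp: N3_mon norm3_def nB_norm nL_norm tens3_mon)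

text \<open>A single letter in the right factor is already normal, so normalisation does not mix the
  two terms and the coefficient of each letter can be read off.\<close>

lemma tens3_indep_R:
  assumes "tens3 1 a (mon [Z]) + tens3 1 b (mon [W]) \<in> J3 q"
  shows "a \<in> IB q" "b \<in> IB q"
proof -
  have l: "lin (\<lambda>(u, b, v). if v = [y] then mon b else 0) (tens3 (mon []) a (mon [z])) = (if y = z then a else 0)"
    for y z a by (simp add: tens3_def lin_lin)
  have "tens3 (mon []) (nB q a) (mon [Z]) + tens3 (mon []) (nB q b) (mon [W]) = 0"
    using assms unfolding J3_iff by (simp add: N3_tens3 nL_Cons mon_Nil[symmetric])
  then have "lin (\<lambda>(u, b, v). if v = [y] then mon b else 0)
      (tens3 (mon []) (nB q a) (mon [Z]) + tens3 (mon []) (nB q b) (mon [W])) = 0" for y by simp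
  from this[of Z] this[of W] show "a \<in> IB q" "b \<in> IB q" by (simp_all add: l IB_iff)
qed

lemma tens3_indep_L:
  assumes "tens3 (mon [Z]) a 1 + tens3 (mon [W]) b 1 \<in> J3 q"
  shows "a \<in> IB q" "b \<in> IB q"
proof -
  have l: "lin (\<lambda>(u, b, v). if u = [y] then mon b else 0) (tens3 (mon [z]) a (mon [])) = (if y = z then a else 0)"
    for y z a by (simp add: tens3_def lin_lin)
  have "tens3 (mon [Z]) (nB q a) (mon []) + tens3 (mon [W]) (nB q b) (mon []) = 0"
    using assms unfolding J3_iff by (simp add: N3_tens3 nL_Cons mon_Nil[symmetric])
  then have "lin (\<lambda>(u, b, v). if u = [y] then mon b else 0)
      (tens3 (mon [Z]) (nB q a) (mon []) + tens3 (mon [W]) (nB q b) (mon [])) = 0" for y by simp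
  from this[of Z] this[of W] show "a \<in> IB q" "b \<in> IB q" by (simp_all add: l IB_iff)
qed

lemma J3_norm_eq_0: "x \<in> supp_on norm3 \<Longrightarrow> x \<in> J3 q \<Longrightarrow> x = 0"
  by (simp add: J3_iff N3_id)

end

section \<open>Derivations and involution modulo the relations\<close>

text \<open>The grading automorphism; it lets the signed Leibniz rule be written linearly, without
  fixing a degree.\<close>

definition sgnop :: "tv3 \<Rightarrow> tv3" where
  "sgnop = lin (\<lambda>(u, b, v). pscale ((-1) ^ (length u + length v)) (mon (u, b, v)))"

lemma plinear_sgnop: "plinear sgnop"
  by (simp add: sgnop_def plinear_lin)

lemmas sgnop_simps [simp] = plinear_simps[OF plinear_sgnop]

lemma sgnop_mon: "sgnop (mon (u, b, v)) = pscale ((-1) ^ (length u + length v)) (mon (u, b, v))"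
  by (simp add: sgnop_def)

lemma sgnop_sgnop [simp]: "sgnop (sgnop x) = x"
  by (rule plinear_eqI[OF plinear_comp[OF plinear_sgnop plinear_sgnop] plinear_ident])
    (clarsimp simp: sgnop_mon power_add[symmetric] mult_2[symmetric])

lemma opL_bideg: "z \<in> supp_on (bideg_words p r) \<Longrightarrow> opL c z \<in> supp_on (bideg_words (Suc p) r)"
  unfolding opL_def by (erule lin_supp_on) (auto simp: bideg_words_def)

lemma opM_bideg: "z \<in> supp_on (bideg_words p r) \<Longrightarrow> opM q c z \<in> supp_on (bideg_words p r)"
proof -
  have "wM q c u b v \<in> supp_on (bideg_words (length u) (length v))" for u b v
    by (induction q c u b v rule: wM.induct)
      (auto simp: bideg_words_def[of 0] case_prod_unfold intro!: lin_in_subspace subspace_supp_on opL_bideg)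
  then show "z \<in> supp_on (bideg_words p r) \<Longrightarrow> opM q c z \<in> supp_on (bideg_words p r)"
    unfolding opM_def by (elim lin_supp_on) (auto simp: bideg_words_def)
qed

lemma opR_bideg: "z \<in> supp_on (bideg_words p r) \<Longrightarrow> opR q c z \<in> supp_on (bideg_words p (Suc r))"
proof -
  have "wR q c u b v \<in> supp_on (bideg_words (length u) (Suc (length v)))" for u b v
  proof (induction q c u b v rule: wR.induct)
    case 2
    then show ?case
      by (auto simp: case_prod_unfold simp del: One_nat_def intro!: lin_in_subspace subspace_supp_on opM_bideg)
  next
    case 3
    then show ?case
      by (auto simp: case_prod_unfold intro!: lin_in_subspace subspace_supp_on opL_bideg)
  qed (simp add: bideg_words_def)
  then show "z \<in> supp_on (bideg_words p r) \<Longrightarrow> opR q c z \<in> supp_on (bideg_words p (Suc r))"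
    unfolding opR_def by (elim lin_supp_on) (auto simp: bideg_words_def)
qed

lemma mon_bideg: "mon (u, b, v) \<in> supp_on (bideg_words (length u) (length v))"
  by (simp add: bideg_words_def)

lemma opW_bideg:
  assumes "y \<in> supp_on (bideg_words p r)"
  shows "opW q (u, b, v) y \<in> supp_on (bideg_words (length u + p) (length v + r))"
proof -
  have 1: "foldr (opR q) v y \<in> supp_on (bideg_words p (length v + r))"
    by (induction v) (use assms in \<open>auto intro: opR_bideg\<close>)
  have 2: "foldr (opM q) b (foldr (opR q) v y) \<in> supp_on (bideg_words p (length v + r))"
    by (induction b) (use 1 in \<open>auto intro: opM_bideg\<close>)
  have 3: "foldr opL u (foldr (opM q) b (foldr (opR q) v y)) \<in> supp_on (bideg_words (length u + p) (length v + r))"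
    by (induction u) (use 2 in \<open>auto intro: opL_bideg\<close>)
  then show ?thesis by (simp add: opW_def)
qed

lemma mul_bideg:
  assumes "x \<in> supp_on (bideg_words p r)" "y \<in> supp_on (bideg_words p' r')"
  shows "mul q x y \<in> supp_on (bideg_words (p + p') (r + r'))"
  unfolding mul_def
proof (rule lin_supp_on[OF assms(1)])
  fix k assume "k \<in> bideg_words p r"
  then show "opW q k y \<in> supp_on (bideg_words (p + p') (r + r'))"
    using opW_bideg[OF assms(2)] by (auto simp: bideg_words_def)
qed

lemma sgnop_bideg: "x \<in> supp_on (bideg_words p r) \<Longrightarrow> sgnop x = pscale ((-1) ^ (p + r)) x"
  unfolding sgnop_def
  by (subst (2) lin_mon_id[symmetric], subst lin_fun_pscale[symmetric])
    (erule lin_eq_on_supp, auto simp: bideg_words_def)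

lemma sgnop_opL: "sgnop (opL c x) = - opL c (sgnop x)"
  by (rule plinear_eqI[of "\<lambda>x. sgnop (opL c x)"])
    (auto intro!: op_intros plinear_comp[OF plinear_sgnop] plinear_sgnop simp: sgnop_mon)

lemma sgnop_opM: "sgnop (opM q c x) = opM q c (sgnop x)"
proof (rule plinear_eqI[of "\<lambda>x. sgnop (opM q c x)"])
  show "sgnop (opM q c (mon k)) = opM q c (sgnop (mon k))" for k
    by (cases k) (simp add: sgnop_mon sgnop_bideg[OF opM_bideg[OF mon_bideg]])
qed (intro op_intros plinear_comp[OF plinear_sgnop] plinear_sgnop)+

lemma sgnop_opR: "sgnop (opR q c x) = - opR q c (sgnop x)"
proof (rule plinear_eqI[of "\<lambda>x. sgnop (opR q c x)"])
  show "sgnop (opR q c (mon k)) = - opR q c (sgnop (mon k))" for k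
    by (cases k) (simp add: sgnop_mon sgnop_bideg[OF opR_bideg[OF mon_bideg]])
qed (intro op_intros plinear_comp[OF plinear_sgnop] plinear_sgnop)+

lemma sgnop_mul: "sgnop (mul q x y) = mul q (sgnop x) (sgnop y)"
proof (rule plinear_eqI[of "\<lambda>x. sgnop (mul q x y)"])
  fix k :: vword3 obtain u b v where k: "k = (u, b, v)" by (cases k)
  show "sgnop (mul q (mon k) y) = mul q (sgnop (mon k)) (sgnop y)"
    unfolding k
    by (induction u b v rule: word_induct[where q=q])
      (simp_all add: sgnop_mon[of "[]" "[]" "[]"] sgnop_opL sgnop_opM sgnop_opR mul_op del: opL_mon opM_mon_Nil opR_mon_Nil)
qed (intro mul_intros plinear_comp[OF plinear_sgnop] plinear_sgnop)+

lemma sgnop_J3: "z \<in> J3 q \<Longrightarrow> sgnop z \<in> J3 q"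
proof -
  have "J3 q \<subseteq> {z. sgnop z \<in> J3 q}"
  proof (rule J3_minimal)
    show "pm.subspace {z. sgnop z \<in> J3 q}" by (intro subspace_vimage plinear_sgnop subspace_J3)
    show "rL q x y (mon k) \<in> {z. sgnop z \<in> J3 q}" for x y k
      using rel_in_J3(1)[of q x y "sgnop (mon k)"]
      by (cases x; cases y) (simp_all add: rL_def sgnop_opL)
    show "rM q (mon k) \<in> {z. sgnop z \<in> J3 q}" for k
      using rel_in_J3(2)[of q "sgnop (mon k)"] by (simp add: rM_def sgnop_opM)
    show "rR q x y (mon k) \<in> {z. sgnop z \<in> J3 q}" for x y k
      using rel_in_J3(3)[of q x y "sgnop (mon k)"]
      by (cases x; cases y) (simp_all add: rR_def sgnop_opR)
  qed (auto simp: sgnop_opL sgnop_opM sgnop_opR intro!: J3_opL J3_opM J3_opR pm.subspace_neg subspace_J3)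
  then show "z \<in> J3 q \<Longrightarrow> sgnop z \<in> J3 q" by blast
qed

lemma J3_wordI:
  assumes "plinear G" "\<And>u b v. G (mon (u, b, v)) \<in> J3 q"
  shows "G z \<in> J3 q"
  by (rule plinear_in_subspace[OF assms(1) subspace_J3]) (use assms(2) in auto)

lemmas J3_intros = pm.subspace_add[OF subspace_J3] pm.subspace_diff[OF subspace_J3]
  pm.subspace_neg[OF subspace_J3] pm.subspace_scale[OF subspace_J3] in_J3_linI
  J3_opL J3_opM J3_opR rel_in_J3 J3_mul_left J3_mul_right pm.subspace_0[OF subspace_J3]

declare opL_mon [simp del] opM_mon_Nil [simp del] opR_mon_Nil [simp del]

context R_of_H
begin

abbreviation dl :: "tv3 \<Rightarrow> tv3" where "dl \<equiv> T3_del R"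
abbreviation db :: "tv3 \<Rightarrow> tv3" where "db \<equiv> T3_delbar R"

lemmas d_intros = mul_intros plinear_comp[OF plinear_T3_del(1)] plinear_comp[OF plinear_T3_del(2)] plinear_T3_del
  plinear_comp[OF plinear_sgnop] plinear_sgnop

text \<open>The defects of the Leibniz rule for a middle or right letter, which vanish only modulo the relations.\<close>

definition eM :: "vgen \<Rightarrow> tv3 \<Rightarrow> tv3" where "eM c z = dl (opM Q c z) - opL c z - opM Q c (dl z)"
definition eR :: "vgen \<Rightarrow> tv3 \<Rightarrow> tv3" where "eR c z = dl (opR Q c z) + opR Q c (dl z)"
definition fM :: "vgen \<Rightarrow> tv3 \<Rightarrow> tv3" where "fM c z = db (opM Q c z) - opR Q c z - opM Q c (db z)"
definition fR :: "vgen \<Rightarrow> tv3 \<Rightarrow> tv3" where "fR c z = db (opR Q c z) + opR Q c (db z)"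

lemma plinear_err: "plinear (eM c)" "plinear (eR c)" "plinear (fM c)" "plinear (fR c)"
  unfolding eM_def eR_def fM_def fR_def by (intro d_intros)+

text \<open>Here the relation of the left factor enters: del of c produces c x before the crossing
  and -Psi(c x) after it.\<close>

lemma eM_opL: "eM c (opL x m) = - lin (\<lambda>(x', c'). opL x' (eM c' m)) (brl Q c x) - rL Q c x m"
  by (cases c; cases x) (auto simp: eM_def rL_def T3_del_opL opM_opL coeff_simps intro!: poly_mapping_eqI)

lemma eR_opL: "eR c (opL x m) = lin (\<lambda>(x', c'). opL x' (eR c' m)) (brl Q c x)"
  by (cases c; cases x) (auto simp: eR_def T3_del_opL opR_opL coeff_simps intro!: poly_mapping_eqI)

lemma fM_opL: "fM c (opL x m) = - lin (\<lambda>(x', c'). opL x' (fM c' m)) (brl Q c x)"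
  by (cases c; cases x) (auto simp: fM_def T3_delbar_opL opM_opL opR_opL coeff_simps intro!: poly_mapping_eqI)

lemma fR_opL: "fR c (opL x m) = lin (\<lambda>(x', c'). opL x' (fR c' m)) (brl Q c x)"
  by (cases c; cases x) (auto simp: fR_def T3_delbar_opL opR_opL coeff_simps intro!: poly_mapping_eqI)

lemma dl_opM: "dl (opM Q c z) = eM c z + opL c z + opM Q c (dl z)"
  and dl_opR: "dl (opR Q c z) = eR c z - opR Q c (dl z)"
  and db_opM: "db (opM Q c z) = fM c z + opR Q c z + opM Q c (db z)"
  and db_opR: "db (opR Q c z) = fR c z - opR Q c (db z)"
  by (simp_all add: eM_def eR_def fM_def fR_def)

lemma eR_opM: "eR c (opM Q x m) = lin (\<lambda>(x', c'). opM Q x' (eR c' m)) (brl Q c x)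
   + lin (\<lambda>(x', c'). eM x' (opR Q c' m)) (brl Q c x) + opR Q c (eM x m)"
  by (cases c; cases x) (auto simp: eR_def eM_def opR_opM opR_opL coeff_simps intro!: poly_mapping_eqI)

text \<open>Here the relation of the right factor enters: delbar of the middle letter x yields the
  right letters c x before the crossing and Psi(c x) after it, with the sign of passing c.\<close>

lemma fR_opM: "fR c (opM Q x m) = lin (\<lambda>(x', c'). opM Q x' (fR c' m)) (brl Q c x)
   + lin (\<lambda>(x', c'). fM x' (opR Q c' m)) (brl Q c x) + opR Q c (fM x m) + rR Q c x m"
  by (cases c; cases x) (auto simp: fR_def fM_def rR_def opR_opM opR_opL coeff_simps intro!: poly_mapping_eqI)

lemma eM_J3: "eM c z \<in> J3 Q"
proof (rule J3_wordI[OF plinear_err(1)])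
  show "eM c (mon (u, b, v)) \<in> J3 Q" for u b v
  proof (induction u arbitrary: c)
    case Nil
    have "eM c (mon ([], b, v)) = 0"
      using T3_del_M[of c b v] by (simp add: eM_def opM_mon_Nil opL_mon)
    then show ?case by (simp add: J3_intros)
  next
    case (Cons x u)
    then show ?case unfolding mon_Cons(1) eM_opL case_prod_unfold by (intro J3_intros)
  qed
qed

lemma fM_J3: "fM c z \<in> J3 Q"
proof (rule J3_wordI[OF plinear_err(3)])
  show "fM c (mon (u, b, v)) \<in> J3 Q" for u b v
  proof (induction u arbitrary: c)
    case Nil
    have "fM c (mon ([], b, v)) = 0"
      using T3_delbar_M[of c b v] by (simp add: fM_def opM_mon_Nil)
    then show ?case by (simp add: J3_intros)
  next
    case (Cons x u)
    then show ?case unfolding mon_Cons(1) fM_opL case_prod_unfold by (intro J3_intros)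
  qed
qed

lemma eR_J3: "eR c z \<in> J3 Q"
proof (rule J3_wordI[OF plinear_err(2)])
  have 1: "eR c (mon ([], b, v)) \<in> J3 Q" for b v c
  proof (induction b arbitrary: c)
    case Nil
    have "eR c (mon ([], [], v)) = 0"
      by (simp add: eR_def opR_mon_Nil T3_del_R)
    then show ?case by (simp add: J3_intros)
  next
    case (Cons x b)
    then show ?case unfolding mon_Cons(2)[of _ _ _ Q] eR_opM case_prod_unfold by (intro J3_intros eM_J3)
  qed
  show "eR c (mon (u, b, v)) \<in> J3 Q" for u b v
  proof (induction u arbitrary: c)
    case (Cons x u)
    then show ?case unfolding mon_Cons(1) eR_opL case_prod_unfold by (intro J3_intros)
  qed (simp add: 1)
qed

lemma fR_J3: "fR c z \<in> J3 Q"
proof (rule J3_wordI[OF plinear_err(4)])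
  have 1: "fR c (mon ([], b, v)) \<in> J3 Q" for b v c
  proof (induction b arbitrary: c)
    case Nil
    have "fR c (mon ([], [], v)) = 0"
      by (simp add: fR_def opR_mon_Nil T3_del_R)
    then show ?case by (simp add: J3_intros)
  next
    case (Cons x b)
    then show ?case unfolding mon_Cons(2)[of _ _ _ Q] fR_opM case_prod_unfold by (intro J3_intros fM_J3)
  qed
  show "fR c (mon (u, b, v)) \<in> J3 Q" for u b v
  proof (induction u arbitrary: c)
    case (Cons x u)
    then show ?case unfolding mon_Cons(1) fR_opL case_prod_unfold by (intro J3_intros)
  qed (simp add: 1)
qed

lemmas err_J3 = eM_J3 eR_J3 fM_J3 fR_J3

lemma dl_J3: "z \<in> J3 Q \<Longrightarrow> dl z \<in> J3 Q"
proof -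
  have "J3 Q \<subseteq> {z. dl z \<in> J3 Q}"
  proof (rule J3_minimal)
    show "pm.subspace {z. dl z \<in> J3 Q}" by (intro subspace_vimage plinear_T3_del subspace_J3)
    show "rL Q x y (mon k) \<in> {z. dl z \<in> J3 Q}" for x y k
      using rel_in_J3(1)[of Q x y "dl (mon k)"]
      by (cases x; cases y) (simp_all add: rL_def T3_del_opL)
    show "rM Q (mon k) \<in> {z. dl z \<in> J3 Q}" for k
    proof -
      \<comment> \<open>The terms in which del hits one of the two letters cancel by the exchange
        relations, which leaves the defects.\<close>
      have "dl (rM Q (mon k)) = rM Q (dl (mon k)) + (eM W (opM Q Z (mon k)) + opM Q W (eM Z (mon k))
          - pscale Q (eM Z (opM Q W (mon k)) + opM Q Z (eM W (mon k))))"
        by (auto simp: rM_def eM_def opM_opL coeff_simps intro!: poly_mapping_eqI)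
      also have "\<dots> \<in> J3 Q" by (intro J3_intros err_J3)
      finally show ?thesis by simp
    qed
    show "rR Q x y (mon k) \<in> {z. dl z \<in> J3 Q}" for x y k
    proof -
      have "dl (rR Q x y (mon k)) = rR Q x y (dl (mon k)) + (eR x (opR Q y (mon k)) - opR Q x (eR y (mon k)))
          + lin (\<lambda>(a, b). eR a (opR Q b (mon k)) - opR Q a (eR b (mon k))) (brl Q x y)"
        by (cases x; cases y) (auto simp: rR_def eR_def coeff_simps intro!: poly_mapping_eqI)
      also have "\<dots> \<in> J3 Q" unfolding case_prod_unfold by (intro J3_intros err_J3)
      finally show ?thesis by simp
    qed
  qed (auto simp: T3_del_opL dl_opM dl_opR intro!: J3_intros err_J3)
  then show "z \<in> J3 Q \<Longrightarrow> dl z \<in> J3 Q" by blast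
qed

lemma db_J3: "z \<in> J3 Q \<Longrightarrow> db z \<in> J3 Q"
proof -
  have "J3 Q \<subseteq> {z. db z \<in> J3 Q}"
  proof (rule J3_minimal)
    show "pm.subspace {z. db z \<in> J3 Q}" by (intro subspace_vimage plinear_T3_del subspace_J3)
    show "rL Q x y (mon k) \<in> {z. db z \<in> J3 Q}" for x y k
      using rel_in_J3(1)[of Q x y "db (mon k)"]
      by (cases x; cases y) (simp_all add: rL_def T3_delbar_opL)
    show "rM Q (mon k) \<in> {z. db z \<in> J3 Q}" for k
    proof -
      have "db (rM Q (mon k)) = rM Q (db (mon k)) + (fM W (opM Q Z (mon k)) + opM Q W (fM Z (mon k))
          - pscale Q (fM Z (opM Q W (mon k)) + opM Q Z (fM W (mon k))))"
        by (auto simp: rM_def fM_def opR_opM coeff_simps intro!: poly_mapping_eqI)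
      also have "\<dots> \<in> J3 Q" by (intro J3_intros err_J3)
      finally show ?thesis by simp
    qed
    show "rR Q x y (mon k) \<in> {z. db z \<in> J3 Q}" for x y k
    proof -
      have "db (rR Q x y (mon k)) = rR Q x y (db (mon k)) + (fR x (opR Q y (mon k)) - opR Q x (fR y (mon k)))
          + lin (\<lambda>(a, b). fR a (opR Q b (mon k)) - opR Q a (fR b (mon k))) (brl Q x y)"
        by (cases x; cases y) (auto simp: rR_def fR_def coeff_simps intro!: poly_mapping_eqI)
      also have "\<dots> \<in> J3 Q" unfolding case_prod_unfold by (intro J3_intros err_J3)
      finally show ?thesis by simp
    qed
  qed (auto simp: T3_delbar_opL db_opM db_opR intro!: J3_intros err_J3)
  then show "z \<in> J3 Q \<Longrightarrow> db z \<in> J3 Q" by blast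
qed

text \<open>Induction on the letters of the first factor with y arbitrary; each letter adds only
  defects, which lie in the ideal.\<close>

lemma dl_Leibniz: "dl (mul Q x y) - mul Q (dl x) y - mul Q (sgnop x) (dl y) \<in> J3 Q" (is "?G x \<in> _")
proof (rule J3_wordI[of ?G])
  show "plinear ?G" by (intro d_intros)
  show "?G (mon (u, b, v)) \<in> J3 Q" for u b v
  proof (induction u b v rule: word_induct[where q=Q])
    case one
    show ?case by (simp add: sgnop_mon T3_del_R J3_intros)
  next
    case (L c u b v)
    have e: "?G (opL c (mon (u, b, v))) = - opL c (?G (mon (u, b, v)))"
      by (simp add: mul_op T3_del_opL sgnop_opL algebra_simps)
    show ?case unfolding e by (intro J3_intros L)
  next
    case (M c b v)
    let ?m = "mon ([], b, v)"
    have e: "?G (opM Q c ?m) = eM c (mul Q ?m y) - mul Q (eM c ?m) y + opM Q c (?G ?m)"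
      by (simp add: mul_op dl_opM sgnop_opM algebra_simps)
    show ?case unfolding e by (intro J3_intros err_J3 M)
  next
    case (R c v)
    let ?m = "mon ([], [], v)"
    have e: "?G (opR Q c ?m) = eR c (mul Q ?m y) - mul Q (eR c ?m) y - opR Q c (?G ?m)"
      by (simp add: mul_op dl_opR sgnop_opR algebra_simps)
    show ?case unfolding e by (intro J3_intros err_J3 R)
  qed
qed

lemma db_Leibniz: "db (mul Q x y) - mul Q (db x) y - mul Q (sgnop x) (db y) \<in> J3 Q" (is "?G x \<in> _")
proof (rule J3_wordI[of ?G])
  show "plinear ?G" by (intro d_intros)
  show "?G (mon (u, b, v)) \<in> J3 Q" for u b v
  proof (induction u b v rule: word_induct[where q=Q])
    case one
    show ?case by (simp add: sgnop_mon T3_del_R J3_intros)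
  next
    case (L c u b v)
    have e: "?G (opL c (mon (u, b, v))) = - opL c (?G (mon (u, b, v)))"
      by (simp add: mul_op T3_delbar_opL sgnop_opL algebra_simps)
    show ?case unfolding e by (intro J3_intros L)
  next
    case (M c b v)
    let ?m = "mon ([], b, v)"
    have e: "?G (opM Q c ?m) = fM c (mul Q ?m y) - mul Q (fM c ?m) y + opM Q c (?G ?m)"
      by (simp add: mul_op db_opM sgnop_opM algebra_simps)
    show ?case unfolding e by (intro J3_intros err_J3 M)
  next
    case (R c v)
    let ?m = "mon ([], [], v)"
    have e: "?G (opR Q c ?m) = fR c (mul Q ?m y) - mul Q (fR c ?m) y - opR Q c (?G ?m)"
      by (simp add: mul_op db_opR sgnop_opR algebra_simps)
    show ?case unfolding e by (intro J3_intros err_J3 R)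
  qed
qed

text \<open>For a middle letter c, the two terms in which exactly one of the differentials hits c
  are opposite, since the resulting form letter anticommutes with the differential up to defects.
  The same cancellation gives the next two lemmas.\<close>

lemma dl_dl: "dl (dl z) \<in> J3 Q"
proof (rule J3_wordI[of "\<lambda>z. dl (dl z)"])
  show "plinear (\<lambda>z. dl (dl z))" by (intro d_intros)
  show "dl (dl (mon (u, b, v))) \<in> J3 Q" for u b v
  proof (induction u b v rule: word_induct[where q=Q and P="\<lambda>z. dl (dl z) \<in> J3 Q"])
    case (M c b v)
    let ?m = "mon ([], b, v)"
    have e: "dl (dl (opM Q c ?m)) = dl (eM c ?m) + eM c (dl ?m) + opM Q c (dl (dl ?m))"
      by (simp add: dl_opM T3_del_opL)
    show ?case unfolding e by (intro J3_intros err_J3 dl_J3 M)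
  qed (simp_all add: T3_del_opL T3_del_R opR_mon_Nil J3_intros)
qed

lemma db_db: "db (db z) \<in> J3 Q"
proof (rule J3_wordI[of "\<lambda>z. db (db z)"])
  show "plinear (\<lambda>z. db (db z))" by (intro d_intros)
  show "db (db (mon (u, b, v))) \<in> J3 Q" for u b v
  proof (induction u b v rule: word_induct[where q=Q and P="\<lambda>z. db (db z) \<in> J3 Q"])
    case (M c b v)
    let ?m = "mon ([], b, v)"
    have e: "db (db (opM Q c ?m)) = db (fM c ?m) + fR c ?m + fM c (db ?m) + opM Q c (db (db ?m))"
      by (simp add: db_opM db_opR)
    show ?case unfolding e by (intro J3_intros err_J3 db_J3 M)
  qed (simp_all add: T3_delbar_opL T3_del_R opR_mon_Nil J3_intros)
qed

lemma dl_db: "dl (db z) + db (dl z) \<in> J3 Q"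
proof (rule J3_wordI[of "\<lambda>z. dl (db z) + db (dl z)"])
  show "plinear (\<lambda>z. dl (db z) + db (dl z))" by (intro d_intros)
  show "dl (db (mon (u, b, v))) + db (dl (mon (u, b, v))) \<in> J3 Q" for u b v
  proof (induction u b v rule: word_induct[where q=Q and P="\<lambda>z. dl (db z) + db (dl z) \<in> J3 Q"])
    case (L c u b v)
    let ?m = "mon (u, b, v)"
    have e: "dl (db (opL c ?m)) + db (dl (opL c ?m)) = opL c (dl (db ?m) + db (dl ?m))"
      by (simp add: T3_del_opL T3_delbar_opL)
    show ?case unfolding e by (intro J3_intros L)
  next
    case (M c b v)
    let ?m = "mon ([], b, v)"
    have "dl (db (opM Q c ?m)) + db (dl (opM Q c ?m)) = dl (fM c ?m) + eR c ?m + eM c (db ?m) + fM c (dl ?m)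
       + db (eM c ?m) + opM Q c (dl (db ?m) + db (dl ?m))"
      by (simp add: dl_opM dl_opR db_opM T3_delbar_opL)
    also have "\<dots> \<in> J3 Q" by (intro J3_intros err_J3 dl_J3 db_J3 M)
    finally show ?case .
  qed (simp_all add: T3_del_R opR_mon_Nil J3_intros)
qed

lemma dl_bideg: "z \<in> supp_on (bideg_words p r) \<Longrightarrow> dl z \<in> supp_on (bideg_words (Suc p) r)"
proof (rule plinear_in_subspace[OF plinear_T3_del(1) subspace_supp_on])
  fix k assume *: "z \<in> supp_on (bideg_words p r)" "k \<in> Poly_Mapping.keys z"
  obtain u b v where k: "k = (u, b, v)" by (cases k)
  have "dl (mon (u, b, v)) \<in> supp_on (bideg_words (Suc (length u)) (length v))"
    unfolding T3_del_mon case_prod_unfold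
    by (intro pm.subspace_scale lin_in_subspace subspace_supp_on) (simp add: bideg_words_def)
  then show "dl (mon k) \<in> supp_on (bideg_words (Suc p) r)"
    using * by (auto simp: k supp_on_def bideg_words_def)
qed

lemma db_bideg: "z \<in> supp_on (bideg_words p r) \<Longrightarrow> db z \<in> supp_on (bideg_words p (Suc r))"
proof (rule plinear_in_subspace[OF plinear_T3_del(2) subspace_supp_on])
  fix k assume *: "z \<in> supp_on (bideg_words p r)" "k \<in> Poly_Mapping.keys z"
  obtain u b v where k: "k = (u, b, v)" by (cases k)
  have "db (mon (u, b, v)) \<in> supp_on (bideg_words (length u) (Suc (length v)))"
    unfolding T3_delbar_mon case_prod_unfold
    by (intro pm.subspace_scale lin_in_subspace subspace_supp_on) (simp add: bideg_words_def)
  then show "db (mon k) \<in> supp_on (bideg_words p (Suc r))"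
    using * by (auto simp: k supp_on_def bideg_words_def)
qed

end

section \<open>Antilinear maps and the involution\<close>

definition pantilinear :: "(('k \<Rightarrow>\<^sub>0 complex) \<Rightarrow> ('l \<Rightarrow>\<^sub>0 complex)) \<Rightarrow> bool" where
  "pantilinear f \<longleftrightarrow> (\<forall>x y. f (x + y) = f x + f y) \<and> (\<forall>c x. f (pscale c x) = pscale (cnj c) (f x))"

lemma pantilinear_simps:
  assumes "pantilinear f"
  shows "f (x + y) = f x + f y" "f (pscale c x) = pscale (cnj c) (f x)" "f 0 = 0" "f (- x) = - f x"
    "f (x - y) = f x - f y" "f (sum g A) = (\<Sum>a\<in>A. f (g a))"
proof -
  show a: "f (x + y) = f x + f y" for x y using assms by (simp add: pantilinear_def)
  show s: "f (pscale c x) = pscale (cnj c) (f x)" for c x using assms by (simp add: pantilinear_def)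
  show z: "f 0 = 0" using s[of 0 0] by simp
  show m: "f (- x) = - f x" for x using s[of "-1" x] by simp
  show "f (x - y) = f x - f y" using a[of x "- y"] m[of y] by simp
  show "f (sum g A) = (\<Sum>a\<in>A. f (g a))"
    by (induction A rule: infinite_finite_induct) (simp_all add: z a)
qed

lemma pantilinear_eqI:
  assumes "pantilinear f" "pantilinear g" "\<And>k. k \<in> Poly_Mapping.keys x \<Longrightarrow> f (mon k) = g (mon k)"
  shows "f x = g x"
  by (rule trans[OF arg_cong[OF pm_eq_sum_mon, of f] trans[OF _ arg_cong[OF pm_eq_sum_mon, of g, symmetric]]])
    (simp add: pantilinear_simps[OF assms(1)] pantilinear_simps[OF assms(2)] assms(3))

lemma pantilinear_subspace:
  assumes "pantilinear f" "pm.subspace S" "\<And>k. k \<in> Poly_Mapping.keys x \<Longrightarrow> f (mon k) \<in> S"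
  shows "f x \<in> S"
  by (subst pm_eq_sum_mon, unfold pantilinear_simps[OF assms(1)])
    (intro pm.subspace_sum pm.subspace_scale assms)

lemma subspace_antivimage: "pantilinear f \<Longrightarrow> pm.subspace S \<Longrightarrow> pm.subspace {x. f x \<in> S}"
  unfolding pm.subspace_def by (simp add: pantilinear_simps)

lemma pantilinear_star: "pantilinear (T3_star q)"
  by (simp add: pantilinear_def T3_star_add T3_star_pscale)

lemmas star_simps [simp] = pantilinear_simps[OF pantilinear_star]

lemma cnj_star_coeff [simp]: "cnj (star_coeff q c) = star_coeff q c"
  by (cases c) (simp_all add: star_coeff_def)

lemma star_coeff_flipv: "q > 0 \<Longrightarrow> star_coeff q c * star_coeff q (flipv c) = 1"
  by (cases c) (simp_all add: star_coeff_def powr_minus)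

context R_of_H
begin

sublocale qgen Q
proof
  show "Q \<noteq> 0" using q by simp
  have "1 + Q\<^sup>2 = complex_of_real (1 + q\<^sup>2)" by simp
  moreover have "1 + q\<^sup>2 \<noteq> 0" by (metis add_pos_nonneg less_numeral_extra(1) less_irrefl zero_le_power2)
  ultimately show "1 + Q\<^sup>2 \<noteq> 0" by (metis of_real_eq_0_iff)
qed

abbreviation st :: "tv3 \<Rightarrow> tv3" where "st \<equiv> T3_star q"
abbreviation sc :: "vgen \<Rightarrow> complex" where "sc \<equiv> star_coeff q"

lemma st_sgnop_mon: "st (sgnop (mon (u, b, v))) = pscale ((-1) ^ (length u + length v)) (st (mon (u, b, v)))"
  by (simp add: sgnop_mon)

lemma st_opL: "st (opL c z) = pscale (sc c) (mul Q (st (sgnop z)) (ltR (flipv c)))"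
proof (rule pantilinear_eqI[of "\<lambda>z. st (opL c z)"])
  fix k :: vword3 obtain u b v where k: "k = (u, b, v)" by (cases k)
  show "st (opL c (mon k)) = pscale (sc c) (mul Q (st (sgnop (mon k))) (ltR (flipv c)))"
    by (simp add: k opL_mon T3_star_L[of q c u b v Q] st_sgnop_mon mult.commute)
qed (simp_all add: pantilinear_def pm.scale_right_distrib mult.commute)

text \<open>Under the star, a middle letter moving past a left letter becomes the conjugate letter
  moving past a right letter from the other side. The coefficients of the braiding are real and the
  exchange relations correspond under the flip of z and w, so the formula extends from words without
  left letters.\<close>

lemma st_opM: "st (opM Q c z) = pscale (sc c) (mul Q (st z) (ltM (flipv c)))"
proof (rule pantilinear_eqI[of "\<lambda>z. st (opM Q c z)"])
  fix k :: vword3 obtain u b v where k: "k = (u, b, v)" by (cases k)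
  show "st (opM Q c (mon k)) = pscale (sc c) (mul Q (st (mon k)) (ltM (flipv c)))"
    unfolding k
  proof (induction u arbitrary: c)
    case Nil
    show ?case by (simp add: opM_mon_Nil T3_star_M[of q c b v Q])
  next
    case (Cons x u)
    let ?m = "mon (u, b, v)"
    have w: "ltR c = opR Q c one3" "ltM c = opM Q c one3" for c by (simp_all add: opR_mon_Nil opM_mon_Nil)
    have IH: "st (opM Q c (sgnop ?m)) = pscale ((-1) ^ (length u + length v) * sc c) (mul Q (st ?m) (ltM (flipv c)))" for c
      by (simp add: sgnop_mon Cons mult.commute)
    show ?case
      unfolding mon_Cons(1)
      by (cases c; cases x)
        (simp_all add: opM_opL st_opL sgnop_opM IH mul_assoc mul_op st_sgnop_mon w[of W] w[of Z] opR_opM mult_ac pm.scale_right_distrib)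
  qed
qed (simp_all add: pantilinear_def pm.scale_right_distrib mult.commute)

lemma st_opR: "st (opR Q c z) = pscale (sc c) (mul Q (st (sgnop z)) (ltL (flipv c)))"
proof (rule pantilinear_eqI[of "\<lambda>z. st (opR Q c z)"])
  have w: "ltR c = opR Q c one3" "ltM c = opM Q c one3" "ltL c = opL c one3" for c
    by (simp_all add: opR_mon_Nil opM_mon_Nil opL_mon)
  fix k :: vword3 obtain u b v where k: "k = (u, b, v)" by (cases k)
  have 1: "st (opR Q c (mon ([], b, v))) = pscale (sc c) (mul Q (st (sgnop (mon ([], b, v)))) (ltL (flipv c)))" for c b v
  proof (induction b arbitrary: c)
    case Nil
    show ?case by (simp add: opR_mon_Nil T3_star_R[of q c v Q] st_sgnop_mon mult.commute)
  next
    case (Cons x b)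
    show ?case
      unfolding mon_Cons(2)[of _ _ _ Q]
      by (cases c; cases x)
        (simp_all add: opR_opM st_opM sgnop_opM Cons mul_assoc mul_op w[of W] w[of Z] opM_opL mult_ac pm.scale_right_distrib)
  qed
  show "st (opR Q c (mon k)) = pscale (sc c) (mul Q (st (sgnop (mon k))) (ltL (flipv c)))"
    unfolding k
  proof (induction u arbitrary: c)
    case Nil
    show ?case by (rule 1)
  next
    case (Cons x u)
    let ?m = "mon (u, b, v)"
    have IH: "st (opR Q c (sgnop ?m)) = pscale (sc c) (mul Q (st ?m) (ltL (flipv c)))" for c
      using Cons[of c] by (simp add: sgnop_mon power_add[symmetric] mult_2[symmetric])
    show ?case
      unfolding mon_Cons(1)
      by (cases c; cases x)
        (simp_all add: opR_opL st_opL sgnop_opL sgnop_opR IH mul_assoc mul_op w[of W] w[of Z] mult_ac pm.scale_right_distrib pm.scale_right_diff_distrib)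
  qed
qed (simp_all add: pantilinear_def pm.scale_right_distrib mult.commute)

text \<open>Only the parity of y enters, through \<open>sgnop\<close>. The word is peeled off letter
  by letter, and each form letter contributes one factor (-1)^e.\<close>

lemma st_mul:
  assumes "sgnop y = pscale ((-1) ^ e) y"
  shows "st (mul Q (mon (u, b, v)) y) = pscale ((-1) ^ ((length u + length v) * e)) (mul Q (st y) (st (mon (u, b, v))))"
proof (induction u)
  case Nil
  have 1: "st (mul Q (mon ([], [], v)) y) = pscale ((-1) ^ (length v * e)) (mul Q (st y) (st (mon ([], [], v))))" for v
  proof (induction v)
    case (Cons c v)
    then show ?case unfolding mon_Cons(3)[of _ _ Q]
      by (simp add: mul_op st_opR sgnop_mul assms sgnop_mon mul_assoc power_add mult_ac)
  qed simp
  have "st (mul Q (mon ([], b, v)) y) = pscale ((-1) ^ (length v * e)) (mul Q (st y) (st (mon ([], b, v))))"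
  proof (induction b)
    case (Cons c b)
    then show ?case unfolding mon_Cons(2)[of _ _ _ Q]
      by (simp add: mul_op st_opM mul_assoc mult_ac)
  qed (rule 1)
  then show ?case by simp
next
  case (Cons c u)
  then show ?case unfolding mon_Cons(1)
    by (simp add: mul_op st_opL sgnop_mul assms sgnop_mon mul_assoc power_add mult_ac)
qed

lemma T_star_supp: "T_star q (mon w) \<in> supp_on {w'. length w' = length w}"
proof (induction w)
  case Nil
  show ?case by (simp add: mon_Nil T_star_Nil) (simp add: mon_Nil[symmetric])
next
  case (Cons c w)
  have "T_star q (mon w) * mon [flipv c] \<in> supp_on {w'. length w' = length (c # w)}"
    by (rule supp_on_mult[OF Cons, of _ "{[flipv c]}"]) (auto simp: plus_list_def)
  then show ?case unfolding T_star_Cons by (intro pm.subspace_scale subspace_supp_on)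
qed

lemma st_bideg: "z \<in> supp_on (bideg_words p r) \<Longrightarrow> st z \<in> supp_on (bideg_words r p)"
proof (rule pantilinear_subspace[OF pantilinear_star subspace_supp_on])
  fix k assume *: "z \<in> supp_on (bideg_words p r)" "k \<in> Poly_Mapping.keys z"
  obtain u b v where k: "k = (u, b, v)" by (cases k)
  have g: "graded_T_star q (mon w) \<in> supp_on {w'. length w' = length w}" for w
    unfolding graded_T_star_def antilin_mon by (intro pm.subspace_scale subspace_supp_on T_star_supp)
  have "st (mon (u, b, v)) \<in> supp_on (bideg_words (length v) (length u))"
    unfolding T3_star_mon tens3_def
    by (intro pm.subspace_scale subspace_supp_on lin_supp_on[OF g] lin_supp_on[OF T_star_supp])
       (simp add: bideg_words_def)
  then show "st (mon k) \<in> supp_on (bideg_words r p)"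
    using * by (auto simp: k supp_on_def bideg_words_def)
qed

lemma sgnop_st: "sgnop (st z) = st (sgnop z)"
proof (rule pantilinear_eqI[of "\<lambda>z. sgnop (st z)"])
  fix k :: vword3 obtain u b v where k: "k = (u, b, v)" by (cases k)
  show "sgnop (st (mon k)) = st (sgnop (mon k))"
    unfolding k st_sgnop_mon using sgnop_bideg[OF st_bideg[OF mon_bideg]] by (simp add: add.commute)
qed (simp_all add: pantilinear_def pm.scale_right_distrib mult.commute)

lemma st_lt: "st (ltL c) = pscale (sc c) (ltR (flipv c))" "st (ltM c) = pscale (sc c) (ltM (flipv c))"
  "st (ltR c) = pscale (sc c) (ltL (flipv c))"
proof -
  have s: "sgnop one3 = one3" by (simp add: sgnop_mon)
  show "st (ltL c) = pscale (sc c) (ltR (flipv c))" "st (ltM c) = pscale (sc c) (ltM (flipv c))"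
  "st (ltR c) = pscale (sc c) (ltL (flipv c))"
    using st_opL[of c one3] st_opM[of c one3] st_opR[of c one3]
    by (simp_all add: s opL_mon opM_mon_Nil opR_mon_Nil)
qed

lemma st_mul_lt: "st (mul Q x (ltR c)) = mul Q (st (ltR c)) (st (sgnop x))"
  "st (mul Q x (ltM c)) = mul Q (st (ltM c)) (st x)"
  "st (mul Q x (ltL c)) = mul Q (st (ltL c)) (st (sgnop x))"
proof -
  have 1: "sgnop (ltR c) = pscale ((-1) ^ 1) (ltR c)" "sgnop (ltM c) = pscale ((-1) ^ 0) (ltM c)"
    "sgnop (ltL c) = pscale ((-1) ^ 1) (ltL c)" by (simp_all add: sgnop_mon)
  show "st (mul Q x (ltR c)) = mul Q (st (ltR c)) (st (sgnop x))"
  proof (rule pantilinear_eqI[of "\<lambda>x. st (mul Q x (ltR c))"])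
    fix k :: vword3 obtain u b v where k: "k = (u, b, v)" by (cases k)
    show "st (mul Q (mon k) (ltR c)) = mul Q (st (ltR c)) (st (sgnop (mon k)))"
      unfolding k st_sgnop_mon st_mul[OF 1(1)] by simp
  qed (simp_all add: pantilinear_def pm.scale_right_distrib mult.commute)
  show "st (mul Q x (ltL c)) = mul Q (st (ltL c)) (st (sgnop x))"
  proof (rule pantilinear_eqI[of "\<lambda>x. st (mul Q x (ltL c))"])
    fix k :: vword3 obtain u b v where k: "k = (u, b, v)" by (cases k)
    show "st (mul Q (mon k) (ltL c)) = mul Q (st (ltL c)) (st (sgnop (mon k)))"
      unfolding k st_sgnop_mon st_mul[OF 1(3)] by simp
  qed (simp_all add: pantilinear_def pm.scale_right_distrib mult.commute)
  show "st (mul Q x (ltM c)) = mul Q (st (ltM c)) (st x)"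
  proof (rule pantilinear_eqI[of "\<lambda>x. st (mul Q x (ltM c))"])
    fix k :: vword3 obtain u b v where k: "k = (u, b, v)" by (cases k)
    show "st (mul Q (mon k) (ltM c)) = mul Q (st (ltM c)) (st (mon k))"
      unfolding k st_mul[OF 1(2)] by simp
  qed (simp_all add: pantilinear_def pm.scale_right_distrib mult.commute)
qed

lemma st_st: "st (st z) = z"
proof (rule plinear_eqI[of "\<lambda>z. st (st z)"])
  show "plinear (\<lambda>z. st (st z))" by (simp add: plinear_def)
  have c: "sc c * sc (flipv c) = 1" for c using star_coeff_flipv[OF q] .
  fix k :: vword3 obtain u b v where k: "k = (u, b, v)" by (cases k)
  have "st (st (mon (u, b, v))) = mon (u, b, v)"
  proof (induction u b v rule: word_induct[where q=Q and P="\<lambda>z. st (st z) = z"])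
    case (L a u b v)
    then show ?case
      by (simp add: st_opL st_mul_lt st_lt sgnop_st[symmetric] mul_ltL c)
  next
    case (M a b v)
    then show ?case
      by (simp add: st_opM st_mul_lt st_lt mul_ltM c)
  next
    case (R a v)
    then show ?case
      by (simp add: st_opR st_mul_lt st_lt sgnop_st[symmetric] mul_ltR c)
  qed simp
  then show "st (st (mon k)) = mon k" by (simp add: k)
qed (rule plinear_ident)

text \<open>The star exchanges the relations of the two exterior factors and fixes that of the
  plane, up to scalars. They reappear at the right end of a product, which is why the ideal has to
  be two-sided.\<close>

lemma st_J3: "z \<in> J3 Q \<Longrightarrow> st z \<in> J3 Q"
proof -
  have w: "ltR c = opR Q c one3" "ltM c = opM Q c one3" "ltL c = opL c one3" for c
    by (simp_all add: opR_mon_Nil opM_mon_Nil opL_mon)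
  have "J3 Q \<subseteq> {z. st z \<in> J3 Q}"
  proof (rule J3_minimal)
    show "pm.subspace {z. st z \<in> J3 Q}" by (rule subspace_antivimage[OF pantilinear_star subspace_J3])
    show "rL Q x y (mon k) \<in> {z. st z \<in> J3 Q}" for x y k
    proof -
      have "st (rL Q x y (mon k)) = - pscale (sc x * sc y) (mul Q (st (mon k)) (rR Q (flipv y) (flipv x) one3))"
        by (cases x; cases y)
          (simp_all add: rL_def rR_def st_opL sgnop_opL mul_assoc mul_op w[of W] w[of Z] mult_ac pm.scale_right_distrib)
      then show ?thesis by (simp add: J3_intros)
    qed
    show "rR Q x y (mon k) \<in> {z. st z \<in> J3 Q}" for x y k
    proof -
      have "st (rR Q x y (mon k)) = - pscale (sc x * sc y) (mul Q (st (mon k)) (rL Q (flipv y) (flipv x) one3))"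
        by (cases x; cases y)
          (simp_all add: rL_def rR_def st_opR sgnop_opR mul_assoc mul_op w[of W] w[of Z] mult_ac pm.scale_right_distrib)
      then show ?thesis by (simp add: J3_intros)
    qed
    show "rM Q (mon k) \<in> {z. st z \<in> J3 Q}" for k
    proof -
      have "st (rM Q (mon k)) = pscale (sc W * sc Z) (mul Q (st (mon k)) (rM Q one3))"
        by (simp add: rM_def st_opM mul_assoc mul_op w[of W] w[of Z] mult_ac pm.scale_right_diff_distrib)
      then show ?thesis by (simp add: J3_intros)
    qed
    show "opL c z \<in> {z. st z \<in> J3 Q}" if "z \<in> J3 Q" "z \<in> {z. st z \<in> J3 Q}" for c z
      using that by (simp add: st_opL sgnop_st[symmetric] J3_intros sgnop_J3)
    show "opM Q c z \<in> {z. st z \<in> J3 Q}" if "z \<in> J3 Q" "z \<in> {z. st z \<in> J3 Q}" for c z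
      using that by (simp add: st_opM J3_intros)
    show "opR Q c z \<in> {z. st z \<in> J3 Q}" if "z \<in> J3 Q" "z \<in> {z. st z \<in> J3 Q}" for c z
      using that by (simp add: st_opR sgnop_st[symmetric] J3_intros sgnop_J3)
  qed
  then show "z \<in> J3 Q \<Longrightarrow> st z \<in> J3 Q" by blast
qed

lemma sgnop_dl: "sgnop (dl z) = - dl (sgnop z)"
proof (rule plinear_eqI[of "\<lambda>z. sgnop (dl z)"])
  fix k :: vword3 obtain u b v where k: "k = (u, b, v)" by (cases k)
  show "sgnop (dl (mon k)) = - dl (sgnop (mon k))"
    unfolding k using sgnop_bideg[OF dl_bideg[OF mon_bideg]] by (simp add: sgnop_mon)
qed (intro d_intros)+

lemma db_lt: "db (ltL c) = 0" "db (ltM c) = ltR c" "db (ltR c) = 0"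
  using db_opM[of c one3] by (simp_all add: T3_del_R T3_delbar_mon[of "[c]"] fM_def T3_delbar_M[of c] opM_mon_Nil opR_mon_Nil)

text \<open>Induction on the first letter of the word: its star is the last factor of a product, to
  which the Leibniz rule for delbar applies.\<close>

lemma st_dl: "st (dl z) - db (st z) \<in> J3 Q"
proof (rule pantilinear_subspace[of "\<lambda>z. st (dl z) - db (st z)", OF _ subspace_J3])
  show "pantilinear (\<lambda>z. st (dl z) - db (st z))"
    by (simp add: pantilinear_def pm.scale_right_diff_distrib)
  fix k :: vword3 obtain u b v where k: "k = (u, b, v)" by (cases k)
  have "st (dl (mon (u, b, v))) - db (st (mon (u, b, v))) \<in> J3 Q"
  proof (induction u b v rule: word_induct[where q=Q and P="\<lambda>z. st (dl z) - db (st z) \<in> J3 Q"])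
    case one
    show ?case by (simp add: T3_del_R J3_intros)
  next
    case (L c u b v)
    let ?z = "mon (u, b, v)" and ?x = "ltR (flipv c)" and ?e = "(-1) ^ (length u + length v) :: complex"
    have e: "st (dl (opL c ?z)) - db (st (opL c ?z)) = pscale (?e * sc c) (mul Q (st (dl ?z) - db (st ?z)) ?x
      - (db (mul Q (st ?z) ?x) - mul Q (db (st ?z)) ?x - mul Q (sgnop (st ?z)) (db ?x)))"
      by (simp add: T3_del_opL st_opL sgnop_dl sgnop_mon db_lt pm.scale_right_diff_distrib mult.commute)
    show ?case unfolding e by (intro J3_intros L db_Leibniz)
  next
    case (M c b v)
    let ?z = "mon ([], b, v)" and ?x = "ltM (flipv c)"
    have e: "st (dl (opM Q c ?z)) - db (st (opM Q c ?z)) = st (eM c ?z) + pscale (sc c) (mul Q (st (dl ?z) - db (st ?z)) ?x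
      - (db (mul Q (st ?z) ?x) - mul Q (db (st ?z)) ?x - mul Q (sgnop (st ?z)) (db ?x)))"
      by (simp add: dl_opM st_opM st_opL sgnop_st db_lt pm.scale_right_diff_distrib)
    show ?case unfolding e by (intro J3_intros M db_Leibniz st_J3 err_J3)
  next
    case (R c v)
    let ?z = "mon ([], [], v)" and ?x = "ltL (flipv c)" and ?e = "(-1) ^ length v :: complex"
    have d: "dl ?z = 0" "dl (opR Q c ?z) = 0" by (simp_all add: T3_del_R opR_mon_Nil)
    have e: "st (dl (opR Q c ?z)) - db (st (opR Q c ?z)) = pscale (?e * sc c) (mul Q (st (dl ?z) - db (st ?z)) ?x
      - (db (mul Q (st ?z) ?x) - mul Q (db (st ?z)) ?x - mul Q (sgnop (st ?z)) (db ?x)))"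
      by (simp add: d st_opR sgnop_mon db_lt pm.scale_right_diff_distrib mult.commute)
    show ?case unfolding e by (intro J3_intros R db_Leibniz)
  qed
  then show "st (dl (mon k)) - db (st (mon k)) \<in> J3 Q" by (simp add: k)
qed

end

section \<open>The braided symmetric algebra is the quantum plane\<close>

lemma perm_of_permutes: "set is \<subseteq> {..<n} \<Longrightarrow> perm_of is permutes {..<Suc n}"
proof (induction "is")
  case (Cons i "is")
  have "transpose i (Suc i) permutes {..<Suc n}" using Cons.prems by (intro permutes_swap_id) auto
  moreover have "perm_of (i # is) = transpose i (Suc i) \<circ> perm_of is" by (simp add: perm_of_def)
  moreover have "perm_of is permutes {..<Suc n}" using Cons by simp
  ultimately show ?case by (metis permutes_compose)
qed (simp add: perm_of_def permutes_id)

text \<open>Splitting off the cycle that moves the preimage of \<open>n\<close> to the last position leaves a permutation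
  of the first \<open>n\<close> points.\<close>

lemma sum_permutes_Suc:
  "(\<Sum>\<sigma> | \<sigma> permutes {..<Suc n}. f (reduced_expr (Suc n) \<sigma>)) =
   (\<Sum>k\<le>n. \<Sum>\<tau> | \<tau> permutes {..<n}. f (reduced_expr n \<tau> @ rev [k..<n]))"
proof -
  have c: "perm_of [k..<n] permutes {..<Suc n}" "perm_of (rev [k..<n]) permutes {..<Suc n}" for k
    by (rule perm_of_permutes, auto)+
  have inv1: "perm_of (rev xs) \<circ> perm_of xs = id" for xs using perm_of_rev[of "rev xs"] by simp
  have cn: "perm_of [k..<n] n = k" if "k \<le> n" for k using perm_of_upt[OF that] by simp
  have "(\<Sum>\<sigma> | \<sigma> permutes {..<Suc n}. f (reduced_expr (Suc n) \<sigma>)) =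
     (\<Sum>(k, \<tau>)\<in>{..n} \<times> {\<tau>. \<tau> permutes {..<n}}. f (reduced_expr n \<tau> @ rev [k..<n]))"
  proof (rule sum.reindex_bij_witness[where i="\<lambda>(k, \<tau>). \<tau> \<circ> perm_of (rev [k..<n])"
        and j="\<lambda>\<sigma>. (inv_into UNIV \<sigma> n, \<sigma> \<circ> perm_of [inv_into UNIV \<sigma> n..<n])"])
    fix \<sigma> assume "\<sigma> \<in> {\<sigma>. \<sigma> permutes {..<Suc n}}"
    then have \<sigma>: "\<sigma> permutes {..<Suc n}" by simp
    define k where "k = inv_into UNIV \<sigma> n"
    have sk: "\<sigma> k = n" unfolding k_def using permutes_inverses(1)[OF \<sigma>] by simp
    have kn: "k \<le> n" using permutes_in_image[OF \<sigma>, of k] sk by simp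
    show "(case (inv_into UNIV \<sigma> n, \<sigma> \<circ> perm_of [inv_into UNIV \<sigma> n..<n]) of (k, \<tau>) \<Rightarrow> \<tau> \<circ> perm_of (rev [k..<n])) = \<sigma>"
      by (simp add: comp_assoc perm_of_rev)
    have "\<sigma> \<circ> perm_of [k..<n] permutes {..<n}"
      by (rule permutes_superset[OF permutes_compose[OF c(1) \<sigma>]]) (use cn[OF kn] sk in \<open>auto simp: less_Suc_eq\<close>)
    then show "(inv_into UNIV \<sigma> n, \<sigma> \<circ> perm_of [inv_into UNIV \<sigma> n..<n]) \<in> {..n} \<times> {\<tau>. \<tau> permutes {..<n}}"
      using kn by (simp add: k_def)
    show "(case (inv_into UNIV \<sigma> n, \<sigma> \<circ> perm_of [inv_into UNIV \<sigma> n..<n]) of (k, \<tau>) \<Rightarrow> f (reduced_expr n \<tau> @ rev [k..<n])) =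
         f (reduced_expr (Suc n) \<sigma>)"
      by (simp add: Let_def)
  next
    fix p assume p: "p \<in> {..n} \<times> {\<tau>. \<tau> permutes {..<n}}"
    obtain k \<tau> where p': "p = (k, \<tau>)" by (cases p)
    have k: "k \<le> n" and \<tau>: "\<tau> permutes {..<n}" using p p' by auto
    have \<tau>': "\<tau> permutes {..<Suc n}" using \<tau> by (rule permutes_subset) auto
    let ?s = "\<tau> \<circ> perm_of (rev [k..<n])"
    have s: "?s permutes {..<Suc n}" by (rule permutes_compose[OF c(2) \<tau>'])
    then show "(case p of (k, \<tau>) \<Rightarrow> \<tau> \<circ> perm_of (rev [k..<n])) \<in> {\<sigma>. \<sigma> permutes {..<Suc n}}" by (simp add: p')
    have "\<tau> n = n" using \<tau> by (simp add: permutes_def)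
    moreover have "perm_of (rev [k..<n]) k = n"
      using fun_cong[OF inv1[of "[k..<n]"], of n] cn[OF k] by simp
    ultimately have "?s k = n" by simp
    then have i: "inv_into UNIV ?s n = k" using permutes_inverses(2)[OF s, of k] by simp
    show "(inv_into UNIV (case p of (k, \<tau>) \<Rightarrow> \<tau> \<circ> perm_of (rev [k..<n])) n, (case p of (k, \<tau>) \<Rightarrow> \<tau> \<circ> perm_of (rev [k..<n])) \<circ>
        perm_of [inv_into UNIV (case p of (k, \<tau>) \<Rightarrow> \<tau> \<circ> perm_of (rev [k..<n])) n..<n]) = p"
      by (simp add: p' i) (simp add: comp_assoc inv1)
  qed
  also have "\<dots> = (\<Sum>k\<le>n. \<Sum>\<tau> | \<tau> permutes {..<n}. f (reduced_expr n \<tau> @ rev [k..<n]))"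
    by (simp add: sum.cartesian_product)
  finally show ?thesis .
qed

lemma reduced_expr_bound: "i \<in> set (reduced_expr n \<sigma>) \<Longrightarrow> Suc i < n"
proof (induction n arbitrary: \<sigma>)
  case (Suc n)
  then show ?case by (fastforce simp: Let_def)
qed simp

lemma mon_neq_0: "mon k \<noteq> 0"
  by (metis keys_mon keys_zero insert_not_empty)

lemma lookup_lin_diag: "Poly_Mapping.lookup (lin (\<lambda>k. pscale (g k) (mon k)) x) k = g k * Poly_Mapping.lookup x k"
proof -
  have "Poly_Mapping.lookup (lin (\<lambda>k. pscale (g k) (mon k)) x) k = (\<Sum>j\<in>Poly_Mapping.keys x. if j = k then g k * Poly_Mapping.lookup x k else 0)"
    unfolding lin_def lookup_sum by (intro sum.cong) (auto simp: lookup_mon)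
  then show ?thesis by (simp add: in_keys_iff)
qed

context R_of_H
begin

section \<open>The braided integer as a differential\<close>

lemma plinear_psi_at: "plinear (psi_at R i)"
  by (simp add: psi_at_def plinear_lin)

lemma psi_at_mon: "psi_at R (length a) (mon (a @ x # y # b)) = lin (\<lambda>(x', c'). mon (a @ x' # c' # b)) (brl Q x y)"
  by (simp add: psi_at_def psi_letter nth_append lin_lin case_prod_unfold)

lemma plinear_psi_fold: "plinear (foldr (psi_at R) is)"
  by (rule plinear_foldr[OF plinear_psi_at])

lemma foldr_psi_lin: "foldr (psi_at R) is (lin f x) = lin (\<lambda>k. foldr (psi_at R) is (f k)) x"
  by (induction "is") (simp_all add: psi_at_def lin_lin)

text \<open>\<open>foldr\<close> applies the last index first, so on the reversed interval c crosses
  the letters of v from left to right; composed, these crossings are the braiding of c with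
  v.\<close>

lemma psi_move_letter:
  "foldr (psi_at R) (rev [length a..<length a + length v]) (mon (a @ c # v)) = lin (\<lambda>(v', y). mon (a @ v' @ y)) (psi R [c] v)"
proof (induction v arbitrary: a c)
  case Nil
  show ?case by (simp add: psi_Nil_right)
next
  case (Cons x v)
  have "[length a..<length a + length (x # v)] = length a # [length (a @ [x'])..<length (a @ [x']) + length v]" for x' :: vgen
    by (simp add: upt_rec)
  then have "foldr (psi_at R) (rev [length a..<length a + length (x # v)]) (mon (a @ c # x # v)) =
     lin (\<lambda>(x', c'). foldr (psi_at R) (rev [length (a @ [x'])..<length (a @ [x']) + length v]) (mon ((a @ [x']) @ c' # v))) (brl Q c x)"
    by (simp add: psi_at_mon foldr_psi_lin case_prod_unfold)
  then show ?case unfolding Cons psi_Cons by (simp add: lin_lin case_prod_unfold)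
qed

lemma db_supp_B: "db (mon ([], w, [])) \<in> supp_on {(u, b, v). u = [] \<and> Suc (length b) = length w \<and> length v = 1}"
proof (induction w)
  case Nil
  show ?case by (simp add: T3_del_R)
next
  case (Cons c w)
  have 1: "opR Q c (mon ([], w, [])) \<in> supp_on {(u, b, v). u = [] \<and> Suc (length b) = length (c # w) \<and> length v = 1}"
    unfolding opR_psi by (simp add: psi_Nil_right) (rule lin_supp_on[OF psi_supp], auto)
  have "opM Q c (db (mon ([], w, []))) \<in> supp_on {(u, b, v). u = [] \<and> Suc (length b) = length (c # w) \<and> length v = 1}"
    unfolding opM_def by (rule lin_supp_on[OF Cons]) auto
  then show ?case unfolding T3_delbar_M using 1 by (intro pm.subspace_add subspace_supp_on)
qed

text \<open>Either the first letter travels to the end, which is the \<open>opR\<close> term of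
  \<open>T3_delbar_M\<close>, or it stays and a later letter travels, which is the
  \<open>opM\<close> term; the prefix \<open>a\<close> collects the letters that stay.\<close>

lemma braided_integer:
  "(\<Sum>k<length w. foldr (psi_at R) (rev [length a + k..<length a + length w - 1]) (mon (a @ w)))
    = lin (\<lambda>(u, b, v). mon (a @ b @ v)) (db (mon ([], w, [])))"
proof (induction w arbitrary: a)
  case Nil
  show ?case by (simp add: T3_del_R)
next
  case (Cons c w)
  have 1: "foldr (psi_at R) (rev [length a..<length a + length w]) (mon (a @ c # w)) =
     lin (\<lambda>(u, b, v). mon (a @ b @ v)) (opR Q c (mon ([], w, [])))"
    unfolding psi_move_letter opR_psi by (simp add: psi_Nil_right lin_lin case_prod_unfold)
  have "(\<Sum>k<length w. foldr (psi_at R) (rev [length a + Suc k..<length a + length w]) (mon (a @ c # w)))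
    = lin (\<lambda>(u, b, v). mon ((a @ [c]) @ b @ v)) (db (mon ([], w, [])))"
    unfolding Cons[of "a @ [c]", symmetric] by simp
  also have "\<dots> = lin (\<lambda>(u, b, v). mon (a @ b @ v)) (opM Q c (db (mon ([], w, []))))"
    unfolding opM_def lin_lin by (rule lin_eq_on_supp[OF db_supp_B]) auto
  finally show ?case
    unfolding T3_delbar_M using 1 by (simp add: sum.lessThan_Suc_shift del: sum.lessThan_Suc)
qed

definition embB :: "tv \<Rightarrow> tv3" where
  "embB = lin (\<lambda>w. mon ([], w, []))"

text \<open>The braided partial derivative along y, read off from delbar x.\<close>

definition pdB :: "vgen \<Rightarrow> tv \<Rightarrow> tv" where
  "pdB y x = lin (\<lambda>(u, b, v). if v = [y] then mon b else 0) (db (embB x))"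

lemma plinear_embB: "plinear embB"
  by (simp add: embB_def plinear_lin)

lemma embB_mon: "embB (mon w) = mon ([], w, [])"
  by (simp add: embB_def)

lemma embB_tens3: "embB x = tens3 1 x 1"
  by (simp add: embB_def tens3_def mon_Nil[symmetric])

lemma plinear_pdB: "plinear (pdB y)"
  unfolding pdB_def by (intro plinear_intros plinear_comp[OF plinear_T3_del(2)] plinear_embB)

lemma pdB_supp: "x \<in> supp_on {w. length w = Suc n} \<Longrightarrow> pdB y x \<in> supp_on {w. length w = n}"
proof (rule plinear_in_subspace[OF plinear_pdB subspace_supp_on])
  fix w assume *: "x \<in> supp_on {w. length w = Suc n}" "w \<in> Poly_Mapping.keys x"
  then have "length w = Suc n" by (auto simp: supp_on_def)
  then show "pdB y (mon w) \<in> supp_on {w. length w = n}"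
    unfolding pdB_def embB_mon by (intro lin_supp_on[OF db_supp_B]) auto
qed

lemma db_embB: "db (embB x) = tens3 1 (pdB Z x) (mon [Z]) + tens3 1 (pdB W x) (mon [W])"
proof (rule plinear_eqI[of "\<lambda>x. db (embB x)"])
  show "plinear (\<lambda>x. db (embB x))" by (intro plinear_comp[OF plinear_T3_del(2)] plinear_embB)
  show "plinear (\<lambda>x. tens3 1 (pdB Z x) (mon [Z]) + tens3 1 (pdB W x) (mon [W]))"
    by (intro plinear_intros plinear_comp[OF plinear_tens3(2)] plinear_pdB)
  have t: "tens3 1 (lin f x) v = lin (\<lambda>k. tens3 1 (f k) v) x" for f :: "vword3 \<Rightarrow> tv" and x v
    by (simp add: tens3_def mon_Nil[symmetric] lin_lin)
  show "db (embB (mon w)) = tens3 1 (pdB Z (mon w)) (mon [Z]) + tens3 1 (pdB W (mon w)) (mon [W])" for w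
    unfolding pdB_def embB_mon t lin_fun_add[symmetric]
    by (subst (1) lin_mon_id[symmetric], rule lin_eq_on_supp[OF db_supp_B])
      (auto simp: mon_Nil[symmetric] tens3_mon length_Suc_conv intro: vgen.exhaust)
qed

lemma psi_at_snoc: "Suc i < length w \<Longrightarrow> psi_at R i (mon (w @ [y])) = psi_at R i (mon w) * mon [y]"
  by (simp add: psi_at_def nth_append lin_mult_left case_prod_unfold mon_mult_list)

lemma psi_at_supp: "Suc i < length w \<Longrightarrow> psi_at R i (mon w) \<in> supp_on {w'. length w' = length w}"
  unfolding psi_at_def by simp (rule lin_supp_on[OF psi_supp], auto)

text \<open>An index i with i + 1 < n concerns only the first n letters, so the appended letter
  stays where it is.\<close>

lemma psi_fold_snoc:
  assumes "\<And>i. i \<in> set is \<Longrightarrow> Suc i < n" "x \<in> supp_on {w. length w = n}"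
  shows "foldr (psi_at R) is (x * mon [y]) = foldr (psi_at R) is x * mon [y]
    \<and> foldr (psi_at R) is x \<in> supp_on {w. length w = n}"
  using assms
proof (induction "is")
  case (Cons i "is")
  let ?z = "foldr (psi_at R) is x"
  have z: "?z \<in> supp_on {w. length w = n}" "foldr (psi_at R) is (x * mon [y]) = ?z * mon [y]" using Cons by auto
  have i: "Suc i < n" using Cons.prems by simp
  have "psi_at R i (?z * mon [y]) = lin (\<lambda>w. psi_at R i (mon (w @ [y]))) ?z"
    by (subst plinear_eq_lin[of "\<lambda>z. psi_at R i (z * mon [y])"])
      (auto intro: plinear_comp[OF plinear_psi_at] plinear_mult_left simp: mon_mult_list)
  also have "\<dots> = lin (\<lambda>w. psi_at R i (mon w) * mon [y]) ?z"
    by (rule lin_eq_on_supp[OF z(1)]) (simp add: psi_at_snoc i)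
  also have "\<dots> = psi_at R i ?z * mon [y]"
    by (simp add: lin_mult_left[symmetric] plinear_eq_lin[OF plinear_psi_at, symmetric])
  finally have 1: "psi_at R i (?z * mon [y]) = psi_at R i ?z * mon [y]" .
  have "psi_at R i ?z \<in> supp_on {w. length w = n}"
    by (rule plinear_in_subspace[OF plinear_psi_at subspace_supp_on])
      (use z(1) i psi_at_supp in \<open>fastforce simp: supp_on_def\<close>)
  then show ?case using 1 z by simp
qed simp

lemma braided_factorial_snoc:
  assumes "x \<in> supp_on {w. length w = n}"
  shows "braided_factorial R n (x * mon [y]) = braided_factorial R n x * mon [y]"
  unfolding braided_factorial_def psi_perm_def sum_distrib_right
  by (intro sum.cong refl psi_fold_snoc[THEN conjunct1, OF _ assms]) (rule reduced_expr_bound)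

lemma plinear_braided_factorial: "plinear (braided_factorial R n)"
  unfolding braided_factorial_def psi_perm_def plinear_def
  by (simp add: plinear_simps[OF plinear_psi_fold] sum.distrib pm.scale_sum_right)

lemma braided_factorial_Suc:
  assumes x: "x \<in> supp_on {w. length w = Suc n}"
  shows "braided_factorial R (Suc n) x = braided_factorial R n (pdB Z x) * mon [Z] + braided_factorial R n (pdB W x) * mon [W]"
proof -
  let ?T = "\<lambda>x. \<Sum>k\<le>n. foldr (psi_at R) (rev [k..<n]) x"
  have T: "plinear ?T"
    unfolding plinear_def by (simp add: plinear_simps[OF plinear_psi_fold] sum.distrib pm.scale_sum_right)
  have "braided_factorial R (Suc n) x = (\<Sum>k\<le>n. \<Sum>\<tau> | \<tau> permutes {..<n}. foldr (psi_at R) (reduced_expr n \<tau> @ rev [k..<n]) x)"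
    unfolding braided_factorial_def psi_perm_def by (rule sum_permutes_Suc)
  also have "\<dots> = (\<Sum>\<tau> | \<tau> permutes {..<n}. \<Sum>k\<le>n. foldr (psi_at R) (reduced_expr n \<tau> @ rev [k..<n]) x)"
    by (rule sum.swap)
  also have "\<dots> = braided_factorial R n (?T x)"
    unfolding braided_factorial_def psi_perm_def by (simp add: plinear_simps[OF plinear_psi_fold])
  also have "?T x = lin (\<lambda>w. ?T (mon w)) x" by (rule plinear_eq_lin[OF T])
  also have "\<dots> = lin (\<lambda>w. pdB Z (mon w) * mon [Z] + pdB W (mon w) * mon [W]) x"
  proof (rule lin_eq_on_supp[OF x])
    fix w :: "vgen list" assume "w \<in> {w. length w = Suc n}"
    then have l: "length w = Suc n" by simp
    have "?T (mon w) = lin (\<lambda>(u, b, v). mon (b @ v)) (db (embB (mon w)))"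
      using braided_integer[where w=w and a="[]"] by (simp add: l lessThan_Suc_atMost embB_mon)
    also have "\<dots> = pdB Z (mon w) * mon [Z] + pdB W (mon w) * mon [W]"
      unfolding db_embB by (simp add: tens3_def mon_Nil[symmetric] lin_lin) (simp add: mult_lin[of _ "mon _"] plus_list_def)
    finally show "?T (mon w) = pdB Z (mon w) * mon [Z] + pdB W (mon w) * mon [W]" .
  qed
  also have "\<dots> = pdB Z x * mon [Z] + pdB W x * mon [W]"
    by (rule plinear_eq_lin[of "\<lambda>x. pdB Z x * mon [Z] + pdB W x * mon [W]", symmetric])
      (intro plinear_intros plinear_comp[OF plinear_mult_left] plinear_pdB)
  finally show ?thesis
    by (simp add: plinear_simps[OF plinear_braided_factorial] braided_factorial_snoc pdB_supp[OF x])
qed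

lemma snoc_eq_0:
  assumes "a * mon [Z] + b * mon [W] = (0 :: tv)"
  shows "a = 0" "b = 0"
proof -
  have l: "lin (\<lambda>w. if w \<noteq> [] \<and> last w = y then mon (butlast w) else 0) (x * mon [z]) = (if y = z then x else 0)"
    for x :: tv and y z
    by (simp add: mult_lin[of x] lin_lin plus_list_def)
  show "a = 0" "b = 0"
    using arg_cong[OF assms, of "lin (\<lambda>w. if w \<noteq> [] \<and> last w = Z then mon (butlast w) else 0)"]
      arg_cong[OF assms, of "lin (\<lambda>w. if w \<noteq> [] \<and> last w = W then mon (butlast w) else 0)"]
    by (simp_all only: lin_simps l) simp_all
qed

section \<open>q^2-integers and the derivatives of ordered monomials\<close>

definition qn :: "nat \<Rightarrow> complex" where "qn n = (\<Sum>i<n. Q ^ (2 * i))"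

lemma qn_nz: "qn (Suc n) \<noteq> 0"
proof -
  have "qn (Suc n) = complex_of_real (\<Sum>i<Suc n. q ^ (2 * i))" by (simp add: qn_def)
  moreover have "(\<Sum>i<Suc n. q ^ (2 * i)) > 0" by (intro sum_pos) (use q in auto)
  ultimately show ?thesis by (metis less_irrefl of_real_eq_0_iff)
qed

lemma opR_W_power: "opR Q W (mon ([], replicate m W, [])) = pscale (Q ^ (2 * m)) (mon ([], replicate m W, [W]))"
proof (induction m)
  case (Suc m)
  have "mon ([], replicate (Suc m) W, v) = opM Q W (mon ([], replicate m W, v))" for v
    by (simp add: opM_mon_Nil)
  then show ?case by (simp add: opR_opM Suc power2_eq_square mult.assoc)
qed (simp add: opR_mon_Nil)

lemma opR_Z_norm: "opR Q Z (mon ([], replicate i Z @ replicate j W, [])) =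
    pscale (Q ^ (2 * i + j)) (mon ([], replicate i Z @ replicate j W, [Z]))"
proof (induction i)
  case 0
  show ?case
  proof (induction j)
    case (Suc m)
    have "mon ([], replicate (Suc m) W, v) = opM Q W (mon ([], replicate m W, v))" for v
      by (simp add: opM_mon_Nil)
    then show ?case using Suc by (simp add: opR_opM)
  qed (simp add: opR_mon_Nil)
next
  case (Suc m)
  have "mon ([], replicate (Suc m) Z @ replicate j W, v) = opM Q Z (mon ([], replicate m Z @ replicate j W, v))" for v
    by (simp add: opM_mon_Nil)
  then show ?case by (simp add: opR_opM Suc power2_eq_square mult.assoc)
qed

text \<open>A letter Z crosses an ordered monomial diagonally and arrives as the right letter Z, so
  it does not contribute along W. The derivative therefore passes the letters Z and counts the
  letters W with weights q^(2i).\<close>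

lemma pdB_W_norm: "pdB W (mon (replicate i Z @ replicate j W)) = (if j = 0 then 0 else pscale (qn j) (mon (replicate i Z @ replicate (j - 1) W)))"
proof -
  have Cons: "pdB W (mon (Z # replicate i Z @ replicate j W)) = mon [Z] * pdB W (mon (replicate i Z @ replicate j W))" for i j
  proof -
    let ?b = "replicate i Z @ replicate j W"
    have "db (mon ([], Z # ?b, [])) = pscale (Q ^ (2 * i + j)) (mon ([], ?b, [Z])) + opM Q Z (db (mon ([], ?b, [])))"
      by (simp add: T3_delbar_M opR_Z_norm)
    moreover have "lin (\<lambda>(u, b, v). if v = [W] then mon b else 0) (opM Q Z (db (mon ([], ?b, []))))
        = mon [Z] * lin (\<lambda>(u, b, v). if v = [W] then mon b else 0) (db (mon ([], ?b, [])))"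
      unfolding opM_def lin_lin lin_mult_right by (rule lin_eq_on_supp[OF db_supp_B]) (auto simp: mon_mult_list)
    ultimately show ?thesis unfolding pdB_def embB_mon by simp
  qed
  have db0: "db (mon ([], replicate j W, [])) = (if j = 0 then 0 else pscale (qn j) (mon ([], replicate (j - 1) W, [W])))" for j
  proof (induction j)
    case (Suc j)
    have "opM Q W (mon ([], replicate (j - 1) W, [W])) = mon ([], replicate j W, [W])" if "j \<noteq> 0"
      using that by (cases j) (simp_all add: opM_mon_Nil)
    then show ?case using Suc
      by (auto simp: T3_delbar_M opR_W_power qn_def pm.scale_left_distrib add.commute)
  qed (simp add: T3_del_R)
  show ?thesis
  proof (induction i)
    case 0
    show ?case by (simp add: pdB_def embB_mon db0)
  next
    case (Suc i)
    then show ?case by (simp add: Cons mult_pscale_right mon_mult_list)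
  qed
qed

lemma pdB_Z_norm: "pdB Z (mon (replicate (Suc i) Z)) = pscale (qn (Suc i)) (mon (replicate i Z))"
proof -
  have "db (mon ([], replicate (Suc i) Z, [])) = pscale (qn (Suc i)) (mon ([], replicate i Z, [Z]))"
  proof (induction i)
    case 0
    show ?case by (simp add: T3_delbar_M opR_mon_Nil T3_del_R qn_def)
  next
    case (Suc i)
    have "db (mon ([], Z # replicate (Suc i) Z, [])) = pscale (Q ^ (2 * Suc i)) (mon ([], replicate (Suc i) Z, [Z]))
        + opM Q Z (db (mon ([], replicate (Suc i) Z, [])))"
      using opR_Z_norm[of "Suc i" 0] by (simp only: T3_delbar_M) simp
    also have "\<dots> = pscale (qn (Suc (Suc i))) (mon ([], replicate (Suc i) Z, [Z]))"
      unfolding Suc by (simp add: opM_mon_Nil qn_def pm.scale_left_distrib[symmetric] add.commute)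
    finally show ?case by simp
  qed
  then show ?thesis by (simp add: pdB_def embB_mon del: replicate_Suc)
qed

text \<open>Delbar respects all relations, and independence of the two right letters separates the
  derivatives in the result.\<close>

lemma pdB_IB: "x \<in> IB Q \<Longrightarrow> pdB y x \<in> IB Q"
proof -
  assume "x \<in> IB Q"
  then have "embB x \<in> J3 Q" by (simp add: embB_tens3 J3_tens3)
  then have "db (embB x) \<in> J3 Q" by (rule db_J3)
  then show ?thesis using tens3_indep_R[of "pdB Z x" "pdB W x"] by (cases y) (simp_all add: db_embB)
qed

text \<open>On the ordered form of x the derivative along W detects every monomial containing W, and
  the derivative along Z detects the remaining pure power of Z; the factors are nonzero
  q^2-integers.\<close>

lemma IB_pdB:
  assumes x: "x \<in> supp_on {w. length w = Suc n}" and p: "\<And>y. pdB y x \<in> IB Q"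
  shows "x \<in> IB Q"
proof -
  define x' where "x' = nB Q x"
  have p': "pdB y x' \<in> IB Q" for y
  proof -
    have "pdB y x - pdB y (x - x') \<in> IB Q"
      unfolding x'_def by (intro pm.subspace_diff subspace_IB p pdB_IB minus_nB)
    then show ?thesis by (simp add: plinear_simps[OF plinear_pdB])
  qed
  have x'_supp: "x' \<in> supp_on (normB \<inter> {w. length w = Suc n})"
    unfolding x'_def
    by (rule plinear_in_subspace[OF plinear_nB subspace_supp_on])
      (use x nB_supp_length in \<open>fastforce simp: supp_on_def\<close>)
  have zero: "d = 0" if "d \<in> IB Q" "d \<in> supp_on normB" for d
    using that nB_id by (simp add: IB_iff)
  \<comment> \<open>The derivative along W of an ordered monomial is again ordered, and an ordered
    element of the ideal vanishes.\<close>
  have W0: "pdB W x' = 0"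
  proof (rule zero[OF p'])
    show "pdB W x' \<in> supp_on normB"
    proof (rule plinear_in_subspace[OF plinear_pdB subspace_supp_on])
      fix w assume "w \<in> Poly_Mapping.keys x'"
      then obtain i j where w: "w = replicate i Z @ replicate j W"
        using x'_supp by (auto simp: supp_on_def normB_def)
      have "replicate i Z @ replicate (j - 1) W \<in> normB" unfolding normB_def by blast
      then show "pdB W (mon w) \<in> supp_on normB"
        unfolding w pdB_W_norm by (simp add: pm.subspace_scale subspace_supp_on)
    qed
  qed
  \<comment> \<open>Appending W again gives the Euler operator in W: each ordered monomial is
    multiplied by the q^2-integer of its exponent of W.\<close>
  have d: "lin (\<lambda>v. mon (v @ [W])) (pdB W x') = lin (\<lambda>w. pscale (qn (count_list w W)) (mon w)) x'"
  proof -
    have "lin (\<lambda>v. mon (v @ [W])) (pdB W x') = lin (\<lambda>w. lin (\<lambda>v. mon (v @ [W])) (pdB W (mon w))) x'"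
      by (subst plinear_eq_lin[OF plinear_pdB]) (simp add: lin_lin)
    also have "\<dots> = lin (\<lambda>w. pscale (qn (count_list w W)) (mon w)) x'"
    proof (rule lin_eq_on_supp[OF x'_supp])
      fix w assume "w \<in> normB \<inter> {w. length w = Suc n}"
      then obtain i j where w: "w = replicate i Z @ replicate j W" by (auto simp: normB_def)
      show "lin (\<lambda>v. mon (v @ [W])) (pdB W (mon w)) = pscale (qn (count_list w W)) (mon w)"
        unfolding w pdB_W_norm
        by (cases j) (simp_all add: count_list_replicate qn_def replicate_append_same)
    qed
    finally show ?thesis .
  qed
  have c0: "Poly_Mapping.lookup x' w = 0" if "w \<noteq> replicate (Suc n) Z" for w
  proof (cases "w \<in> normB \<inter> {w. length w = Suc n}")
    case True
    then obtain i j where w: "w = replicate i Z @ replicate j W" "i + j = Suc n" by (auto simp: normB_def)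
    with that obtain m where "j = Suc m" by (cases j) auto
    then have "qn (count_list w W) \<noteq> 0" using qn_nz by (simp add: w count_list_append count_list_replicate)
    moreover have "qn (count_list w W) * Poly_Mapping.lookup x' w = 0"
      using d W0 lookup_lin_diag[of "\<lambda>w. qn (count_list w W)" x' w] by simp
    ultimately show ?thesis by simp
  next
    case False
    then show ?thesis using x'_supp by (auto simp: supp_on_def in_keys_iff)
  qed
  define c where "c = Poly_Mapping.lookup x' (replicate (Suc n) Z)"
  have x': "x' = pscale c (mon (replicate (Suc n) Z))"
    by (rule poly_mapping_eqI) (metis c0 c_def lookup_mon lookup_pscale mult_cancel_left1 mult_zero_right)
  have nz: "replicate n Z \<in> normB" unfolding normB_def by (rule CollectI, rule exI[of _ n], rule exI[of _ 0]) simp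
  have "pdB Z x' = pscale (c * qn (Suc n)) (mon (replicate n Z))"
    unfolding x' by (simp add: plinear_simps[OF plinear_pdB] pdB_Z_norm del: replicate_Suc)
  moreover have "pdB Z x' = 0"
    by (rule zero[OF p']) (use calculation nz in \<open>auto intro!: pm.subspace_scale subspace_supp_on\<close>)
  ultimately have "c = 0" using qn_nz by (simp add: mon_neq_0)
  then have "x' = 0" by (simp add: x')
  then show ?thesis by (simp add: IB_iff x'_def)
qed

lemma braided_factorial_iff:
  "x \<in> supp_on {w. length w = n} \<Longrightarrow> braided_factorial R n x = 0 \<longleftrightarrow> x \<in> IB Q"
proof (induction n arbitrary: x)
  case 0
  have "braided_factorial R 0 x = x" by (simp add: braided_factorial_def psi_perm_def)
  moreover have "nB Q x = x" by (rule nB_id, rule supp_on_mono[OF _ 0]) simp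
  ultimately show ?case by (simp add: IB_iff)
next
  case (Suc n)
  have "braided_factorial R (Suc n) x = 0 \<longleftrightarrow> braided_factorial R n (pdB Z x) = 0 \<and> braided_factorial R n (pdB W x) = 0"
    unfolding braided_factorial_Suc[OF Suc.prems]
    using snoc_eq_0[of "braided_factorial R n (pdB Z x)" "braided_factorial R n (pdB W x)"] by auto
  also have "\<dots> \<longleftrightarrow> pdB Z x \<in> IB Q \<and> pdB W x \<in> IB Q"
    using Suc.IH[OF pdB_supp[OF Suc.prems]] by blast
  also have "\<dots> \<longleftrightarrow> x \<in> IB Q"
  proof
    assume *: "pdB Z x \<in> IB Q \<and> pdB W x \<in> IB Q"
    have "pdB y x \<in> IB Q" for y using * by (cases y) auto
    then show "x \<in> IB Q" by (rule IB_pdB[OF Suc.prems])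
  qed (simp add: pdB_IB)
  finally show ?case .
qed

lemma B_ideal_eq: "B_ideal R = IB Q"
proof
  show "B_ideal R \<subseteq> IB Q"
    unfolding B_ideal_def by (rule pspan_minimal) (auto simp: braided_factorial_iff subspace_IB)
  show "IB Q \<subseteq> B_ideal R"
    unfolding IB_def
  proof (rule two_sided_ideal_minimal)
    show "pm.subspace (B_ideal R)" by (simp add: B_ideal_def pspan_def')
    fix u v r assume r: "r \<in> {relB Q}"
    let ?x = "mon u * relB Q * mon v" and ?n = "length u + 2 + length v"
    have "?x \<in> supp_on {w. length w = ?n}"
      by (simp add: relB_def left_diff_distrib right_diff_distrib mult_pscale_left mult_pscale_right mon_mult_list)
         (intro pm.subspace_diff pm.subspace_scale subspace_supp_on, simp_all)
    then have "?x \<in> {x \<in> supp_on {w. length w = ?n}. braided_factorial R ?n x = 0}"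
      using braided_factorial_iff relB_IB by blast
    then show "mon u * r * mon v \<in> B_ideal R"
      unfolding B_ideal_def pspan_def' using r by (intro pm.span_base) blast
  qed
qed

lemma Lambda_ideal_eq: "Lambda_ideal R = IL Q"
  unfolding Lambda_ideal_def IL_def relL_def psi_letter by (simp add: lin_lin case_prod_unfold)

lemma Omega_rel_eq: "Omega_rel R = J3 Q"
  unfolding Omega_rel_def J3_def B_ideal_eq Lambda_ideal_eq ..

end

section \<open>Reversing the order of the factors\<close>

text \<open>The images of the letters are multiplied in the original order, so this is to be a
  homomorphism, not an antihomomorphism. The images of left letters are right letters standing
  first, and \<open>opR\<close> reorders them.\<close>

definition phi :: "complex \<Rightarrow> tv3 \<Rightarrow> tv3" where
  "phi q = lin (\<lambda>(u, b, v). foldr (opR (1 / q)) (map flipv u) (foldr (opM (1 / q)) (map flipv b)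
     (foldr opL (map flipv v) one3)))"

lemma plinear_phi: "plinear (phi q)"
  by (simp add: phi_def plinear_lin)

lemmas phi_simps [simp] = plinear_simps[OF plinear_phi]

lemma phi_opL: "phi q (opL c x) = opR (1 / q) (flipv c) (phi q x)"
  by (rule plinear_eqI[of "\<lambda>x. phi q (opL c x)"])
    (simp_all add: plinear_def, auto simp: phi_def opL_mon)

lemma phi_one [simp]: "phi q one3 = one3"
  by (simp add: phi_def)

context qgen
begin

lemma qgen_inverse: "qgen (1 / q)"
proof
  show "1 / q \<noteq> 0" using q0 by simp
  have "1 + (1 / q)\<^sup>2 = (1 + q\<^sup>2) / q\<^sup>2" using q0 by (simp add: field_simps power2_eq_square)
  then show "1 + (1 / q)\<^sup>2 \<noteq> 0" using q0 q1 by simp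
qed

text \<open>The exchange of a middle letter with a left letter has to become that of a right letter
  with a middle letter for 1/q, read backwards. This is the inversion formula for the braiding of
  two letters.\<close>

lemma phi_opM: "phi q (opM q c x) = opM (1 / q) (flipv c) (phi q x)"
proof (rule plinear_eqI[of "\<lambda>x. phi q (opM q c x)"])
  fix k :: vword3 obtain u b v where k: "k = (u, b, v)" by (cases k)
  show "phi q (opM q c (mon k)) = opM (1 / q) (flipv c) (phi q (mon k))"
    unfolding k
  proof (induction u arbitrary: c)
    case Nil
    show ?case by (simp add: opM_mon_Nil phi_def)
  next
    case (Cons x u)
    show ?case
      unfolding mon_Cons(1)
      by (cases c; cases x) (use q0 in \<open>auto simp: opM_opL phi_opL Cons opR_opM lookup_add field_simps power2_eq_square
        intro!: poly_mapping_eqI\<close>)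
  qed
qed (simp_all add: plinear_def)

lemma phi_opR: "phi q (opR q c x) = opL (flipv c) (phi q x)"
proof (rule plinear_eqI[of "\<lambda>x. phi q (opR q c x)"])
  fix k :: vword3 obtain u b v where k: "k = (u, b, v)" by (cases k)
  have 1: "phi q (opR q c (mon ([], b, v))) = opL (flipv c) (phi q (mon ([], b, v)))" for c b v
  proof (induction b arbitrary: c)
    case Nil
    show ?case by (simp add: opR_mon_Nil phi_def)
  next
    case (Cons x b)
    show ?case
      unfolding mon_Cons(2)[of _ _ _ q]
      by (cases c; cases x) (use q0 in \<open>auto simp: opR_opM phi_opM Cons opM_opL lookup_add field_simps power2_eq_square
        intro!: poly_mapping_eqI\<close>)
  qed
  show "phi q (opR q c (mon k)) = opL (flipv c) (phi q (mon k))"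
    unfolding k
  proof (induction u arbitrary: c)
    case Nil
    show ?case by (rule 1)
  next
    case (Cons x u)
    show ?case
      unfolding mon_Cons(1)
      by (cases c; cases x) (use q0 in \<open>auto simp: opR_opL phi_opL Cons lookup_add field_simps power2_eq_square
        intro!: poly_mapping_eqI\<close>)
  qed
qed (simp_all add: plinear_def)

lemmas phi_op = phi_opL phi_opM phi_opR

lemma phi_mul: "phi q (mul q x y) = mul (1 / q) (phi q x) (phi q y)"
proof (rule plinear_eqI[of "\<lambda>x. phi q (mul q x y)"])
  fix k :: vword3 obtain u b v where k: "k = (u, b, v)" by (cases k)
  show "phi q (mul q (mon k) y) = mul (1 / q) (phi q (mon k)) (phi q y)"
    unfolding k
    by (induction u b v rule: word_induct[where q=q]) (simp_all add: mul_op phi_op)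
qed (simp_all add: plinear_def)

lemma phi_phi: "phi (1 / q) (phi q x) = x"
proof (rule plinear_eqI[of "\<lambda>x. phi (1 / q) (phi q x)"])
  interpret inv: qgen "1 / q" by (rule qgen_inverse)
  fix k :: vword3 obtain u b v where k: "k = (u, b, v)" by (cases k)
  show "phi (1 / q) (phi q (mon k)) = mon k"
    unfolding k
    by (induction u b v rule: word_induct[where q=q]) (use inv.phi_op in \<open>simp_all add: phi_op\<close>)
qed (simp_all add: plinear_def)

lemma phi_J3: "z \<in> J3 q \<Longrightarrow> phi q z \<in> J3 (1 / q)"
proof -
  have "J3 q \<subseteq> {z. phi q z \<in> J3 (1 / q)}"
  proof (rule J3_minimal)
    show "pm.subspace {z. phi q z \<in> J3 (1 / q)}" by (rule subspace_vimage[OF plinear_phi subspace_J3])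
    \<comment> \<open>The relations for the pairs Z W and W Z are proportional, so both can be sent
      to the one for Z W.\<close>
    have L: "phi q (rL q Z Z k) = pscale (q\<^sup>2) (rR (1 / q) W W (phi q k))"
       "phi q (rL q W W k) = pscale (q\<^sup>2) (rR (1 / q) Z Z (phi q k))"
       "phi q (rL q Z W k) = pscale q (rR (1 / q) Z W (phi q k))"
       "phi q (rL q W Z k) = pscale (q\<^sup>2) (rR (1 / q) Z W (phi q k))" for k
      using q0 by (auto simp: rL_def rR_def phi_op lookup_add field_simps power2_eq_square intro!: poly_mapping_eqI)
    show "rL q x y (mon k) \<in> {z. phi q z \<in> J3 (1 / q)}" for x y k
      by (cases x; cases y) (simp_all add: L J3_intros)
    have R: "phi q (rR q Z Z k) = pscale (q\<^sup>2) (rL (1 / q) W W (phi q k))"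
       "phi q (rR q W W k) = pscale (q\<^sup>2) (rL (1 / q) Z Z (phi q k))"
       "phi q (rR q Z W k) = pscale q (rL (1 / q) Z W (phi q k))"
       "phi q (rR q W Z k) = pscale (q\<^sup>2) (rL (1 / q) Z W (phi q k))" for k
      using q0 by (auto simp: rL_def rR_def phi_op lookup_add field_simps power2_eq_square intro!: poly_mapping_eqI)
    show "rR q x y (mon k) \<in> {z. phi q z \<in> J3 (1 / q)}" for x y k
      by (cases x; cases y) (simp_all add: R J3_intros)
    have M: "phi q (rM q k) = - pscale q (rM (1 / q) (phi q k))" for k
      using q0 by (auto simp: rM_def phi_op lookup_add field_simps power2_eq_square intro!: poly_mapping_eqI)
    show "rM q (mon k) \<in> {z. phi q z \<in> J3 (1 / q)}" for k
      by (simp add: M J3_intros)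
  qed (auto simp: phi_op J3_intros)
  then show "z \<in> J3 q \<Longrightarrow> phi q z \<in> J3 (1 / q)" by blast
qed

lemma phi_bideg: "z \<in> supp_on (bideg_words p r) \<Longrightarrow> phi q z \<in> supp_on (bideg_words r p)"
proof (rule plinear_in_subspace[OF plinear_phi subspace_supp_on])
  fix k assume *: "z \<in> supp_on (bideg_words p r)" "k \<in> Poly_Mapping.keys z"
  obtain u b v where k: "k = (u, b, v)" by (cases k)
  have 1: "phi q (mon ([], [], v)) \<in> supp_on (bideg_words (length v) 0)" for v
    by (induction v) (simp_all add: mon_Cons(3)[of _ _ q] phi_op opL_bideg, simp add: bideg_words_def)
  have 2: "phi q (mon ([], b, v)) \<in> supp_on (bideg_words (length v) 0)" for b v
    by (induction b) (simp_all add: 1 mon_Cons(2)[of _ _ _ q] phi_op opM_bideg)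
  have 3: "phi q (mon (u, b, v)) \<in> supp_on (bideg_words (length v) (length u))"
    by (induction u) (simp_all add: 2 mon_Cons(1) phi_op opR_bideg)
  then show "phi q (mon k) \<in> supp_on (bideg_words r p)"
    using * by (auto simp: k supp_on_def bideg_words_def)
qed

lemma phi_lt: "phi q (ltL c) = ltR (flipv c)" "phi q (ltM c) = ltM (flipv c)" "phi q (ltR c) = ltL (flipv c)"
  using phi_opL[of q c one3] phi_opM[of c one3] phi_opR[of c one3]
  by (simp_all add: opL_mon opM_mon_Nil opR_mon_Nil)

end

section \<open>Quotient algebras\<close>

lemma cls_eq_iff:
  assumes "pm.subspace J"
  shows "cls J x = cls J y \<longleftrightarrow> x - y \<in> J"
proof
  assume e: "cls J x = cls J y"
  have "x \<in> cls J x" using pm.subspace_0[OF assms] by (simp add: cls_def)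
  then show "x - y \<in> J" unfolding e by (simp add: cls_def)
next
  assume d: "x - y \<in> J"
  have "z - x \<in> J \<longleftrightarrow> z - y \<in> J" for z
    using pm.subspace_add[OF assms _ d, of "z - x"] pm.subspace_diff[OF assms _ d, of "z - y"] by auto
  then show "cls J x = cls J y" by (simp add: cls_def)
qed

lemma the_elem_image_const: "x \<in> X \<Longrightarrow> (\<And>y. y \<in> X \<Longrightarrow> f y = c) \<Longrightarrow> the_elem (f ` X) = c"
  by (metis (no_types, lifting) empty_iff image_eqI the_elem_image_unique)

lemma induced_cls:
  assumes "pm.subspace I" "pm.subspace J" "\<And>y. y - x \<in> I \<Longrightarrow> f y - f x \<in> J"
  shows "induced J f (cls I x) = cls J (f x)"
  unfolding induced_def
  by (rule the_elem_image_const[of x])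
    (use assms pm.subspace_0[OF assms(1)] in \<open>auto simp: cls_eq_iff[OF assms(2)] cls_def[of I]\<close>)

lemma induced2_cls:
  assumes "pm.subspace I" "pm.subspace I'" "pm.subspace J"
    "\<And>x' y'. x' - x \<in> I \<Longrightarrow> y' - y \<in> I' \<Longrightarrow> f x' y' - f x y \<in> J"
  shows "induced2 J f (cls I x) (cls I' y) = cls J (f x y)"
  unfolding induced2_def
proof (rule the_elem_image_const[of "(x, y)"])
  show "(x, y) \<in> cls I x \<times> cls I' y"
    using pm.subspace_0[OF assms(1)] pm.subspace_0[OF assms(2)] by (simp add: cls_def)
  fix p assume "p \<in> cls I x \<times> cls I' y"
  then have "fst p - x \<in> I" "snd p - y \<in> I'" by (auto simp: cls_def)
  then show "(case p of (x, y) \<Rightarrow> cls J (f x y)) = cls J (f x y)"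
    by (simp add: case_prod_unfold cls_eq_iff[OF assms(3)] assms(4))
qed

lemma complex_ring_simps [simp]: "carrier complex_ring = UNIV" "a \<otimes>\<^bsub>complex_ring\<^esub> b = a * b"
  "a \<oplus>\<^bsub>complex_ring\<^esub> b = a + b" "\<zero>\<^bsub>complex_ring\<^esub> = 0" "\<one>\<^bsub>complex_ring\<^esub> = 1"
  by (simp_all add: complex_ring_def)

lemma cring_complex_ring: "cring complex_ring"
proof (rule cringI)
  show "abelian_group complex_ring"
    by (rule abelian_groupI) (auto intro: exI[of _ "- _"] simp: algebra_simps)
  show "Group.comm_monoid complex_ring"
    by (rule Group.comm_monoidI) (auto simp: algebra_simps)
qed (auto simp: algebra_simps)

section \<open>Restriction to a set of basis words\<close>

definition restr :: "'k set \<Rightarrow> ('k \<Rightarrow>\<^sub>0 complex) \<Rightarrow> ('k \<Rightarrow>\<^sub>0 complex)" where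
  "restr S = lin (\<lambda>k. if k \<in> S then mon k else 0)"

lemma plinear_restr: "plinear (restr S)"
  by (simp add: restr_def plinear_lin)

lemma restr_supp: "restr S x \<in> supp_on S"
  unfolding restr_def by (intro lin_in_subspace subspace_supp_on) auto

lemma restr_id: "x \<in> supp_on S \<Longrightarrow> restr S x = x"
  unfolding restr_def by (subst (2) lin_mon_id[symmetric]) (erule lin_eq_on_supp, simp)

lemma restr_disjoint: "x \<in> supp_on T \<Longrightarrow> S \<inter> T = {} \<Longrightarrow> restr S x = 0"
  unfolding restr_def by (rule trans[OF lin_eq_on_supp lin_const0[of x]]) auto

lemma restr_sum:
  assumes "finite I" "x \<in> supp_on (\<Union>i\<in>I. S i)" "\<And>i j. i \<in> I \<Longrightarrow> j \<in> I \<Longrightarrow> i \<noteq> j \<Longrightarrow> S i \<inter> S j = {}"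
  shows "(\<Sum>i\<in>I. restr (S i) x) = x"
proof -
  have p: "plinear (\<lambda>x. \<Sum>i\<in>I. restr (S i) x)"
    by (simp add: plinear_def plinear_simps[OF plinear_restr] sum.distrib pm.scale_sum_right)
  have "(\<Sum>i\<in>I. restr (S i) (mon k)) = mon k" if "k \<in> (\<Union>i\<in>I. S i)" for k
  proof -
    from that obtain j where j: "j \<in> I" "k \<in> S j" by auto
    then have "(\<Sum>i\<in>I. restr (S i) (mon k)) = (\<Sum>i\<in>I. if i = j then mon k else 0)"
      using assms(3)[of _ j] by (intro sum.cong) (auto simp: restr_def)
    then show ?thesis using assms(1) j by simp
  qed
  then have "lin (\<lambda>k. \<Sum>i\<in>I. restr (S i) (mon k)) x = lin mon x"
    by (intro lin_eq_on_supp[OF assms(2)])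
  then show ?thesis using plinear_eq_lin[OF p, of x] by simp
qed

text \<open>Shared by the double complex and the quantum plane; the record may carry further
  fields.\<close>

locale quotient_algebra =
  fixes A :: "(complex, ('k \<Rightarrow>\<^sub>0 complex) set, 'm) module_scheme" (structure)
    and J :: "('k \<Rightarrow>\<^sub>0 complex) set" and m :: "('k \<Rightarrow>\<^sub>0 complex) \<Rightarrow> ('k \<Rightarrow>\<^sub>0 complex) \<Rightarrow> ('k \<Rightarrow>\<^sub>0 complex)"
    and e :: "'k \<Rightarrow>\<^sub>0 complex"
  assumes J: "pm.subspace J"
    and bilinear: "plinear (\<lambda>x. m x y)" "plinear (m x)"
    and assoc: "m (m x y) z = m x (m y z)" and unit: "m e x = x" "m x e = x"
    and ideal: "x \<in> J \<Longrightarrow> m x y \<in> J" "y \<in> J \<Longrightarrow> m x y \<in> J"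
    and A: "carrier A = range (cls J)" "monoid.mult A = induced2 J m" "\<one> = cls J e" "\<zero> = cls J 0"
      "add A = induced2 J (+)" "smult A = (\<lambda>s. induced J (pscale s))"
begin

lemma cls_iff: "cls J x = cls J y \<longleftrightarrow> x - y \<in> J"
  by (rule cls_eq_iff[OF J])

lemma mult_cls: "cls J x \<otimes> cls J y = cls J (m x y)"
  unfolding A
proof (rule induced2_cls[OF J J J])
  fix x' y' assume "x' - x \<in> J" "y' - y \<in> J"
  then have "m (x' - x) y' + m x (y' - y) \<in> J" by (intro pm.subspace_add[OF J] ideal)
  then show "m x' y' - m x y \<in> J"
    by (simp add: plinear_simps[OF bilinear(1)] plinear_simps[OF bilinear(2)])
qed

lemma add_cls: "cls J x \<oplus> cls J y = cls J (x + y)"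
  unfolding A
proof (rule induced2_cls[OF J J J])
  fix x' y' assume "x' - x \<in> J" "y' - y \<in> J"
  from pm.subspace_add[OF J this] show "x' + y' - (x + y) \<in> J" by (simp add: algebra_simps)
qed

lemma smult_cls: "s \<odot> cls J x = cls J (pscale s x)"
  unfolding A
proof (rule induced_cls[OF J J])
  fix y assume "y - x \<in> J"
  from pm.subspace_scale[OF J this, of s] show "pscale s y - pscale s x \<in> J"
    by (simp add: pm.scale_right_diff_distrib)
qed

lemmas cls_simps = mult_cls add_cls smult_cls A(3,4)

lemma cls_in_carrier: "cls J x \<in> carrier A"
  by (simp add: A)

lemma carrierE: "X \<in> carrier A \<Longrightarrow> (\<And>x. X = cls J x \<Longrightarrow> P) \<Longrightarrow> P"
  by (auto simp: A)

lemma abelian_group: "abelian_group A"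
proof (rule abelian_groupI)
  fix X assume "X \<in> carrier A"
  then obtain x where "X = cls J x" by (rule carrierE)
  then have "cls J (- x) \<oplus> X = \<zero>" by (simp add: cls_simps)
  then show "\<exists>Y\<in>carrier A. Y \<oplus> X = \<zero>" using cls_in_carrier by blast
qed (auto simp: A(1) cls_simps add_ac)

lemma complex_algebra: "complex_algebra A"
proof (rule complex_algebra.intro)
  show "ring A"
  proof (rule ringI)
    show "Group.monoid A" by (rule monoidI) (auto simp: A(1) cls_simps unit assoc)
  qed (auto simp: A(1) cls_simps abelian_group plinear_simps[OF bilinear(1)] plinear_simps[OF bilinear(2)])
  show "Module.module complex_ring A"
    by (rule moduleI) (auto simp: A(1) cls_simps abelian_group cring_complex_ring pm.scale_left_distrib pm.scale_right_distrib)
  show "complex_algebra_axioms A"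
    by standard (auto simp: A(1) cls_simps plinear_simps[OF bilinear(1)] plinear_simps[OF bilinear(2)])
qed

sublocale complex_algebra A
  by (rule complex_algebra)

lemma finsum_cls: "finite I \<Longrightarrow> (\<Oplus>i\<in>I. cls J (f i)) = cls J (\<Sum>i\<in>I. f i)"
proof (induction I rule: finite_induct)
  case (insert i I)
  then show ?case by (simp add: finsum_insert cls_in_carrier add_cls Pi_def)
qed (simp add: A)

lemma linear_subspace_cls: "pm.subspace S \<Longrightarrow> linear_subspace A (cls J ` S)"
  unfolding linear_subspace_def
  by (auto simp: A(1,4) add_cls smult_cls pm.subspace_0 intro!: imageI pm.subspace_add pm.subspace_scale)

text \<open>The hypothesis \<open>res\<close> says that J is homogeneous for the decomposition of
  the basis; this keeps the sum direct in the quotient.\<close>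

lemma internal_direct_sum_cls:
  assumes disj: "\<And>i j. i \<in> I \<Longrightarrow> j \<in> I \<Longrightarrow> i \<noteq> j \<Longrightarrow> S i \<inter> S j = {}"
    and res: "\<And>i x. i \<in> I \<Longrightarrow> x \<in> J \<Longrightarrow> restr (S i) x \<in> J"
  shows "internal_direct_sum A I (\<lambda>i. cls J ` supp_on (S i)) (cls J ` supp_on (\<Union>i\<in>I. S i))"
  unfolding internal_direct_sum_def
proof (intro conjI allI impI ballI)
  show "linear_subspace A (cls J ` supp_on (S i))" for i
    by (rule linear_subspace_cls[OF subspace_supp_on])
  have rep: "\<exists>g. (\<forall>i\<in>K. g i \<in> supp_on (S i) \<and> f i = cls J (g i)) \<and> (\<Oplus>i\<in>K. f i) = cls J (\<Sum>i\<in>K. g i)"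
    if K: "finite K" and f: "\<forall>i\<in>K. f i \<in> cls J ` supp_on (S i)" for K f
  proof -
    from f have "\<forall>i\<in>K. \<exists>x. x \<in> supp_on (S i) \<and> f i = cls J x" by auto
    from bchoice[OF this] obtain g where g: "\<forall>i\<in>K. g i \<in> supp_on (S i) \<and> f i = cls J (g i)" by auto
    have "(\<Oplus>i\<in>K. f i) = (\<Oplus>i\<in>K. cls J (g i))"
      by (rule abelian_monoid.finsum_cong'[OF abelian_group.axioms(1)[OF abelian_group]]) (use g in \<open>auto simp: cls_in_carrier\<close>)
    then show ?thesis using g finsum_cls[OF K] by auto
  qed
  show "cls J ` supp_on (\<Union>i\<in>I. S i) =
    {\<Oplus>i\<in>K. f i |K f. finite K \<and> K \<subseteq> I \<and> (\<forall>i\<in>K. f i \<in> cls J ` supp_on (S i))}" (is "?L = ?R")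
  proof
    show "?L \<subseteq> ?R"
    proof
      fix X assume "X \<in> ?L"
      then obtain x where x: "X = cls J x" "x \<in> supp_on (\<Union>i\<in>I. S i)" by auto
      then have "\<forall>k\<in>Poly_Mapping.keys x. \<exists>i. i \<in> I \<and> k \<in> S i" by (auto simp: supp_on_def)
      from bchoice[OF this] obtain g where g: "\<forall>k\<in>Poly_Mapping.keys x. g k \<in> I \<and> k \<in> S (g k)" by auto
      define K where "K = g ` Poly_Mapping.keys x"
      have K: "finite K" "K \<subseteq> I" using g by (auto simp: K_def)
      have "x \<in> supp_on (\<Union>i\<in>K. S i)" using g by (auto simp: supp_on_def K_def)
      then have "(\<Sum>i\<in>K. restr (S i) x) = x" by (rule restr_sum[OF K(1)]) (use K disj in blast)
      then have "X = (\<Oplus>i\<in>K. cls J (restr (S i) x))" by (simp add: finsum_cls[OF K(1)] x)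
      then show "X \<in> ?R" using K restr_supp by blast
    qed
    show "?R \<subseteq> ?L"
    proof clarify
      fix K f assume *: "finite K" "K \<subseteq> I" "\<forall>i\<in>K. f i \<in> cls J ` supp_on (S i)"
      from rep[OF *(1,3)] obtain g where g: "\<forall>i\<in>K. g i \<in> supp_on (S i) \<and> f i = cls J (g i)"
        "(\<Oplus>i\<in>K. f i) = cls J (\<Sum>i\<in>K. g i)" by auto
      have "g i \<in> supp_on (\<Union>i\<in>I. S i)" if "i \<in> K" for i
        by (rule supp_on_mono[of "S i"]) (use g(1) *(2) that in auto)
      then have "(\<Sum>i\<in>K. g i) \<in> supp_on (\<Union>i\<in>I. S i)"
        by (intro pm.subspace_sum subspace_supp_on)
      then show "(\<Oplus>i\<in>K. f i) \<in> ?L" using g by auto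
    qed
  qed
  fix K f j assume *: "finite K \<and> K \<subseteq> I \<and> (\<forall>i\<in>K. f i \<in> cls J ` supp_on (S i)) \<and> (\<Oplus>i\<in>K. f i) = \<zero>" and j: "j \<in> K"
  from rep[of K f] * obtain g where g: "\<forall>i\<in>K. g i \<in> supp_on (S i) \<and> f i = cls J (g i)"
    "(\<Oplus>i\<in>K. f i) = cls J (\<Sum>i\<in>K. g i)" by auto
  then have "cls J (\<Sum>i\<in>K. g i) = cls J 0" using * by (simp add: A)
  then have "(\<Sum>i\<in>K. g i) \<in> J" unfolding cls_iff by simp
  then have "restr (S j) (\<Sum>i\<in>K. g i) \<in> J" using * j by (intro res) auto
  also have "restr (S j) (\<Sum>i\<in>K. g i) = (\<Sum>i\<in>K. if i = j then g j else 0)"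
    unfolding plinear_simps(6)[OF plinear_restr]
  proof (intro sum.cong refl)
    fix i assume i: "i \<in> K"
    show "restr (S j) (g i) = (if i = j then g j else 0)"
    proof (cases "i = j")
      case False
      then show ?thesis using restr_disjoint[of "g i" "S i" "S j"] disj[of j i] g i j * by auto
    next
      case True
      then show ?thesis using g(1) i restr_id[of "g j" "S j"] by simp
    qed
  qed
  also have "\<dots> = g j" using * j by simp
  finally show "f j = \<zero>" using g j by (simp add: A cls_iff)
qed

end

context R_of_H
begin

section \<open>The double complex as a graded quotient\<close>

abbreviation Om :: "tv3 set dolbeault_data" where "Om \<equiv> Omega q R"
abbreviation cl :: "tv3 \<Rightarrow> tv3 set" where "cl \<equiv> cls (J3 Q)"

abbreviation deg_words :: "nat \<Rightarrow> vword3 set" where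
  "deg_words m \<equiv> {(u, b, v). length u + length v = m}"

lemma T3_mult_mul: "T3_mult R = mul Q"
  by (intro ext) (rule T3_mult_eq_mul)

sublocale Om: quotient_algebra "Omega q R" "J3 Q" "mul Q" one3
  by standard (auto simp: Omega_def Let_def Omega_rel_eq T3_mult_mul subspace_J3 plinear_mul_left plinear_mul_right mul_assoc
    J3_mul_left J3_mul_right)

sublocale Bp: quotient_algebra "B_plus R" "IB Q" "(*)" 1
proof (standard, goal_cases)
  case (7 x y)
  then show ?case using IB_mult[of x Q 1 y] by simp
next
  case (8 y x)
  then show ?case using IB_mult[of y Q x 1] by simp
qed (auto simp: B_plus_def B_ideal_eq subspace_IB plinear_mult_left plinear_mult_right mult.assoc)

lemma bideg_Om: "bideg Om p r = cl ` supp_on (bideg_words p r)"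
  by (simp add: Omega_def Let_def Omega_rel_eq)

lemma del_cl: "del Om (cl x) = cl (dl x)"
  by (simp add: Omega_def Let_def Omega_rel_eq)
    (rule induced_cls[OF subspace_J3 subspace_J3], simp flip: T3_del_simps(5) add: dl_J3)

lemma delbar_cl: "delbar Om (cl x) = cl (db x)"
  by (simp add: Omega_def Let_def Omega_rel_eq)
    (rule induced_cls[OF subspace_J3 subspace_J3], simp flip: T3_del_simps(11) add: db_J3)

lemma dstar_cl: "dstar Om (cl x) = cl (st x)"
  by (simp add: Omega_def Let_def Omega_rel_eq)
    (rule induced_cls[OF subspace_J3 subspace_J3], simp flip: star_simps(5) add: st_J3)

text \<open>Membership in S depends on the form degrees only, and normalisation preserves them.
  Since the ideal is the kernel of \<open>N3\<close>, it is homogeneous.\<close>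

lemma restr_N3:
  assumes S: "\<And>u b v u' b' v'. length u = length u' \<Longrightarrow> length v = length v' \<Longrightarrow> (u, b, v) \<in> S \<longleftrightarrow> (u', b', v') \<in> S"
  shows "N3 (restr S x) = restr S (N3 x)"
proof (rule plinear_eqI[of "\<lambda>x. N3 (restr S x)"])
  show "plinear (\<lambda>x. N3 (restr S x))" "plinear (\<lambda>x. restr S (N3 x))"
    by (simp_all add: plinear_def plinear_simps[OF plinear_restr])
  fix k :: vword3 obtain u b v where k: "k = (u, b, v)" by (cases k)
  let ?T = "{(u', b', v'). length u' = length u \<and> length b' = length b \<and> length v' = length v}"
  have T: "N3 (mon k) \<in> supp_on ?T" unfolding k by (rule supp_on_mono[OF _ N3_supp_mon]) auto
  show "N3 (restr S (mon k)) = restr S (N3 (mon k))"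
  proof (cases "k \<in> S")
    case True
    then have "?T \<subseteq> S" using S unfolding k by blast
    then have "restr S (N3 (mon k)) = N3 (mon k)" using T by (intro restr_id supp_on_mono[of ?T S])
    then show ?thesis using True by (simp add: restr_def)
  next
    case False
    then have "S \<inter> ?T = {}" using S unfolding k by blast
    then have "restr S (N3 (mon k)) = 0" using T by (intro restr_disjoint)
    then show ?thesis using False by (simp add: restr_def)
  qed
qed

lemma restr_J3:
  assumes "\<And>u b v u' b' v'. length u = length u' \<Longrightarrow> length v = length v' \<Longrightarrow> (u, b, v) \<in> S \<longleftrightarrow> (u', b', v') \<in> S"
    and "x \<in> J3 Q"
  shows "restr S x \<in> J3 Q"
  using assms(2) by (simp add: J3_iff restr_N3[OF assms(1)] plinear_simps[OF plinear_restr])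

lemma bideg_words_Un: "(\<Union>p\<le>m. bideg_words p (m - p)) = deg_words m"
  by (auto simp: bideg_words_def)

lemma bigrading_Om: "internal_direct_sum Om {..m} (\<lambda>p. bideg Om p (m - p)) (cl ` supp_on (deg_words m))"
  unfolding bideg_Om bideg_words_Un[symmetric]
  by (rule Om.internal_direct_sum_cls) (auto simp: bideg_words_def intro!: restr_J3)

lemma total_deg_Om: "total_deg Om m = cl ` supp_on (deg_words m)"
proof
  show "total_deg Om m \<subseteq> cl ` supp_on (deg_words m)"
  proof
    fix Y assume "Y \<in> total_deg Om m"
    then obtain f where f: "Y = (\<Oplus>\<^bsub>Om\<^esub>p\<in>{..m}. f p)" "\<forall>p\<le>m. f p \<in> bideg Om p (m - p)"
      unfolding total_deg_def by blast
    have "Y \<in> {\<Oplus>\<^bsub>Om\<^esub>i\<in>K. f i |K f. finite K \<and> K \<subseteq> {..m} \<and> (\<forall>i\<in>K. f i \<in> bideg Om i (m - i))}"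
      by (rule CollectI, rule exI[of _ "{..m}"], rule exI[of _ f]) (use f in simp)
    also have "\<dots> = cl ` supp_on (deg_words m)"
      using bigrading_Om[of m, unfolded internal_direct_sum_def, THEN conjunct2, THEN conjunct1] by simp
    finally show "Y \<in> cl ` supp_on (deg_words m)" .
  qed
  show "cl ` supp_on (deg_words m) \<subseteq> total_deg Om m"
  proof clarify
    fix x assume x: "x \<in> supp_on (deg_words m)"
    have "(\<Sum>p\<le>m. restr (bideg_words p (m - p)) x) = x"
      by (rule restr_sum) (use x in \<open>auto simp: bideg_words_Un, auto simp: bideg_words_def\<close>)
    then have "cl x = (\<Oplus>\<^bsub>Om\<^esub>p\<in>{..m}. cl (restr (bideg_words p (m - p)) x))"
      by (simp add: Om.finsum_cls)
    then show "cl x \<in> total_deg Om m"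
      unfolding total_deg_def bideg_Om using restr_supp by blast
  qed
qed

lemma grading_Om: "internal_direct_sum Om UNIV (total_deg Om) (carrier Om)"
proof -
  have "internal_direct_sum Om UNIV (\<lambda>m. cl ` supp_on (deg_words m))
     (cl ` supp_on (\<Union>m. deg_words m))"
    by (rule Om.internal_direct_sum_cls) (auto intro!: restr_J3)
  moreover have "(\<Union>m. deg_words m) = (UNIV :: vword3 set)" by auto
  moreover have "supp_on (UNIV :: vword3 set) = UNIV" by (auto simp: supp_on_def)
  moreover have "total_deg Om = (\<lambda>m. cl ` supp_on (deg_words m))"
    by (rule ext) (rule total_deg_Om)
  ultimately show ?thesis by (simp add: Om.A)
qed

end

section \<open>Tensor products over the quantum plane\<close>

lemma form_bimodule_simps [simp]:
  "bim_carrier (form_bimodule \<Omega> p r) = bideg \<Omega> p r" "bim_add (form_bimodule \<Omega> p r) = add \<Omega>"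
  "bim_scale (form_bimodule \<Omega> p r) = smult \<Omega>" "bim_left (form_bimodule \<Omega> p r) = monoid.mult \<Omega>"
  "bim_right (form_bimodule \<Omega> p r) = monoid.mult \<Omega>"
  by (simp_all add: form_bimodule_def)

context R_of_H
begin

abbreviation B0 :: "tv3 set set" where "B0 \<equiv> bideg Om 0 0"

abbreviation Bal :: "nat \<Rightarrow> nat \<Rightarrow> nat \<Rightarrow> nat \<Rightarrow> (tv3 set \<times> tv3 set \<Rightarrow>\<^sub>0 complex) set" where
  "Bal p r p' r' \<equiv> balanced_rel B0 (form_bimodule Om p r) (form_bimodule Om p' r')"

lemma subspace_Bal: "pm.subspace (Bal p r p' r')"
  by (simp add: balanced_rel_def pspan_def')

lemma bideg_E: "X \<in> bideg Om p r \<Longrightarrow> (\<And>x. X = cl x \<Longrightarrow> x \<in> supp_on (bideg_words p r) \<Longrightarrow> P) \<Longrightarrow> P"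
  by (auto simp: bideg_Om)

lemma cl_bideg: "x \<in> supp_on (bideg_words p r) \<Longrightarrow> cl x \<in> bideg Om p r"
  by (auto simp: bideg_Om)

lemma bideg_mult: "X \<in> bideg Om p r \<Longrightarrow> Y \<in> bideg Om p' r' \<Longrightarrow> X \<otimes>\<^bsub>Om\<^esub> Y \<in> bideg Om (p + p') (r + r')"
  by (elim bideg_E) (simp add: Om.mult_cls cl_bideg mul_bideg)

lemma bideg_add: "X \<in> bideg Om p r \<Longrightarrow> Y \<in> bideg Om p r \<Longrightarrow> X \<oplus>\<^bsub>Om\<^esub> Y \<in> bideg Om p r"
  by (elim bideg_E) (simp add: Om.add_cls cl_bideg pm.subspace_add subspace_supp_on)

lemma bideg_smult: "X \<in> bideg Om p r \<Longrightarrow> s \<odot>\<^bsub>Om\<^esub> X \<in> bideg Om p r"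
  by (elim bideg_E) (simp add: Om.smult_cls cl_bideg pm.subspace_scale subspace_supp_on)

lemma Bal_base:
  "\<lbrakk>X \<in> bideg Om p r; X' \<in> bideg Om p r; Y \<in> bideg Om p' r'\<rbrakk> \<Longrightarrow>
     mon (X \<oplus>\<^bsub>Om\<^esub> X', Y) - mon (X, Y) - mon (X', Y) \<in> Bal p r p' r'"
  "\<lbrakk>X \<in> bideg Om p r; Y \<in> bideg Om p' r'; Y' \<in> bideg Om p' r'\<rbrakk> \<Longrightarrow>
     mon (X, Y \<oplus>\<^bsub>Om\<^esub> Y') - mon (X, Y) - mon (X, Y') \<in> Bal p r p' r'"
  "\<lbrakk>X \<in> bideg Om p r; Y \<in> bideg Om p' r'\<rbrakk> \<Longrightarrow> mon (s \<odot>\<^bsub>Om\<^esub> X, Y) - pscale s (mon (X, Y)) \<in> Bal p r p' r'"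
  "\<lbrakk>X \<in> bideg Om p r; Y \<in> bideg Om p' r'\<rbrakk> \<Longrightarrow> mon (X, s \<odot>\<^bsub>Om\<^esub> Y) - pscale s (mon (X, Y)) \<in> Bal p r p' r'"
  "\<lbrakk>b \<in> B0; X \<in> bideg Om p r; Y \<in> bideg Om p' r'\<rbrakk> \<Longrightarrow>
     mon (X \<otimes>\<^bsub>Om\<^esub> b, Y) - mon (X, b \<otimes>\<^bsub>Om\<^esub> Y) \<in> Bal p r p' r'"
  unfolding balanced_rel_def pspan_def' by (rule pm.span_base, simp, blast)+

lemma Bal_minimal:
  assumes S: "pm.subspace S"
    and "\<And>X X' Y. X \<in> bideg Om p r \<Longrightarrow> X' \<in> bideg Om p r \<Longrightarrow> Y \<in> bideg Om p' r' \<Longrightarrow>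
     mon (X \<oplus>\<^bsub>Om\<^esub> X', Y) - mon (X, Y) - mon (X', Y) \<in> S"
  "\<And>X Y Y'. X \<in> bideg Om p r \<Longrightarrow> Y \<in> bideg Om p' r' \<Longrightarrow> Y' \<in> bideg Om p' r' \<Longrightarrow>
     mon (X, Y \<oplus>\<^bsub>Om\<^esub> Y') - mon (X, Y) - mon (X, Y') \<in> S"
  "\<And>s X Y. X \<in> bideg Om p r \<Longrightarrow> Y \<in> bideg Om p' r' \<Longrightarrow> mon (s \<odot>\<^bsub>Om\<^esub> X, Y) - pscale s (mon (X, Y)) \<in> S"
  "\<And>s X Y. X \<in> bideg Om p r \<Longrightarrow> Y \<in> bideg Om p' r' \<Longrightarrow> mon (X, s \<odot>\<^bsub>Om\<^esub> Y) - pscale s (mon (X, Y)) \<in> S"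
  "\<And>b X Y. b \<in> B0 \<Longrightarrow> X \<in> bideg Om p r \<Longrightarrow> Y \<in> bideg Om p' r' \<Longrightarrow>
     mon (X \<otimes>\<^bsub>Om\<^esub> b, Y) - mon (X, b \<otimes>\<^bsub>Om\<^esub> Y) \<in> S"
  shows "Bal p r p' r' \<subseteq> S"
  unfolding balanced_rel_def by (rule pspan_minimal[OF _ S]) (use assms(2-) in auto)

definition rep :: "tv3 set \<Rightarrow> tv3" where "rep X = (SOME x. cl x = X)"

lemma cl_rep: "cl (rep (cl x)) = cl x"
  unfolding rep_def by (rule someI) (rule refl)

text \<open>The keys are pairs of classes; multiplying chosen representatives gives a linear map
  into free words, of which only the class is meaningful.\<close>

definition ev :: "(tv3 set \<times> tv3 set \<Rightarrow>\<^sub>0 complex) \<Rightarrow> tv3" where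
  "ev = lin (\<lambda>(X, Y). mul Q (rep X) (rep Y))"

lemma plinear_ev: "plinear ev"
  by (simp add: ev_def plinear_lin)

lemmas ev_simps [simp] = plinear_simps[OF plinear_ev]

lemma ev_mon: "cl (ev (mon (cl x, cl y))) = cl (mul Q x y)"
  by (simp add: ev_def Om.mult_cls[symmetric] cl_rep)

lemma ev_mon_iff: "ev (mon (cl x, cl y)) - mul Q x y \<in> J3 Q"
  using ev_mon unfolding Om.cls_iff .

lemma ev_Bal: "f \<in> Bal p r p' r' \<Longrightarrow> ev f \<in> J3 Q"
proof -
  note e = ev_mon_iff
  have "Bal p r p' r' \<subseteq> {f. ev f \<in> J3 Q}"
  proof (rule Bal_minimal)
    show "pm.subspace {f. ev f \<in> J3 Q}" by (rule subspace_vimage[OF plinear_ev subspace_J3])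
  next
    fix X X' Y assume "X \<in> bideg Om p r" "X' \<in> bideg Om p r" "Y \<in> bideg Om p' r'"
    then obtain x x' y where X: "X = cl x" "X' = cl x'" "Y = cl y" by (elim bideg_E) blast
    have "(ev (mon (cl (x + x'), Y)) - mul Q (x + x') y) - (ev (mon (X, Y)) - mul Q x y) - (ev (mon (X', Y)) - mul Q x' y) \<in> J3 Q"
      unfolding X by (intro J3_intros e)
    then show "mon (X \<oplus>\<^bsub>Om\<^esub> X', Y) - mon (X, Y) - mon (X', Y) \<in> {f. ev f \<in> J3 Q}"
      by (simp add: X Om.add_cls algebra_simps)
  next
    fix X Y Y' assume "X \<in> bideg Om p r" "Y \<in> bideg Om p' r'" "Y' \<in> bideg Om p' r'"
    then obtain x y y' where X: "X = cl x" "Y = cl y" "Y' = cl y'" by (elim bideg_E) blast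
    have "(ev (mon (X, cl (y + y'))) - mul Q x (y + y')) - (ev (mon (X, Y)) - mul Q x y) - (ev (mon (X, Y')) - mul Q x y') \<in> J3 Q"
      unfolding X by (intro J3_intros e)
    then show "mon (X, Y \<oplus>\<^bsub>Om\<^esub> Y') - mon (X, Y) - mon (X, Y') \<in> {f. ev f \<in> J3 Q}"
      by (simp add: X Om.add_cls algebra_simps)
  next
    fix s X Y assume "X \<in> bideg Om p r" "Y \<in> bideg Om p' r'"
    then obtain x y where X: "X = cl x" "Y = cl y" by (elim bideg_E) blast
    have "(ev (mon (cl (pscale s x), Y)) - mul Q (pscale s x) y) - pscale s (ev (mon (X, Y)) - mul Q x y) \<in> J3 Q"
      "(ev (mon (X, cl (pscale s y))) - mul Q x (pscale s y)) - pscale s (ev (mon (X, Y)) - mul Q x y) \<in> J3 Q"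
      unfolding X by (intro J3_intros e)+
    then show "mon (s \<odot>\<^bsub>Om\<^esub> X, Y) - pscale s (mon (X, Y)) \<in> {f. ev f \<in> J3 Q}"
       "mon (X, s \<odot>\<^bsub>Om\<^esub> Y) - pscale s (mon (X, Y)) \<in> {f. ev f \<in> J3 Q}"
      by (simp_all add: X Om.smult_cls algebra_simps)
  next
    fix b X Y assume "b \<in> B0" "X \<in> bideg Om p r" "Y \<in> bideg Om p' r'"
    then obtain c x y where X: "X = cl x" "Y = cl y" "b = cl c" by (elim bideg_E) blast
    have "(ev (mon (cl (mul Q x c), Y)) - mul Q (mul Q x c) y) - (ev (mon (X, cl (mul Q c y))) - mul Q x (mul Q c y)) \<in> J3 Q"
      unfolding X by (intro J3_intros e)
    then show "mon (X \<otimes>\<^bsub>Om\<^esub> b, Y) - mon (X, b \<otimes>\<^bsub>Om\<^esub> Y) \<in> {f. ev f \<in> J3 Q}"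
      by (simp add: X Om.mult_cls mul_assoc)
  qed
  then show "f \<in> Bal p r p' r' \<Longrightarrow> ev f \<in> J3 Q" by blast
qed

lemma finsum_ev:
  assumes "g \<in> supp_on (bideg Om p r \<times> bideg Om p' r')"
  shows "(\<Oplus>\<^bsub>Om\<^esub>k\<in>Poly_Mapping.keys g. Poly_Mapping.lookup g k \<odot>\<^bsub>Om\<^esub> (fst k \<otimes>\<^bsub>Om\<^esub> snd k)) = cl (ev g)"
proof -
  have "cl (pscale (Poly_Mapping.lookup g k) (mul Q (rep (fst k)) (rep (snd k)))) =
      Poly_Mapping.lookup g k \<odot>\<^bsub>Om\<^esub> (fst k \<otimes>\<^bsub>Om\<^esub> snd k)" if "k \<in> Poly_Mapping.keys g" for k
  proof -
    obtain X Y where k: "k = (X, Y)" by (cases k)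
    with that assms have "X \<in> bideg Om p r" "Y \<in> bideg Om p' r'" by (auto simp: supp_on_def)
    then show ?thesis by (elim bideg_E) (simp add: k Om.smult_cls[symmetric] Om.mult_cls[symmetric] cl_rep)
  qed
  then have "(\<Oplus>\<^bsub>Om\<^esub>k\<in>Poly_Mapping.keys g. Poly_Mapping.lookup g k \<odot>\<^bsub>Om\<^esub> (fst k \<otimes>\<^bsub>Om\<^esub> snd k)) =
     (\<Oplus>\<^bsub>Om\<^esub>k\<in>Poly_Mapping.keys g. cl (pscale (Poly_Mapping.lookup g k) (mul Q (rep (fst k)) (rep (snd k)))))"
    by (intro abelian_monoid.finsum_cong'[OF abelian_group.axioms(1)[OF Om.abelian_group]] refl)
      (simp_all only: Pi_iff Om.cls_in_carrier Ball_def simp_thms)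
  also have "\<dots> = cl (ev g)"
    by (simp add: Om.finsum_cls ev_def lin_def case_prod_unfold)
  finally show ?thesis .
qed

lemma wedge_map_cls:
  assumes "f \<in> supp_on (bideg Om p r \<times> bideg Om p' r')"
  shows "wedge_map Om p r p' r' (cls (Bal p r p' r') f) = cl (ev f)"
  unfolding wedge_map_def
proof (rule the_elem_image_const[of f])
  show "f \<in> cls (Bal p r p' r') f \<inter> supp_on (bideg Om p r \<times> bideg Om p' r')"
    using assms pm.subspace_0[OF subspace_Bal] by (simp add: cls_def)
  fix g assume g: "g \<in> cls (Bal p r p' r') f \<inter> supp_on (bideg Om p r \<times> bideg Om p' r')"
  then have "ev (g - f) \<in> J3 Q" by (intro ev_Bal[of _ p r p' r']) (simp add: cls_def)
  then have "cl (ev g) = cl (ev f)" by (simp add: Om.cls_iff)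
  then show "(\<Oplus>\<^bsub>Om\<^esub>k\<in>Poly_Mapping.keys g. Poly_Mapping.lookup g k \<odot>\<^bsub>Om\<^esub> (fst k \<otimes>\<^bsub>Om\<^esub> snd k)) = cl (ev f)"
    using finsum_ev[of g p r p' r'] g by simp
qed

section \<open>The bimodule structure of the tensor products\<close>

abbreviation lact :: "tv3 set \<Rightarrow> (tv3 set \<times> tv3 set \<Rightarrow>\<^sub>0 complex) \<Rightarrow> (tv3 set \<times> tv3 set \<Rightarrow>\<^sub>0 complex)" where
  "lact b \<equiv> lin (\<lambda>(x, y). mon (b \<otimes>\<^bsub>Om\<^esub> x, y))"

abbreviation ract :: "tv3 set \<Rightarrow> (tv3 set \<times> tv3 set \<Rightarrow>\<^sub>0 complex) \<Rightarrow> (tv3 set \<times> tv3 set \<Rightarrow>\<^sub>0 complex)" where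
  "ract b \<equiv> lin (\<lambda>(x, y). mon (x, y \<otimes>\<^bsub>Om\<^esub> b))"

lemma B0_mult: "b \<in> B0 \<Longrightarrow> X \<in> bideg Om p r \<Longrightarrow> b \<otimes>\<^bsub>Om\<^esub> X \<in> bideg Om p r"
  "b \<in> B0 \<Longrightarrow> X \<in> bideg Om p r \<Longrightarrow> X \<otimes>\<^bsub>Om\<^esub> b \<in> bideg Om p r"
  using bideg_mult[of b 0 0 X p r] bideg_mult[of X p r b 0 0] by simp_all

lemma bideg_in_carrier: "X \<in> bideg Om p r \<Longrightarrow> X \<in> carrier Om"
  by (auto simp: bideg_Om Om.cls_in_carrier)

lemma Om_arith:
  "\<lbrakk>X \<in> carrier Om; Y \<in> carrier Om; U \<in> carrier Om\<rbrakk> \<Longrightarrow> X \<otimes>\<^bsub>Om\<^esub> (Y \<oplus>\<^bsub>Om\<^esub> U) = X \<otimes>\<^bsub>Om\<^esub> Y \<oplus>\<^bsub>Om\<^esub> X \<otimes>\<^bsub>Om\<^esub> U"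
  "\<lbrakk>X \<in> carrier Om; Y \<in> carrier Om; U \<in> carrier Om\<rbrakk> \<Longrightarrow> (Y \<oplus>\<^bsub>Om\<^esub> U) \<otimes>\<^bsub>Om\<^esub> X = Y \<otimes>\<^bsub>Om\<^esub> X \<oplus>\<^bsub>Om\<^esub> U \<otimes>\<^bsub>Om\<^esub> X"
  "\<lbrakk>X \<in> carrier Om; Y \<in> carrier Om\<rbrakk> \<Longrightarrow> X \<otimes>\<^bsub>Om\<^esub> (s \<odot>\<^bsub>Om\<^esub> Y) = s \<odot>\<^bsub>Om\<^esub> (X \<otimes>\<^bsub>Om\<^esub> Y)"
  "\<lbrakk>X \<in> carrier Om; Y \<in> carrier Om\<rbrakk> \<Longrightarrow> (s \<odot>\<^bsub>Om\<^esub> Y) \<otimes>\<^bsub>Om\<^esub> X = s \<odot>\<^bsub>Om\<^esub> (Y \<otimes>\<^bsub>Om\<^esub> X)"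
  "\<lbrakk>X \<in> carrier Om; Y \<in> carrier Om; U \<in> carrier Om\<rbrakk> \<Longrightarrow> X \<otimes>\<^bsub>Om\<^esub> (Y \<otimes>\<^bsub>Om\<^esub> U) = (X \<otimes>\<^bsub>Om\<^esub> Y) \<otimes>\<^bsub>Om\<^esub> U"
  by (auto elim!: Om.carrierE simp: Om.cls_simps mul_assoc)

lemma lact_Bal:
  assumes "b \<in> B0" "f \<in> Bal p r p' r'"
  shows "lact b f \<in> Bal p r p' r'"
proof -
  have c: "b \<in> carrier Om" using assms(1) by (rule bideg_in_carrier)
  have "Bal p r p' r' \<subseteq> {f. lact b f \<in> Bal p r p' r'}"
    by (rule Bal_minimal)
      (auto simp: bideg_in_carrier c Om_arith intro!: subspace_vimage plinear_lin subspace_Bal Bal_base B0_mult(1)[OF assms(1)])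
  then show ?thesis using assms(2) by blast
qed

lemma ract_Bal:
  assumes "b \<in> B0" "f \<in> Bal p r p' r'"
  shows "ract b f \<in> Bal p r p' r'"
proof -
  have c: "b \<in> carrier Om" using assms(1) by (rule bideg_in_carrier)
  have "Bal p r p' r' \<subseteq> {f. ract b f \<in> Bal p r p' r'}"
    by (rule Bal_minimal)
      (auto simp: bideg_in_carrier c Om_arith(2,4) Om_arith(5)[symmetric] intro!: subspace_vimage plinear_lin subspace_Bal Bal_base B0_mult(2)[OF assms(1)])
  then show ?thesis using assms(2) by blast
qed

abbreviation FT where "FT \<equiv> form_tensor Om"

lemma FT_carrier: "bim_carrier (FT p r p' r') = cls (Bal p r p' r') ` supp_on (bideg Om p r \<times> bideg Om p' r')"
  by (simp add: form_tensor_def tensor_over_def)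

lemma FT_add: "bim_add (FT p r p' r') (cls (Bal p r p' r') f) (cls (Bal p r p' r') g) = cls (Bal p r p' r') (f + g)"
  unfolding form_tensor_def tensor_over_def bimodule.simps
  by (rule induced2_cls[OF subspace_Bal subspace_Bal subspace_Bal])
    (subst add_diff_add, rule pm.subspace_add[OF subspace_Bal])

lemma FT_scale: "bim_scale (FT p r p' r') s (cls (Bal p r p' r') f) = cls (Bal p r p' r') (pscale s f)"
  unfolding form_tensor_def tensor_over_def bimodule.simps
  by (rule induced_cls[OF subspace_Bal subspace_Bal])
    (subst pm.scale_right_diff_distrib[symmetric], rule pm.subspace_scale[OF subspace_Bal])

lemma FT_left: "b \<in> B0 \<Longrightarrow> bim_left (FT p r p' r') b (cls (Bal p r p' r') f) = cls (Bal p r p' r') (lact b f)"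
  unfolding form_tensor_def tensor_over_def bimodule.simps form_bimodule_simps
  by (rule induced_cls[OF subspace_Bal subspace_Bal]) (simp flip: lin_simps(3) add: lact_Bal)

lemma FT_right: "b \<in> B0 \<Longrightarrow> bim_right (FT p r p' r') (cls (Bal p r p' r') f) b = cls (Bal p r p' r') (ract b f)"
  unfolding form_tensor_def tensor_over_def bimodule.simps form_bimodule_simps
  by (rule induced_cls[OF subspace_Bal subspace_Bal]) (simp flip: lin_simps(3) add: ract_Bal)

lemma lact_supp: "b \<in> B0 \<Longrightarrow> f \<in> supp_on (bideg Om p r \<times> bideg Om p' r') \<Longrightarrow> lact b f \<in> supp_on (bideg Om p r \<times> bideg Om p' r')"
  by (erule lin_supp_on) (auto simp: B0_mult)

lemma ract_supp: "b \<in> B0 \<Longrightarrow> f \<in> supp_on (bideg Om p r \<times> bideg Om p' r') \<Longrightarrow> ract b f \<in> supp_on (bideg Om p r \<times> bideg Om p' r')"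
  by (erule lin_supp_on) (auto simp: B0_mult)

lemma ev_lact:
  assumes "f \<in> supp_on (bideg Om p r \<times> bideg Om p' r')"
  shows "ev (lact (cl c) f) - mul Q c (ev f) \<in> J3 Q"
proof (rule plinear_in_subspace[of "\<lambda>f. ev (lact (cl c) f) - mul Q c (ev f)", OF _ subspace_J3])
  show "plinear (\<lambda>f. ev (lact (cl c) f) - mul Q c (ev f))"
    by (intro plinear_minus plinear_comp[OF plinear_ev plinear_lin] plinear_comp[OF plinear_mul_right plinear_ev])
  fix k assume "k \<in> Poly_Mapping.keys f"
  with assms have "fst k \<in> bideg Om p r" "snd k \<in> bideg Om p' r'" by (auto simp: supp_on_def)
  then obtain x y where k: "fst k = cl x" "snd k = cl y" by (elim bideg_E) blast
  have "(ev (mon (cl (mul Q c x), cl y)) - mul Q (mul Q c x) y) - mul Q c (ev (mon (cl x, cl y)) - mul Q x y) \<in> J3 Q"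
    by (intro J3_intros ev_mon_iff)
  moreover have "k = (cl x, cl y)" using k by (metis prod.collapse)
  ultimately show "ev (lact (cl c) (mon k)) - mul Q c (ev (mon k)) \<in> J3 Q"
    by (simp add: Om.mult_cls mul_assoc)
qed

lemma ev_ract:
  assumes "f \<in> supp_on (bideg Om p r \<times> bideg Om p' r')"
  shows "ev (ract (cl c) f) - mul Q (ev f) c \<in> J3 Q"
proof (rule plinear_in_subspace[of "\<lambda>f. ev (ract (cl c) f) - mul Q (ev f) c", OF _ subspace_J3])
  show "plinear (\<lambda>f. ev (ract (cl c) f) - mul Q (ev f) c)"
    by (intro plinear_minus plinear_comp[OF plinear_ev plinear_lin] plinear_comp[OF plinear_mul_left plinear_ev])
  fix k assume "k \<in> Poly_Mapping.keys f"
  with assms have "fst k \<in> bideg Om p r" "snd k \<in> bideg Om p' r'" by (auto simp: supp_on_def)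
  then obtain x y where k: "fst k = cl x" "snd k = cl y" by (elim bideg_E) blast
  have "(ev (mon (cl x, cl (mul Q y c))) - mul Q x (mul Q y c)) - mul Q (ev (mon (cl x, cl y)) - mul Q x y) c \<in> J3 Q"
    by (intro J3_intros ev_mon_iff)
  moreover have "k = (cl x, cl y)" using k by (metis prod.collapse)
  ultimately show "ev (ract (cl c) (mon k)) - mul Q (ev (mon k)) c \<in> J3 Q"
    by (simp add: Om.mult_cls mul_assoc)
qed

lemma ev_bideg:
  assumes "f \<in> supp_on (bideg Om p r \<times> bideg Om p' r')"
  shows "cl (ev f) \<in> bideg Om (p + p') (r + r')"
proof -
  have S: "pm.subspace {x. cl x \<in> bideg Om (p + p') (r + r')}"
    unfolding pm.subspace_def
    by (auto simp: Om.add_cls[symmetric] Om.smult_cls[symmetric] bideg_add bideg_smult intro: cl_bideg)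
  have "ev f \<in> {x. cl x \<in> bideg Om (p + p') (r + r')}"
  proof (rule plinear_in_subspace[OF plinear_ev S])
    fix k assume "k \<in> Poly_Mapping.keys f"
    with assms have *: "fst k \<in> bideg Om p r" "snd k \<in> bideg Om p' r'" by (auto simp: supp_on_def)
    then obtain x y where k: "fst k = cl x" "snd k = cl y" by (elim bideg_E) blast
    then have "k = (cl x, cl y)" by (metis prod.collapse)
    then show "ev (mon k) \<in> {x. cl x \<in> bideg Om (p + p') (r + r')}"
      using bideg_mult[OF *] by (simp add: Om.mult_cls ev_mon)
  qed
  then show ?thesis by simp
qed

text \<open>Reduces bijectivity to formal combinations of pairs, where it is enough to argue modulo
  the ideal on one side and modulo the balancing relations on the other.\<close>

lemma wedge_iso:
  assumes surj: "\<And>x. x \<in> supp_on (bideg_words (p + p') (r + r')) \<Longrightarrow>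
      \<exists>f \<in> supp_on (bideg Om p r \<times> bideg Om p' r'). ev f - x \<in> J3 Q"
    and inj: "\<And>f. f \<in> supp_on (bideg Om p r \<times> bideg Om p' r') \<Longrightarrow> ev f \<in> J3 Q \<Longrightarrow> f \<in> Bal p r p' r'"
  shows "bimodule_iso B0 (FT p r p' r') (form_bimodule Om (p + p') (r + r')) (wedge_map Om p r p' r')"
proof -
  let ?S = "supp_on (bideg Om p r \<times> bideg Om p' r')" and ?c = "cls (Bal p r p' r')" and ?w = "wedge_map Om p r p' r'"
  have "inj_on ?w (?c ` ?S)"
  proof (rule inj_onI)
    fix X Y assume "X \<in> ?c ` ?S" "Y \<in> ?c ` ?S" and e: "?w X = ?w Y"
    then obtain f g where f: "X = ?c f" "Y = ?c g" "f \<in> ?S" "g \<in> ?S" by blast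
    have "ev (f - g) \<in> J3 Q" using e by (simp add: f wedge_map_cls Om.cls_iff)
    moreover have "f - g \<in> ?S" using f by (intro pm.subspace_diff subspace_supp_on)
    ultimately have "f - g \<in> Bal p r p' r'" by (rule inj[rotated])
    then show "X = Y" by (simp add: f cls_eq_iff[OF subspace_Bal])
  qed
  moreover have "?w ` ?c ` ?S = bideg Om (p + p') (r + r')"
  proof
    show "?w ` ?c ` ?S \<subseteq> bideg Om (p + p') (r + r')" using ev_bideg by (auto simp: wedge_map_cls)
    show "bideg Om (p + p') (r + r') \<subseteq> ?w ` ?c ` ?S"
    proof
      fix X assume "X \<in> bideg Om (p + p') (r + r')"
      then obtain x where x: "X = cl x" "x \<in> supp_on (bideg_words (p + p') (r + r'))" by (rule bideg_E)
      from surj[OF x(2)] obtain f where f: "f \<in> ?S" "ev f - x \<in> J3 Q" by blast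
      then have "?w (?c f) = X" by (simp add: x wedge_map_cls Om.cls_iff)
      then show "X \<in> ?w ` ?c ` ?S" using f by blast
    qed
  qed
  moreover have "?w (?c (lact b f)) = b \<otimes>\<^bsub>Om\<^esub> ?w (?c f)" "?w (?c (ract b f)) = ?w (?c f) \<otimes>\<^bsub>Om\<^esub> b"
    if "b \<in> B0" "f \<in> ?S" for b f
  proof -
    from that(1) obtain c where c: "b = cl c" by (rule bideg_E)
    show "?w (?c (lact b f)) = b \<otimes>\<^bsub>Om\<^esub> ?w (?c f)" "?w (?c (ract b f)) = ?w (?c f) \<otimes>\<^bsub>Om\<^esub> b"
      using that lact_supp[OF that] ract_supp[OF that] ev_lact[OF that(2), of c] ev_ract[OF that(2), of c]
      by (simp_all add: wedge_map_cls Om.cls_iff Om.mult_cls c)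
  qed
  ultimately show ?thesis
    unfolding bimodule_iso_def FT_carrier bij_betw_def form_bimodule_simps
    by (auto simp: FT_add FT_scale FT_left FT_right wedge_map_cls Om.add_cls Om.smult_cls pm.subspace_add pm.subspace_scale subspace_supp_on)
qed

lemma mon_zero_Bal:
  assumes "X \<in> bideg Om p r" "Y \<in> bideg Om p' r'"
  shows "mon (cl 0, Y) \<in> Bal p r p' r'" "mon (X, cl 0) \<in> Bal p r p' r'"
proof -
  from assms obtain x y where X: "X = cl x" "Y = cl y" by (elim bideg_E) blast
  show "mon (cl 0, Y) \<in> Bal p r p' r'" "mon (X, cl 0) \<in> Bal p r p' r'"
    using Bal_base(3)[OF assms, of 0] Bal_base(4)[OF assms, of 0] by (simp_all add: X Om.smult_cls)
qed

text \<open>Bilinearity is available only for classes of the prescribed bidegrees, so the expansion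
  into words is carried out in the subspaces \<open>?T\<close>, which keep track of
  supports.\<close>

lemma Bal_lin:
  assumes \<phi>: "plinear \<phi>" "plinear \<phi>'" "\<And>k. k \<in> S \<Longrightarrow> \<phi> (mon k) \<in> supp_on (bideg_words p r)"
     "\<And>k. k \<in> S' \<Longrightarrow> \<phi>' (mon k) \<in> supp_on (bideg_words p' r')"
    and x: "x \<in> supp_on S" and y: "y \<in> supp_on S'"
  shows "mon (cl (\<phi> x), cl (\<phi>' y)) - lin (\<lambda>k. lin (\<lambda>l. mon (cl (\<phi> (mon k)), cl (\<phi>' (mon l)))) y) x \<in> Bal p r p' r'"
proof -
  have p1: "\<phi> x \<in> supp_on (bideg_words p r)" if "x \<in> supp_on S" for x
    by (rule plinear_in_subspace[OF \<phi>(1) subspace_supp_on]) (use that \<phi>(3) in \<open>auto simp: supp_on_def[of S]\<close>)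
  have p2: "\<phi>' x \<in> supp_on (bideg_words p' r')" if "x \<in> supp_on S'" for x
    by (rule plinear_in_subspace[OF \<phi>(2) subspace_supp_on]) (use that \<phi>(4) in \<open>auto simp: supp_on_def[of S']\<close>)
  have c1: "cl (\<phi> x) \<in> bideg Om p r" if "x \<in> supp_on S" for x using p1[OF that] by (rule cl_bideg)
  have c2: "cl (\<phi>' x) \<in> bideg Om p' r'" if "x \<in> supp_on S'" for x using p2[OF that] by (rule cl_bideg)
  note B = subspace_Bal[of p r p' r']
  have 1: "mon (X, cl (\<phi>' y)) - lin (\<lambda>l. mon (X, cl (\<phi>' (mon l)))) y \<in> Bal p r p' r'" if X: "X \<in> bideg Om p r" for X
  proof -
    let ?D = "\<lambda>y. mon (X, cl (\<phi>' y)) - lin (\<lambda>l. mon (X, cl (\<phi>' (mon l)))) y"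
    let ?T = "{y \<in> supp_on S'. ?D y \<in> Bal p r p' r'}"
    have "pm.subspace ?T"
      unfolding pm.subspace_def
    proof (intro conjI ballI allI)
      show "0 \<in> ?T" using mon_zero_Bal(2)[OF X c2[OF y]] by (simp add: plinear_simps[OF \<phi>(2)])
    next
      fix a b assume ab: "a \<in> ?T" "b \<in> ?T"
      have "?D (a + b) = (mon (X, cl (\<phi>' a) \<oplus>\<^bsub>Om\<^esub> cl (\<phi>' b)) - mon (X, cl (\<phi>' a)) - mon (X, cl (\<phi>' b))) + (?D a + ?D b)"
        by (simp add: Om.add_cls plinear_simps[OF \<phi>(2)])
      also have "\<dots> \<in> Bal p r p' r'" using ab c2 by (intro pm.subspace_add[OF B] Bal_base X) auto
      finally show "a + b \<in> ?T" using ab by (simp add: pm.subspace_add subspace_supp_on)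
    next
      fix s a assume a: "a \<in> ?T"
      have "?D (pscale s a) = (mon (X, s \<odot>\<^bsub>Om\<^esub> cl (\<phi>' a)) - pscale s (mon (X, cl (\<phi>' a)))) + pscale s (?D a)"
        by (simp add: Om.smult_cls plinear_simps[OF \<phi>(2)] pm.scale_right_diff_distrib)
      also have "\<dots> \<in> Bal p r p' r'" using a c2 by (intro pm.subspace_add[OF B] pm.subspace_scale[OF B] Bal_base X) auto
      finally show "pscale s a \<in> ?T" using a by (simp add: pm.subspace_scale subspace_supp_on)
    qed
    then have "y \<in> ?T"
      by (rule plinear_in_subspace[OF plinear_ident]) (use y in \<open>auto simp: supp_on_def pm.subspace_0[OF B]\<close>)
    then show ?thesis by simp
  qed
  let ?F = "\<lambda>X. lin (\<lambda>l. mon (X, cl (\<phi>' (mon l)))) y"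
  let ?D = "\<lambda>x. mon (cl (\<phi> x), cl (\<phi>' y)) - lin (\<lambda>k. ?F (cl (\<phi> (mon k)))) x"
  let ?T = "{x \<in> supp_on S. ?D x \<in> Bal p r p' r'}"
  have "pm.subspace ?T"
    unfolding pm.subspace_def
  proof (intro conjI ballI allI)
    show "0 \<in> ?T" using mon_zero_Bal(1)[OF c1[OF x] c2[OF y]] by (simp add: plinear_simps[OF \<phi>(1)])
  next
    fix a b assume ab: "a \<in> ?T" "b \<in> ?T"
    have "?D (a + b) = (mon (cl (\<phi> a) \<oplus>\<^bsub>Om\<^esub> cl (\<phi> b), cl (\<phi>' y)) - mon (cl (\<phi> a), cl (\<phi>' y)) - mon (cl (\<phi> b), cl (\<phi>' y))) + (?D a + ?D b)"
      by (simp add: Om.add_cls plinear_simps[OF \<phi>(1)])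
    also have "\<dots> \<in> Bal p r p' r'" using ab c1 c2[OF y] by (intro pm.subspace_add[OF B] Bal_base) auto
    finally show "a + b \<in> ?T" using ab by (simp add: pm.subspace_add subspace_supp_on)
  next
    fix s a assume a: "a \<in> ?T"
    have "?D (pscale s a) = (mon (s \<odot>\<^bsub>Om\<^esub> cl (\<phi> a), cl (\<phi>' y)) - pscale s (mon (cl (\<phi> a), cl (\<phi>' y)))) + pscale s (?D a)"
      by (simp add: Om.smult_cls plinear_simps[OF \<phi>(1)] pm.scale_right_diff_distrib)
    also have "\<dots> \<in> Bal p r p' r'" using a c1 c2[OF y] by (intro pm.subspace_add[OF B] pm.subspace_scale[OF B] Bal_base) auto
    finally show "pscale s a \<in> ?T" using a by (simp add: pm.subspace_scale subspace_supp_on)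
  qed
  then have "x \<in> ?T"
    by (rule plinear_in_subspace[OF plinear_ident]) (use x 1 c1 in \<open>auto simp: supp_on_def[of S] \<close>)
  then show ?thesis by simp
qed

end

text \<open>\<open>\<phi>\<close> carries the order of factors of the free words to that of the wedge product under consideration: the
  identity for $\Omega^{p,0}\otimes_B\Omega^{0,r}$, and the reversal with \<open>q' = 1 / q\<close> for the opposite order.\<close>

locale wedge_frame = R_of_H + alt: qgen q'
  for q' :: complex +
  fixes \<phi> \<psi> :: "tv3 \<Rightarrow> tv3" and a c p r p' r' :: nat
  assumes plinear_\<phi>: "plinear \<phi>" and plinear_\<psi>: "plinear \<psi>"
    and \<phi>_mul: "\<And>x y. \<phi> (mul q' x y) = mul Q (\<phi> x) (\<phi> y)"
    and \<phi>_\<psi>: "\<And>x. \<phi> (\<psi> x) = x" and \<psi>_\<phi>: "\<And>x. \<psi> (\<phi> x) = x"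
    and \<phi>_J3: "\<And>x. x \<in> J3 q' \<Longrightarrow> \<phi> x \<in> J3 Q" and \<psi>_J3: "\<And>x. x \<in> J3 Q \<Longrightarrow> \<psi> x \<in> J3 q'"
    and \<phi>_bideg: "\<And>x. x \<in> supp_on (bideg_words a 0) \<Longrightarrow> \<phi> x \<in> supp_on (bideg_words p r)"
      "\<And>x. x \<in> supp_on (bideg_words 0 c) \<Longrightarrow> \<phi> x \<in> supp_on (bideg_words p' r')"
      "\<And>x. x \<in> supp_on (bideg_words 0 0) \<Longrightarrow> \<phi> x \<in> supp_on (bideg_words 0 0)"
    and \<psi>_bideg: "\<And>x. x \<in> supp_on (bideg_words p r) \<Longrightarrow> \<psi> x \<in> supp_on (bideg_words a 0)"
      "\<And>x. x \<in> supp_on (bideg_words p' r') \<Longrightarrow> \<psi> x \<in> supp_on (bideg_words 0 c)"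
      "\<And>x. x \<in> supp_on (bideg_words (p + p') (r + r')) \<Longrightarrow> \<psi> x \<in> supp_on (bideg_words a c)"
begin

text \<open>The whole coefficient is put into the first tensor factor; this is the standard form to
  which balancing brings every tensor.\<close>

definition std :: "tv3 \<Rightarrow> (tv3 set \<times> tv3 set \<Rightarrow>\<^sub>0 complex)" where
  "std = lin (\<lambda>(u, b, v). mon (cl (\<phi> (mon (u, b, []))), cl (\<phi> (mon ([], [], v)))))"

lemma std_mon: "std (mon (u, b, v)) = mon (cl (\<phi> (mon (u, b, []))), cl (\<phi> (mon ([], [], v))))"
  by (simp add: std_def)

lemma plinear_std: "plinear std"
  by (simp add: std_def plinear_lin)

lemma ev_std: "ev (std x) - \<phi> x \<in> J3 Q"
proof (rule J3_wordI[of "\<lambda>x. ev (std x) - \<phi> x"])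
  show "plinear (\<lambda>x. ev (std x) - \<phi> x)" by (intro plinear_minus plinear_comp[OF plinear_ev plinear_std] plinear_\<phi>)
  fix u b v
  have "\<phi> (mon (u, b, v)) = mul Q (\<phi> (mon (u, b, []))) (\<phi> (mon ([], [], v)))"
    by (simp add: \<phi>_mul[symmetric] mul_mon opW_mult)
  then show "ev (std (mon (u, b, v))) - \<phi> (mon (u, b, v)) \<in> J3 Q"
    by (simp add: std_mon ev_mon_iff)
qed

lemma std_supp: "x \<in> supp_on (bideg_words a c) \<Longrightarrow> std x \<in> supp_on (bideg Om p r \<times> bideg Om p' r')"
  unfolding std_def
  by (erule lin_supp_on) (auto simp: bideg_words_def[of a c] intro!: cl_bideg \<phi>_bideg, simp_all add: bideg_words_def)

text \<open>Normalise both entries, carry the coefficient of the second across the tensor sign, and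
  normalise the resulting product of coefficients in the first. The form letters are already normal
  and stay so.\<close>

lemma std_spans:
  assumes "f \<in> supp_on (bideg Om p r \<times> bideg Om p' r')"
  shows "\<exists>x \<in> supp_on (alt.norm3 \<inter> bideg_words a c). f - std x \<in> Bal p r p' r'"
proof -
  let ?S = "alt.norm3 \<inter> bideg_words a c"
  note B = subspace_Bal[of p r p' r']
  let ?T = "{f. \<exists>x \<in> supp_on ?S. f - std x \<in> Bal p r p' r'}"
  have T: "pm.subspace ?T"
    unfolding pm.subspace_def
  proof (intro conjI ballI allI)
    show "0 \<in> ?T" by (intro CollectI bexI[of _ 0]) (simp_all add: plinear_simps[OF plinear_std] pm.subspace_0[OF B])
  next
    fix f g assume "f \<in> ?T" "g \<in> ?T"
    then obtain x y where xy: "x \<in> supp_on ?S" "f - std x \<in> Bal p r p' r'" "y \<in> supp_on ?S" "g - std y \<in> Bal p r p' r'" by blast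
    show "f + g \<in> ?T"
      using pm.subspace_add[OF B xy(2,4)] xy
      by (intro CollectI bexI[of _ "x + y"]) (simp_all add: plinear_simps[OF plinear_std] algebra_simps pm.subspace_add subspace_supp_on)
  next
    fix s f assume "f \<in> ?T"
    then obtain x where xy: "x \<in> supp_on ?S" "f - std x \<in> Bal p r p' r'" by blast
    show "pscale s f \<in> ?T"
      using pm.subspace_scale[OF B xy(2)] xy
      by (intro CollectI bexI[of _ "pscale s x"])
        (simp_all add: plinear_simps[OF plinear_std] pm.scale_right_diff_distrib pm.subspace_scale subspace_supp_on)
  qed
  have cong: "f \<in> ?T" if "f - g \<in> Bal p r p' r'" "g \<in> ?T" for f g
  proof -
    from that(2) obtain x where x: "x \<in> supp_on ?S" "g - std x \<in> Bal p r p' r'" by blast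
    from pm.subspace_add[OF B that(1) x(2)] x(1) show ?thesis by (intro CollectI bexI[of _ x]) simp_all
  qed
  have N: "alt.N3 x \<in> supp_on (alt.norm3 \<inter> bideg_words i j)" if "x \<in> supp_on (bideg_words i j)" for x i j
  proof (rule plinear_in_subspace[OF alt.plinear_N3 subspace_supp_on])
    fix k assume "k \<in> Poly_Mapping.keys x"
    then have k: "k \<in> bideg_words i j" using that by (auto simp: supp_on_def)
    obtain u b v where "k = (u, b, v)" by (cases k)
    then show "alt.N3 (mon k) \<in> supp_on (alt.norm3 \<inter> bideg_words i j)"
      using supp_on_mono[OF _ alt.N3_supp_mon[of u b v], of "alt.norm3 \<inter> bideg_words i j"] k
      by (auto simp: bideg_words_def)
  qed
  have clN: "cl (\<phi> (alt.N3 x)) = cl (\<phi> x)" for x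
  proof -
    have "\<phi> (x - alt.N3 x) \<in> J3 Q" by (intro \<phi>_J3 alt.minus_N3)
    then have "- \<phi> (x - alt.N3 x) \<in> J3 Q" by (intro J3_intros)
    then show ?thesis by (simp add: Om.cls_iff plinear_simps[OF plinear_\<phi>])
  qed
  have words: "mon (cl (\<phi> (mon k)), cl (\<phi> (mon l))) \<in> ?T"
    if kl: "k \<in> alt.norm3 \<inter> bideg_words a 0" "l \<in> alt.norm3 \<inter> bideg_words 0 c" for k l
  proof -
    from kl obtain u b b' v where k: "k = (u, b, [])" and l: "l = ([], b', v)"
      and uv: "u \<in> normL" "length u = a" "v \<in> normL" "length v = c"
      by (auto simp: bideg_words_def alt.norm3_def)
    let ?X = "cl (\<phi> (mon k))" and ?Y = "cl (\<phi> (mon ([], [], v)))" and ?b = "cl (\<phi> (mon ([], b', [])))"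
    have X: "?X \<in> bideg Om p r" and Y: "?Y \<in> bideg Om p' r'" and b: "?b \<in> B0"
      by (intro cl_bideg \<phi>_bideg, simp add: k uv bideg_words_def)+
    have 1: "cl (\<phi> (mon l)) = ?b \<otimes>\<^bsub>Om\<^esub> ?Y"
      by (simp add: l \<phi>_mul[symmetric] Om.mult_cls mul_mon opW_mult)
    have 2: "?X \<otimes>\<^bsub>Om\<^esub> ?b = cl (\<phi> (mon (u, b @ b', [])))"
      by (simp add: k \<phi>_mul[symmetric] Om.mult_cls mul_mon opW_mult)
    let ?n = "nB q' (mon (b @ b'))"
    let ?x = "lin (\<lambda>w. mon (u, w, [])) ?n"
    have Nx: "alt.N3 (mon (u, b @ b', [])) = ?x"
      by (simp add: alt.N3_mon nL_norm uv(1) tens3_def)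
    have "lin (\<lambda>w. mon (u, w, v)) ?n \<in> supp_on ?S"
      by (rule lin_supp_on[OF nB_supp]) (simp add: alt.norm3_def uv bideg_words_def)
    moreover have "mon (cl (\<phi> ?x), ?Y) - std (lin (\<lambda>w. mon (u, w, v)) ?n) \<in> Bal p r p' r'"
    proof -
      have "mon (cl (\<phi> ?x), cl (\<phi> (mon ([], [], v)))) - lin (\<lambda>k. lin (\<lambda>l. mon (cl (\<phi> (mon k)), cl (\<phi> (mon l)))) (mon ([], [], v))) ?x \<in> Bal p r p' r'"
      proof (rule Bal_lin[OF plinear_\<phi> plinear_\<phi>])
        show "\<phi> (mon k) \<in> supp_on (bideg_words p r)" if "k \<in> bideg_words a 0" for k
          by (rule \<phi>_bideg) (simp add: that)
        show "\<phi> (mon k) \<in> supp_on (bideg_words p' r')" if "k \<in> bideg_words 0 c" for k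
          by (rule \<phi>_bideg) (simp add: that)
        show "?x \<in> supp_on (bideg_words a 0)"
          by (rule lin_supp_on[OF nB_supp]) (simp add: uv bideg_words_def)
        show "mon ([], [], v) \<in> supp_on (bideg_words 0 c)" by (simp add: uv bideg_words_def)
      qed
      then show ?thesis by (simp add: std_def lin_lin)
    qed
    moreover have "cl (\<phi> ?x) = ?X \<otimes>\<^bsub>Om\<^esub> ?b" unfolding Nx[symmetric] clN 2 ..
    ultimately have m1: "mon (?X \<otimes>\<^bsub>Om\<^esub> ?b, ?Y) \<in> ?T" by auto
    \<comment> \<open>Balancing carries the middle word b' into the first factor.\<close>
    have m2: "mon (?X, ?b \<otimes>\<^bsub>Om\<^esub> ?Y) - mon (?X \<otimes>\<^bsub>Om\<^esub> ?b, ?Y) \<in> Bal p r p' r'"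
      using pm.subspace_neg[OF B Bal_base(5)[OF b X Y]] by simp
    show ?thesis unfolding 1 by (rule cong[OF m2 m1])
  qed
  have "f \<in> ?T"
  proof (rule plinear_in_subspace[OF plinear_ident T])
    fix h assume "h \<in> Poly_Mapping.keys f"
    with assms have "fst h \<in> bideg Om p r" "snd h \<in> bideg Om p' r'" by (auto simp: supp_on_def)
    then obtain x y where h: "fst h = cl x" "snd h = cl y"
      and x: "x \<in> supp_on (bideg_words p r)" and y: "y \<in> supp_on (bideg_words p' r')"
      by (elim bideg_E) blast
    let ?x = "alt.N3 (\<psi> x)" and ?y = "alt.N3 (\<psi> y)"
    have h': "h = (cl (\<phi> ?x), cl (\<phi> ?y))" using h by (simp add: clN \<phi>_\<psi>) (metis prod.collapse)
    have xs: "?x \<in> supp_on (alt.norm3 \<inter> bideg_words a 0)" and ys: "?y \<in> supp_on (alt.norm3 \<inter> bideg_words 0 c)"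
      by (intro N \<psi>_bideg x y)+
    show "mon h \<in> ?T"
      unfolding h'
    proof (rule cong)
      show "mon (cl (\<phi> ?x), cl (\<phi> ?y)) - lin (\<lambda>k. lin (\<lambda>l. mon (cl (\<phi> (mon k)), cl (\<phi> (mon l)))) ?y) ?x \<in> Bal p r p' r'"
        by (rule Bal_lin[OF plinear_\<phi> plinear_\<phi> _ _ xs ys]) (auto intro!: \<phi>_bideg)
      show "lin (\<lambda>k. lin (\<lambda>l. mon (cl (\<phi> (mon k)), cl (\<phi> (mon l)))) ?y) ?x \<in> ?T"
        by (intro lin_in_subspace[OF T] words) (use xs ys in \<open>auto simp: supp_on_def\<close>)
    qed
  qed
  then show ?thesis by simp
qed

text \<open>For injectivity a tensor is replaced by a standard one over a normal combination x. If
  its product vanishes, x lies in the ideal, and a normal element of the ideal is zero.\<close>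

lemma wedge_frame_iso: "bimodule_iso B0 (FT p r p' r') (form_bimodule Om (p + p') (r + r')) (wedge_map Om p r p' r')"
proof (rule wedge_iso)
  fix x assume x: "x \<in> supp_on (bideg_words (p + p') (r + r'))"
  show "\<exists>f \<in> supp_on (bideg Om p r \<times> bideg Om p' r'). ev f - x \<in> J3 Q"
    using ev_std[of "\<psi> x"] std_supp[OF \<psi>_bideg(3)[OF x]] by (intro bexI[of _ "std (\<psi> x)"]) (simp_all add: \<phi>_\<psi>)
next
  fix f assume f: "f \<in> supp_on (bideg Om p r \<times> bideg Om p' r')" "ev f \<in> J3 Q"
  from std_spans[OF f(1)] obtain x where x: "x \<in> supp_on (alt.norm3 \<inter> bideg_words a c)" "f - std x \<in> Bal p r p' r'" by blast
  have "ev f - ev (f - std x) - (ev (std x) - \<phi> x) \<in> J3 Q"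
    by (intro J3_intros f(2) ev_Bal[OF x(2)] ev_std)
  then have "\<phi> x \<in> J3 Q" by simp
  then have "x \<in> J3 q'" using \<psi>_J3 \<psi>_\<phi> by metis
  moreover have "x \<in> supp_on alt.norm3" using x(1) by (rule supp_on_mono[rotated]) simp
  ultimately have "x = 0" by (rule alt.J3_norm_eq_0[rotated])
  then show "f \<in> Bal p r p' r'" using x(2) by (simp add: plinear_simps[OF plinear_std])
qed

end

context R_of_H
begin

lemma factorisable_left: "bimodule_iso B0 (FT p 0 0 r) (form_bimodule Om p r) (wedge_map Om p 0 0 r)"
proof -
  interpret wedge_frame q R Q "\<lambda>x. x" "\<lambda>x. x" p r p 0 0 r
    by unfold_locales (auto simp: plinear_ident)
  show ?thesis using wedge_frame_iso by simp
qed

lemma factorisable_right: "bimodule_iso B0 (FT 0 r p 0) (form_bimodule Om p r) (wedge_map Om 0 r p 0)"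
proof -
  interpret inv: qgen "1 / Q" by (rule qgen_inverse)
  \<comment> \<open>Words with r left and p right letters for the parameter 1/q represent products
    of a form of bidegree (0, r) with one of bidegree (p, 0).\<close>
  interpret wedge_frame q R "1 / Q" "phi (1 / Q)" "phi Q" r p 0 r p 0
    by unfold_locales
      (use inv.phi_mul inv.phi_phi phi_phi inv.phi_J3 phi_J3 inv.phi_bideg phi_bideg in \<open>auto simp: plinear_phi\<close>)
  show ?thesis using wedge_frame_iso by simp
qed

end

section \<open>The Dolbeault double complex\<close>

context R_of_H
begin

lemma word_deg: "x \<in> supp_on (deg_words n) \<Longrightarrow> k \<in> Poly_Mapping.keys x \<Longrightarrow> (case k of (u, b, v) \<Rightarrow> length u + length v = n)"
  by (auto simp: supp_on_def)

lemma bideg_deg: "x \<in> supp_on (bideg_words p r) \<Longrightarrow> p + r = n \<Longrightarrow> x \<in> supp_on (deg_words n)"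
  by (erule supp_on_mono[rotated]) (auto simp: bideg_words_def)

lemma mul_deg:
  assumes "x \<in> supp_on (deg_words m)" "y \<in> supp_on (deg_words n)"
  shows "mul Q x y \<in> supp_on (deg_words (m + n))"
proof (rule plinear_in_subspace[OF plinear_mul_left[of Q y] subspace_supp_on])
  fix k assume k: "k \<in> Poly_Mapping.keys x"
  show "mul Q (mon k) y \<in> supp_on (deg_words (m + n))"
  proof (rule plinear_in_subspace[OF plinear_mul_right subspace_supp_on])
    fix l assume l: "l \<in> Poly_Mapping.keys y"
    obtain u b v u' b' v' where kl: "k = (u, b, v)" "l = (u', b', v')" by (cases k, cases l)
    show "mul Q (mon k) (mon l) \<in> supp_on (deg_words (m + n))"
      using mul_bideg[OF mon_bideg[of u b v] mon_bideg[of u' b' v'], of Q]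
        word_deg[OF assms(1) k] word_deg[OF assms(2) l] unfolding kl
      by (elim bideg_deg) simp
  qed
qed

lemma sgnop_deg:
  assumes "x \<in> supp_on (deg_words n)"
  shows "sgnop x = pscale ((-1) ^ n) x"
  unfolding sgnop_def
  by (subst (2) lin_mon_id[symmetric], subst lin_fun_pscale[symmetric])
    (rule lin_eq_on_supp[OF assms], auto)

lemma d_deg:
  assumes "x \<in> supp_on (deg_words n)"
  shows "dl x \<in> supp_on (deg_words (Suc n))" "db x \<in> supp_on (deg_words (Suc n))"
proof -
  show "dl x \<in> supp_on (deg_words (Suc n))"
  proof (rule plinear_in_subspace[OF plinear_T3_del(1) subspace_supp_on])
    fix k assume k: "k \<in> Poly_Mapping.keys x"
    obtain u b v where uv: "k = (u, b, v)" by (cases k)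
    show "dl (mon k) \<in> supp_on (deg_words (Suc n))"
      unfolding uv using word_deg[OF assms k] uv by (intro bideg_deg[OF dl_bideg[OF mon_bideg]]) simp
  qed
  show "db x \<in> supp_on (deg_words (Suc n))"
  proof (rule plinear_in_subspace[OF plinear_T3_del(2) subspace_supp_on])
    fix k assume k: "k \<in> Poly_Mapping.keys x"
    obtain u b v where uv: "k = (u, b, v)" by (cases k)
    show "db (mon k) \<in> supp_on (deg_words (Suc n))"
      unfolding uv using word_deg[OF assms k] uv by (intro bideg_deg[OF db_bideg[OF mon_bideg]]) simp
  qed
qed

lemma st_deg:
  assumes "x \<in> supp_on (deg_words n)"
  shows "st x \<in> supp_on (deg_words n)"
proof (rule pantilinear_subspace[OF pantilinear_star subspace_supp_on])
  fix k assume k: "k \<in> Poly_Mapping.keys x"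
  obtain u b v where uv: "k = (u, b, v)" by (cases k)
  show "st (mon k) \<in> supp_on (deg_words n)"
    unfolding uv using word_deg[OF assms k] uv by (intro bideg_deg[OF st_bideg[OF mon_bideg]]) simp
qed

lemma st_mul_deg:
  assumes "x \<in> supp_on (deg_words m)" "y \<in> supp_on (deg_words n)"
  shows "st (mul Q x y) = pscale ((-1) ^ (m * n)) (mul Q (st y) (st x))"
proof (rule pantilinear_eqI[of "\<lambda>x. st (mul Q x y)"])
  fix k assume k: "k \<in> Poly_Mapping.keys x"
  obtain u b v where uv: "k = (u, b, v)" by (cases k)
  show "st (mul Q (mon k) y) = pscale ((-1) ^ (m * n)) (mul Q (st y) (st (mon k)))"
    using st_mul[OF sgnop_deg[OF assms(2)], of u b v] word_deg[OF assms(1) k] by (simp add: uv)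
qed (simp_all add: pantilinear_def pm.scale_right_distrib mult.commute)

text \<open>This is \<open>st_dl\<close> at the starred element, starred once more.\<close>

lemma st_db: "st (db z) - dl (st z) \<in> J3 Q"
proof -
  have "st (st (dl (st z)) - db (st (st z))) \<in> J3 Q" by (intro st_J3 st_dl)
  then have "dl (st z) - st (db z) \<in> J3 Q" unfolding star_simps st_st .
  from pm.subspace_neg[OF subspace_J3 this] show ?thesis by simp
qed

lemma total_deg_E: "X \<in> total_deg Om n \<Longrightarrow> (\<And>x. X = cl x \<Longrightarrow> x \<in> supp_on (deg_words n) \<Longrightarrow> P) \<Longrightarrow> P"
  by (auto simp: total_deg_Om)

lemma cl_total_deg: "x \<in> supp_on (deg_words n) \<Longrightarrow> cl x \<in> total_deg Om n"
  by (auto simp: total_deg_Om)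

lemma total_diff_cl: "total_diff Om (cl x) = cl (dl x + db x)"
  by (simp add: total_diff_def del_cl delbar_cl Om.add_cls)

lemma linear_endo_cl: "plinear f \<Longrightarrow> (\<And>x. F (cl x) = cl (f x)) \<Longrightarrow> linear_endo Om F"
  unfolding linear_endo_def
  by (auto elim!: Om.carrierE simp: Om.cls_simps Om.cls_in_carrier plinear_simps)

lemma star_DGA_Om: "star_DGA Om (total_deg Om) (total_diff Om) (dstar Om)"
proof (rule star_DGA.intro[OF Om.complex_algebra], rule star_DGA_axioms.intro)
  show "internal_direct_sum Om UNIV (total_deg Om) (carrier Om)" by (rule grading_Om)
  show "\<one>\<^bsub>Om\<^esub> \<in> total_deg Om 0" by (simp add: Om.A cl_total_deg)
  show "X \<otimes>\<^bsub>Om\<^esub> Y \<in> total_deg Om (m + n)" if "X \<in> total_deg Om m" "Y \<in> total_deg Om n" for X Y m n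
    using that by (elim total_deg_E) (simp add: Om.mult_cls cl_total_deg mul_deg)
  show "linear_endo Om (total_diff Om)"
    by (rule linear_endo_cl[where f="\<lambda>x. dl x + db x"]) (simp_all add: total_diff_cl plinear_plus plinear_T3_del)
  show "total_diff Om X \<in> total_deg Om (Suc n)" if "X \<in> total_deg Om n" for X n
    using that by (elim total_deg_E) (simp add: total_diff_cl cl_total_deg d_deg pm.subspace_add subspace_supp_on)
  show "total_diff Om (total_diff Om X) = \<zero>\<^bsub>Om\<^esub>" if X: "X \<in> carrier Om" for X
  proof -
    from X obtain x where x: "X = cl x" by (rule Om.carrierE)
    have "dl (dl x) + (dl (db x) + db (dl x)) + db (db x) \<in> J3 Q"
      by (intro J3_intros dl_dl db_db dl_db)
    then show ?thesis by (simp add: x total_diff_cl Om.A(4) Om.cls_iff algebra_simps)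
  qed
  show "total_diff Om (X \<otimes>\<^bsub>Om\<^esub> Y) = total_diff Om X \<otimes>\<^bsub>Om\<^esub> Y \<oplus>\<^bsub>Om\<^esub> (-1) ^ n \<odot>\<^bsub>Om\<^esub> (X \<otimes>\<^bsub>Om\<^esub> total_diff Om Y)"
    if X: "X \<in> total_deg Om n" and Y: "Y \<in> carrier Om" for X Y n
  proof -
    from X obtain x where x: "X = cl x" "x \<in> supp_on (deg_words n)" by (rule total_deg_E)
    from Y obtain y where y: "Y = cl y" by (rule Om.carrierE)
    have "(dl (mul Q x y) - mul Q (dl x) y - mul Q (sgnop x) (dl y)) + (db (mul Q x y) - mul Q (db x) y - mul Q (sgnop x) (db y)) \<in> J3 Q"
      by (intro J3_intros dl_Leibniz db_Leibniz)
    then show ?thesis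
      by (simp add: x y total_diff_cl Om.cls_simps Om.cls_iff sgnop_deg[OF x(2)] algebra_simps pm.scale_right_distrib)
  qed
  show "dstar Om X \<in> total_deg Om n" if "X \<in> total_deg Om n" for X n
    using that by (elim total_deg_E) (simp add: dstar_cl cl_total_deg st_deg)
  show "dstar Om X \<in> carrier Om" if "X \<in> carrier Om" for X
    using that by (elim Om.carrierE) (simp add: dstar_cl Om.cls_in_carrier)
  show "dstar Om (X \<oplus>\<^bsub>Om\<^esub> Y) = dstar Om X \<oplus>\<^bsub>Om\<^esub> dstar Om Y" if "X \<in> carrier Om" "Y \<in> carrier Om" for X Y
    using that by (elim Om.carrierE) (simp add: dstar_cl Om.cls_simps)
  show "dstar Om (s \<odot>\<^bsub>Om\<^esub> X) = cnj s \<odot>\<^bsub>Om\<^esub> dstar Om X" if "X \<in> carrier Om" for X s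
    using that by (elim Om.carrierE) (simp add: dstar_cl Om.cls_simps)
  show "dstar Om (dstar Om X) = X" if "X \<in> carrier Om" for X
    using that by (elim Om.carrierE) (simp add: dstar_cl st_st)
  show "dstar Om (X \<otimes>\<^bsub>Om\<^esub> Y) = (-1) ^ (m * n) \<odot>\<^bsub>Om\<^esub> (dstar Om Y \<otimes>\<^bsub>Om\<^esub> dstar Om X)"
    if "X \<in> total_deg Om m" "Y \<in> total_deg Om n" for X Y m n
    using that by (elim total_deg_E) (simp add: dstar_cl Om.cls_simps st_mul_deg)
  show "total_diff Om (dstar Om X) = dstar Om (total_diff Om X)" if X: "X \<in> carrier Om" for X
  proof -
    from X obtain x where x: "X = cl x" by (rule Om.carrierE)
    \<comment> \<open>The star exchanges del and delbar, so the two summands of the total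
      differential match crosswise.\<close>
    have "- (st (dl x) - db (st x)) - (st (db x) - dl (st x)) \<in> J3 Q"
      by (intro J3_intros st_dl st_db)
    then show ?thesis by (simp add: x total_diff_cl dstar_cl Om.cls_iff algebra_simps)
  qed
qed

lemma quantum_complex_manifold_Om: "quantum_complex_manifold Om"
proof (rule quantum_complex_manifold.intro[OF star_DGA_Om], rule quantum_complex_manifold_axioms.intro)
  show "internal_direct_sum Om {..m} (\<lambda>p. bideg Om p (m - p)) (total_deg Om m)" for m
    unfolding total_deg_Om by (rule bigrading_Om)
  show "X \<otimes>\<^bsub>Om\<^esub> Y \<in> bideg Om (p + p') (r + r')" if "X \<in> bideg Om p r" "Y \<in> bideg Om p' r'" for X Y p r p' r'
    using that by (rule bideg_mult)
  show "linear_endo Om (del Om)" by (rule linear_endo_cl[OF plinear_T3_del(1) del_cl])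
  show "linear_endo Om (delbar Om)" by (rule linear_endo_cl[OF plinear_T3_del(2) delbar_cl])
  show "del Om X \<in> bideg Om (Suc p) r" if "X \<in> bideg Om p r" for X p r
    using that by (elim bideg_E) (simp add: del_cl cl_bideg dl_bideg)
  show "delbar Om X \<in> bideg Om p (Suc r)" if "X \<in> bideg Om p r" for X p r
    using that by (elim bideg_E) (simp add: delbar_cl cl_bideg db_bideg)
  show "del Om (X \<otimes>\<^bsub>Om\<^esub> Y) = del Om X \<otimes>\<^bsub>Om\<^esub> Y \<oplus>\<^bsub>Om\<^esub> (-1) ^ (p + r) \<odot>\<^bsub>Om\<^esub> (X \<otimes>\<^bsub>Om\<^esub> del Om Y)"
    "delbar Om (X \<otimes>\<^bsub>Om\<^esub> Y) = delbar Om X \<otimes>\<^bsub>Om\<^esub> Y \<oplus>\<^bsub>Om\<^esub> (-1) ^ (p + r) \<odot>\<^bsub>Om\<^esub> (X \<otimes>\<^bsub>Om\<^esub> delbar Om Y)"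
    if X: "X \<in> bideg Om p r" and Y: "Y \<in> carrier Om" for X Y p r
  proof -
    from X obtain x where x: "X = cl x" "x \<in> supp_on (bideg_words p r)" by (rule bideg_E)
    from Y obtain y where y: "Y = cl y" by (rule Om.carrierE)
    show "del Om (X \<otimes>\<^bsub>Om\<^esub> Y) = del Om X \<otimes>\<^bsub>Om\<^esub> Y \<oplus>\<^bsub>Om\<^esub> (-1) ^ (p + r) \<odot>\<^bsub>Om\<^esub> (X \<otimes>\<^bsub>Om\<^esub> del Om Y)"
      "delbar Om (X \<otimes>\<^bsub>Om\<^esub> Y) = delbar Om X \<otimes>\<^bsub>Om\<^esub> Y \<oplus>\<^bsub>Om\<^esub> (-1) ^ (p + r) \<odot>\<^bsub>Om\<^esub> (X \<otimes>\<^bsub>Om\<^esub> delbar Om Y)"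
      using dl_Leibniz[of x y] db_Leibniz[of x y]
      by (simp_all add: x y del_cl delbar_cl Om.cls_simps Om.cls_iff sgnop_bideg[OF x(2)] diff_diff_eq)
  qed
  show "del Om (del Om X) = \<zero>\<^bsub>Om\<^esub>" if "X \<in> carrier Om" for X
    using that by (elim Om.carrierE) (simp add: del_cl Om.A Om.cls_iff dl_dl)
  show "delbar Om (delbar Om X) = \<zero>\<^bsub>Om\<^esub>" if "X \<in> carrier Om" for X
    using that by (elim Om.carrierE) (simp add: delbar_cl Om.A Om.cls_iff db_db)
  show "del Om (delbar Om X) \<oplus>\<^bsub>Om\<^esub> delbar Om (del Om X) = \<zero>\<^bsub>Om\<^esub>" if "X \<in> carrier Om" for X
    using that by (elim Om.carrierE) (simp add: del_cl delbar_cl Om.cls_simps Om.cls_iff dl_db)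
  show "dstar Om ` bideg Om p r = bideg Om r p" for p r
  proof
    show "dstar Om ` bideg Om p r \<subseteq> bideg Om r p"
      by (auto elim!: bideg_E simp: dstar_cl cl_bideg st_bideg)
    show "bideg Om r p \<subseteq> dstar Om ` bideg Om p r"
    proof
      fix X assume "X \<in> bideg Om r p"
      then obtain x where x: "X = cl x" "x \<in> supp_on (bideg_words r p)" by (rule bideg_E)
      then have "X = dstar Om (cl (st x))" by (simp add: dstar_cl st_st)
      then show "X \<in> dstar Om ` bideg Om p r" using x by (blast intro: cl_bideg st_bideg)
    qed
  qed
  show "dstar Om (del Om X) = delbar Om (dstar Om X)" if "X \<in> carrier Om" for X
    using that by (elim Om.carrierE) (simp add: dstar_cl del_cl delbar_cl Om.cls_iff st_dl)
  show "bimodule_iso B0 (FT p 0 0 r) (form_bimodule Om p r) (wedge_map Om p 0 0 r)" for p r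
    by (rule factorisable_left)
  show "bimodule_iso B0 (FT 0 r p 0) (form_bimodule Om p r) (wedge_map Om 0 r p 0)" for p r
    by (rule factorisable_right)
qed

subsection \<open>The algebra in degree zero\<close>

lemma embB_mult: "embB (x * y) = mul Q (embB x) (embB y)"
  by (simp add: embB_def mult_lin[of x y] lin_lin mul_lin mul_mon opW_mult plus_list_def) (rule lin_swap)

lemma embB_J3_iff: "embB x \<in> J3 Q \<longleftrightarrow> x \<in> IB Q"
proof
  assume "embB x \<in> J3 Q"
  then have "tens3 (mon []) (nB Q x) (mon []) = 0"
    by (simp add: J3_iff embB_tens3 N3_tens3 mon_Nil[symmetric])
  then have "lin (\<lambda>(u, b, v). mon b) (tens3 (mon []) (nB Q x) (mon [])) = 0" by simp
  then show "x \<in> IB Q" by (simp add: tens3_def lin_lin IB_iff)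
qed (simp add: embB_tens3 J3_tens3)

lemma B_embed_cls: "B_embed R (cls (IB Q) x) = cl (embB x)"
  unfolding B_embed_def Omega_rel_eq embB_tens3
  by (rule induced_cls[OF subspace_IB subspace_J3]) (simp flip: tens3_simps add: J3_tens3)

lemma bideg_00_E:
  assumes "X \<in> B0" obtains b where "X = cl (embB b)"
proof -
  from assms obtain x where x: "X = cl x" "x \<in> supp_on (bideg_words 0 0)" by (rule bideg_E)
  have "x = embB (lin (\<lambda>(u, b, v). mon b) x)"
    unfolding embB_def lin_lin
    by (subst (1) lin_mon_id[symmetric], rule lin_eq_on_supp[OF x(2)]) (auto simp: bideg_words_def)
  then show ?thesis using that x by metis
qed

lemma embB_bideg: "embB b \<in> supp_on (bideg_words 0 0)"
  unfolding embB_def by (intro lin_in_subspace subspace_supp_on) (simp add: bideg_words_def)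

lemma cl_embB: "cl (embB b) \<in> B0"
  by (rule cl_bideg[OF embB_bideg])

lemma B_embed_iso: "B_embed R \<in> ring_iso (B_plus R) (Om\<lparr>carrier := B0\<rparr>)"
  unfolding ring_iso_def
proof (intro CollectI conjI)
  show "B_embed R \<in> ring_hom (B_plus R) (Om\<lparr>carrier := B0\<rparr>)"
  proof (rule ring_hom_memI)
    have "one3 = embB 1" by (simp add: embB_def mon_Nil[symmetric])
    then show "B_embed R \<one>\<^bsub>B_plus R\<^esub> = \<one>\<^bsub>Om\<lparr>carrier := B0\<rparr>\<^esub>"
      by (simp add: Bp.A(3) Om.A(3) B_embed_cls)
  qed (auto elim!: Bp.carrierE simp: B_embed_cls cl_embB Bp.cls_simps Om.cls_simps embB_mult plinear_simps[OF plinear_embB])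
  show "bij_betw (B_embed R) (carrier (B_plus R)) (carrier (Om\<lparr>carrier := B0\<rparr>))"
    unfolding bij_betw_def
  proof
    show "inj_on (B_embed R) (carrier (B_plus R))"
    proof (rule inj_onI)
      fix X Y assume *: "X \<in> carrier (B_plus R)" "Y \<in> carrier (B_plus R)" "B_embed R X = B_embed R Y"
      obtain x y where xy: "X = cls (IB Q) x" "Y = cls (IB Q) y" using *(1,2) by (auto simp: Bp.A(1))
      have "embB (x - y) \<in> J3 Q" using *(3) by (simp add: xy B_embed_cls Om.cls_iff plinear_simps[OF plinear_embB])
      then show "X = Y" by (simp add: xy Bp.cls_iff embB_J3_iff)
    qed
    show "B_embed R ` carrier (B_plus R) = carrier (Om\<lparr>carrier := B0\<rparr>)"
      by (auto simp: Bp.A(1) B_embed_cls cl_embB elim!: bideg_00_E) (metis B_embed_cls image_eqI rangeI)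
  qed
qed

lemma st_embB: "st (embB x) = embB (T_star q x)"
proof (rule pantilinear_eqI[of "\<lambda>x. st (embB x)"])
  have T: "pantilinear (T_star q)" by (simp add: pantilinear_def T_star_def antilin_add antilin_pscale)
  show "pantilinear (\<lambda>x. embB (T_star q x))" "pantilinear (\<lambda>x. st (embB x))"
    by (simp_all add: pantilinear_def plinear_simps[OF plinear_embB] pantilinear_simps[OF T])
  show "st (embB (mon w)) = embB (T_star q (mon w))" for w
    unfolding embB_mon T3_star_mon by (simp add: embB_tens3 mon_Nil graded_T_star_Nil)
qed

lemma B_star_cls: "B_star q R (cls (IB Q) x) = cls (IB Q) (T_star q x)"
  unfolding B_star_def B_ideal_eq
proof (rule induced_cls[OF subspace_IB subspace_IB])
  have T: "pantilinear (T_star q)" by (simp add: pantilinear_def T_star_def antilin_add antilin_pscale)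
  fix y assume "y - x \<in> IB Q"
  then have "st (embB (y - x)) \<in> J3 Q" by (intro st_J3) (simp add: embB_J3_iff)
  then show "T_star q y - T_star q x \<in> IB Q" by (simp add: st_embB embB_J3_iff pantilinear_simps[OF T])
qed

lemma B_embed_star:
  assumes "b \<in> carrier (B_plus R)"
  shows "B_embed R (B_star q R b) = dstar Om (B_embed R b)"
    "B_embed R (s \<odot>\<^bsub>B_plus R\<^esub> b) = s \<odot>\<^bsub>Om\<^esub> B_embed R b"
  using assms by (auto elim!: Bp.carrierE simp: B_star_cls B_embed_cls dstar_cl st_embB Bp.smult_cls Om.smult_cls
    plinear_simps[OF plinear_embB])

text \<open>The generator written with the star is the relation of the plane times the nonzero
  factor q^(1/2).\<close>

lemma B_ideal_star: "B_ideal R = two_sided_ideal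
       {T_star q (mon [Z]) * mon [Z] - pscale q (mon [Z] * T_star q (mon [Z]))}"
proof -
  let ?s = "sc Z" and ?r = "T_star q (mon [Z]) * mon [Z] - pscale q (mon [Z] * T_star q (mon [Z]))"
  have s: "?s \<noteq> 0" using star_coeff_flipv[OF q, of Z] by auto
  have "T_star q (mon [Z]) = pscale ?s (mon [W])" using T_star_Cons[of q Z "[]"] by (simp add: mon_Nil T_star_Nil)
  then have r: "?r = pscale ?s (relB Q)"
    by (simp add: relB_def mult_pscale_left mult_pscale_right mon_mult_list pm.scale_right_diff_distrib mult.commute)
  show ?thesis
    unfolding B_ideal_eq IB_def
  proof
    show "two_sided_ideal {relB Q} \<subseteq> two_sided_ideal {?r}"
    proof (rule two_sided_ideal_minimal[OF two_sided_ideal_subspace])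
      fix u v t assume "t \<in> {relB Q}"
      then have "t = pscale (1 / ?s) ?r" using s by (simp add: r)
      then have "mon u * t * mon v = pscale (1 / ?s) (mon u * ?r * mon v)"
        by (simp only: mult_pscale_left mult_pscale_right)
      then show "mon u * t * mon v \<in> two_sided_ideal {?r}"
        using two_sided_ideal_base[of ?r "{?r}" "mon u" "mon v"]
        by (simp only: pm.subspace_scale[OF two_sided_ideal_subspace] singletonI)
    qed
    show "two_sided_ideal {?r} \<subseteq> two_sided_ideal {relB Q}"
    proof (rule two_sided_ideal_minimal[OF two_sided_ideal_subspace])
      fix u v t assume "t \<in> {?r}"
      then have "mon u * t * mon v = pscale ?s (mon u * relB Q * mon v)"
        by (simp add: r mult_pscale_left mult_pscale_right)
      then show "mon u * t * mon v \<in> two_sided_ideal {relB Q}"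
        using two_sided_ideal_base[of "relB Q" "{relB Q}" "mon u" "mon v"]
        by (simp only: pm.subspace_scale[OF two_sided_ideal_subspace] singletonI)
    qed
  qed
qed

end

section \<open>Bases of one-forms\<close>

definition flB :: "tv \<Rightarrow> tv" where
  "flB = lin (\<lambda>w. mon (map flipv w))"

lemma mul_tens3_lt: "mul q (tens3 1 a 1) (ltR c) = tens3 1 a (mon [c])" "mul q (ltL c) (tens3 1 a 1) = tens3 (mon [c]) a 1"
  using mul_tens3(1)[of q 1 a 1 "[c]"] by (simp_all add: mul_ltL foldr_op_tens3_1)

lemma phi_tens3: "phi q (tens3 1 x 1) = tens3 1 (flB x) 1"
proof -
  have "foldr (opM p) b one3 = mon ([], b, [])" for p b
    using opW_mult(2)[of p "[]" b "[]" "[]"] by (simp add: opW_def)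
  then show ?thesis by (simp add: tens3_def mon_Nil[symmetric] phi_def flB_def lin_lin)
qed

context R_of_H
begin

lemma one_form_R:
  assumes "x \<in> supp_on (bideg_words 0 1)"
  obtains a b where "x = tens3 1 a (mon [Z]) + tens3 1 b (mon [W])"
proof -
  let ?e = "\<lambda>y. lin (\<lambda>(u, b, v). if v = [y] then mon b else 0)"
  have t: "tens3 1 (lin f x) v = lin (\<lambda>k. tens3 1 (f k) v) x" for f :: "vword3 \<Rightarrow> tv" and x v
    by (simp add: tens3_def mon_Nil[symmetric] lin_lin)
  have "x = tens3 1 (?e Z x) (mon [Z]) + tens3 1 (?e W x) (mon [W])"
    unfolding t lin_fun_add[symmetric]
    by (subst (1) lin_mon_id[symmetric], rule lin_eq_on_supp[OF assms])
      (auto simp: bideg_words_def mon_Nil[symmetric] tens3_mon length_Suc_conv intro: vgen.exhaust)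
  then show ?thesis by (rule that)
qed

lemma one_form_L:
  assumes "x \<in> supp_on (bideg_words 1 0)"
  obtains a b where "x = tens3 (mon [Z]) a 1 + tens3 (mon [W]) b 1"
proof -
  let ?e = "\<lambda>y. lin (\<lambda>(u, b, v). if u = [y] then mon b else 0)"
  have t: "tens3 (mon u) (lin f x) 1 = lin (\<lambda>k. tens3 (mon u) (f k) 1) x" for f :: "vword3 \<Rightarrow> tv" and x u
    by (simp add: tens3_def mon_Nil[symmetric] lin_lin)
  have "x = tens3 (mon [Z]) (?e Z x) 1 + tens3 (mon [W]) (?e W x) 1"
    unfolding t lin_fun_add[symmetric]
    by (subst (1) lin_mon_id[symmetric], rule lin_eq_on_supp[OF assms])
      (auto simp: bideg_words_def mon_Nil[symmetric] tens3_mon length_Suc_conv intro: vgen.exhaust)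
  then show ?thesis by (rule that)
qed

lemma phi_inverse_mul: "phi (1 / Q) (mul (1 / Q) x y) = mul Q (phi (1 / Q) x) (phi (1 / Q) y)"
  "phi (1 / Q) (ltL c) = ltR (flipv c)" "phi (1 / Q) (ltR c) = ltL (flipv c)"
  using qgen.phi_mul[OF qgen_inverse] qgen.phi_lt[OF qgen_inverse] by simp_all

text \<open>A word of bidegree (1, 0) carries its coefficient to the right of the form letter. The
  reversal turns it into a word of bidegree (0, 1), with the coefficient on the left, and the
  inverse reversal brings this back.\<close>

lemma one_form_left:
  assumes "x \<in> supp_on (bideg_words 1 0)"
  obtains a b where "x = mul Q (embB a) (ltL Z) + mul Q (embB b) (ltL W)"
proof -
  obtain a b where "phi Q x = tens3 1 a (mon [Z]) + tens3 1 b (mon [W])"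
    using one_form_R[OF phi_bideg[OF assms]] by metis
  then have "phi (1 / Q) (phi Q x) = phi (1 / Q) (mul (1 / Q) (tens3 1 a 1) (ltR Z) + mul (1 / Q) (tens3 1 b 1) (ltR W))"
    by (simp add: mul_tens3_lt)
  then have "x = mul Q (embB (flB b)) (ltL Z) + mul Q (embB (flB a)) (ltL W)"
    by (simp add: phi_phi phi_inverse_mul phi_tens3 embB_tens3 add.commute)
  then show ?thesis by (rule that)
qed

lemma one_form_right:
  assumes "x \<in> supp_on (bideg_words 0 1)"
  obtains a b where "x = mul Q (ltR Z) (embB a) + mul Q (ltR W) (embB b)"
proof -
  obtain a b where "phi Q x = tens3 (mon [Z]) a 1 + tens3 (mon [W]) b 1"
    using one_form_L[OF phi_bideg[OF assms]] by metis
  then have "phi (1 / Q) (phi Q x) = phi (1 / Q) (mul (1 / Q) (ltL Z) (tens3 1 a 1) + mul (1 / Q) (ltL W) (tens3 1 b 1))"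
    by (simp add: mul_tens3_lt)
  then have "x = mul Q (ltR Z) (embB (flB b)) + mul Q (ltR W) (embB (flB a))"
    by (simp add: phi_phi phi_inverse_mul phi_tens3 embB_tens3 add.commute)
  then show ?thesis by (rule that)
qed

text \<open>The reversal for 1/q undoes \<open>flB\<close> on the middle factor and carries the
  ideal for 1/q into that for q.\<close>

lemma flB_IB: "flB a \<in> IB (1 / Q) \<Longrightarrow> a \<in> IB Q"
proof -
  assume "flB a \<in> IB (1 / Q)"
  then have "phi (1 / Q) (tens3 1 (flB a) 1) \<in> J3 Q"
    using qgen.phi_J3[OF qgen_inverse, of "tens3 1 (flB a) 1"] by (simp add: J3_tens3)
  then have "embB a \<in> J3 Q" using phi_phi[of "embB a"] by (simp add: phi_tens3 embB_tens3)
  then show "a \<in> IB Q" by (simp add: embB_J3_iff)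
qed

lemma one_form_left_indep:
  assumes "mul Q (embB a) (ltL Z) + mul Q (embB b) (ltL W) \<in> J3 Q"
  shows "a \<in> IB Q" "b \<in> IB Q"
proof -
  from phi_J3[OF assms] have "tens3 1 (flB b) (mon [Z]) + tens3 1 (flB a) (mon [W]) \<in> J3 (1 / Q)"
    by (simp add: phi_mul phi_lt embB_tens3 phi_tens3 mul_tens3_lt add.commute)
  from qgen.tens3_indep_R[OF qgen_inverse this] show "a \<in> IB Q" "b \<in> IB Q" by (simp_all add: flB_IB)
qed

lemma one_form_right_indep:
  assumes "mul Q (ltR Z) (embB a) + mul Q (ltR W) (embB b) \<in> J3 Q"
  shows "a \<in> IB Q" "b \<in> IB Q"
proof -
  from phi_J3[OF assms] have "tens3 (mon [Z]) (flB b) 1 + tens3 (mon [W]) (flB a) 1 \<in> J3 (1 / Q)"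
    by (simp add: phi_mul phi_lt embB_tens3 phi_tens3 mul_tens3_lt add.commute)
  from qgen.tens3_indep_L[OF qgen_inverse this] show "a \<in> IB Q" "b \<in> IB Q" by (simp_all add: flB_IB)
qed

lemma lt_bideg: "ltL c \<in> supp_on (bideg_words 1 0)" "ltR c \<in> supp_on (bideg_words 0 1)"
  by (simp_all add: bideg_words_def)

lemma split_J3:
  assumes "x + y \<in> J3 Q" "x \<in> supp_on (bideg_words 1 0)" "y \<in> supp_on (bideg_words 0 1)"
  shows "x \<in> J3 Q" "y \<in> J3 Q"
proof -
  have "restr (bideg_words 1 0) (x + y) \<in> J3 Q" "restr (bideg_words 0 1) (x + y) \<in> J3 Q"
    by (rule restr_J3[OF _ assms(1)], auto simp: bideg_words_def)+
  moreover have "bideg_words 1 0 \<inter> bideg_words 0 1 = {}" by (auto simp: bideg_words_def)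
  ultimately show "x \<in> J3 Q" "y \<in> J3 Q"
    using assms(2,3) by (simp_all add: plinear_simps[OF plinear_restr] restr_id restr_disjoint[of _ "bideg_words 0 1"]
      restr_disjoint[of _ "bideg_words 1 0"] Int_commute)
qed

lemma deg_1_split:
  assumes "x \<in> supp_on (deg_words 1)"
  obtains y w where "x = y + w" "y \<in> supp_on (bideg_words 1 0)" "w \<in> supp_on (bideg_words 0 1)"
proof -
  have "(\<Sum>p\<in>{..1}. restr (bideg_words p (1 - p)) x) = x"
    by (rule restr_sum) (use assms in \<open>simp_all only: bideg_words_Un finite_atMost\<close>, auto simp: bideg_words_def)
  then have "x = restr (bideg_words 1 0) x + restr (bideg_words 0 1) x" by (simp add: atMost_Suc)
  then show ?thesis using that restr_supp by blast
qed

text \<open>Representatives of the del-derivatives of z and of its conjugate, followed by their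
  delbar-derivatives; the scalar is the q^(1/2) by which the conjugate of z differs from w.\<close>

definition frame :: "nat \<Rightarrow> tv3" where
  "frame i = [ltL Z, pscale (sc Z) (ltL W), ltR Z, pscale (sc Z) (ltR W)] ! i"

lemma frame_simps [simp]: "frame 0 = ltL Z" "frame (Suc 0) = pscale (sc Z) (ltL W)"
  "frame 2 = ltR Z" "frame 3 = pscale (sc Z) (ltR W)"
  by (simp_all add: frame_def)

lemma sum_4: "(\<Sum>i<4. f i) = f 0 + f 1 + (f 2 + f (3::nat) :: 'a::comm_monoid_add)"
  by (simp add: eval_nat_numeral add.assoc)

lemma sc_nz: "sc Z \<noteq> 0"
  using star_coeff_flipv[OF q, of Z] by auto

text \<open>\<open>F\<close> and \<open>G\<close> leave open on which side the coefficient stands,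
  so one argument serves the left and the right basis.\<close>

lemma free_basis:
  fixes F :: "nat \<Rightarrow> tv \<Rightarrow> tv3" and G :: "tv3 set \<Rightarrow> nat \<Rightarrow> tv3 set"
  assumes F: "\<And>i. plinear (F i)" and G: "\<And>i b. G (cl (embB b)) i = cl (F i b)"
    and ex: "\<And>x. x \<in> supp_on (deg_words 1) \<Longrightarrow> \<exists>\<beta>. x = (\<Sum>i<4. F i (\<beta> i))"
    and ind: "\<And>\<beta>. (\<Sum>i<4. F i (\<beta> i)) \<in> J3 Q \<Longrightarrow> \<forall>i<4. \<beta> i \<in> IB Q"
    and X: "X \<in> total_deg Om 1"
  shows "\<exists>!c. c \<in> {..<4} \<rightarrow>\<^sub>E B0 \<and> X = (\<Oplus>\<^bsub>Om\<^esub>i\<in>{..<4}. G (c i) i)"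
proof -
  have s: "(\<Oplus>\<^bsub>Om\<^esub>i\<in>{..<4::nat}. G (c i) i) = cl (\<Sum>i<4. F i (\<beta> i))"
    if "\<And>i. i < 4 \<Longrightarrow> c i = cl (embB (\<beta> i))" for c \<beta>
  proof -
    have "(\<Oplus>\<^bsub>Om\<^esub>i\<in>{..<4::nat}. G (c i) i) = (\<Oplus>\<^bsub>Om\<^esub>i\<in>{..<4::nat}. cl (F i (\<beta> i)))"
      by (rule abelian_monoid.finsum_cong'[OF abelian_group.axioms(1)[OF Om.abelian_group]])
        (use that G in \<open>auto simp: Om.cls_in_carrier\<close>)
    then show ?thesis by (simp add: Om.finsum_cls)
  qed
  from X obtain x where x: "X = cl x" "x \<in> supp_on (deg_words 1)" by (rule total_deg_E)
  from ex[OF x(2)] obtain \<beta> where \<beta>: "x = (\<Sum>i<4. F i (\<beta> i))" by blast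
  define c where "c = (\<lambda>i\<in>{..<4::nat}. cl (embB (\<beta> i)))"
  show ?thesis
  proof (rule ex1I[of _ c])
    show "c \<in> {..<4} \<rightarrow>\<^sub>E B0 \<and> X = (\<Oplus>\<^bsub>Om\<^esub>i\<in>{..<4}. G (c i) i)"
      using s[of c \<beta>] by (simp add: c_def cl_embB x \<beta>)
  next
    fix d assume d: "d \<in> {..<4} \<rightarrow>\<^sub>E B0 \<and> X = (\<Oplus>\<^bsub>Om\<^esub>i\<in>{..<4}. G (d i) i)"
    have "\<exists>b. d i = cl (embB b)" if "i < 4" for i
    proof -
      have "d i \<in> B0" using d that by auto
      then show ?thesis by (rule bideg_00_E) blast
    qed
    then obtain \<gamma> where \<gamma>: "\<And>i. i < 4 \<Longrightarrow> d i = cl (embB (\<gamma> i))" by metis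
    have "cl x = cl (\<Sum>i<4. F i (\<gamma> i))" using d s[of d \<gamma>, OF \<gamma>] x by simp
    then have "(\<Sum>i<4. F i (\<beta> i - \<gamma> i)) \<in> J3 Q"
      by (simp add: Om.cls_iff \<beta> plinear_simps[OF F] sum_subtractf)
    from ind[OF this] have "cl (embB (\<gamma> i)) = cl (embB (\<beta> i))" if "i < 4" for i
      using that by (metis Om.cls_iff embB_J3_iff plinear_simps(5)[OF plinear_embB])
    then have "d i = c i" if "i < 4" for i using that \<gamma> by (simp add: c_def)
    moreover have "d \<in> {..<4} \<rightarrow>\<^sub>E B0" "c \<in> {..<4} \<rightarrow>\<^sub>E B0" using d by (simp_all add: c_def cl_embB)
    ultimately show "d = c" by (intro PiE_ext) auto
  qed
qed

lemma frame_cases: "i < 4 \<Longrightarrow> i = 0 \<or> i = Suc 0 \<or> i = 2 \<or> i = (3::nat)"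
  by auto

lemma frame_deg: "i < 4 \<Longrightarrow> frame i \<in> supp_on (deg_words 1)"
  by (drule frame_cases) (auto intro!: pm.subspace_scale subspace_supp_on)

abbreviation frame_list :: "tv3 set list" where
  "frame_list \<equiv> map (\<lambda>i. cl (frame i)) [0..<4]"

lemma frame_list_nth: "i < 4 \<Longrightarrow> frame_list ! i = cl (frame i)"
  by simp

lemma frame_list_deg: "set frame_list \<subseteq> total_deg Om 1"
  using frame_deg by (auto intro!: cl_total_deg simp del: upt_rec_numeral)

lemma scale_IB: "pscale (sc Z) x \<in> IB Q \<Longrightarrow> x \<in> IB Q"
  using pm.subspace_scale[OF subspace_IB, of "pscale (sc Z) x" Q "1 / sc Z"] sc_nz by simp

lemma left_basis_Om: "left_basis Om B0 (total_deg Om 1) frame_list"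
proof -
  let ?F = "\<lambda>i b. mul Q (embB b) (frame i)"
  have *: "\<exists>!c. c \<in> {..<4} \<rightarrow>\<^sub>E B0 \<and> X = (\<Oplus>\<^bsub>Om\<^esub>i\<in>{..<4}. c i \<otimes>\<^bsub>Om\<^esub> cl (frame i))" if "X \<in> total_deg Om 1" for X
  proof (rule free_basis[where F="?F" and G="\<lambda>c i. c \<otimes>\<^bsub>Om\<^esub> cl (frame i)", OF _ _ _ _ that])
    show "plinear (?F i)" for i by (intro plinear_comp[OF plinear_mul_left] plinear_embB)
    show "cl (embB b) \<otimes>\<^bsub>Om\<^esub> cl (frame i) = cl (?F i b)" for i b by (rule Om.mult_cls)
  next
    fix x assume "x \<in> supp_on (deg_words 1)"
    then obtain y w where yw: "x = y + w" "y \<in> supp_on (bideg_words 1 0)" "w \<in> supp_on (bideg_words 0 1)"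
      by (rule deg_1_split)
    obtain a b where y: "y = mul Q (embB a) (ltL Z) + mul Q (embB b) (ltL W)" using one_form_left[OF yw(2)] by metis
    obtain c d where w: "w = mul Q (embB c) (ltR Z) + mul Q (embB d) (ltR W)"
      using one_form_R[OF yw(3)] by (metis embB_tens3 mul_tens3_lt(1))
    \<comment> \<open>The frame contains the letter W with the factor q^(1/2), which the
      coefficients have to compensate.\<close>
    let ?b = "\<lambda>i. [a, pscale (1 / sc Z) b, c, pscale (1 / sc Z) d] ! i"
    have "x = (\<Sum>i<4. ?F i (?b i))"
      unfolding sum_4 using sc_nz by (simp add: yw(1) y w plinear_simps[OF plinear_embB])
    then show "\<exists>\<beta>. x = (\<Sum>i<4. ?F i (\<beta> i))" by blast
  next
    fix \<beta> assume *: "(\<Sum>i<4. ?F i (\<beta> i)) \<in> J3 Q"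
    let ?y = "mul Q (embB (\<beta> 0)) (ltL Z) + mul Q (embB (pscale (sc Z) (\<beta> 1))) (ltL W)"
    let ?w = "mul Q (embB (\<beta> 2)) (ltR Z) + mul Q (embB (pscale (sc Z) (\<beta> 3))) (ltR W)"
    have "?y + ?w \<in> J3 Q" using * unfolding sum_4 by (simp add: plinear_simps[OF plinear_embB])
    moreover have "?y \<in> supp_on (bideg_words 1 0)" "?w \<in> supp_on (bideg_words 0 1)"
      using mul_bideg[OF embB_bideg lt_bideg(1)] mul_bideg[OF embB_bideg lt_bideg(2)]
      by (simp_all add: pm.subspace_add subspace_supp_on)
    ultimately have J: "?y \<in> J3 Q" "?w \<in> J3 Q" by (rule split_J3)+
    have "\<beta> 0 \<in> IB Q" "\<beta> 1 \<in> IB Q" using one_form_left_indep[OF J(1)] scale_IB by auto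
    moreover have "\<beta> 2 \<in> IB Q" "\<beta> 3 \<in> IB Q"
      using tens3_indep_R[of "\<beta> 2" "pscale (sc Z) (\<beta> 3)"] J(2) scale_IB by (auto simp: embB_tens3 mul_tens3_lt)
    ultimately show "\<forall>i<4. \<beta> i \<in> IB Q" using frame_cases by force
  qed
  have e: "(\<Oplus>\<^bsub>Om\<^esub>i\<in>{..<4}. c i \<otimes>\<^bsub>Om\<^esub> frame_list ! i) = (\<Oplus>\<^bsub>Om\<^esub>i\<in>{..<4}. c i \<otimes>\<^bsub>Om\<^esub> cl (frame i))"
    if "c \<in> {..<4} \<rightarrow>\<^sub>E B0" for c
  proof (rule abelian_monoid.finsum_cong'[OF abelian_group.axioms(1)[OF Om.abelian_group] refl])
    show "(\<lambda>i. c i \<otimes>\<^bsub>Om\<^esub> cl (frame i)) \<in> {..<4} \<rightarrow> carrier Om"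
    proof
      fix i assume "i \<in> {..<4::nat}"
      then have "c i \<in> B0" using that by auto
      then show "c i \<otimes>\<^bsub>Om\<^esub> cl (frame i) \<in> carrier Om" by (elim bideg_00_E) (simp add: Om.mult_cls Om.cls_in_carrier)
    qed
  qed (simp only: lessThan_iff frame_list_nth)
  show ?thesis
    unfolding left_basis_def
  proof (intro conjI ballI frame_list_deg)
    fix X assume X: "X \<in> total_deg Om 1"
    have l: "length frame_list = 4" by simp
    show "\<exists>!c. c \<in> {..<length frame_list} \<rightarrow>\<^sub>E B0 \<and> X = (\<Oplus>\<^bsub>Om\<^esub>i\<in>{..<length frame_list}. c i \<otimes>\<^bsub>Om\<^esub> frame_list ! i)"
      unfolding l using *[OF X] by (simp only: e cong: conj_cong)
  qed
qed

lemma right_basis_Om: "right_basis Om B0 (total_deg Om 1) frame_list"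
proof -
  let ?F = "\<lambda>i b. mul Q (frame i) (embB b)"
  have *: "\<exists>!c. c \<in> {..<4} \<rightarrow>\<^sub>E B0 \<and> X = (\<Oplus>\<^bsub>Om\<^esub>i\<in>{..<4}. cl (frame i) \<otimes>\<^bsub>Om\<^esub> c i)" if "X \<in> total_deg Om 1" for X
  proof (rule free_basis[where F="?F" and G="\<lambda>c i. cl (frame i) \<otimes>\<^bsub>Om\<^esub> c", OF _ _ _ _ that])
    show "plinear (?F i)" for i by (intro plinear_comp[OF plinear_mul_right] plinear_embB)
    show "cl (frame i) \<otimes>\<^bsub>Om\<^esub> cl (embB b) = cl (?F i b)" for i b by (rule Om.mult_cls)
  next
    fix x assume "x \<in> supp_on (deg_words 1)"
    then obtain y w where yw: "x = y + w" "y \<in> supp_on (bideg_words 1 0)" "w \<in> supp_on (bideg_words 0 1)"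
      by (rule deg_1_split)
    obtain a b where y: "y = mul Q (ltL Z) (embB a) + mul Q (ltL W) (embB b)"
      using one_form_L[OF yw(2)] by (metis embB_tens3 mul_tens3_lt(2))
    obtain c d where w: "w = mul Q (ltR Z) (embB c) + mul Q (ltR W) (embB d)" using one_form_right[OF yw(3)] by metis
    let ?b = "\<lambda>i. [a, pscale (1 / sc Z) b, c, pscale (1 / sc Z) d] ! i"
    have "x = (\<Sum>i<4. ?F i (?b i))"
      unfolding sum_4 using sc_nz by (simp add: yw(1) y w plinear_simps[OF plinear_embB])
    then show "\<exists>\<beta>. x = (\<Sum>i<4. ?F i (\<beta> i))" by blast
  next
    fix \<beta> assume *: "(\<Sum>i<4. ?F i (\<beta> i)) \<in> J3 Q"
    let ?y = "mul Q (ltL Z) (embB (\<beta> 0)) + mul Q (ltL W) (embB (pscale (sc Z) (\<beta> 1)))"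
    let ?w = "mul Q (ltR Z) (embB (\<beta> 2)) + mul Q (ltR W) (embB (pscale (sc Z) (\<beta> 3)))"
    have "?y + ?w \<in> J3 Q" using * unfolding sum_4 by (simp add: plinear_simps[OF plinear_embB])
    moreover have "?y \<in> supp_on (bideg_words 1 0)" "?w \<in> supp_on (bideg_words 0 1)"
      using mul_bideg[OF lt_bideg(1) embB_bideg] mul_bideg[OF lt_bideg(2) embB_bideg]
      by (simp_all add: pm.subspace_add subspace_supp_on)
    ultimately have J: "?y \<in> J3 Q" "?w \<in> J3 Q" by (rule split_J3)+
    have "\<beta> 2 \<in> IB Q" "\<beta> 3 \<in> IB Q" using one_form_right_indep[OF J(2)] scale_IB by auto
    moreover have "\<beta> 0 \<in> IB Q" "\<beta> 1 \<in> IB Q"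
      using tens3_indep_L[of "\<beta> 0" "pscale (sc Z) (\<beta> 1)"] J(1) scale_IB by (auto simp: embB_tens3 mul_tens3_lt)
    ultimately show "\<forall>i<4. \<beta> i \<in> IB Q" using frame_cases by force
  qed
  have e: "(\<Oplus>\<^bsub>Om\<^esub>i\<in>{..<4}. frame_list ! i \<otimes>\<^bsub>Om\<^esub> c i) = (\<Oplus>\<^bsub>Om\<^esub>i\<in>{..<4}. cl (frame i) \<otimes>\<^bsub>Om\<^esub> c i)"
    if "c \<in> {..<4} \<rightarrow>\<^sub>E B0" for c
  proof (rule abelian_monoid.finsum_cong'[OF abelian_group.axioms(1)[OF Om.abelian_group] refl])
    show "(\<lambda>i. cl (frame i) \<otimes>\<^bsub>Om\<^esub> c i) \<in> {..<4} \<rightarrow> carrier Om"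
    proof
      fix i assume "i \<in> {..<4::nat}"
      then have "c i \<in> B0" using that by auto
      then show "cl (frame i) \<otimes>\<^bsub>Om\<^esub> c i \<in> carrier Om" by (elim bideg_00_E) (simp add: Om.mult_cls Om.cls_in_carrier)
    qed
  qed (simp only: lessThan_iff frame_list_nth)
  show ?thesis
    unfolding right_basis_def
  proof (intro conjI ballI frame_list_deg)
    fix X assume X: "X \<in> total_deg Om 1"
    have l: "length frame_list = 4" by simp
    show "\<exists>!c. c \<in> {..<length frame_list} \<rightarrow>\<^sub>E B0 \<and> X = (\<Oplus>\<^bsub>Om\<^esub>i\<in>{..<length frame_list}. frame_list ! i \<otimes>\<^bsub>Om\<^esub> c i)"
      unfolding l using *[OF X] by (simp only: e cong: conj_cong)
  qed
qed

end

section \<open>The factorisation structure\<close>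

declare One_nat_def [simp del]

context R_of_H
begin

definition proj2 :: "(vword3 \<times> vword3 \<Rightarrow>\<^sub>0 complex) \<Rightarrow> (tv3 set \<times> tv3 set \<Rightarrow>\<^sub>0 complex)" where
  "proj2 = lin (\<lambda>(x, y). mon (cl (mon x), cl (mon y)))"

definition mul2 :: "(vword3 \<times> vword3 \<Rightarrow>\<^sub>0 complex) \<Rightarrow> tv3" where
  "mul2 = lin (\<lambda>(x, y). mul Q (mon x) (mon y))"

abbreviation theta :: "(vword3 \<times> vword3 \<Rightarrow>\<^sub>0 complex) \<Rightarrow> (vword3 \<times> vword3 \<Rightarrow>\<^sub>0 complex)" where
  "theta \<equiv> lin (theta_words R)"

lemma plinear_proj2: "plinear proj2" "plinear mul2"
  by (simp_all add: proj2_def mul2_def plinear_lin)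

lemma form_proj_eq: "form_proj q R p r p' r' g = cls (Bal p r p' r') (proj2 g)"
  by (simp add: form_proj_def proj2_def Omega_rel_eq)

lemma proj2_supp: "g \<in> supp_on (bideg_words p r \<times> bideg_words p' r') \<Longrightarrow> proj2 g \<in> supp_on (bideg Om p r \<times> bideg Om p' r')"
  unfolding proj2_def by (erule lin_supp_on) (auto intro!: cl_bideg)

lemma ev_proj2: "ev (proj2 g) - mul2 g \<in> J3 Q"
proof (rule plinear_in_subspace[of "\<lambda>g. ev (proj2 g) - mul2 g", OF _ subspace_J3])
  show "plinear (\<lambda>g. ev (proj2 g) - mul2 g)" by (intro plinear_minus plinear_comp[OF plinear_ev] plinear_proj2)
  show "ev (proj2 (mon k)) - mul2 (mon k) \<in> J3 Q" for k
    by (cases k) (simp add: proj2_def mul2_def ev_mon_iff)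
qed

lemma wedge_form_proj:
  assumes "g \<in> supp_on (bideg_words p r \<times> bideg_words p' r')"
  shows "wedge_map Om p r p' r' (form_proj q R p r p' r' g) = cl (mul2 g)"
  unfolding form_proj_eq using wedge_map_cls[OF proj2_supp[OF assms]] ev_proj2[of g] by (simp add: Om.cls_iff)

lemma theta_supp:
  assumes "g \<in> supp_on (bideg_words 0 1 \<times> bideg_words 1 0)"
  shows "theta g \<in> supp_on (bideg_words 1 0 \<times> bideg_words 0 1)"
proof (rule lin_supp_on[OF assms])
  fix k :: "vword3 \<times> vword3" assume k: "k \<in> bideg_words 0 1 \<times> bideg_words 1 0"
  then obtain b v u b' where k': "k = (([], b, v), (u, b', []))" "length v = 1" "length u = 1" by (auto simp: bideg_words_def)
  show "theta_words R k \<in> supp_on (bideg_words 1 0 \<times> bideg_words 0 1)"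
    unfolding k' theta_words_def prod.case
    by (rule lin_supp_on[OF psi_supp], clarsimp simp only: mem_Collect_eq prod.case,
        rule lin_supp_on[OF psi_supp], clarsimp simp only: mem_Collect_eq prod.case,
        rule lin_supp_on[OF psi_supp], clarsimp simp only: mem_Collect_eq prod.case mon_supp_on)
      (simp add: bideg_words_def k')
qed

lemma mul_ordered: "mul Q (mon (u, b, [])) (mon ([], b', v)) = mon (u, b @ b', v)"
  unfolding T3_mult_eq_mul[symmetric] by (simp add: T3_mult_def psi_Nil_left psi_Nil_right)

text \<open>\<open>theta\<close> and the product of free words perform the same three braidings; the
  product has in addition the super sign of v and u, both of length one.\<close>

lemma mul2_theta:
  assumes "g \<in> supp_on (bideg_words 0 1 \<times> bideg_words 1 0)"
  shows "mul2 (theta g) = - mul2 g"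
proof -
  have "mul2 (theta g) = lin (\<lambda>k. mul2 (theta_words R k)) g"
    by (simp add: mul2_def lin_lin)
  also have "\<dots> = lin (\<lambda>k. - mul2 (mon k)) g"
  proof (rule lin_eq_on_supp[OF assms])
    fix k :: "vword3 \<times> vword3" assume k: "k \<in> bideg_words 0 1 \<times> bideg_words 1 0"
    then obtain b v u b' where k': "k = (([], b, v), (u, b', []))" "length v = 1" "length u = 1" by (auto simp: bideg_words_def)
    have "mul Q (mon ([], b, v)) (mon (u, b', [])) = - lin (\<lambda>(u1, v1). lin (\<lambda>(u2, b1). lin (\<lambda>(b2, v2). mon (u2, b1 @ b2, v2))
         (psi R v1 b')) (psi R b u1)) (psi R v u)"
      unfolding T3_mult_eq_mul[symmetric] by (simp add: T3_mult_def k')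
    then show "mul2 (theta_words R k) = - mul2 (mon k)"
      by (simp only: k' theta_words_def mul2_def lin_lin case_prod_unfold lin_mon fst_conv snd_conv mul_ordered minus_minus)
  qed
  also have "\<dots> = - mul2 g" by (simp add: lin_fun_uminus plinear_eq_lin[OF plinear_proj2(2), symmetric])
  finally show ?thesis .
qed

section \<open>Theta determined by wedge products\<close>

abbreviation "S11 \<equiv> FT 0 1 1 0"
abbreviation "T11 \<equiv> FT 1 0 0 1"
abbreviation "wS \<equiv> wedge_map Om 0 1 1 0"
abbreviation "wT \<equiv> wedge_map Om 1 0 0 1"

lemma wS_hom:
  "X \<in> bim_carrier S11 \<Longrightarrow> Y \<in> bim_carrier S11 \<Longrightarrow> wS (bim_add S11 X Y) = wS X \<oplus>\<^bsub>Om\<^esub> wS Y"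
  "X \<in> bim_carrier S11 \<Longrightarrow> wS (bim_scale S11 s X) = s \<odot>\<^bsub>Om\<^esub> wS X"
  "b \<in> B0 \<Longrightarrow> X \<in> bim_carrier S11 \<Longrightarrow> wS (bim_left S11 b X) = b \<otimes>\<^bsub>Om\<^esub> wS X"
  "b \<in> B0 \<Longrightarrow> X \<in> bim_carrier S11 \<Longrightarrow> wS (bim_right S11 X b) = wS X \<otimes>\<^bsub>Om\<^esub> b"
  using factorisable_right[of 1 1] by (simp_all add: bimodule_iso_def form_bimodule_def)

lemma wT_hom:
  "X \<in> bim_carrier T11 \<Longrightarrow> Y \<in> bim_carrier T11 \<Longrightarrow> wT (bim_add T11 X Y) = wT X \<oplus>\<^bsub>Om\<^esub> wT Y"
  "X \<in> bim_carrier T11 \<Longrightarrow> wT (bim_scale T11 s X) = s \<odot>\<^bsub>Om\<^esub> wT X"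
  "b \<in> B0 \<Longrightarrow> X \<in> bim_carrier T11 \<Longrightarrow> wT (bim_left T11 b X) = b \<otimes>\<^bsub>Om\<^esub> wT X"
  "b \<in> B0 \<Longrightarrow> X \<in> bim_carrier T11 \<Longrightarrow> wT (bim_right T11 X b) = wT X \<otimes>\<^bsub>Om\<^esub> b"
  using factorisable_left[of 1 1] by (simp_all add: bimodule_iso_def form_bimodule_def)

lemma wedge_inj:
  "X \<in> bim_carrier S11 \<Longrightarrow> Y \<in> bim_carrier S11 \<Longrightarrow> wS X = wS Y \<Longrightarrow> X = Y"
  "X \<in> bim_carrier T11 \<Longrightarrow> Y \<in> bim_carrier T11 \<Longrightarrow> wT X = wT Y \<Longrightarrow> X = Y"
  using factorisable_left[of 1 1] factorisable_right[of 1 1]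
  unfolding bimodule_iso_def bij_betw_def by (auto dest: inj_onD)

lemma form_proj_carrier:
  "g \<in> supp_on (bideg_words p r \<times> bideg_words p' r') \<Longrightarrow> form_proj q R p r p' r' g \<in> bim_carrier (FT p r p' r')"
  unfolding form_proj_eq FT_carrier by (rule imageI) (rule proj2_supp)

text \<open>\<open>Theta11\<close> is given on combinations of pairs of words, so every tensor has
  to be represented by one; bilinearity of the tensor product provides it.\<close>

lemma form_proj_surj:
  assumes "X \<in> bim_carrier (FT p r p' r')"
  obtains g where "g \<in> supp_on (bideg_words p r \<times> bideg_words p' r')" "form_proj q R p r p' r' g = X"
proof -
  let ?S = "bideg_words p r \<times> bideg_words p' r'"
  note B = subspace_Bal[of p r p' r']
  from assms obtain f where f: "X = cls (Bal p r p' r') f" "f \<in> supp_on (bideg Om p r \<times> bideg Om p' r')"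
    unfolding FT_carrier by blast
  let ?T = "{f. \<exists>g \<in> supp_on ?S. f - proj2 g \<in> Bal p r p' r'}"
  have T: "pm.subspace ?T"
    unfolding pm.subspace_def
  proof (intro conjI ballI allI)
    show "0 \<in> ?T" by (intro CollectI bexI[of _ 0]) (simp_all add: plinear_simps[OF plinear_proj2(1)] pm.subspace_0[OF B])
  next
    fix f g assume "f \<in> ?T" "g \<in> ?T"
    then obtain x y where xy: "x \<in> supp_on ?S" "f - proj2 x \<in> Bal p r p' r'" "y \<in> supp_on ?S" "g - proj2 y \<in> Bal p r p' r'" by blast
    show "f + g \<in> ?T"
      using pm.subspace_add[OF B xy(2,4)] xy
      by (intro CollectI bexI[of _ "x + y"]) (simp_all add: plinear_simps[OF plinear_proj2(1)] algebra_simps pm.subspace_add subspace_supp_on)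
  next
    fix s f assume "f \<in> ?T"
    then obtain x where xy: "x \<in> supp_on ?S" "f - proj2 x \<in> Bal p r p' r'" by blast
    show "pscale s f \<in> ?T"
      using pm.subspace_scale[OF B xy(2)] xy
      by (intro CollectI bexI[of _ "pscale s x"])
        (simp_all add: plinear_simps[OF plinear_proj2(1)] pm.scale_right_diff_distrib pm.subspace_scale subspace_supp_on)
  qed
  have "f \<in> ?T"
  proof (rule plinear_in_subspace[OF plinear_ident T])
    fix h assume "h \<in> Poly_Mapping.keys f"
    with f(2) have "fst h \<in> bideg Om p r" "snd h \<in> bideg Om p' r'" by (auto simp: supp_on_def)
    then obtain x y where h: "fst h = cl x" "snd h = cl y"
      and x: "x \<in> supp_on (bideg_words p r)" and y: "y \<in> supp_on (bideg_words p' r')"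
      by (elim bideg_E) blast
    have h': "h = (cl x, cl y)" using h by (metis prod.collapse)
    let ?g = "lin (\<lambda>k. lin (\<lambda>l. mon (k, l)) y) x"
    have "mon (cl x, cl y) - lin (\<lambda>k. lin (\<lambda>l. mon (cl (mon k), cl (mon l))) y) x \<in> Bal p r p' r'"
      by (rule Bal_lin[OF plinear_ident plinear_ident _ _ x y]) simp_all
    then have "mon h - proj2 ?g \<in> Bal p r p' r'" by (simp add: h' proj2_def lin_lin)
    moreover have "?g \<in> supp_on ?S" by (rule lin_supp_on[OF x], rule lin_supp_on[OF y]) simp
    ultimately show "mon h \<in> ?T" by blast
  qed
  then obtain g where "g \<in> supp_on ?S" "f - proj2 g \<in> Bal p r p' r'" by blast
  then show ?thesis using that[of g] by (simp add: form_proj_eq f cls_eq_iff[OF B, THEN iffD2, symmetric])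
qed

abbreviation "Th \<equiv> Theta11 q R"

lemma wT_theta:
  assumes "g \<in> supp_on (bideg_words 0 1 \<times> bideg_words 1 0)"
  shows "wT (form_proj q R 1 0 0 1 (theta g)) = (- 1) \<odot>\<^bsub>Om\<^esub> wS (form_proj q R 0 1 1 0 g)"
  by (simp add: wedge_form_proj[OF theta_supp[OF assms]] wedge_form_proj[OF assms] mul2_theta[OF assms] Om.smult_cls)

text \<open>Two representatives of one tensor have the same wedge product, so their images under
  \<open>theta\<close> have the same one as well, and injectivity of \<open>wT\<close> identifies
  the images.\<close>

lemma Th_form_proj:
  assumes g: "g \<in> supp_on (bideg_words 0 1 \<times> bideg_words 1 0)"
  shows "Th (form_proj q R 0 1 1 0 g) = form_proj q R 1 0 0 1 (theta g)"
  unfolding Theta11_def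
proof (rule the_elem_image_const[of g])
  fix h assume "h \<in> {h \<in> supp_on (bideg_words 0 1 \<times> bideg_words 1 0). form_proj q R 0 1 1 0 h = form_proj q R 0 1 1 0 g}"
  then have h: "h \<in> supp_on (bideg_words 0 1 \<times> bideg_words 1 0)" "form_proj q R 0 1 1 0 h = form_proj q R 0 1 1 0 g" by auto
  show "form_proj q R 1 0 0 1 (theta h) = form_proj q R 1 0 0 1 (theta g)"
    by (rule wedge_inj(2)) (simp_all add: form_proj_carrier theta_supp g h wT_theta)
qed (use g in simp)

lemma Th_wedge:
  assumes "X \<in> bim_carrier S11"
  shows "Th X \<in> bim_carrier T11" "wT (Th X) = (- 1) \<odot>\<^bsub>Om\<^esub> wS X"
proof -
  from assms obtain g where g: "g \<in> supp_on (bideg_words 0 1 \<times> bideg_words 1 0)" "form_proj q R 0 1 1 0 g = X"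
    by (rule form_proj_surj)
  from Th_form_proj[OF g(1)] wT_theta[OF g(1)] form_proj_carrier[OF theta_supp[OF g(1)]]
  show "Th X \<in> bim_carrier T11" "wT (Th X) = (- 1) \<odot>\<^bsub>Om\<^esub> wS X" by (simp_all add: g(2))
qed

lemma FT_closed:
  assumes "X \<in> bim_carrier (FT p r p' r')" "Y \<in> bim_carrier (FT p r p' r')" "b \<in> B0"
  shows "bim_add (FT p r p' r') X Y \<in> bim_carrier (FT p r p' r')" "bim_scale (FT p r p' r') s X \<in> bim_carrier (FT p r p' r')"
    "bim_left (FT p r p' r') b X \<in> bim_carrier (FT p r p' r')" "bim_right (FT p r p' r') X b \<in> bim_carrier (FT p r p' r')"
proof -
  from assms obtain f g where f: "X = cls (Bal p r p' r') f" "f \<in> supp_on (bideg Om p r \<times> bideg Om p' r')"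
    and g: "Y = cls (Bal p r p' r') g" "g \<in> supp_on (bideg Om p r \<times> bideg Om p' r')"
    unfolding FT_carrier by blast
  show "bim_add (FT p r p' r') X Y \<in> bim_carrier (FT p r p' r')" "bim_scale (FT p r p' r') s X \<in> bim_carrier (FT p r p' r')"
    "bim_left (FT p r p' r') b X \<in> bim_carrier (FT p r p' r')" "bim_right (FT p r p' r') X b \<in> bim_carrier (FT p r p' r')"
    unfolding f(1) g(1) FT_add FT_scale FT_left[OF assms(3)] FT_right[OF assms(3)] FT_carrier
    by (rule imageI; simp add: f g pm.subspace_add pm.subspace_scale subspace_supp_on lact_supp ract_supp assms(3))+
qed

text \<open>Up to sign the map is \<open>wS\<close> followed by the inverse of \<open>wT\<close>;
  every compatibility is therefore compared after the injective homomorphism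
  \<open>wT\<close>.\<close>

lemma Th_iso: "bimodule_iso B0 S11 T11 Th"
proof -
  note S = factorisable_right[of 1 1] and T = factorisable_left[of 1 1]
  have c: "wS X \<in> bideg Om 1 1" if "X \<in> bim_carrier S11" for X
    using S that by (auto simp: bimodule_iso_def bij_betw_def form_bimodule_def)
  have cc: "wS X \<in> carrier Om" if "X \<in> bim_carrier S11" for X by (rule bideg_in_carrier[OF c[OF that]])
  have neg: "(-1) \<odot>\<^bsub>Om\<^esub> ((-1) \<odot>\<^bsub>Om\<^esub> X) = X" if "X \<in> carrier Om" for X
    using that by (elim Om.carrierE) (simp add: Om.smult_cls)
  \<comment> \<open>\<open>FT_closed\<close> asks for an element of the degree zero algebra; for
    sums and scalar multiples the unit serves.\<close>
  have b0: "\<one>\<^bsub>Om\<^esub> \<in> B0" by (simp add: Om.A(3) cl_bideg bideg_words_def)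
  have inj: "inj_on Th (bim_carrier S11)"
  proof (rule inj_onI)
    fix X Y assume *: "X \<in> bim_carrier S11" "Y \<in> bim_carrier S11" "Th X = Th Y"
    then have "(-1) \<odot>\<^bsub>Om\<^esub> wS X = (-1) \<odot>\<^bsub>Om\<^esub> wS Y" using Th_wedge(2) by metis
    then have "wS X = wS Y" using neg cc * by metis
    then show "X = Y" using * wedge_inj(1) by blast
  qed
  have surj: "Th ` bim_carrier S11 = bim_carrier T11"
  proof
    show "Th ` bim_carrier S11 \<subseteq> bim_carrier T11" using Th_wedge(1) by blast
    show "bim_carrier T11 \<subseteq> Th ` bim_carrier S11"
    proof
      fix Y assume Y: "Y \<in> bim_carrier T11"
      have im: "wS ` bim_carrier S11 = bideg Om 1 1" and "wT ` bim_carrier T11 = bideg Om 1 1"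
        using S T by (simp_all add: bimodule_iso_def bij_betw_def form_bimodule_def)
      then have "wT Y \<in> bideg Om 1 1" using Y by blast
      then have YC: "wT Y \<in> carrier Om" and "(-1) \<odot>\<^bsub>Om\<^esub> wT Y \<in> bideg Om 1 1"
        by (rule bideg_in_carrier, rule bideg_smult)
      then have "(-1) \<odot>\<^bsub>Om\<^esub> wT Y \<in> wS ` bim_carrier S11" by (simp only: im)
      then obtain X where X: "X \<in> bim_carrier S11" "wS X = (-1) \<odot>\<^bsub>Om\<^esub> wT Y"
        by (elim imageE) simp
      then have "wT (Th X) = wT Y" using Th_wedge(2) neg[OF YC] by simp
      then have "Th X = Y" using wedge_inj(2) Th_wedge(1)[OF X(1)] Y by blast
      then show "Y \<in> Th ` bim_carrier S11" using X by blast
    qed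
  qed
  show ?thesis
    unfolding bimodule_iso_def bij_betw_def
  proof (intro conjI ballI allI inj surj)
    fix X Y assume X: "X \<in> bim_carrier S11" and Y: "Y \<in> bim_carrier S11"
    note TX = Th_wedge[OF X] and TY = Th_wedge[OF Y]
    have "wT (Th (bim_add S11 X Y)) = (-1) \<odot>\<^bsub>Om\<^esub> (wS X \<oplus>\<^bsub>Om\<^esub> wS Y)"
      by (simp only: Th_wedge(2)[OF FT_closed(1)[OF X Y b0]] wS_hom(1)[OF X Y])
    also have "\<dots> = wT (bim_add T11 (Th X) (Th Y))"
      unfolding wT_hom(1)[OF TX(1) TY(1)] TX(2) TY(2)
      by (rule Om.carrierE[OF cc[OF X]], rule Om.carrierE[OF cc[OF Y]]) (simp add: Om.cls_simps)
    finally show "Th (bim_add S11 X Y) = bim_add T11 (Th X) (Th Y)"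
      by (rule wedge_inj(2)[OF Th_wedge(1)[OF FT_closed(1)[OF X Y b0]] FT_closed(1)[OF TX(1) TY(1) b0]])
  next
    fix s X assume X: "X \<in> bim_carrier S11"
    note TX = Th_wedge[OF X]
    have "wT (Th (bim_scale S11 s X)) = (-1) \<odot>\<^bsub>Om\<^esub> (s \<odot>\<^bsub>Om\<^esub> wS X)"
      by (simp only: Th_wedge(2)[OF FT_closed(2)[OF X X b0]] wS_hom(2)[OF X])
    also have "\<dots> = wT (bim_scale T11 s (Th X))"
      unfolding wT_hom(2)[OF TX(1)] TX(2) by (rule Om.carrierE[OF cc[OF X]]) (simp add: Om.cls_simps)
    finally show "Th (bim_scale S11 s X) = bim_scale T11 s (Th X)"
      by (rule wedge_inj(2)[OF Th_wedge(1)[OF FT_closed(2)[OF X X b0]] FT_closed(2)[OF TX(1) TX(1) b0]])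
  next
    fix b X assume b: "b \<in> B0" and X: "X \<in> bim_carrier S11"
    note TX = Th_wedge[OF X] and bc = bideg_in_carrier[OF b]
    have "wT (Th (bim_left S11 b X)) = (-1) \<odot>\<^bsub>Om\<^esub> (b \<otimes>\<^bsub>Om\<^esub> wS X)"
      by (simp only: Th_wedge(2)[OF FT_closed(3)[OF X X b]] wS_hom(3)[OF b X])
    also have "\<dots> = wT (bim_left T11 b (Th X))"
      unfolding wT_hom(3)[OF b TX(1)] TX(2) Om_arith(3)[OF bc cc[OF X]] ..
    finally show "Th (bim_left S11 b X) = bim_left T11 b (Th X)"
      by (rule wedge_inj(2)[OF Th_wedge(1)[OF FT_closed(3)[OF X X b]] FT_closed(3)[OF TX(1) TX(1) b]])
    have "wT (Th (bim_right S11 X b)) = (-1) \<odot>\<^bsub>Om\<^esub> (wS X \<otimes>\<^bsub>Om\<^esub> b)"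
      by (simp only: Th_wedge(2)[OF FT_closed(4)[OF X X b]] wS_hom(4)[OF b X])
    also have "\<dots> = wT (bim_right T11 (Th X) b)"
      unfolding wT_hom(4)[OF b TX(1)] TX(2) Om_arith(4)[OF bc cc[OF X]] ..
    finally show "Th (bim_right S11 X b) = bim_right T11 (Th X) b"
      by (rule wedge_inj(2)[OF Th_wedge(1)[OF FT_closed(4)[OF X X b]] FT_closed(4)[OF TX(1) TX(1) b]])
  qed
qed

lemma form_pure_cl:
  assumes "x \<in> supp_on (bideg_words p r)" "y \<in> supp_on (bideg_words p' r')"
  shows "form_pure Om p r p' r' (cl (pscale s x)) (cl (pscale s' y)) = bim_scale (FT p r p' r') (s * s') (form_pure Om p r p' r' (cl x) (cl y))"
proof -
  note xy = cl_bideg[OF assms(1)] cl_bideg[OF assms(2)]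
  have 1: "mon (s \<odot>\<^bsub>Om\<^esub> cl x, s' \<odot>\<^bsub>Om\<^esub> cl y) - pscale s (mon (cl x, s' \<odot>\<^bsub>Om\<^esub> cl y)) \<in> Bal p r p' r'"
    by (rule Bal_base(3)[OF xy(1) bideg_smult[OF xy(2)]])
  have 2: "mon (cl x, s' \<odot>\<^bsub>Om\<^esub> cl y) - pscale s' (mon (cl x, cl y)) \<in> Bal p r p' r'"
    by (rule Bal_base(4)[OF xy])
  have "mon (cl (pscale s x), cl (pscale s' y)) - pscale (s * s') (mon (cl x, cl y)) \<in> Bal p r p' r'"
    using pm.subspace_add[OF subspace_Bal 1 pm.subspace_scale[OF subspace_Bal 2, of s]]
    by (simp add: Om.smult_cls pm.scale_right_diff_distrib)
  then show ?thesis
    by (simp only: form_pure_def pure_tensor_def FT_scale cls_eq_iff[OF subspace_Bal])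
qed

lemma form_pure_mon: "form_pure Om p r p' r' (cl (mon k)) (cl (mon l)) = form_proj q R p r p' r' (mon (k, l))"
  by (simp add: form_pure_def pure_tensor_def form_proj_eq proj2_def)

lemma theta_letters: "theta_words R (([], [], [c]), ([x], [], [])) = lin (\<lambda>(x', c'). mon (([x'], [], []), ([], [], [c']))) (brl Q c x)"
  by (simp add: theta_words_def psi_letter lin_lin case_prod_unfold psi_Nil_left psi_Nil_right)

lemma form_proj_linear:
  "form_proj q R p r p' r' (f + g) = bim_add (FT p r p' r') (form_proj q R p r p' r' f) (form_proj q R p r p' r' g)"
  "form_proj q R p r p' r' (pscale s f) = bim_scale (FT p r p' r') s (form_proj q R p r p' r' f)"
  by (simp_all add: form_proj_eq FT_add FT_scale plinear_simps[OF plinear_proj2(1)])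

end

context R_of_H
begin

section \<open>The relations between the generators\<close>

lemma letter_products:
  "mul Q (ltM c) (ltL x) = lin (\<lambda>(a, b). mon ([a], [b], [])) (brl Q c x)"
  "mul Q (ltR c) (ltL x) = - lin (\<lambda>(a, b). mon ([a], [], [b])) (brl Q c x)"
  "mul Q (ltR c) (ltM x) = lin (\<lambda>(a, b). mon ([], [a], [b])) (brl Q c x)"
  "mul Q (ltL c) (ltL x) = mon ([c, x], [], [])"
  "mul Q (ltL c) (ltM x) = mon ([c], [x], [])"
  "mul Q (ltL c) (ltR x) = mon ([c], [], [x])"
  "mul Q (ltM c) (ltM x) = mon ([], [c, x], [])"
  "mul Q (ltM c) (ltR x) = mon ([], [c], [x])"
  "mul Q (ltR c) (ltR x) = mon ([], [], [c, x])"
  by (cases c; cases x; simp add: mul_ltL mul_ltM mul_ltR opM_def opR_def opL_def plinear_simps[OF plinear_lin])+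

lemma letters_mod:
  "mon ([], [W, Z], []) - pscale Q (mon ([], [Z, W], [])) \<in> J3 Q"
  "mon ([c, c], [], []) \<in> J3 Q"
  "mon ([], [], [c, c]) \<in> J3 Q"
  "mon ([W, Z], [], []) + pscale (1 / Q) (mon ([Z, W], [], [])) \<in> J3 Q"
  "mon ([], [], [W, Z]) + pscale (1 / Q) (mon ([], [], [Z, W])) \<in> J3 Q"
proof -
  have B: "relB Q \<in> IB Q" using relB_IB[of 1 Q 1] by simp
  show "mon ([], [W, Z], []) - pscale Q (mon ([], [Z, W], [])) \<in> J3 Q"
    using J3_tens3(2)[OF B, of 1 1] by (simp add: relB_def tens3_simps flip: mon_Nil tens3_mon)
  show "mon ([c, c], [], []) \<in> J3 Q" "mon ([], [], [c, c]) \<in> J3 Q"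
    using J3_tens3(1,3)[OF IL_words(1)] by (simp_all flip: tens3_mon)
  show "mon ([W, Z], [], []) + pscale (1 / Q) (mon ([Z, W], [], [])) \<in> J3 Q"
    "mon ([], [], [W, Z]) + pscale (1 / Q) (mon ([], [], [Z, W])) \<in> J3 Q"
    using J3_tens3(1,3)[OF IL_words(2), of 1 1] by (simp_all add: tens3_simps flip: mon_Nil tens3_mon)
qed

abbreviation "gz \<equiv> cl (ltM Z)"
abbreviation "gzs \<equiv> cl (pscale (sc Z) (ltM W))"
abbreviation "gdz \<equiv> cl (ltL Z)"
abbreviation "gdzs \<equiv> cl (pscale (sc Z) (ltL W))"
abbreviation "gbz \<equiv> cl (ltR Z)"
abbreviation "gbzs \<equiv> cl (pscale (sc Z) (ltR W))"

lemma generators: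
  "B_embed R (cls (B_ideal R) (mon [Z])) = gz"
  "dstar Om gz = gzs" "del Om gz = gdz" "del Om gzs = gdzs" "delbar Om gz = gbz" "delbar Om gzs = gbzs"
  "dstar Om gdz = gbzs"
proof -
  have dl: "dl (ltM c) = ltL c" for c
    using T3_del_M[of c "[]" "[]"] by (simp add: T3_del_R)
  show "B_embed R (cls (B_ideal R) (mon [Z])) = gz"
    unfolding B_ideal_eq B_embed_cls embB_mon ..
  show "dstar Om gz = gzs" "del Om gz = gdz" "del Om gzs = gdzs" "delbar Om gz = gbz" "delbar Om gzs = gbzs"
    "dstar Om gdz = gbzs"
    by (simp_all add: dstar_cl del_cl delbar_cl st_lt dl db_lt )
qed

text \<open>These are exchange relations of letters, some solved for the opposite order. They hold
  already between free words, so coefficients are compared before passing to classes.\<close>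

lemma bimodule_relations:
  "gz \<otimes>\<^bsub>Om\<^esub> gdz = (q\<^sup>2) \<odot>\<^bsub>Om\<^esub> (gdz \<otimes>\<^bsub>Om\<^esub> gz)"
  "gzs \<otimes>\<^bsub>Om\<^esub> gdzs = (q\<^sup>2) \<odot>\<^bsub>Om\<^esub> (gdzs \<otimes>\<^bsub>Om\<^esub> gzs)"
  "gz \<otimes>\<^bsub>Om\<^esub> gdzs = q \<odot>\<^bsub>Om\<^esub> (gdzs \<otimes>\<^bsub>Om\<^esub> gz)"
  "gzs \<otimes>\<^bsub>Om\<^esub> gdz = q \<odot>\<^bsub>Om\<^esub> (gdz \<otimes>\<^bsub>Om\<^esub> gzs) \<oplus>\<^bsub>Om\<^esub> (q\<^sup>2 - 1) \<odot>\<^bsub>Om\<^esub> (gdzs \<otimes>\<^bsub>Om\<^esub> gz)"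
  "gz \<otimes>\<^bsub>Om\<^esub> gbzs = (1/q) \<odot>\<^bsub>Om\<^esub> (gbzs \<otimes>\<^bsub>Om\<^esub> gz) \<oplus>\<^bsub>Om\<^esub> (1/q\<^sup>2 - 1) \<odot>\<^bsub>Om\<^esub> (gbz \<otimes>\<^bsub>Om\<^esub> gzs)"
  "gzs \<otimes>\<^bsub>Om\<^esub> gbzs = (1/q\<^sup>2) \<odot>\<^bsub>Om\<^esub> (gbzs \<otimes>\<^bsub>Om\<^esub> gzs)"
  "gz \<otimes>\<^bsub>Om\<^esub> gbz = (1/q\<^sup>2) \<odot>\<^bsub>Om\<^esub> (gbz \<otimes>\<^bsub>Om\<^esub> gz)"
  "gzs \<otimes>\<^bsub>Om\<^esub> gbz = (1/q) \<odot>\<^bsub>Om\<^esub> (gbz \<otimes>\<^bsub>Om\<^esub> gzs)"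
  "gbzs \<otimes>\<^bsub>Om\<^esub> gz = q \<odot>\<^bsub>Om\<^esub> (gz \<otimes>\<^bsub>Om\<^esub> gbzs) \<oplus>\<^bsub>Om\<^esub> (q\<^sup>2 - 1) \<odot>\<^bsub>Om\<^esub> (gzs \<otimes>\<^bsub>Om\<^esub> gbz)"
  "gbz \<otimes>\<^bsub>Om\<^esub> gdz = (- (q\<^sup>2)) \<odot>\<^bsub>Om\<^esub> (gdz \<otimes>\<^bsub>Om\<^esub> gbz)"
  "gbzs \<otimes>\<^bsub>Om\<^esub> gdzs = (- (q\<^sup>2)) \<odot>\<^bsub>Om\<^esub> (gdzs \<otimes>\<^bsub>Om\<^esub> gbzs)"
  "gbz \<otimes>\<^bsub>Om\<^esub> gdzs = (- q) \<odot>\<^bsub>Om\<^esub> (gdzs \<otimes>\<^bsub>Om\<^esub> gbz)"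
  "gbzs \<otimes>\<^bsub>Om\<^esub> gdz = (- q) \<odot>\<^bsub>Om\<^esub> (gdz \<otimes>\<^bsub>Om\<^esub> gbzs) \<oplus>\<^bsub>Om\<^esub> (- (q\<^sup>2 - 1)) \<odot>\<^bsub>Om\<^esub> (gdzs \<otimes>\<^bsub>Om\<^esub> gbz)"
  unfolding Om.mult_cls T3_mult_mul Om.smult_cls Om.add_cls
  by ((rule arg_cong[of _ _ cl], rule poly_mapping_eqI, insert q,
      simp add: letter_products plinear_simps[OF plinear_lin] lookup_add lookup_minus field_simps power2_eq_square)+)

text \<open>In contrast these come from generators of the ideal, multiplied by the powers of q^(1/2)
  that the conjugate generators carry.\<close>

lemma exterior_relations:
  "gzs \<otimes>\<^bsub>Om\<^esub> gz = q \<odot>\<^bsub>Om\<^esub> (gz \<otimes>\<^bsub>Om\<^esub> gzs)"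
  "gdz \<otimes>\<^bsub>Om\<^esub> gdz = \<zero>\<^bsub>Om\<^esub>" "gdzs \<otimes>\<^bsub>Om\<^esub> gdzs = \<zero>\<^bsub>Om\<^esub>"
  "gdzs \<otimes>\<^bsub>Om\<^esub> gdz \<oplus>\<^bsub>Om\<^esub> (1/q) \<odot>\<^bsub>Om\<^esub> (gdz \<otimes>\<^bsub>Om\<^esub> gdzs) = \<zero>\<^bsub>Om\<^esub>"
  "gbz \<otimes>\<^bsub>Om\<^esub> gbz = \<zero>\<^bsub>Om\<^esub>" "gbzs \<otimes>\<^bsub>Om\<^esub> gbzs = \<zero>\<^bsub>Om\<^esub>"
  "gbzs \<otimes>\<^bsub>Om\<^esub> gbz \<oplus>\<^bsub>Om\<^esub> (1/q) \<odot>\<^bsub>Om\<^esub> (gbz \<otimes>\<^bsub>Om\<^esub> gbzs) = \<zero>\<^bsub>Om\<^esub>"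
  using letters_mod[THEN pm.subspace_scale[OF subspace_J3], of "sc Z"] letters_mod(2,3)
    letters_mod(2,3)[THEN pm.subspace_scale[OF subspace_J3], of "sc Z * sc Z"]
  by (simp_all add: Om.cls_simps Om.cls_iff letter_products pm.scale_right_diff_distrib
      pm.scale_right_distrib mult.commute)

lemma theta_relations:
  "Th (form_pure Om 0 1 1 0 gbz gdz) = bim_scale T11 (q\<^sup>2) (form_pure Om 1 0 0 1 gdz gbz)"
  "Th (form_pure Om 0 1 1 0 gbzs gdzs) = bim_scale T11 (q\<^sup>2) (form_pure Om 1 0 0 1 gdzs gbzs)"
  "Th (form_pure Om 0 1 1 0 gbz gdzs) = bim_scale T11 q (form_pure Om 1 0 0 1 gdzs gbz)"
  "Th (form_pure Om 0 1 1 0 gbzs gdz) = bim_add T11 (bim_scale T11 q (form_pure Om 1 0 0 1 gdz gbzs))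
     (bim_scale T11 (q\<^sup>2 - 1) (form_pure Om 1 0 0 1 gdzs gbz))"
proof -
  have S: "form_pure Om 0 1 1 0 (cl (pscale s (ltR c))) (cl (pscale s' (ltL x))) = form_proj q R 0 1 1 0 (pscale (s * s') (mon (([], [], [c]), ([x], [], []))))"
    and T: "form_pure Om 1 0 0 1 (cl (pscale s (ltL c))) (cl (pscale s' (ltR x))) = form_proj q R 1 0 0 1 (pscale (s * s') (mon (([c], [], []), ([], [], [x]))))"
    for s s' c x
    by (simp_all only: form_pure_cl[OF lt_bideg(2,1)] form_pure_cl[OF lt_bideg] form_pure_mon form_proj_linear)
  have Th: "Th (form_pure Om 0 1 1 0 (cl (pscale s (ltR c))) (cl (pscale s' (ltL x))))
      = form_proj q R 1 0 0 1 (pscale (s * s') (lin (\<lambda>(x', c'). mon (([x'], [], []), ([], [], [c']))) (brl Q c x)))" for s s' c x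
    unfolding S by (subst Th_form_proj)
      (auto intro!: pm.subspace_scale subspace_supp_on simp: bideg_words_def theta_letters plinear_simps[OF plinear_lin])
  \<comment> \<open>Instances with scalar 1, for generators that are bare letters; the factor
    q^(1/2) occurs only with the conjugate ones.\<close>
  note Th1 = Th[of 1, simplified] and Th2 = Th[of _ _ 1, simplified] and Th3 = Th[of 1 _ 1, simplified]
  note T1 = T[of 1, simplified] and T2 = T[of _ _ 1, simplified] and T3 = T[of 1 _ 1, simplified]
  show "Th (form_pure Om 0 1 1 0 gbz gdz) = bim_scale T11 (q\<^sup>2) (form_pure Om 1 0 0 1 gdz gbz)"
    unfolding Th3 T3 form_proj_linear(2)[symmetric] by (simp add: plinear_simps[OF plinear_lin])
  show "Th (form_pure Om 0 1 1 0 gbzs gdzs) = bim_scale T11 (q\<^sup>2) (form_pure Om 1 0 0 1 gdzs gbzs)"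
    unfolding Th T form_proj_linear(2)[symmetric] by (simp add: plinear_simps[OF plinear_lin] ac_simps)
  show "Th (form_pure Om 0 1 1 0 gbz gdzs) = bim_scale T11 q (form_pure Om 1 0 0 1 gdzs gbz)"
    unfolding Th1 T2 form_proj_linear(2)[symmetric] by (simp add: plinear_simps[OF plinear_lin] ac_simps)
  show "Th (form_pure Om 0 1 1 0 gbzs gdz) = bim_add T11 (bim_scale T11 q (form_pure Om 1 0 0 1 gdz gbzs))
     (bim_scale T11 (q\<^sup>2 - 1) (form_pure Om 1 0 0 1 gdzs gbz))"
    unfolding Th2 T1 T2 form_proj_linear[symmetric]
    by (simp add: plinear_simps[OF plinear_lin] pm.scale_right_distrib ac_simps)
qed

end

theorem corollary3p4:
  fixes q :: real and R :: "hfree \<Rightarrow> hfree \<Rightarrow> complex"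
    and \<Omega> (structure) and z zs dz dzs bz bzs :: "tv3 set"
    and \<Theta> :: "(tv3 set \<times> tv3 set \<Rightarrow>\<^sub>0 complex) set \<Rightarrow> (tv3 set \<times> tv3 set \<Rightarrow>\<^sub>0 complex) set"
    and S T :: "(tv3 set, (tv3 set \<times> tv3 set \<Rightarrow>\<^sub>0 complex) set) bimodule"
    and s t :: "tv3 set \<Rightarrow> tv3 set \<Rightarrow> (tv3 set \<times> tv3 set \<Rightarrow>\<^sub>0 complex) set"
  assumes q: "q > 0"
    and R: "is_R_of_H q R"
  defines "\<Omega> \<equiv> Omega q R"
    and "z \<equiv> B_embed R (cls (B_ideal R) (mon [Z]))"
    and "zs \<equiv> dstar \<Omega> z"
    and "dz \<equiv> del \<Omega> z" and "dzs \<equiv> del \<Omega> zs"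
    and "bz \<equiv> delbar \<Omega> z" and "bzs \<equiv> delbar \<Omega> zs"
    and "\<Theta> \<equiv> Theta11 q R"
    and "S \<equiv> form_tensor \<Omega> 0 1 1 0" and "T \<equiv> form_tensor \<Omega> 1 0 0 1"
    and "s \<equiv> form_pure \<Omega> 0 1 1 0" and "t \<equiv> form_pure \<Omega> 1 0 0 1"
  shows
    \<comment> \<open>$B_+(V)$ is the quantum plane and is the degree 0 part of Omega\<close>
    "B_ideal R = two_sided_ideal
       {T_star q (mon [Z]) * mon [Z] - pscale q (mon [Z] * T_star q (mon [Z]))} \<and>
     complex_algebra (B_plus R) \<and>
     B_embed R \<in> ring_iso (B_plus R) (\<Omega>\<lparr>carrier := bideg \<Omega> 0 0\<rparr>) \<and>
     (\<forall>b\<in>carrier (B_plus R). B_embed R (B_star q R b) = dstar \<Omega> (B_embed R b) \<and>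
        (\<forall>c. B_embed R (c \<odot>\<^bsub>B_plus R\<^esub> b) = c \<odot> B_embed R b)) \<and>
     zs \<otimes> z = q \<odot> (z \<otimes> zs) \<and>
     \<comment> \<open>the structure maps of Omega are well defined\<close>
     (\<forall>x y. cls (Omega_rel R) x \<otimes> cls (Omega_rel R) y = cls (Omega_rel R) (T3_mult R x y)) \<and>
     (\<forall>x. del \<Omega> (cls (Omega_rel R) x) = cls (Omega_rel R) (T3_del R x) \<and>
        delbar \<Omega> (cls (Omega_rel R) x) = cls (Omega_rel R) (T3_delbar R x) \<and>
        dstar \<Omega> (cls (Omega_rel R) x) = cls (Omega_rel R) (T3_star q x)) \<and>
     quantum_complex_manifold \<Omega> \<and>
     left_basis \<Omega> (bideg \<Omega> 0 0) (total_deg \<Omega> 1) [dz, dzs, bz, bzs] \<and>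
     right_basis \<Omega> (bideg \<Omega> 0 0) (total_deg \<Omega> 1) [dz, dzs, bz, bzs] \<and>
     \<comment> \<open>bimodule relations\<close>
     z \<otimes> dz = q\<^sup>2 \<odot> (dz \<otimes> z) \<and>
     zs \<otimes> dzs = q\<^sup>2 \<odot> (dzs \<otimes> zs) \<and>
     z \<otimes> dzs = q \<odot> (dzs \<otimes> z) \<and>
     zs \<otimes> dz = q \<odot> (dz \<otimes> zs) \<oplus> (q\<^sup>2 - 1) \<odot> (dzs \<otimes> z) \<and>
     z \<otimes> bzs = (1/q) \<odot> (bzs \<otimes> z) \<oplus> (1/q\<^sup>2 - 1) \<odot> (bz \<otimes> zs) \<and>
     zs \<otimes> bzs = (1/q\<^sup>2) \<odot> (bzs \<otimes> zs) \<and>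
     z \<otimes> bz = (1/q\<^sup>2) \<odot> (bz \<otimes> z) \<and>
     zs \<otimes> bz = (1/q) \<odot> (bz \<otimes> zs) \<and>
     bzs \<otimes> z = q \<odot> (z \<otimes> bzs) \<oplus> (q\<^sup>2 - 1) \<odot> (zs \<otimes> bz) \<and>
     \<comment> \<open>exterior algebra relations\<close>
     dz \<otimes> dz = \<zero> \<and> dzs \<otimes> dzs = \<zero> \<and>
     dzs \<otimes> dz \<oplus> (1/q) \<odot> (dz \<otimes> dzs) = \<zero> \<and>
     bz \<otimes> bz = \<zero> \<and> bzs \<otimes> bzs = \<zero> \<and>
     bzs \<otimes> bz \<oplus> (1/q) \<odot> (bz \<otimes> bzs) = \<zero> \<and>
     bz \<otimes> dz = (- (q\<^sup>2)) \<odot> (dz \<otimes> bz) \<and>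
     bzs \<otimes> dzs = (- (q\<^sup>2)) \<odot> (dzs \<otimes> bzs) \<and>
     bz \<otimes> dzs = (- q) \<odot> (dzs \<otimes> bz) \<and>
     bzs \<otimes> dz = (- q) \<odot> (dz \<otimes> bzs) \<oplus> (- (q\<^sup>2 - 1)) \<odot> (dzs \<otimes> bz) \<and>
     bzs = dstar \<Omega> dz \<and>
     \<comment> \<open>the factorisation structure\<close>
     (\<forall>g\<in>supp_on (bideg_words 0 1 \<times> bideg_words 1 0).
        \<Theta> (form_proj q R 0 1 1 0 g) = form_proj q R 1 0 0 1 (lin (theta_words R) g)) \<and>
     bimodule_iso (bideg \<Omega> 0 0) S T \<Theta> \<and>
     (\<forall>X\<in>bim_carrier S. wedge_map \<Omega> 1 0 0 1 (\<Theta> X) = (- 1) \<odot> wedge_map \<Omega> 0 1 1 0 X) \<and>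
     \<Theta> (s bz dz) = bim_scale T (q\<^sup>2) (t dz bz) \<and>
     \<Theta> (s bzs dzs) = bim_scale T (q\<^sup>2) (t dzs bzs) \<and>
     \<Theta> (s bz dzs) = bim_scale T q (t dzs bz) \<and>
     \<Theta> (s bzs dz) = bim_add T (bim_scale T q (t dz bzs)) (bim_scale T (q\<^sup>2 - 1) (t dzs bz))"
proof -
  interpret R_of_H q R by unfold_locales (rule q, rule R)
  note defs = \<Omega>_def z_def zs_def dz_def dzs_def bz_def bzs_def \<Theta>_def S_def T_def s_def t_def
  have frame: "[gdz, gdzs, gbz, gbzs] = frame_list"
    by (simp add: upt_rec frame_def)
  show ?thesis
    unfolding defs generators frame
    by (intro conjI ballI allI B_ideal_star Bp.complex_algebra B_embed_iso B_embed_star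
        quantum_complex_manifold_Om left_basis_Om right_basis_Om bimodule_relations exterior_relations
        Th_form_proj Th_iso Th_wedge(2) theta_relations; (rule refl | assumption)?)
      (simp_all add: Omega_rel_eq Om.mult_cls T3_mult_mul del_cl delbar_cl dstar_cl generators)
qed

end
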